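(* Let $P$ be an algebraic $d$-polytope. Then there exist a combinatorial $(d+2)$-polytope $\mathcal{S}_P$ and a specified face $f_P\in\mathcal{S}_P$ such that for every realization $S$ of $\mathcal{S}_P$, the face $\operatorname{face}(S,f_P)$ is projectively equivalent to $P$.
   Context: Polytopes are convex polytopes. A combinatorial $k$-polytope is a bounded poset $\mathcal{P}$ (least element $\bot$, greatest element $\top$) that is isomorphic to the face lattice of some $k$-dimensional polytope. A realization of $\mathcal{P}$ is a polytope $P$ together with an isomorphism from $\mathcal{P}$ to its face lattice; $\operatorname{face}(P,f)$ is the face of $P$ with index $f\in\mathcal{P}$ ($\bot$ indexes the empty face, $\top$ indexes $P$). The face $\operatorname{face}(P,f)$ is itself a realization of the interval $[\bot,f]$. A polytope is algebraic if all coordinates of its vertices lie in $\mathbb{R}_{\rm alg}$, the field of real algebraic numbers. Two polytopes $P,Q$ are projectively equivalent if their faces are indexed by the same poset and there is an invertible projective transformation $\pi$ (between the projective closures of their affine hulls, and finite on $P$) with $\pi(\operatorname{face}(P,f))=\operatorname{face}(Q,f)$ for every index $f$. In the claim, the interval $[\bot,f_P]$ is identified with the index poset of the face lattice of $P$. *)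

theory Defs
  imports "HOL-Analysis.Analysis" "HOL-Analysis.Finite_Function_Topology"
    "HOL-Computational_Algebra.Polynomial"
begin

text \<open>
  Ambient space: the finitely supported real sequences, i.e. the union of all \<open>\<real>\<^sup>n\<close>, with
  \<open>\<real>\<^sup>n\<close> the sequences supported in \<open>{..<n}\<close>. Every polytope, being the convex hull of a finite
  set, lies in one of these \<open>\<real>\<^sup>n\<close>. A single type is needed because the realizations of a
  combinatorial polytope, in all ambient dimensions, are quantified over inside a formula.
\<close>
type_synonym rvec = "nat \<Rightarrow>\<^sub>0 real"

text \<open>
  The relational form of \<^const>\<open>aff_dim\<close>, which the library restricts to Euclidean spaces.
  The empty set has dimension \<open>-1\<close>.
\<close>
definition has_aff_dim :: "'a::real_vector set \<Rightarrow> int \<Rightarrow> bool" where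
  "has_aff_dim V d \<longleftrightarrow> (\<exists>B. finite B \<and> affine hull B = affine hull V \<and>
     \<not> affine_dependent B \<and> int (card B) = d + 1)"

lemma has_aff_dim_iff_aff_dim:
  fixes V :: "'a::euclidean_space set"
  shows "has_aff_dim V d \<longleftrightarrow> aff_dim V = d"
proof
  assume "has_aff_dim V d"
  then obtain B where "affine hull B = affine hull V" "\<not> affine_dependent B" "int (card B) = d + 1"
    unfolding has_aff_dim_def by blast
  then show "aff_dim V = d"
    by (metis add_diff_cancel_right' aff_dim_unique of_int_of_nat_eq)
next
  assume "aff_dim V = d"
  moreover obtain B where "affine hull B = affine hull V" "\<not> affine_dependent B"
      "int (card B) = aff_dim V + 1"
    using aff_dim_basis_exists[of V] by auto
  ultimately show "has_aff_dim V d"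
    unfolding has_aff_dim_def using aff_independent_finite by blast
qed

definition algebraic_polytope :: "rvec set \<Rightarrow> bool" where
  "algebraic_polytope P \<longleftrightarrow> polytope P \<and>
     (\<forall>v. v extreme_point_of P \<longrightarrow> (\<forall>i. algebraic (Poly_Mapping.lookup v i)))"

text \<open>
  A poset is represented by its order relation \<open>r\<close> (\<open>(a, b) \<in> r\<close> means \<open>a \<le> b\<close>), with
  underlying set \<^term>\<open>Field r\<close>.
\<close>
definition bounded_poset :: "'p rel \<Rightarrow> bool" where
  "bounded_poset r \<longleftrightarrow> Partial_order r \<and>
     (\<exists>b \<in> Field r. \<forall>x \<in> Field r. (b, x) \<in> r) \<and>
     (\<exists>t \<in> Field r. \<forall>x \<in> Field r. (x, t) \<in> r)"

text \<open>
  The interval from the least element to \<open>f\<close>, which is the set of all elements below \<open>f\<close>.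
\<close>
definition lower_interval :: "'p rel \<Rightarrow> 'p \<Rightarrow> 'p rel" where
  "lower_interval r f = Restr r (under r f)"

text \<open>
  \<^term>\<open>F f\<close> is the face of \<open>P\<close> with index \<open>f\<close>. The library notion of face includes the empty
  face and the polytope itself; all faces of a polytope are exposed.
\<close>
definition realization :: "'p rel \<Rightarrow> 'a::real_vector set \<Rightarrow> ('p \<Rightarrow> 'a set) \<Rightarrow> bool" where
  "realization r P F \<longleftrightarrow> polytope P \<and> bij_betw F (Field r) {G. G face_of P} \<and>
     (\<forall>a \<in> Field r. \<forall>b \<in> Field r. (a, b) \<in> r \<longleftrightarrow> F a \<subseteq> F b)"

definition combinatorial_polytope :: "int \<Rightarrow> 'p rel \<Rightarrow> bool" where
  "combinatorial_polytope k r \<longleftrightarrow> bounded_poset r \<and>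
     (\<exists>(P :: rvec set) F. has_aff_dim P k \<and> realization r P F)"

text \<open>
  The linear subspace over an affine subspace \<open>A\<close> placed at height 1. The points of the
  projective closure of \<open>A\<close> are the lines through the origin in it; those not at infinity are
  the lines through \<open>(x, 1)\<close> for \<open>x \<in> A\<close>.
\<close>
definition homogenization :: "'a::real_vector set \<Rightarrow> ('a \<times> real) set" where
  "homogenization A = span ((\<lambda>x. (x, 1)) ` A)"

definition projective_closure :: "'a::real_vector set \<Rightarrow> ('a \<times> real) set set" where
  "projective_closure A = {span {v} | v. v \<in> homogenization A \<and> v \<noteq> 0}"

definition proj_point :: "'a::real_vector \<Rightarrow> ('a \<times> real) set" where
  "proj_point x = span {(x, 1)}"

text \<open>
  Invertible projective transformations between the projective closures of \<open>A\<close> and \<open>B\<close>, i.e. the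
  maps induced by linear isomorphisms of the homogenizations. That \<open>T\<close> is defined on the whole
  space is no restriction, since a linear map on a subspace extends.
\<close>
definition projective_transformation ::
  "'a::real_vector set \<Rightarrow> 'b::real_vector set \<Rightarrow> (('a \<times> real) set \<Rightarrow> ('b \<times> real) set) \<Rightarrow> bool" where
  "projective_transformation A B \<pi> \<longleftrightarrow>
     (\<exists>T. linear T \<and> bij_betw T (homogenization A) (homogenization B) \<and>
       (\<forall>l \<in> projective_closure A. \<pi> l = T ` l))"

text \<open>
  Projective equivalence of \<open>P\<close> and \<open>Q\<close>, whose faces are indexed by the same poset \<open>r\<close> through
  \<open>F\<close> and \<open>G\<close>. The middle conjunct says that the transformation is finite on \<open>P\<close>.
\<close>
definition projectively_equivalent ::
  "'p rel \<Rightarrow> 'a::real_vector set \<Rightarrow> ('p \<Rightarrow> 'a set) \<Rightarrow> 'b::real_vector set \<Rightarrow> ('p \<Rightarrow> 'b set) \<Rightarrow> bool"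
where
  "projectively_equivalent r P F Q G \<longleftrightarrow> realization r P F \<and> realization r Q G \<and>
     (\<exists>\<pi>. projective_transformation (affine hull P) (affine hull Q) \<pi> \<and>
       \<pi> ` proj_point ` P \<subseteq> range proj_point \<and>
       (\<forall>f \<in> Field r. \<pi> ` proj_point ` F f = proj_point ` G f))"

end

theory Submission
 imports Defs
begin

text \<open>
  Let \<open>P\<close> have at least three vertices. The polytope \<open>\<S>\<close> is the convex hull of finitely many fibres
  \<open>V i \<times> {w i}\<close>, where \<open>w i\<close> runs over points of a plane and \<open>V i\<close> over finite sets parallel to \<open>P\<close>:
  zonotopes, a copy of \<open>P\<close>, parallelograms, and subsets of these. For a linear functional \<open>u\<close>, an
  upper face of the points \<open>w i\<close> lifted to the heights \<open>max u (V i)\<close> is a face of \<open>\<S>\<close> spanned by the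
  \<open>u\<close>-maximal parts of the fibres involved. New points \<open>w i\<close> are attached close to an edge of the
  planar hull, so that the earlier faces survive and prescribed ones are added.

  In every realization the vertices of a planar face are coplanar, and a vertex off a face is off
  its affine hull. Hence parallel edges that lie in common faces with the hub zonotope meet it in
  a common point \<open>X e\<close>, the ideal point of the direction \<open>e\<close>. A chain of fibres, each losing a vertex
  of its predecessor and tied to it by a homothety of ratio \<open>1/2\<close>, extends this from the edges to
  all lines through two vertices. So \<open>X\<close> is determined on all differences of vertices, and each
  parallelogram forces a relation between \<open>X a\<close>, \<open>X b\<close>, \<open>X (a + b)\<close> and \<open>X (a - b)\<close>. Finitely many such
  relations express midpoints and squares of coordinates, which pins down every algebraic number:
  after a linear map, \<open>X v\<close> is proportional to \<open>v\<close> for all \<open>v = p - q\<close> with vertices \<open>p\<close>, \<open>q\<close> of \<open>P\<close>.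
  The vertices of the face over \<open>P\<close> are then a projective image of those of \<open>P\<close>.

  If \<open>P\<close> has at most two vertices, a simplex serves as \<open>\<S>\<close>.
\<close>

text \<open>Parallelism and ratios are invisible in a face lattice; what it fixes are the dimensions
  of faces, hence the coplanarity of four vertices of a two-dimensional face. So the span of the
  hub, in homogeneous coordinates, acts as the space at infinity. Only two dimensions may be added
  to \<open>P\<close>: all gadgets share one planar shadow and sit around a single polygon.
  Attaching a fibre uses up an edge of that polygon and creates two; for the zero functional, faces
  through the old edge are lost, so it is tracked separately from the functionals in
  \<open>U\<close>. A direction \<open>e\<close> may be seen by several functionals, and nothing so
  far makes them yield the same ideal point. A segment \<open>{0, e}\<close> forces this, since its
  line is the same for all of them. Diagonals are not edges: a vertex has to be cut off before their
  ideal points can be seen, and the homothety brings the result back to the uncut fibre.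
  Realizations might also collapse directions or produce scaling factors of mixed sign. The
  dimension of the face over \<open>P\<close> excludes the former, the disjointness of that face
  from the hub the latter.\<close>

notation scaleR (infixr "*R" 75)

abbreviation "coord \<equiv> Poly_Mapping.lookup"

section \<open>Linear functionals and finite point sets\<close>

lemma exists_linear_functional:
 fixes v :: "'a::real_vector"
 assumes "v \<notin> span S"
 obtains f :: "'a => real" where "linear f" "\<And>x. x \<in> span S ==> f x = 0" "f v = 1"
proof -
 obtain B where B: "B \<subseteq> S" "independent B" "S \<subseteq> span B"
  using maximal_independent_subset by blast
 have spB: "span B = span S"
  using subset_trans[OF B(1) span_superset] B(3) by (simp add: span_eq)
 have "v \<notin> span B"
  unfolding spB by (rule assms)
 hence "independent (insert v B)"
  by (rule independent_insertI) (rule B(2))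
 then obtain f :: "'a => real" where f: "linear f" "\<forall>x\<in>insert v B. f x = (if x = v then 1 else 0)"
  using linear_independent_extend[of "insert v B" "\<lambda>x. if x = v then 1 else 0"] by blast
 have "v \<notin> B"
  using assms spB span_base by blast
 hence "\<forall>x\<in>B. f x = 0"
  using f by auto
 hence "f x = 0" if "x \<in> span S" for x
  using linear_eq_0_on_span[OF f(1), of B x] that spB by auto
 thus ?thesis
  using that f by auto
qed

lemma exists_generic_functional:
 fixes A :: "'a::real_vector set"
 assumes "finite A" "\<And>a. a \<in> A ==> a \<notin> span S"
 shows "\<exists>f :: 'a => real. linear f & (\<forall>x\<in>span S. f x = 0) & (\<forall>a\<in>A. f a ~= 0)"
 using assms
proof (induction A rule: finite_induct)
 case empty
 show ?case
  by (rule exI[of _ "\<lambda>_. 0"]) (auto simp: linear_zero)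
next
 case (insert a A)
 then obtain f :: "'a => real" where f: "linear f" "\<forall>x\<in>span S. f x = 0" "\<forall>a\<in>A. f a ~= 0"
  by auto
 obtain g :: "'a => real" where g: "linear g" "\<And>x. x \<in> span S ==> g x = 0" "g a = 1"
  using exists_linear_functional[OF insert.prems[OF insertI1]] by blast
 have "finite ((\<lambda>x. - f x / g x) ` insert a A)"
  using insert by simp
 \<comment> \<open>For each vector at most one value of \<open>t\<close> makes
   \<open>f + t g\<close> vanish while \<open>g\<close> does not, so finitely many values have to be
   avoided.\<close>
 then obtain t where t: "t \<notin> (\<lambda>x. - f x / g x) ` insert a A"
  using ex_new_if_finite[OF infinite_UNIV_char_0] by blast
 let ?h = "\<lambda>x. f x + t * g x"
 have "?h x ~= 0" if x: "x \<in> insert a A" for x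
 proof (cases "g x = 0")
  case True
  thus ?thesis using x f(3) g(3) by auto
 next
  case False
  show ?thesis
  proof
   assume "f x + t * g x = 0"
   hence "t = - f x / g x" using False by (simp add: field_simps)
   thus False using t x by blast
  qed
 qed
 moreover have "linear ?h"
  using f(1) g(1) by (auto simp: linear_iff algebra_simps)
 moreover have "\<forall>x\<in>span S. ?h x = 0"
  using f g by auto
 ultimately show ?case by blast
qed

text \<open>Each strict inequality leaves room for a positive step, and finitely many steps have a
  positive minimum. The conclusion covers all smaller \<open>e\<close> as well, so that thresholds
  from several applications can be combined.\<close>

lemma small_perturbation:
 fixes f g :: "'a => real"
 assumes "finite A" "\<And>a. a \<in> A ==> f a > 0"
 obtains d where "d > 0" "\<And>e a. 0 < e ==> e <= d ==> a \<in> A ==> f a + e * g a > 0"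
proof -
 have "\<exists>d>0. \<forall>e a. 0 < e --> e <= d --> a \<in> A --> f a + e * g a > 0"
  using assms
 proof (induction A rule: finite_induct)
  case empty
  show ?case by (rule exI[of _ 1]) simp
 next
  case (insert b A)
  then obtain d where d: "d > 0" "\<forall>e a. 0 < e --> e <= d --> a \<in> A --> f a + e * g a > 0"
   by auto
  have fb: "f b > 0" using insert by simp
  let ?d = "min d (f b / (\<bar>g b\<bar> + 1))"
  have "f b + e * g b > 0" if e: "0 < e" "e <= ?d" for e
  proof -
   have "e * (\<bar>g b\<bar> + 1) <= f b"
    using e by (simp add: field_simps)
   moreover have "e * g b >= - (e * \<bar>g b\<bar>)"
    using e by (simp add: abs_if)
   ultimately show ?thesis using e by (simp add: algebra_simps)
  qed
  moreover have "?d > 0" using d fb by simp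
  ultimately show ?case using d(2) by (intro exI[of _ ?d]) auto
 qed
 thus ?thesis using that by blast
qed

text \<open>A finite set of vectors either has \<open>0\<close> in its convex hull or lies in an open half space; the
 induction step projects along the new vector.\<close>

lemma gordan:
 fixes A :: "'a::real_vector set"
 assumes "finite A" "0 \<notin> convex hull A"
 shows "\<exists>f :: 'a => real. linear f & (\<forall>a\<in>A. f a > 0)"
 using assms
proof (induction "card A" arbitrary: A rule: less_induct)
 case less
 show ?case
 proof (cases "A = {}")
  case True
  thus ?thesis by (auto intro!: exI[of _ "\<lambda>_. 0"] linear_zero)
 next
 case False
 then obtain a B where A: "A = insert a B" "a \<notin> B"
  by (meson Set.set_insert ex_in_conv)
 hence finB: "finite B" and cB: "card B < card A"
  using less.prems by auto
 have "0 \<notin> convex hull B"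
  using less.prems A hull_mono[of B A convex] by blast
 then obtain f :: "'a => real" where f: "linear f" "\<forall>b\<in>B. f b > 0"
  using less.hyps[OF cB finB] by blast
 have a0: "a ~= 0"
  using less.prems A hull_inc[of a A convex] by blast
 consider "f a > 0" | "f a = 0" | "f a < 0" by linarith
 thus ?thesis
 proof cases
  case 1
  thus ?thesis using f A by blast
 next
  case 2
  obtain g :: "'a => real" where g: "linear g" "g a = 1"
   using exists_linear_functional[of a "{}"] a0 by auto
  obtain e where e: "e > 0" "\<forall>b\<in>B. f b + e * g b > 0"
   using small_perturbation[OF finB, of f g] f(2) by (metis order_refl)
  show ?thesis
   using e f g A 2 by (intro exI[of _ "\<lambda>x. f x + e * g x"]) (auto simp: linear_iff algebra_simps)
 next
  case 3
  define p where "p b = b - (f b / f a) *R a" for b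
  have lp: "linear p"
   using f(1) unfolding p_def by (auto simp: linear_iff algebra_simps add_divide_distrib)
  have "0 \<notin> convex hull (p ` B)"
  proof
   assume "0 \<in> convex hull (p ` B)"
   hence "0 \<in> p ` (convex hull B)"
    by (simp add: convex_hull_linear_image[OF lp])
   then obtain x where x: "x \<in> convex hull B" "p x = 0" by auto
   have "convex {y. f y > 0}"
   proof (rule convexI)
    fix x y :: 'a and u v :: real
    assume *: "x \<in> {y. f y > 0}" "y \<in> {y. f y > 0}" "0 <= u" "0 <= v" "u + v = 1"
    hence "u > 0 \<or> v > 0" by linarith
    hence "u * f x + v * f y > 0"
     using * by (auto intro: add_pos_nonneg add_nonneg_pos)
    thus "u *R x + v *R y \<in> {y. f y > 0}"
     using f(1) by (simp add: linear_iff)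
   qed
   hence fx: "f x > 0"
    using hull_minimal[of B "{y. f y > 0}" convex] f(2) x(1) by blast
   define s where "s = - f x / f a"
   have s: "s > 0" using fx 3 by (simp add: s_def divide_pos_neg)
   have xs: "x + s *R a = 0" using x unfolding p_def s_def by simp
   have xA: "x \<in> convex hull A" "a \<in> convex hull A"
    using x A hull_mono[of B A convex] hull_inc[of a A convex] by auto
   have "(1/(1+s)) *R x + (s/(1+s)) *R a \<in> convex hull A"
    using s by (intro convexD[OF convex_convex_hull xA]) (auto simp: field_simps)
   moreover have "(1/(1+s)) *R x + (s/(1+s)) *R a = (1/(1+s)) *R (x + s *R a)"
    by (simp add: algebra_simps)
   ultimately show False
    using xs less.prems by simp
  qed
  moreover have "card (p ` B) < card A" using cB finB card_image_le[of B p] by linarith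
  ultimately obtain g :: "'a => real" where g: "linear g" "\<forall>b\<in>p ` B. g b > 0"
   using less.hyps[of "p ` B"] finB by blast
  have "\<forall>b\<in>B. g (p b) > 0" using g by blast
  then obtain e where e: "e > 0" "\<forall>b\<in>B. g (p b) + e * (- f b) > 0"
   using small_perturbation[OF finB, of "\<lambda>b. g (p b)" "\<lambda>b. - f b"] by (metis order_refl)
  have pa: "p a = 0" using 3 by (simp add: p_def)
  \<comment> \<open>\<open>g\<close> composed with \<open>p\<close> is positive on \<open>B\<close>
    and kills \<open>a\<close>; since \<open>f a\<close> is negative, a small multiple of
    \<open>- f\<close> makes the value at \<open>a\<close> positive without spoiling
    \<open>B\<close>.\<close>
  have "linear (\<lambda>x. g (p x) + e * (- f x))"
   using f(1) g(1) lp by (simp add: linear_iff algebra_simps)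
  moreover have "g (p a) + e * (- f a) > 0"
   using pa g(1) 3 e(1) by (simp add: linear_0 mult_pos_neg)
  ultimately show ?thesis
   using e(2) A by (intro exI[of _ "\<lambda>x. g (p x) + e * (- f x)"]) auto
 qed
 qed
qed

text \<open>The formula for \<open>h\<close> is part of the conclusion because a tie of
  \<open>f\<close> survives wherever \<open>g\<close> also has one; edges depend on this.\<close>

lemma perturb_functional:
 fixes f g :: "'a::real_vector => real"
 assumes "linear f" "linear g" "finite A" "\<And>a. a \<in> A ==> f a > 0"
  "finite E" "\<And>e. e \<in> E ==> g e ~= 0"
 obtains h :: "'a => real" and t where "linear h" "\<And>x. h x = f x + t * g x"
  "\<And>a. a \<in> A ==> h a > 0" "\<And>e. e \<in> E ==> h e ~= 0"
proof -
 obtain d1 where d1: "d1 > 0" "\<And>e a. 0 < e ==> e <= d1 ==> a \<in> A ==> f a + e * g a > 0"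
  using small_perturbation[OF assms(3), of f g] assms(4) by metis
 have fin: "finite {e\<in>E. f e ~= 0}" using assms(5) by simp
 obtain d2 where d2: "d2 > 0" "\<And>e a. 0 < e ==> e <= d2 ==> a \<in> {e\<in>E. f e ~= 0} ==> \<bar>f a\<bar> + e * (- \<bar>g a\<bar>) > 0"
  using small_perturbation[OF fin, of "\<lambda>a. \<bar>f a\<bar>" "\<lambda>a. - \<bar>g a\<bar>"] by auto
 define t where "t = min d1 d2"
 have t: "0 < t" "t <= d1" "t <= d2" using d1 d2 by (auto simp: t_def)
 have "f e + t * g e ~= 0" if e: "e \<in> E" for e
 proof (cases "f e = 0")
  case True
  thus ?thesis using assms(6)[OF e] t by simp
 next
  case False
  hence "\<bar>f e\<bar> + t * (- \<bar>g e\<bar>) > 0" using d2(2)[of t e] t e by simp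
  hence *: "t * \<bar>g e\<bar> < \<bar>f e\<bar>" by simp
  show ?thesis
  proof
   assume "f e + t * g e = 0"
   hence "f e = - (t * g e)" by linarith
   hence "\<bar>f e\<bar> = t * \<bar>g e\<bar>" using t by (simp add: abs_mult)
   with * show False by simp
  qed
 qed
 moreover have "linear (\<lambda>x. f x + t * g x)"
  using assms(1,2) by (simp add: linear_iff algebra_simps)
 ultimately show ?thesis
  using that[of "\<lambda>x. f x + t * g x" t] d1(2)[of t] t by blast
qed

section \<open>Convex position, exposed vertices and edges\<close>

definition convex_position :: "'a::real_vector set => bool" where
 "convex_position J \<longleftrightarrow> finite J & (\<forall>v\<in>J. v \<notin> convex hull (J - {v}))"

text \<open>Edges are encoded by a supporting functional because the faces of the final polytope are
  produced from functionals on the fibres.\<close>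

definition is_edge :: "'a::real_vector set => 'a => 'a => bool" where
 "is_edge J v w \<longleftrightarrow> v \<in> J & w \<in> J & v ~= w &
   (\<exists>u :: 'a => real. linear u & u v = u w & (\<forall>x\<in>J - {v, w}. u x < u v))"

lemma convex_position_subset:
 assumes "convex_position J" "K \<subseteq> J"
 shows "convex_position K"
 using assms hull_mono[of "K - {_}" "J - {_}" convex] unfolding convex_position_def
 by (meson Diff_mono finite_subset subset_iff order_refl)

text \<open>\<open>0\<close> is outside the convex hull of the differences \<open>v - w\<close>, so
  \<open>gordan\<close> gives a functional positive on them; a generic perturbation makes it nonzero
  on \<open>E\<close>.\<close>

lemma convex_position_vertex:
 assumes "convex_position J" "v \<in> J" "finite E" "0 \<notin> E"
 obtains u :: "'a::real_vector => real" where "linear u" "\<And>x. x \<in> J - {v} ==> u x < u v"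
  "\<And>e. e \<in> E ==> u e ~= 0"
proof -
 have fin: "finite J" and nv: "v \<notin> convex hull (J - {v})"
  using assms by (auto simp: convex_position_def)
 have "0 \<notin> convex hull ((\<lambda>w. v - w) ` (J - {v}))"
 proof
  assume *: "0 \<in> convex hull ((\<lambda>w. v - w) ` (J - {v}))"
  have "(\<lambda>w. v - w) ` (J - {v}) = (+) v ` (uminus ` (J - {v}))"
   by (auto simp: image_image)
  hence "convex hull ((\<lambda>w. v - w) ` (J - {v})) = (+) v ` (uminus ` (convex hull (J - {v})))"
   by (simp add: convex_hull_translation convex_hull_linear_image[OF linear_uminus])
  with * nv show False by (auto simp: image_iff)
 qed
 then obtain f :: "'a => real" where f: "linear f" "\<forall>a\<in>(\<lambda>w. v - w) ` (J - {v}). f a > 0"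
  using gordan[of "(\<lambda>w. v - w) ` (J - {v})"] fin by blast
 obtain g :: "'a => real" where g: "linear g" "\<forall>e\<in>E. g e ~= 0"
  using exists_generic_functional[of E "{}"] assms by auto
 obtain h :: "'a => real" where h: "linear h" "\<And>a. a \<in> (\<lambda>w. v - w) ` (J - {v}) ==> h a > 0"
  "\<And>e. e \<in> E ==> h e ~= 0"
  using perturb_functional[OF f(1) g(1), of "(\<lambda>w. v - w) ` (J - {v})" E] f(2) g(2) fin assms(3)
  by (metis finite_Diff finite_imageI)
 have "h x < h v" if "x \<in> J - {v}" for x
 proof -
  have "h (v - x) > 0" using h(2) that by blast
  thus ?thesis using h(1) by (simp add: linear_diff)
 qed
 thus ?thesis using that h by blast
qed

text \<open>The perturbing functional vanishes on the direction of the edge, so the tie between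
  \<open>v\<close> and \<open>w\<close> is kept while every vector of \<open>E\<close> gets a
  nonzero value.\<close>

lemma is_edge_generic:
 assumes "is_edge J v w" "finite J" "finite E" "\<And>e. e \<in> E ==> e \<notin> span {v - w}"
 obtains u :: "'a::real_vector => real" where "linear u" "u v = u w"
  "\<And>x. x \<in> J - {v, w} ==> u x < u v" "\<And>e. e \<in> E ==> u e ~= 0"
proof -
 obtain f :: "'a => real" where f: "linear f" "f v = f w" "\<forall>x\<in>J - {v, w}. f x < f v"
  using assms(1) unfolding is_edge_def by blast
 obtain g :: "'a => real" where g: "linear g" "\<forall>x\<in>span {v - w}. g x = 0" "\<forall>e\<in>E. g e ~= 0"
  using exists_generic_functional[OF assms(3), of "{v - w}"] assms(4) by blast
 let ?A = "(\<lambda>x. v - x) ` (J - {v, w})"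
 have "f a > 0" if "a \<in> ?A" for a
  using that f by (auto simp: linear_diff)
 then obtain h t where h: "linear h" "\<And>x. h x = f x + t * g x" "\<And>a. a \<in> ?A ==> h a > 0" "\<And>e. e \<in> E ==> h e ~= 0"
  using perturb_functional[OF f(1) g(1), of ?A E] g(3) assms(2,3)
  by (metis finite_Diff finite_imageI)
 have "g (v - w) = 0" using g(2) by (simp add: span_base)
 hence "h v = h w" using h(2) f(2) g(1) by (simp add: linear_diff)
 moreover have "h x < h v" if "x \<in> J - {v, w}" for x
 proof -
  have "h (v - x) > 0" using h(3) that by blast
  thus ?thesis using h(1) by (simp add: linear_diff)
 qed
 ultimately show ?thesis using that h by blast
qed

text \<open>The slice of the cone at the vertex \<open>v\<close>: an edge of \<open>J\<close> at \<open>v\<close> is found where a generic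
 perturbation of \<open>f\<close> is minimal on it.\<close>

lemma convex_position_slice:
 assumes J: "convex_position J" "v \<in> J" "J ~= {v}"
 obtains s :: "'a::real_vector => 'a" and c :: "'a => real" where
  "inj_on s (J - {v})" "\<And>x. x \<in> J - {v} ==> c x > 0 & s x = c x *R (x - v)"
  "\<And>f :: 'a => real. linear f ==> \<exists>w\<in>J - {v}. is_edge J v w & (\<forall>x\<in>J - {v}. f (s w) <= f (s x))"
proof -
 have fin: "finite J" using J by (simp add: convex_position_def)
 obtain u :: "'a => real" where u: "linear u" "\<And>x. x \<in> J - {v} ==> u x < u v"
  using convex_position_vertex[OF J(1,2), of "{}"] by auto
 \<comment> \<open>The vertex figure: the ray from \<open>v\<close> through \<open>x\<close>, moved
   to the origin, meets the hyperplane \<open>u = -1\<close> in \<open>s x\<close>. Two points on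
   one ray cannot both be vertices, as the nearer one lies between \<open>v\<close> and the other;
   hence injectivity.\<close>
 define s where "s x = (1 / (u v - u x)) *R (x - v)" for x
 have inj: "inj_on s (J - {v})"
 proof (rule inj_onI)
  have aux: False if x: "x \<in> J - {v}" and y: "y \<in> J - {v}" and eq: "s x = s y" and ne: "x ~= y" and le: "u y <= u x" for x y
  proof -
   define r where "r = (u v - u x) / (u v - u y)"
   have r: "0 <= r" "r <= 1" using u(2)[OF x] u(2)[OF y] le by (auto simp: r_def field_simps)
   have "x - v = (u v - u x) *R s x" using u(2)[OF x] by (simp add: s_def)
   also have "... = r *R (y - v)" using u(2)[OF y] by (simp add: eq) (simp add: s_def r_def)
   finally have "x = (1 - r) *R v + r *R y" by (simp add: algebra_simps)
   moreover have "v \<in> convex hull (J - {x})" "y \<in> convex hull (J - {x})"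
    using x y ne J(2) by (auto intro!: hull_inc)
   ultimately have "x \<in> convex hull (J - {x})"
    using r convexD[OF convex_convex_hull, of v "J - {x}" y "1 - r" r] by simp
   thus False using J(1) x by (auto simp: convex_position_def)
  qed
  fix x y assume "x \<in> J - {v}" "y \<in> J - {v}" "s x = s y"
  thus "x = y" using aux[of x y] aux[of y x] by (metis linear)
 qed
 have main: "\<exists>w\<in>J - {v}. is_edge J v w & (\<forall>x\<in>J - {v}. f (s w) <= f (s x))" if f: "linear f" for f :: "'a => real"
 proof -
  let ?D = "(\<lambda>(x, y). s x - s y) ` {(x, y). x \<in> J - {v} & y \<in> J - {v} & x ~= y}"
  have "{(x, y). x \<in> J - {v} & y \<in> J - {v} & x ~= y} \<subseteq> J \<times> J" by auto
  hence finD: "finite ?D" using fin by (meson finite_SigmaI finite_imageI finite_subset)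
  have "a \<notin> span {}" if "a \<in> ?D" for a
   using that inj by (auto simp: inj_on_def)
  then obtain g :: "'a => real" where g: "linear g" "\<forall>a\<in>?D. g a ~= 0"
   using exists_generic_functional[OF finD, of "{}"] by blast
  have ginj: "g (s x) ~= g (s y)" if "x \<in> J - {v}" "y \<in> J - {v}" "x ~= y" for x y
   using g(2) that by (force simp: linear_diff[OF g(1)])
  have ne: "J - {v} ~= {}" using J by auto
  define m where "m = Min ((\<lambda>x. f (s x)) ` (J - {v}))"
  have m: "m <= f (s x)" if "x \<in> J - {v}" for x using that fin by (simp add: m_def)
  define A where "A = {x\<in>J - {v}. f (s x) = m}"
  have "m \<in> (\<lambda>x. f (s x)) ` (J - {v})" unfolding m_def using fin ne by (intro Min_in) auto
  hence "A ~= {}" by (auto simp: A_def)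
  moreover have finA: "finite A" using fin by (simp add: A_def)
  ultimately obtain w where w: "w \<in> A" "\<And>x. x \<in> A ==> g (s w) <= g (s x)"
   using ex_min_if_finite[of "(\<lambda>x. g (s x)) ` A"] by (metis arg_min_if_finite(1) arg_min_least)
  have wJ: "w \<in> J - {v}" "f (s w) = m" using w by (auto simp: A_def)
  have finB: "finite (J - {v} - A)" using fin by simp
  have "f (s x) - m > 0" if "x \<in> J - {v} - A" for x
   using that m[of x] by (auto simp: A_def less_le)
  then obtain d where d: "d > 0" "\<And>e x. 0 < e ==> e <= d ==> x \<in> J - {v} - A ==> f (s x) - m + e * (g (s x) - g (s w)) > 0"
   using small_perturbation[OF finB, of "\<lambda>x. f (s x) - m" "\<lambda>x. g (s x) - g (s w)"] by metis
  define F where "F x = f x + d * g x" for x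
  have linF: "linear F" using f g(1) by (simp add: F_def linear_iff algebra_simps)
  have Fw: "F (s w) < F (s x)" if x: "x \<in> J - {v}" "x ~= w" for x
  proof (cases "x \<in> A")
   case True
   hence "g (s w) < g (s x)" using w(2)[OF True] ginj[OF x(1) wJ(1) x(2)] by simp
   thus ?thesis using True wJ d(1) by (simp add: F_def A_def)
  next
   case False
   thus ?thesis using d(2)[of d x] d(1) x wJ(2) by (simp add: F_def algebra_simps)
  qed
  \<comment> \<open>Homogenises the inequality \<open>F (s w) < F (s x)\<close>: multiplied by
    \<open>u v - u x\<close> it becomes linear in \<open>x\<close> and reads
    \<open>h x < h v\<close>.\<close>
  define h where "h x = - F x - F (s w) * u x" for x
  have linh: "linear h" using linF u(1) by (simp add: h_def linear_iff algebra_simps)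
  have hx: "h x - h v = - (u v - u x) * (F (s x) - F (s w))" if x: "x \<in> J - {v}" for x
  proof -
   have "x - v = (u v - u x) *R s x" using u(2)[OF x] by (simp add: s_def)
   hence "F x - F v = (u v - u x) * F (s x)"
    using linF by (metis linear_diff linear_scale real_scaleR_def)
   thus ?thesis by (simp add: h_def algebra_simps)
  qed
  have "h w = h v" using hx[OF wJ(1)] by simp
  moreover have "h x < h v" if "x \<in> J - {v, w}" for x
  proof -
   have "(u v - u x) * (F (s x) - F (s w)) > 0" using that u(2)[of x] Fw[of x] by simp
   moreover have "h x - h v = - ((u v - u x) * (F (s x) - F (s w)))"
   proof -
    have "x \<in> J - {v}" using that by blast
    thus ?thesis using hx by (simp only: minus_mult_left)
   qed
   ultimately show ?thesis by linarith
  qed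
  ultimately have "is_edge J v w"
   unfolding is_edge_def using linh wJ J(2) by (intro conjI exI[of _ h]) auto
  thus ?thesis using wJ m by auto
 qed
 show ?thesis
  by (rule that[of s "\<lambda>x. 1 / (u v - u x)"]) (use inj u(2) main in \<open>auto simp: s_def\<close>)
qed

text \<open>The step of the simplex method. On the vertex figure the minimum of \<open>f\<close> is
  at most its value for \<open>x\<close>, which is negative, and it is taken at a neighbour of
  \<open>v\<close>.\<close>

lemma is_edge_improve:
 fixes f :: "'a::real_vector => real"
 assumes "convex_position J" "v \<in> J" "linear f" "x \<in> J" "f x < f v"
 obtains w where "is_edge J v w" "f w < f v"
proof -
 have "J ~= {v}" using assms by auto
 then obtain s c where s: "\<And>x. x \<in> J - {v} ==> c x > 0 & s x = c x *R (x - v)"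
  "\<And>f :: 'a => real. linear f ==> \<exists>w\<in>J - {v}. is_edge J v w & (\<forall>x\<in>J - {v}. f (s w) <= f (s x))"
  using convex_position_slice[OF assms(1,2)] by metis
 obtain w where w: "w \<in> J - {v}" "is_edge J v w" "\<forall>x\<in>J - {v}. f (s w) <= f (s x)"
  using s(2)[OF assms(3)] by blast
 have fs: "f (s y) = c y * (f y - f v)" if "y \<in> J - {v}" for y
  using s(1)[OF that] assms(3) by (simp add: linear_diff linear_scale)
 have x: "x \<in> J - {v}" using assms by auto
 have "f (s w) < 0"
  using w(3) x fs[OF x] s(1)[OF x] assms(5) by (smt (verit) mult_pos_neg)
 hence "f w < f v" using fs[OF w(1)] s(1)[OF w(1)] by (simp add: mult_less_0_iff)
 thus ?thesis using that w by blast
qed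

text \<open>A functional separating two points of the vertex figure has different minimisers and
  maximisers; both can be chosen to be neighbours of \<open>v\<close>.\<close>

lemma is_edge_two:
 assumes "convex_position J" "v \<in> J" "card J >= 3"
 obtains w w' where "is_edge J v w" "is_edge J v w'" "w ~= w'"
proof -
 have fin: "finite J" using assms by (simp add: convex_position_def)
 have card2: "card (J - {v}) >= 2" using assms fin by simp
 hence "J ~= {v}" by auto
 then obtain s c where s: "inj_on s (J - {v})"
  "\<And>f :: 'a => real. linear f ==> \<exists>w\<in>J - {v}. is_edge J v w & (\<forall>x\<in>J - {v}. f (s w) <= f (s x))"
  using convex_position_slice[OF assms(1,2)] by metis
 obtain x y where xy: "x \<in> J - {v}" "y \<in> J - {v}" "x ~= y"
  using card2 by (metis card_le_Suc0_iff_eq not_less_eq_eq numeral_2_eq_2 fin finite_Diff)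
 have "s x - s y \<notin> span {}" using s(1) xy by (auto simp: inj_on_def)
 then obtain g :: "'a => real" where g: "linear g" "g (s x - s y) ~= 0"
  using exists_generic_functional[of "{s x - s y}" "{}"] by auto
 obtain w where w: "w \<in> J - {v}" "is_edge J v w" "\<forall>x\<in>J - {v}. g (s w) <= g (s x)"
  using s(2)[OF g(1)] by blast
 have "linear (\<lambda>x. - g x)" using g(1) by (simp add: linear_iff)
 then obtain w' where w': "w' \<in> J - {v}" "is_edge J v w'" "\<forall>x\<in>J - {v}. - g (s w') <= - g (s x)"
  using s(2) by blast
 have "w ~= w'"
 proof
  assume "w = w'"
  hence "g (s x) = g (s y)" using w w' xy by (metis antisym neg_le_iff_le)
  thus False using g by (simp add: linear_diff)
 qed
 thus ?thesis using that w w' by blast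
qed

section \<open>Faces of finite convex hulls\<close>

text \<open>Homogeneous coordinates turn affine hulls and affine independence into spans and linear
  independence, where the exchange lemma bounds cardinalities.\<close>

definition hat :: "'a::real_vector => 'a \<times> real" where
 "hat x = (x, 1)"

lemma inj_hat: "inj_on hat A"
 by (auto simp: inj_on_def hat_def)

lemma sum_hat: "(\<Sum>v\<in>S. u v *R hat v) = (\<Sum>v\<in>S. u v *R v, \<Sum>v\<in>S. u v)"
 by (induction S rule: infinite_finite_induct) (auto simp: hat_def zero_prod_def)

lemma hat_in_span_iff: "hat x \<in> span (hat ` G) \<longleftrightarrow> x \<in> affine hull G"
proof
 assume "hat x \<in> span (hat ` G)"
 then obtain t r where t: "finite t" "t \<subseteq> hat ` G" "hat x = (\<Sum>a\<in>t. r a *R a)"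
  unfolding span_explicit by blast
 then obtain S where S: "finite S" "S \<subseteq> G" "t = hat ` S"
  by (meson finite_subset_image)
 have "hat x = (\<Sum>v\<in>S. r (hat v) *R hat v)"
  using t(3) S(3) by (simp add: sum.reindex[OF inj_hat])
 hence *: "x = (\<Sum>v\<in>S. r (hat v) *R v)" "1 = (\<Sum>v\<in>S. r (hat v))"
  unfolding sum_hat by (simp_all add: hat_def)
 hence "S ~= {}" by auto
 thus "x \<in> affine hull G"
  unfolding affine_hull_explicit using S * by (auto intro!: exI[of _ S] exI[of _ "\<lambda>v. r (hat v)"])
next
 assume "x \<in> affine hull G"
 then obtain S u where S: "finite S" "S \<subseteq> G" "sum u S = 1" "(\<Sum>v\<in>S. u v *R v) = x"
  unfolding affine_hull_explicit by blast
 have "hat x = (\<Sum>v\<in>S. u v *R hat v)"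
  unfolding sum_hat S(3,4) by (simp add: hat_def)
 also have "... \<in> span (hat ` G)"
  using S(2) by (intro span_sum span_scale span_base) auto
 finally show "hat x \<in> span (hat ` G)" .
qed

lemma affine_dependent_hat: "affine_dependent B \<longleftrightarrow> dependent (hat ` B)"
proof -
 have "hat ` B - {hat x} = hat ` (B - {x})" for x :: 'a
  by (auto simp: hat_def)
 thus ?thesis
  unfolding affine_dependent_def dependent_def by (simp add: hat_in_span_iff)
qed

lemma affine_hull_eq_hat: "affine hull B = affine hull V \<longleftrightarrow> span (hat ` B) = span (hat ` V)"
proof
 assume "affine hull B = affine hull V"
 hence "hat ` B \<subseteq> span (hat ` V)" "hat ` V \<subseteq> span (hat ` B)"
  by (auto simp: hat_in_span_iff hull_inc)
 thus "span (hat ` B) = span (hat ` V)" by (simp add: span_eq)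
next
 assume "span (hat ` B) = span (hat ` V)"
 thus "affine hull B = affine hull V"
  by (auto simp: hat_in_span_iff[symmetric])
qed

lemma span_hat_convex_hull: "span (hat ` (convex hull V)) = span (hat ` V)"
 by (simp add: affine_hull_eq_hat[symmetric])

lemma has_aff_dim_hat:
 "has_aff_dim V d \<longleftrightarrow> (\<exists>B. finite B & independent (hat ` B) & span (hat ` B) = span (hat ` V) & int (card B) = d + 1)"
 unfolding has_aff_dim_def affine_dependent_hat affine_hull_eq_hat by auto

lemma has_aff_dim_convex_hull: "has_aff_dim (convex hull V) d \<longleftrightarrow> has_aff_dim V d"
 unfolding has_aff_dim_hat span_hat_convex_hull ..

lemma has_aff_dim_subset:
 assumes "has_aff_dim V d"
 obtains B where "B \<subseteq> V" "finite B" "independent (hat ` B)" "span (hat ` B) = span (hat ` V)" "int (card B) = d + 1"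
proof -
 obtain C where C: "finite C" "independent (hat ` C)" "span (hat ` C) = span (hat ` V)" "int (card C) = d + 1"
  using assms unfolding has_aff_dim_hat by blast
 obtain B' where B': "B' \<subseteq> hat ` V" "independent B'" "hat ` V \<subseteq> span B'"
  using maximal_independent_subset[of "hat ` V"] by blast
 have eq: "span B' = span (hat ` V)"
  using B' span_superset[of "hat ` V"] by (metis span_eq subset_trans)
 have f: "finite B'" "card B' <= card (hat ` C)"
  using independent_span_bound[of "hat ` C" B'] B'(1,2) C span_superset[of "hat ` V"] by auto
 have "card (hat ` C) <= card B'"
  using independent_span_bound[OF f(1) C(2)] C(3) eq span_superset[of "hat ` C"] by auto
 moreover obtain B where B: "B \<subseteq> V" "B' = hat ` B"
  using B'(1) by (meson subset_imageE)
 ultimately show ?thesis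
  using f B' eq C(4) that[of B]
  by (metis card_image finite_imageD inj_hat le_antisym)
qed

lemma has_aff_dim_le:
 assumes "has_aff_dim V d" "has_aff_dim W e" "hat ` V \<subseteq> span (hat ` W)"
 shows "d <= e" and "d = e ==> span (hat ` V) = span (hat ` W)"
proof -
 obtain B where B: "finite B" "independent (hat ` B)" "span (hat ` B) = span (hat ` V)" "int (card B) = d + 1"
  using assms(1) unfolding has_aff_dim_hat by blast
 obtain C where C: "finite C" "independent (hat ` C)" "span (hat ` C) = span (hat ` W)" "int (card C) = e + 1"
  using assms(2) unfolding has_aff_dim_hat by blast
 have sub: "span (hat ` V) \<subseteq> span (hat ` W)"
  using assms(3) by (simp add: span_minimal)
 hence BC: "hat ` B \<subseteq> span (hat ` C)"
  using B(3) C(3) span_superset[of "hat ` B"] by auto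
 have cards: "card (hat ` B) = card B" "card (hat ` C) = card C"
  by (simp_all add: card_image inj_hat)
 show "d <= e"
  using independent_span_bound[OF _ B(2) BC] C(1) cards B(4) C(4) by auto
 show "span (hat ` V) = span (hat ` W)" if "d = e"
 proof (rule ccontr)
  assume "span (hat ` V) ~= span (hat ` W)"
  hence "\<not> hat ` W \<subseteq> span (hat ` B)"
   using sub B(3) span_minimal[OF _ subspace_span, of "hat ` W" "hat ` B"] by auto
  then obtain w where w: "w \<in> hat ` W" "w \<notin> span (hat ` B)"
   by blast
  hence "independent (insert w (hat ` B))"
   using B(2) independent_insertI by blast
  moreover have "insert w (hat ` B) \<subseteq> span (hat ` C)"
   using BC w(1) C(3) by (simp add: span_base)
  ultimately have "card (insert w (hat ` B)) <= card (hat ` C)"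
   using independent_span_bound[of "hat ` C"] C(1) by blast
  moreover have "w \<notin> hat ` B" using span_base[of w "hat ` B"] w(2) by auto
  ultimately have "Suc (card (hat ` B)) <= card (hat ` C)"
   using card_insert_disjoint[OF finite_imageI[OF B(1)], of w hat] by linarith
  hence "Suc (card B) <= card C" using cards by linarith
  thus False using B(4) C(4) that by linarith
 qed
qed

lemma has_aff_dim_unique: "has_aff_dim V d ==> has_aff_dim V e ==> d = e"
 using has_aff_dim_le(1)[of V d V e] has_aff_dim_le(1)[of V e V d] span_superset[of "hat ` V"] by fastforce

lemma has_aff_dim_exists:
 assumes "finite V"
 obtains n where "has_aff_dim V (int n - 1)"
proof -
 obtain B' where B': "B' \<subseteq> hat ` V" "independent B'" "hat ` V \<subseteq> span B'"
  using maximal_independent_subset[of "hat ` V"] by blast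
 have eq: "span B' = span (hat ` V)"
  using B' span_superset[of "hat ` V"] by (metis span_eq subset_trans)
 obtain B where B: "B \<subseteq> V" "B' = hat ` B"
  using B'(1) by (meson subset_imageE)
 have "finite B" using B(1) assms finite_subset by blast
 hence "has_aff_dim V (int (card B) - 1)"
  unfolding has_aff_dim_hat using B B' eq by auto
 thus ?thesis using that by blast
qed

text \<open>Separate the positive and the negative coefficients of \<open>x\<close>: normalised,
  they give points \<open>g\<close> and \<open>h\<close> of \<open>F\<close> with
  \<open>x = p g - n h\<close> and \<open>p = 1 + n\<close>. Solved for \<open>g\<close>, this puts
  \<open>g\<close> strictly between \<open>x\<close> and \<open>h\<close>.\<close>

lemma convex_affine_hull_split:
 assumes "convex F" "x \<in> affine hull F" "x \<notin> F"
 obtains g h r where "g \<in> F" "h \<in> F" "0 < r" "r < 1" "g = (1 - r) *R x + r *R h"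
proof -
 obtain S u where S: "finite S" "S \<subseteq> F" "sum u S = 1" "(\<Sum>v\<in>S. u v *R v) = x"
  using assms(2) unfolding affine_hull_explicit by blast
 define P where "P = {v\<in>S. u v > 0}"
 define N where "N = {v\<in>S. u v <= 0}"
 have PN: "S = P \<union> N" "P \<inter> N = {}" "finite P" "finite N" using S by (auto simp: P_def N_def)
 define p where "p = sum u P"
 define n where "n = - sum u N"
 have pn: "p = 1 + n" using S(3) PN by (simp add: p_def n_def sum.union_disjoint)
 have n0: "n >= 0" using sum_nonpos[of N u] by (auto simp: n_def N_def)
 have p0: "p > 0" using pn n0 by linarith
 define g where "g = (\<Sum>v\<in>P. (u v / p) *R v)"
 have "(\<Sum>v\<in>P. u v / p) = 1"
  using p0 by (simp add: p_def sum_divide_distrib[symmetric])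
 hence g: "g \<in> F"
  unfolding g_def using S(2) p0
  by (intro convex_sum[OF PN(3) assms(1)]) (auto simp: P_def)
 have "p *R g = (\<Sum>v\<in>P. u v *R v)"
  using p0 by (simp add: g_def scaleR_sum_right)
 moreover have "x = (\<Sum>v\<in>P. u v *R v) + (\<Sum>v\<in>N. u v *R v)"
  unfolding S(4)[symmetric] PN(1) by (rule sum.union_disjoint[OF PN(3,4,2)])
 ultimately have xs: "x = p *R g + (\<Sum>v\<in>N. u v *R v)"
  by simp
 show ?thesis
 proof (cases "n = 0")
  case True
  hence "sum (\<lambda>v. - u v) N = 0" by (simp add: n_def sum_negf)
  hence "\<forall>v\<in>N. - u v = 0"
   using sum_nonneg_eq_0_iff[OF PN(4), of "\<lambda>v. - u v"] by (auto simp: N_def)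
  hence "(\<Sum>v\<in>N. u v *R v) = 0" by (intro sum.neutral) auto
  thus ?thesis using xs g assms(3) pn True by simp
 next
  case False
  hence n: "n > 0" using n0 by simp
  define h where "h = (\<Sum>v\<in>N. (- u v / n) *R v)"
  have "sum (\<lambda>v. - u v / n) N = 1"
   using n by (simp add: n_def sum_divide_distrib[symmetric] sum_negf)
  hence h: "h \<in> F"
   unfolding h_def using S(2) n
   by (intro convex_sum[OF PN(4) assms(1)]) (auto simp: N_def divide_nonpos_pos)
  have "n *R h = - (\<Sum>v\<in>N. u v *R v)"
   using n by (simp add: h_def scaleR_sum_right sum_negf)
  hence "x = p *R g - n *R h" using xs by simp
  hence "x + n *R h = p *R g" by simp
  hence "(1 / p) *R (x + n *R h) = g" using p0 by simp
  hence "(1 / p) *R x + (n / p) *R h = g" by (simp add: scaleR_add_right)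
  moreover have "n = p - 1" using pn by linarith
  hence "1 - n / p = 1 / p" using p0 by (simp add: diff_divide_distrib)
  moreover have "0 < n / p" using n p0 by simp
  moreover have "n / p < 1" using p0 pn by simp
  ultimately show ?thesis
   using that[OF g h, of "n / p"] by presburger
 qed
qed

text \<open>If \<open>x\<close> were outside \<open>F\<close>, some point of \<open>F\<close> would
  be interior to a segment from \<open>x\<close> to another point of \<open>F\<close>, and a face
  containing an interior point of a segment contains its ends.\<close>

lemma face_of_affine_hull:
 assumes "F face_of S" "x \<in> S" "x \<in> affine hull F"
 shows "x \<in> F"
proof (rule ccontr)
 assume nx: "x \<notin> F"
 have F: "convex F" "F \<subseteq> S" using assms(1) by (auto simp: face_of_def)
 obtain g h r where *: "g \<in> F" "h \<in> F" "0 < r" "r < 1" "g = (1 - r) *R x + r *R h"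
  using convex_affine_hull_split[OF F(1) assms(3) nx] by blast
 have "x ~= h" using *(2) nx by blast
 hence "g \<in> open_segment x h" using * by (auto simp: in_segment)
 thus False using face_ofD[OF assms(1)] * F assms(2) nx by blast
qed

lemma face_of_hat_span:
 assumes "F face_of S" "x \<in> S" "hat x \<in> span (hat ` F)"
 shows "x \<in> F"
 using face_of_affine_hull assms hat_in_span_iff by blast

lemma convex_hull_supporting:
 fixes f :: "'a::real_vector => real"
 assumes "finite V" "linear f" "\<And>v. v \<in> V ==> f v <= c"
 shows "convex hull {v\<in>V. f v = c} = {x\<in>convex hull V. f x = c}"
proof
 have "convex {x\<in>convex hull V. f x = c}"
 proof (rule convexI)
  fix x y and a b :: real
  assume *: "x \<in> {x \<in> convex hull V. f x = c}" "y \<in> {x \<in> convex hull V. f x = c}" "0 <= a" "0 <= b" "a + b = 1"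
  have "f (a *R x + b *R y) = a * c + b * c"
   using * assms(2) by (simp add: linear_add linear_scale)
  also have "... = c" using *(5) by (metis distrib_right mult_1)
  finally have "f (a *R x + b *R y) = c" .
  thus "a *R x + b *R y \<in> {x \<in> convex hull V. f x = c}"
   using * convexD[OF convex_convex_hull, of x V y a b] by simp
 qed
 thus "convex hull {v\<in>V. f v = c} \<subseteq> {x\<in>convex hull V. f x = c}"
  by (intro hull_minimal) (auto simp: hull_inc)
next
 show "{x\<in>convex hull V. f x = c} \<subseteq> convex hull {v\<in>V. f v = c}"
 proof safe
  fix x assume x: "x \<in> convex hull V" "c = f x"
  obtain u where u: "\<forall>v\<in>V. 0 <= u v" "sum u V = 1" "(\<Sum>v\<in>V. u v *R v) = x"
   using x(1) unfolding convex_hull_finite[OF assms(1)] by blast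
  have "f x = (\<Sum>v\<in>V. u v * f v)"
   using u(3) assms(2) by (auto simp: linear_sum linear_scale)
  hence "(\<Sum>v\<in>V. u v * (c - f v)) = 0"
   using x(2) u(2) by (simp add: right_diff_distrib sum_subtractf sum_distrib_right[symmetric])
  hence z: "\<forall>v\<in>V. u v * (c - f v) = 0"
   using sum_nonneg_eq_0_iff[OF assms(1), of "\<lambda>v. u v * (c - f v)"] u(1) assms(3) by simp
  let ?W = "{v\<in>V. f v = c}"
  have "sum u ?W = sum u V" "(\<Sum>v\<in>?W. u v *R v) = (\<Sum>v\<in>V. u v *R v)"
   using z assms(1) by (auto intro!: sum.mono_neutral_left)
  thus "x \<in> convex hull {v\<in>V. f v = f x}"
   using u x(2) convex_sum[of ?W "convex hull ?W" u "\<lambda>v. v"] assms(1) by (auto simp: hull_inc)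
 qed
qed

lemma supporting_face_of:
 fixes f :: "'a::real_vector => real"
 assumes "finite V" "linear f" "\<And>v. v \<in> V ==> f v <= c"
 shows "convex hull {v\<in>V. f v = c} face_of convex hull V"
proof -
 have le: "f x <= c" if "x \<in> convex hull V" for x
 proof -
  have "convex {x. f x <= c}"
   using convex_linear_vimage[OF assms(2), of "{..c}"] by (simp add: vimage_def)
  thus ?thesis using hull_minimal[of V "{x. f x <= c}" convex] assms(3) that by blast
 qed
 have eq: "convex hull {v \<in> V. f v = c} = {x \<in> convex hull V. f x = c}"
  by (rule convex_hull_supporting) (use assms in auto)
 have conv: "convex {x \<in> convex hull V. f x = c}"
  using convex_convex_hull[of "{v\<in>V. f v = c}"] by (simp only: eq)
 show ?thesis
  unfolding eq face_of_def
 proof (intro conjI ballI impI)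
  show "convex {x \<in> convex hull V. f x = c}" by (rule conv)
  fix a b x
  assume *: "a \<in> convex hull V" "b \<in> convex hull V" "x \<in> {x \<in> convex hull V. f x = c}" "x \<in> open_segment a b"
  obtain r where r: "0 < r" "r < 1" "x = (1 - r) *R a + r *R b"
   using *(4) by (auto simp: in_segment)
  have fx: "(1 - r) * f a + r * f b = c"
   using r(3) *(3) assms(2) by (auto simp: linear_add linear_scale)
  have "(1 - r) * f a <= (1 - r) * c" "r * f b <= r * c"
   using le *(1,2) r by (simp_all add: mult_left_mono)
  moreover have "(1 - r) * c + r * c = c" by (simp add: algebra_simps)
  ultimately have "(1 - r) * f a = (1 - r) * c" "r * f b = r * c"
   using fx by linarith+
  thus "a \<in> {x \<in> convex hull V. f x = c}" "b \<in> {x \<in> convex hull V. f x = c}"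
   using r * by auto
 qed auto
qed

text \<open>A point of \<open>V\<close> that has positive weight in a representation of
  \<open>x\<close> is an end of a segment with \<open>x\<close> in its interior, unless it equals
  \<open>x\<close>; so it belongs to the face of \<open>x\<close>.\<close>

lemma face_of_finite_hull:
 assumes "finite V" "F face_of convex hull V"
 shows "F = convex hull (V \<inter> F)"
proof
 have cF: "convex F" "F \<subseteq> convex hull V" using assms(2) by (auto simp: face_of_def)
 show "convex hull (V \<inter> F) \<subseteq> F"
  using cF by (simp add: hull_minimal)
 show "F \<subseteq> convex hull (V \<inter> F)"
 proof
  fix x assume xF: "x \<in> F"
  then obtain u where u: "\<forall>v\<in>V. 0 <= u v" "sum u V = 1" "(\<Sum>v\<in>V. u v *R v) = x"
   using cF(2) unfolding convex_hull_finite[OF assms(1)] by blast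
  have inF: "v \<in> F" if v: "v \<in> V" "u v > 0" for v
  proof (cases "u v = 1")
   case True
   have split: "sum u V = u v + sum u (V - {v})" "x = u v *R v + (\<Sum>w\<in>V - {v}. u w *R w)"
    using u(3) by (simp_all add: sum.remove[OF assms(1) v(1)])
   hence "sum u (V - {v}) = 0" using u(2) True by simp
   hence "\<forall>w\<in>V - {v}. u w = 0"
    using sum_nonneg_eq_0_iff[of "V - {v}" u] assms(1) u(1) by auto
   hence "(\<Sum>w\<in>V - {v}. u w *R w) = 0" by (intro sum.neutral) auto
   hence "x = v" using split True by simp
   thus ?thesis using xF by simp
  next
   case False
   have split: "sum u V = u v + sum u (V - {v})" "x = u v *R v + (\<Sum>w\<in>V - {v}. u w *R w)"
    using u(3) by (simp_all add: sum.remove[OF assms(1) v(1)])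
   have "sum u (V - {v}) >= 0" using u(1) by (intro sum_nonneg) auto
   with split(1) u(2) have s: "sum u (V - {v}) = 1 - u v" "1 - u v > 0" using False by auto
   define y where "y = (\<Sum>w\<in>V - {v}. (u w / (1 - u v)) *R w)"
   have y: "y \<in> convex hull V"
    unfolding y_def using u(1) s assms(1)
    by (intro convex_sum) (auto simp: sum_divide_distrib[symmetric] hull_inc)
   have "(1 - u v) *R y = (\<Sum>w\<in>V - {v}. u w *R w)"
    using s(2) by (simp add: y_def scaleR_sum_right)
   hence xy: "x = (1 - u v) *R y + u v *R v" using split(2) by simp
   show ?thesis
   proof (cases "y = v")
    case True
    hence "x = v" using xy by (simp add: scaleR_add_left[symmetric])
    thus ?thesis using xF by simp
   next
    case False
    hence "x \<in> open_segment y v"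
     using xy v(2) s(2) by (auto simp: in_segment)
    thus ?thesis using face_ofD[OF assms(2) _ y] v xF by (auto simp: hull_inc)
   qed
  qed
  let ?W = "{v\<in>V. u v > 0}"
  have "sum u ?W = sum u V" "(\<Sum>v\<in>?W. u v *R v) = (\<Sum>v\<in>V. u v *R v)"
   using u(1) assms(1) by (auto intro!: sum.mono_neutral_left simp: less_le)
  thus "x \<in> convex hull (V \<inter> F)"
   using u convex_sum[of ?W "convex hull (V \<inter> F)" u "\<lambda>v. v"] assms(1) inF by (auto simp: hull_inc)
 qed
qed

lemma polytope_face_polytope:
 assumes "polytope K" "F face_of K"
 shows "polytope F"
 using assms face_of_finite_hull unfolding polytope_def by (metis finite_Int)

lemma finite_faces_polytope:
 assumes "polytope K"
 shows "finite {F. F face_of K}"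
proof -
 obtain V where V: "finite V" "K = convex hull V" using assms unfolding polytope_def by blast
 have "{F. F face_of K} \<subseteq> (\<lambda>A. convex hull A) ` Pow V"
  using face_of_finite_hull[OF V(1)] V(2) by blast
 thus ?thesis using V(1) by (meson finite_Pow_iff finite_imageI finite_subset)
qed

section \<open>Vertices, facets, and dimension as an invariant of the face lattice\<close>

definition vertices :: "'a::real_vector set => 'a set" where
 "vertices K = {x. {x} face_of K}"

lemma vertices_extreme: "x \<in> vertices K \<longleftrightarrow> x extreme_point_of K"
 by (simp add: vertices_def face_of_singleton)

lemma convex_position_vertices:
 assumes "convex_position J"
 shows "vertices (convex hull J) = J"
proof
 have fin: "finite J" using assms by (simp add: convex_position_def)
 show "J \<subseteq> vertices (convex hull J)"
 proof
  fix v assume v: "v \<in> J"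
  obtain u :: "'a => real" where u: "linear u" "\<And>x. x \<in> J - {v} ==> u x < u v"
   using convex_position_vertex[OF assms v, of "{}"] by auto
  have "{w\<in>J. u w = u v} = {v}" using u(2) v by force
  hence "{v} face_of convex hull J"
   using supporting_face_of[OF fin u(1), of "u v"] u(2) by (metis Diff_iff convex_hull_singleton order.order_iff_strict singletonD)
  thus "v \<in> vertices (convex hull J)" by (simp add: vertices_def)
 qed
 show "vertices (convex hull J) \<subseteq> J"
  using extreme_point_of_convex_hull by (auto simp: vertices_extreme)
qed

text \<open>A generating subset of least cardinality is in convex position, since a point in the
  hull of the others could be dropped; its members are then exactly the extreme points.\<close>

lemma polytope_vertices:
 assumes "polytope K"
 shows "convex_position (vertices K)" "convex hull (vertices K) = K"
proof -
 obtain V where V: "finite V" "K = convex hull V" using assms unfolding polytope_def by blast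
 define W where "W = arg_min_on card {W. W \<subseteq> V & convex hull W = K}"
 have "finite {W. W \<subseteq> V & convex hull W = K}" "{W. W \<subseteq> V & convex hull W = K} ~= {}"
  using V by auto
 hence W: "W \<subseteq> V" "convex hull W = K" "\<And>W'. W' \<subseteq> V ==> convex hull W' = K ==> card W <= card W'"
  unfolding W_def using arg_min_if_finite(1)[of "{W. W \<subseteq> V & convex hull W = K}" card]
   arg_min_least[of "{W. W \<subseteq> V & convex hull W = K}" _ card] by auto
 have finW: "finite W" using W(1) V(1) finite_subset by blast
 have "convex_position W"
  unfolding convex_position_def
 proof (intro conjI ballI notI)
  fix v assume v: "v \<in> W" "v \<in> convex hull (W - {v})"
  hence "convex hull (W - {v}) = K"
   using W(2) hull_redundant[of v convex "W - {v}"] by (simp add: insert_absorb)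
  hence "card W <= card (W - {v})" using W by blast
  moreover have "card W > 0" using v(1) finW by (auto simp: card_gt_0_iff)
  ultimately show False using v(1) finW by simp
 qed (rule finW)
 thus "convex_position (vertices K)" "convex hull (vertices K) = K"
  using convex_position_vertices W(2) by metis+
qed

lemma has_aff_dim_insert:
 assumes "has_aff_dim A m" "hat v \<notin> span (hat ` A)"
 shows "has_aff_dim (insert v A) (m + 1)"
proof -
 obtain B where B: "finite B" "independent (hat ` B)" "span (hat ` B) = span (hat ` A)" "int (card B) = m + 1"
  using assms(1) unfolding has_aff_dim_hat by blast
 have nB: "hat v \<notin> span (hat ` B)" using assms(2) B(3) by simp
 hence "v \<notin> B" using span_base[of "hat v" "hat ` B"] by auto
 moreover have "independent (hat ` insert v B)"
  using independent_insertI[OF nB B(2)] by simp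
 moreover have "span (hat ` insert v B) = span (hat ` insert v A)"
  using B(3) by (simp add: span_insert)
 ultimately show ?thesis
  unfolding has_aff_dim_hat using B(1,4) by (intro exI[of _ "insert v B"]) simp
qed

lemma hat_functional_face:
 fixes \<phi> :: "'a::real_vector \<times> real => real"
 assumes "finite V" "linear \<phi>" "\<And>v. v \<in> V ==> \<phi> (hat v) <= 0"
 shows "convex hull {v\<in>V. \<phi> (hat v) = 0} face_of convex hull V"
proof -
 let ?f = "\<lambda>x. \<phi> (x, 0)" and ?c = "- \<phi> (0, 1)"
 have eq: "\<phi> (hat v) = ?f v - ?c" for v
  using linear_add[OF assms(2), of "(v, 0)" "(0, 1)"] by (simp add: hat_def)
 have "linear ?f"
 proof (rule linearI)
  show "\<phi> (x + y, 0) = \<phi> (x, 0) + \<phi> (y, 0)" for x y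
   using linear_add[OF assms(2), of "(x, 0)" "(y, 0)"] by simp
  show "\<phi> (r *R x, 0) = r *R \<phi> (x, 0)" for r x
   using linear_scale[OF assms(2), of r "(x, 0)"] by simp
 qed
 moreover have "?f v <= ?c" if "v \<in> V" for v
  using assms(3)[OF that] eq[of v] by linarith
 ultimately have "convex hull {v\<in>V. ?f v = ?c} face_of convex hull V"
  by (rule supporting_face_of[OF assms(1)])
 moreover have "{v\<in>V. \<phi> (hat v) = 0} = {v\<in>V. ?f v = ?c}"
  by (intro Collect_cong) (use eq in fastforce)
 ultimately show ?thesis by simp
qed

text \<open>An inclusion-maximal proper exposed set has codimension one: otherwise its supporting
 functional can be rotated until it meets a further point.\<close>

lemma polytope_facet:
 assumes "polytope K" "has_aff_dim K k" "k >= 0"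
 obtains G where "G face_of K" "has_aff_dim G (k - 1)"
proof -
 obtain V where V: "finite V" "K = convex hull V" using assms(1) unfolding polytope_def by blast
 have dimV: "has_aff_dim V k" using assms(2) V(2) has_aff_dim_convex_hull by blast
 have Vne: "V ~= {}"
 proof
  assume "V = {}"
  hence "has_aff_dim V (-1)" unfolding has_aff_dim_hat by (intro exI[of _ "{}"]) (auto simp: dependent_def)
  thus False using has_aff_dim_unique[OF dimV] assms(3) by force
 qed
 define \<A> where "\<A> = {A. A ~= V & (\<exists>\<phi> :: 'a \<times> real => real. linear \<phi> & (\<forall>v\<in>V. \<phi> (hat v) <= 0) & A = {v\<in>V. \<phi> (hat v) = 0})}"
 \<comment> \<open>Minus the homogenising coordinate is constant -1 on all points, so it exposes the
   empty set and the family of proper exposed sets is nonempty.\<close>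
 let ?n = "\<lambda>p :: 'a \<times> real. - snd p"
 have n: "linear ?n" "\<forall>v\<in>V. ?n (hat v) <= 0" "{} = {v\<in>V. ?n (hat v) = 0}"
  by (intro linearI) (auto simp: hat_def)
 have "{} \<in> \<A>"
  unfolding \<A>_def by (intro CollectI conjI exI[of _ ?n]) (use Vne n in blast)+
 moreover have "\<A> \<subseteq> Pow V"
  unfolding \<A>_def by blast
 hence "finite \<A>"
  by (rule finite_subset) (use V(1) in simp)
 ultimately obtain A where A: "A \<in> \<A>" "\<And>B. B \<in> \<A> ==> A \<subseteq> B ==> A = B"
  using finite_has_maximal2[of \<A> "{}"] by blast
 obtain \<phi> :: "'a \<times> real => real" where \<phi>: "linear \<phi>" "\<And>v. v \<in> V ==> \<phi> (hat v) <= 0" "A = {v\<in>V. \<phi> (hat v) = 0}" "A ~= V"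
  using A(1) unfolding \<A>_def by blast
 have AV: "A \<subseteq> V" using \<phi>(3) by blast
 obtain v1 where v1: "v1 \<in> V" "v1 \<notin> A" using \<phi>(4) AV by blast
 hence \<phi>v1: "\<phi> (hat v1) < 0" using \<phi>(2)[OF v1(1)] \<phi>(3) by auto
 have \<phi>A: "\<phi> y = 0" if "y \<in> span (hat ` A)" for y
  by (rule linear_eq_0_on_span[OF \<phi>(1) _ that]) (use \<phi>(3) in auto)
 hence v1A: "hat v1 \<notin> span (hat ` A)" using \<phi>v1 by fastforce
 obtain n where n: "has_aff_dim A (int n - 1)"
  using has_aff_dim_exists AV V(1) finite_subset by metis
 define m where "m = int n - 1"
 have dimA: "has_aff_dim A m" using n by (simp add: m_def)
 have dimA1: "has_aff_dim (insert v1 A) (m + 1)" by (rule has_aff_dim_insert[OF dimA v1A])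
 have sub: "hat ` insert v1 A \<subseteq> span (hat ` V)"
  using v1(1) AV span_superset[of "hat ` V"] by blast
 have le: "m + 1 <= k" by (rule has_aff_dim_le(1)[OF dimA1 dimV sub])
 have "m + 1 = k"
 proof (rule ccontr)
  assume ne: "m + 1 ~= k"
  have "\<not> hat ` V \<subseteq> span (hat ` insert v1 A)"
  proof
   assume "hat ` V \<subseteq> span (hat ` insert v1 A)"
   hence "k <= m + 1" by (rule has_aff_dim_le(1)[OF dimV dimA1])
   thus False using le ne by simp
  qed
  then obtain v2 where v2: "v2 \<in> V" "hat v2 \<notin> span (hat ` insert v1 A)" by blast
  obtain \<psi> :: "'a \<times> real => real" where \<psi>: "linear \<psi>" "\<And>y. y \<in> span (hat ` insert v1 A) ==> \<psi> y = 0" "\<psi> (hat v2) = 1"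
   using exists_linear_functional[OF v2(2)] by blast
  have \<psi>0: "\<psi> (hat v) = 0" if "v \<in> insert v1 A" for v
   using \<psi>(2)[OF span_base] that by blast
  define W where "W = {v\<in>V. \<psi> (hat v) > 0}"
  have W: "finite W" "v2 \<in> W" using V(1) v2(1) \<psi>(3) by (auto simp: W_def)
  have \<phi>W: "\<phi> (hat v) < 0" if "v \<in> W" for v
  proof -
   have "v \<in> V" "v \<notin> A" using that \<psi>0[of v] by (auto simp: W_def)
   thus ?thesis using \<phi>(2)[of v] \<phi>(3) by auto
  qed
  \<comment> \<open>The ratio test: moving from \<open>\<phi>\<close> in the direction of
    \<open>\<psi>\<close>, the point with the smallest ratio is the first to reach 0. On
    \<open>A\<close> and at \<open>v1\<close> nothing changes, so the new exposed set is larger than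
    \<open>A\<close> and still proper.\<close>
  define q where "q v = - \<phi> (hat v) / \<psi> (hat v)" for v
  obtain w where w: "w \<in> W" "\<And>v. v \<in> W ==> q w <= q v"
   using W arg_min_if_finite(1)[of W q] arg_min_least[of W _ q] by (metis empty_iff)
  have qw: "q w > 0" using \<phi>W[OF w(1)] w(1) by (auto simp: q_def W_def divide_neg_pos)
  define \<zeta> where "\<zeta> y = \<phi> y + q w * \<psi> y" for y
  have \<zeta>: "linear \<zeta>" using \<phi>(1) \<psi>(1) by (simp add: \<zeta>_def linear_iff algebra_simps)
  have \<zeta>le: "\<zeta> (hat v) <= 0" if v: "v \<in> V" for v
  proof (cases "v \<in> W")
   case True
   hence pos: "\<psi> (hat v) > 0" by (simp add: W_def)
   hence "q w * \<psi> (hat v) <= q v * \<psi> (hat v)" using w(2)[OF True] by simp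
   also have "... = - \<phi> (hat v)" using pos by (simp add: q_def)
   finally show ?thesis by (simp add: \<zeta>_def)
  next
   case False
   hence "\<psi> (hat v) <= 0" using v by (simp add: W_def)
   hence "q w * \<psi> (hat v) <= 0" using qw by (simp add: mult_nonneg_nonpos)
   thus ?thesis using \<phi>(2)[OF v] by (simp add: \<zeta>_def)
  qed
  have "\<zeta> (hat v1) < 0" using \<phi>v1 \<psi>0[of v1] by (simp add: \<zeta>_def)
  hence "{v\<in>V. \<zeta> (hat v) = 0} ~= V" using v1(1) by force
  hence "{v\<in>V. \<zeta> (hat v) = 0} \<in> \<A>" using \<zeta> \<zeta>le unfolding \<A>_def by blast
  moreover have "A \<subseteq> {v\<in>V. \<zeta> (hat v) = 0}" using \<phi>(3) \<psi>0 by (auto simp: \<zeta>_def)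
  ultimately have "A = {v\<in>V. \<zeta> (hat v) = 0}" using A(2) by blast
  moreover have "\<zeta> (hat w) = 0" using w(1) by (simp add: \<zeta>_def q_def W_def)
  ultimately have "w \<in> A" using w(1) by (simp add: W_def)
  thus False using \<phi>W[OF w(1)] \<phi>(3) by simp
 qed
 moreover have "convex hull A face_of K"
  using hat_functional_face[OF V(1) \<phi>(1,2)] \<phi>(3) V(2) by simp
 ultimately show ?thesis
  using that[of "convex hull A"] dimA by (auto simp: has_aff_dim_convex_hull)
qed

lemma face_dim_strict:
 assumes "F face_of K" "G face_of K" "F \<subset> G" "has_aff_dim F i" "has_aff_dim G j"
 shows "i < j"
proof -
 have sub: "hat ` F \<subseteq> span (hat ` G)" using assms(3) span_superset[of "hat ` G"] by blast
 have "i ~= j"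
 proof
  assume "i = j"
  hence eq: "span (hat ` F) = span (hat ` G)" by (rule has_aff_dim_le(2)[OF assms(4,5) sub])
  obtain x where x: "x \<in> G" "x \<notin> F" using assms(3) by blast
  hence "hat x \<in> span (hat ` F)" unfolding eq by (simp add: span_base)
  moreover have "x \<in> K" using x assms(2) face_of_imp_subset by blast
  ultimately show False using face_of_hat_span[OF assms(1)] x by blast
 qed
 thus ?thesis using has_aff_dim_le(1)[OF assms(4,5) sub] by simp
qed

lemma polytope_has_aff_dim:
 assumes "polytope K"
 obtains n where "has_aff_dim K (int n - 1)"
proof -
 obtain V where "finite V" "K = convex hull V" using assms unfolding polytope_def by blast
 thus ?thesis using has_aff_dim_exists[of V] that by (metis has_aff_dim_convex_hull)
qed

lemma has_aff_dim_ge: "has_aff_dim V d ==> d >= -1"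
 unfolding has_aff_dim_def by force

text \<open>A facet of \<open>F a\<close> corresponds to a face properly inside \<open>F' a\<close>,
  and a proper face has smaller dimension. The induction runs on \<open>i + 1\<close> because
  dimensions start at -1.\<close>

lemma realization_dim_le:
 assumes "realization r K F" "realization r K' F'" "a \<in> Field r" "has_aff_dim (F a) i" "has_aff_dim (F' a) j"
 shows "i <= j"
 using assms(3-5)
proof (induction "nat (i + 1)" arbitrary: a i j)
 case 0
 hence "i <= -1" by simp
 thus ?case using has_aff_dim_ge[OF 0(4)] by simp
next
 case (Suc n)
 have bij: "bij_betw F (Field r) {G. G face_of K}" "bij_betw F' (Field r) {G. G face_of K'}"
  and le: "\<And>a b. a \<in> Field r ==> b \<in> Field r ==> F a \<subseteq> F b \<longleftrightarrow> F' a \<subseteq> F' b"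
  and poly: "polytope K" "polytope K'"
  using assms(1,2) unfolding realization_def by auto
 have Fa: "F a face_of K" "F' a face_of K'"
  using bij Suc(3) by (auto dest: bij_betwE)
 have i: "i >= 0" using Suc(2) by simp
 obtain G where G: "G face_of F a" "has_aff_dim G (i - 1)"
  using polytope_facet[OF polytope_face_polytope[OF poly(1) Fa(1)] Suc(4) i] by blast
 have GK: "G face_of K" using G(1) Fa(1) face_of_trans by blast
 then obtain b where b: "b \<in> Field r" "F b = G"
  using bij(1) by (metis bij_betw_iff_bijections mem_Collect_eq)
 have "G ~= F a" using has_aff_dim_unique[OF G(2)] Suc(4) by fastforce
 hence "G \<subset> F a" using G(1) face_of_imp_subset by blast
 hence sub: "F' b \<subset> F' a" using le b Suc(3) by (metis psubset_eq order_refl subset_antisym)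
 have F'b: "F' b face_of K'" using bij(2) b(1) by (auto dest: bij_betwE)
 obtain m where m: "has_aff_dim (F' b) (int m - 1)"
  using polytope_has_aff_dim[OF polytope_face_polytope[OF poly(2) F'b]] by blast
 have "n = nat (i - 1 + 1)" using Suc(2) by simp
 hence "i - 1 <= int m - 1" using Suc(1) b m G(2) by blast
 moreover have "int m - 1 < j" by (rule face_dim_strict[OF F'b Fa(2) sub m Suc(5)])
 ultimately show ?case by simp
qed

lemma realization_dim:
 assumes "realization r K F" "realization r K' F'" "a \<in> Field r" "has_aff_dim (F a) i"
 shows "has_aff_dim (F' a) i"
proof -
 have "F' a face_of K'" using assms(2,3) unfolding realization_def by (auto dest: bij_betwE)
 moreover have "polytope K'" using assms(2) unfolding realization_def by blast
 ultimately obtain m where m: "has_aff_dim (F' a) (int m - 1)"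
  using polytope_has_aff_dim polytope_face_polytope by metis
 have "i = int m - 1"
  using realization_dim_le[OF assms m] realization_dim_le[OF assms(2,1,3) m assms(4)] by simp
 thus ?thesis using m by simp
qed

section \<open>Attaching points to a lifted planar configuration\<close>

definition affine_fun :: "(real \<times> real => real) => bool" where
 "affine_fun L \<longleftrightarrow> (\<exists>a b c. L = (\<lambda>p. a * fst p + b * snd p + c))"

lemma affine_fun_add_scale: "affine_fun L ==> affine_fun M ==> affine_fun (\<lambda>p. L p + t * M p)"
 unfolding affine_fun_def
proof clarify
 fix a b c a' b' c' :: real
 show "\<exists>x y z. (\<lambda>p. a * fst p + b * snd p + c + t * (a' * fst p + b' * snd p + c')) =
   (\<lambda>p :: real \<times> real. x * fst p + y * snd p + z)"
  by (rule exI[of _ "a + t * a'"], rule exI[of _ "b + t * b'"], rule exI[of _ "c + t * c'"])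
   (auto simp: algebra_simps)
qed

text \<open>The points \<open>w i\<close>, lifted to the heights \<open>h i\<close>, have an upper face with index set \<open>K\<close>.\<close>

definition cert :: "nat set => (nat => real \<times> real) => (nat => real) => nat set => bool" where
 "cert I w h K \<longleftrightarrow> K \<subseteq> I & (\<exists>L. affine_fun L & (\<forall>i\<in>K. h i + L (w i) = 0) & (\<forall>i\<in>I - K. h i + L (w i) < 0))"

lemma cert_cong:
 assumes "\<And>i. i \<in> I ==> h i = h' i" "\<And>i. i \<in> I ==> w i = w' i"
 shows "cert I w h K \<longleftrightarrow> cert I w' h' K"
proof (cases "K \<subseteq> I")
 case True
 hence "(\<forall>i\<in>K. h i + L (w i) = 0) = (\<forall>i\<in>K. h' i + L (w' i) = 0)"
  "(\<forall>i\<in>I - K. h i + L (w i) < 0) = (\<forall>i\<in>I - K. h' i + L (w' i) < 0)" for L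
  using assms by (auto simp: subset_iff)
 thus ?thesis unfolding cert_def by simp
qed (simp add: cert_def)

text \<open>Add the two affine functions: the second certificate has height 0, so the sum is a
  certificate for \<open>h\<close> again, and it vanishes only where both do.\<close>

lemma cert_inter:
 assumes "cert I w h K1" "cert I w (\<lambda>_. 0) K2"
 shows "cert I w h (K1 \<inter> K2)"
proof -
 obtain L1 where L1: "K1 \<subseteq> I" "affine_fun L1" "\<forall>i\<in>K1. h i + L1 (w i) = 0" "\<forall>i\<in>I - K1. h i + L1 (w i) < 0"
  using assms(1) unfolding cert_def by blast
 obtain L2 where L2: "K2 \<subseteq> I" "affine_fun L2" "\<forall>i\<in>K2. 0 + L2 (w i) = 0" "\<forall>i\<in>I - K2. 0 + L2 (w i) < 0"
  using assms(2) unfolding cert_def by blast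
 have "h i + (L1 (w i) + 1 * L2 (w i)) < 0" if i: "i \<in> I - K1 \<inter> K2" for i
 proof (cases "i \<in> K1")
  case True
  hence "h i + L1 (w i) = 0" "L2 (w i) < 0" using L1(3) L2(4) i by auto
  thus ?thesis by simp
 next
  case False
  hence "h i + L1 (w i) < 0" "L2 (w i) <= 0" using L1(4) L2(3,4) i by (cases "i \<in> K2"; force)+
  thus ?thesis by simp
 qed
 moreover have "h i + (L1 (w i) + 1 * L2 (w i)) = 0" if "i \<in> K1 \<inter> K2" for i
  using L1(3) L2(3) that by force
 ultimately show ?thesis
  unfolding cert_def using L1(1) affine_fun_add_scale[OF L1(2) L2(2), of 1] by blast
qed

lemma cert_vertex:
 assumes "cert I w (\<lambda>_. 0) {j, a}" "w j ~= w a" "finite I"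
 shows "cert I w (\<lambda>_. 0) {a}"
proof -
 obtain L where L: "{j, a} \<subseteq> I" "affine_fun L" "\<forall>i\<in>{j, a}. 0 + L (w i) = 0" "\<forall>i\<in>I - {j, a}. 0 + L (w i) < 0"
  using assms(1) unfolding cert_def by blast
 \<comment> \<open>The inner product with \<open>w a - w j\<close>, measured from
   \<open>w a\<close>: zero at \<open>a\<close> and negative at \<open>j\<close>. A small multiple
   turns the certificate of the edge into one of its end \<open>a\<close>.\<close>
 define M where "M p = (fst (w a) - fst (w j)) * (fst p - fst (w a)) + (snd (w a) - snd (w j)) * (snd p - snd (w a))" for p
 have M: "affine_fun M"
  unfolding affine_fun_def M_def
  by (rule exI[of _ "fst (w a) - fst (w j)"], rule exI[of _ "snd (w a) - snd (w j)"],
    rule exI[of _ "- (fst (w a) - fst (w j)) * fst (w a) - (snd (w a) - snd (w j)) * snd (w a)"])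
   (auto simp: algebra_simps)
 have Ma: "M (w a) = 0" by (simp add: M_def)
 have "M (w j) = - ((fst (w a) - fst (w j))\<^sup>2 + (snd (w a) - snd (w j))\<^sup>2)"
  by (simp add: M_def power2_eq_square algebra_simps)
 moreover have "(fst (w a) - fst (w j))\<^sup>2 + (snd (w a) - snd (w j))\<^sup>2 > 0"
  using assms(2) unfolding sum_power2_gt_zero_iff by (auto simp: prod_eq_iff)
 ultimately have Mj: "M (w j) < 0" by linarith
 have fin: "finite (I - {j, a})" using assms(3) by simp
 obtain d where d: "d > 0" "\<And>e i. 0 < e ==> e <= d ==> i \<in> I - {j, a} ==> - L (w i) + e * (- M (w i)) > 0"
  using small_perturbation[OF fin, of "\<lambda>i. - L (w i)" "\<lambda>i. - M (w i)"] L(4) by auto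
 have "0 + (L (w i) + d * M (w i)) < 0" if i: "i \<in> I - {a}" for i
 proof (cases "i = j")
  case True
  thus ?thesis using L(3) Mj d(1) by (simp add: mult_pos_neg)
 next
  case False
  thus ?thesis using d(2)[of d i] d(1) i by simp
 qed
 moreover have "\<forall>i\<in>{a}. 0 + (L (w i) + d * M (w i)) = 0" using L(3) Ma by simp
 ultimately show ?thesis
  unfolding cert_def using L(1) affine_fun_add_scale[OF L(2) M, of d]
  by (intro conjI exI[of _ "\<lambda>p. L p + d * M p"]) auto
qed

lemma affine_fun_comb:
 assumes "affine_fun L"
 shows "L ((1 - s) *R x + s *R y + e *R r) = (1 - s) * L x + s * L y + e * (L r - L 0)"
proof -
 obtain a b c where "L = (\<lambda>p. a * fst p + b * snd p + c)" using assms unfolding affine_fun_def by blast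
 thus ?thesis by (simp add: algebra_simps)
qed

text \<open>On the open segment from \<open>w j\<close> to \<open>w k\<close> the new heights lie
  strictly below every certificate: for \<open>u ~= z\<close> by assumption, for \<open>z\<close>
  because one end of the segment is strictly below. These are finitely many strict inequalities, so
  a common small displacement of the new points in the directions \<open>r m\<close> preserves all
  of them.\<close>

lemma attach_eventually:
 fixes h :: "'u => nat => real"
 assumes "finite I" "finite H" "j \<in> I" "k \<in> I" "finite M" "\<And>m. m \<in> M ==> 0 < s m & s m < 1"
  "\<And>u m. u \<in> H ==> u ~= z ==> m \<in> M ==> h u m < (1 - s m) * h u j + s m * h u k"
  "\<And>i. h z i = 0"
 shows "\<exists>d>0. \<forall>u\<in>H. \<forall>K e. cert I w (h u) K --> (u ~= z \<or> \<not> {j, k} \<subseteq> K) --> 0 < e --> e <= d -->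
   (\<exists>L. affine_fun L & (\<forall>i\<in>K. h u i + L (w i) = 0) & (\<forall>i\<in>I - K. h u i + L (w i) < 0)
    & (\<forall>m\<in>M. h u m + L ((1 - s m) *R w j + s m *R w k + e *R r m) < 0))"
proof -
 define T where "T = {(u, K). u \<in> H & K \<subseteq> I & cert I w (h u) K & (u ~= z \<or> \<not> {j, k} \<subseteq> K)}"
 have "T \<subseteq> H \<times> Pow I" by (auto simp: T_def)
 hence "finite T" using assms(1,2) by (meson finite_Pow_iff finite_SigmaI finite_subset)
 hence finT: "finite (T \<times> M)" using assms(5) by simp
 have "\<forall>t\<in>T. \<exists>L. affine_fun L & (\<forall>i\<in>snd t. h (fst t) i + L (w i) = 0) & (\<forall>i\<in>I - snd t. h (fst t) i + L (w i) < 0)"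
  unfolding T_def cert_def by auto
 from bchoice[OF this] obtain L where L': "\<forall>t\<in>T. affine_fun (L t) & (\<forall>i\<in>snd t. h (fst t) i + L t (w i) = 0) & (\<forall>i\<in>I - snd t. h (fst t) i + L t (w i) < 0)" ..
 have L: "affine_fun (L t)" "i \<in> snd t ==> h (fst t) i + L t (w i) = 0"
  "i \<in> I - snd t ==> h (fst t) i + L t (w i) < 0" if "t \<in> T" for t i
  using L' that by blast+
 define f where "f tm = - (h (fst (fst tm)) (snd tm) + ((1 - s (snd tm)) * L (fst tm) (w j) + s (snd tm) * L (fst tm) (w k)))" for tm
 define g where "g tm = - (L (fst tm) (r (snd tm)) - L (fst tm) 0)" for tm
 have "f (t, m) > 0" if t: "t \<in> T" and m: "m \<in> M" for t m
 proof -
  have s: "0 < s m" "s m < 1" using assms(6)[OF m] by auto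
  have le: "h (fst t) i + L t (w i) <= 0" if "i \<in> I" for i
   using L(2)[OF t, of i] L(3)[OF t, of i] that by (cases "i \<in> snd t") auto
  hence lejk: "(1 - s m) * L t (w j) <= (1 - s m) * (- h (fst t) j)" "s m * L t (w k) <= s m * (- h (fst t) k)"
   using le[OF assms(3)] le[OF assms(4)] s by (intro mult_left_mono; linarith)+
  show ?thesis
  proof (cases "fst t = z")
   case False
   hence "h (fst t) m < (1 - s m) * h (fst t) j + s m * h (fst t) k" using assms(7) t m by (auto simp: T_def)
   thus ?thesis using lejk by (simp add: f_def)
  next
   case True
   hence "\<not> {j, k} \<subseteq> snd t" using t by (auto simp: T_def)
   hence "L t (w j) < 0 \<or> L t (w k) < 0"
    using L(3)[OF t, of j] L(3)[OF t, of k] assms(3,4,8) True by auto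
   moreover have "L t (w j) <= 0" "L t (w k) <= 0" using le[OF assms(3)] le[OF assms(4)] assms(8) True by auto
   ultimately have "(1 - s m) * L t (w j) + s m * L t (w k) < 0"
    using s by (smt (verit) mult_pos_neg mult_nonneg_nonpos)
   thus ?thesis using True assms(8) by (simp add: f_def)
  qed
 qed
 hence "f tm > 0" if "tm \<in> T \<times> M" for tm using that by (cases tm) auto
 then obtain d where d: "d > 0" "\<And>e t. 0 < e ==> e <= d ==> t \<in> T \<times> M ==> f t + e * g t > 0"
  using small_perturbation[OF finT, of f g] by metis
 show ?thesis
 proof (intro exI[of _ d] conjI ballI allI impI)
  show "d > 0" by (rule d(1))
  fix u K e
  assume *: "u \<in> H" "cert I w (h u) K" "u ~= z \<or> \<not> {j, k} \<subseteq> K" "0 < e" "e <= d"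
  hence t: "(u, K) \<in> T" by (auto simp: T_def cert_def)
  have "h u m + L (u, K) ((1 - s m) *R w j + s m *R w k + e *R r m) < 0" if m: "m \<in> M" for m
  proof -
   have "h u m + L (u, K) ((1 - s m) *R w j + s m *R w k + e *R r m) = - (f ((u, K), m) + e * g ((u, K), m))"
    unfolding affine_fun_comb[OF L(1)[OF t]] by (simp add: f_def g_def algebra_simps)
   thus ?thesis using d(2)[OF *(4,5), of "((u, K), m)"] t m by simp
  qed
  thus "\<exists>L. affine_fun L & (\<forall>i\<in>K. h u i + L (w i) = 0) & (\<forall>i\<in>I - K. h u i + L (w i) < 0)
    & (\<forall>m\<in>M. h u m + L ((1 - s m) *R w j + s m *R w k + e *R r m) < 0)"
   using L[OF t] by (intro exI[of _ "L (u, K)"]) auto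
 qed
qed

lemma cert_extendI:
 assumes "K \<subseteq> insert m I" "m \<notin> I" "affine_fun L"
  "\<And>i. i \<in> K ==> i ~= m ==> h i + L (w i) = 0" "\<And>i. i \<in> I ==> i \<notin> K ==> h i + L (w i) < 0"
  "m \<in> K ==> h m + L p = 0" "m \<notin> K ==> h m + L p < 0"
 shows "cert (insert m I) (w(m := p)) h K"
 unfolding cert_def
proof (intro conjI exI[of _ L] ballI)
 show "K \<subseteq> insert m I" "affine_fun L" by fact+
 show "h i + L ((w(m := p)) i) = 0" if "i \<in> K" for i
  using assms(4)[OF that] assms(6) that by (cases "i = m") auto
 show "h i + L ((w(m := p)) i) < 0" if "i \<in> insert m I - K" for i
  using assms(5)[of i] assms(7) that by (cases "i = m") auto
qed

text \<open>\<open>r\<close> is the gradient of \<open>L\<close>, an outer normal of the edge. The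
  third point ensures that \<open>L\<close> is not constant.\<close>

lemma shadow_edge_normal:
 assumes "cert I w (\<lambda>_. 0) {j, k}" "i \<in> I" "i \<notin> {j, k}"
 obtains L r where "affine_fun L" "L (w j) = 0" "L (w k) = 0" "\<And>i. i \<in> I ==> i \<notin> {j, k} ==> L (w i) < 0"
  "L r - L 0 > 0"
proof -
 obtain L where L: "affine_fun L" "\<forall>i\<in>{j, k}. 0 + L (w i) = 0" "\<forall>i\<in>I - {j, k}. 0 + L (w i) < 0"
  using assms(1) unfolding cert_def by blast
 obtain a b c where abc: "L = (\<lambda>p. a * fst p + b * snd p + c)" using L(1) unfolding affine_fun_def by blast
 have "(a, b) ~= (0, 0)"
 proof
  assume "(a, b) = (0, 0)"
  hence "L (w i) = L (w j)" by (simp add: abc)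
  thus False using L(2,3) assms(2,3) by force
 qed
 hence "a\<^sup>2 + b\<^sup>2 > 0" by (auto simp: sum_power2_gt_zero_iff)
 hence "L (a, b) - L 0 > 0" by (simp add: abc power2_eq_square)
 thus ?thesis using that[of L "(a, b)"] L by auto
qed

text \<open>The new point is the midpoint of the edge, pushed outward a little. Old certificates
  stay strict there. To let \<open>m\<close> join a face on the edge, its certificate is tilted
  about the line of the edge by a multiple of \<open>L0\<close>, which raises \<open>m\<close>,
  keeps \<open>j\<close> and \<open>k\<close>, and lowers the rest. Only faces of \<open>z\<close>
  that contain the whole edge are given up, because the planar edge is now cut off by
  \<open>m\<close>.\<close>

lemma attach_fibre:
 fixes h :: "'u => nat => real"
 assumes fin: "finite I" "finite H" and jk: "j \<in> I" "k \<in> I" "j ~= k" and third: "i0 \<in> I" "i0 \<notin> {j, k}"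
  and m: "m \<notin> I" and z: "z \<in> H" "\<And>i. h z i = 0"
  and singles: "\<And>i. i \<in> I ==> cert I w (h z) {i}"
  and edge: "\<And>u. u \<in> H ==> cert I w (h u) {j, k}"
  and height: "\<And>u. u \<in> H ==> u ~= z ==> h u m < (h u j + h u k) / 2"
 obtains p where
  "\<And>u K. u \<in> H ==> cert I w (h u) K ==> u ~= z \<or> \<not> {j, k} \<subseteq> K ==> cert (insert m I) (w(m := p)) (h u) K"
  "\<And>u. u \<in> H ==> u ~= z ==> cert (insert m I) (w(m := p)) (h u) {j, k, m}"
  "\<And>u. u \<in> H ==> cert (insert m I) (w(m := p)) (h u) {j, m}"
  "\<And>u. u \<in> H ==> cert (insert m I) (w(m := p)) (h u) {m, k}"
  "cert (insert m I) (w(m := p)) (h z) {m}"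
proof -
 have hz: "h z = (\<lambda>_. 0)" using z(2) by auto
 have edgez: "cert I w (\<lambda>_. 0) {j, k}" using edge[OF z(1)] unfolding hz .
 obtain L0 r where L0: "affine_fun L0" "L0 (w j) = 0" "L0 (w k) = 0" "\<And>i. i \<in> I ==> i \<notin> {j, k} ==> L0 (w i) < 0"
  and r: "L0 r - L0 0 > 0"
  by (rule shadow_edge_normal[OF edgez third]) (rule that)
 have hs: "h u m < (1 - 1/2) * h u j + 1/2 * h u k" if "u \<in> H" "u ~= z" for u
  using height[OF that] by simp
 define x where "x e = (1 - 1/2) *R w j + (1/2) *R w k + e *R r" for e :: real
 obtain d where d: "d > 0" and ev: "\<forall>u\<in>H. \<forall>K e. cert I w (h u) K --> (u ~= z \<or> \<not> {j, k} \<subseteq> K) --> 0 < e --> e <= d -->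
   (\<exists>L. affine_fun L & (\<forall>i\<in>K. h u i + L (w i) = 0) & (\<forall>i\<in>I - K. h u i + L (w i) < 0) & h u m + L (x e) < 0)"
  using attach_eventually[of I H j k "{m}" "\<lambda>_. 1/2" z h w "\<lambda>_. r", OF fin jk(1,2) _ _ _ z(2)] hs
  unfolding x_def by auto
 define p where "p = x d"
 have evp: "\<exists>L. affine_fun L & (\<forall>i\<in>K. h u i + L (w i) = 0) & (\<forall>i\<in>I - K. h u i + L (w i) < 0) & h u m + L p < 0"
  if "u \<in> H" "cert I w (h u) K" "u ~= z \<or> \<not> {j, k} \<subseteq> K" for u K
  using ev that d unfolding p_def by blast
 define N where "N = L0 p"
 have N: "N > 0"
  unfolding N_def p_def x_def affine_fun_comb[OF L0(1)] using L0(2,3) r d by simp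
 let ?I = "insert m I" and ?w = "w(m := p)"
 have old: "cert ?I ?w (h u) K" if u: "u \<in> H" "cert I w (h u) K" "u ~= z \<or> \<not> {j, k} \<subseteq> K" for u K
 proof -
  obtain L where L: "affine_fun L" "\<forall>i\<in>K. h u i + L (w i) = 0" "\<forall>i\<in>I - K. h u i + L (w i) < 0" "h u m + L p < 0"
   using evp[OF u] by blast
  have K: "K \<subseteq> I" using u(2) by (simp add: cert_def)
  show ?thesis
   by (rule cert_extendI[OF _ m L(1)]) (use L K m in auto)
 qed
 \<comment> \<open>The factor \<open>- v / N\<close> is positive and cancels the deficit
   \<open>v\<close> at the new point; elsewhere \<open>L0\<close> is nonpositive.\<close>
 have tilt: "affine_fun (\<lambda>q. L q + (- v / N) * L0 q)" "L p + (- v / N) * L0 p = L p - v"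
  "v < 0 ==> i \<in> I ==> L (w i) + (- v / N) * L0 (w i) <= L (w i)" if "affine_fun L" for L v i
 proof -
  show "affine_fun (\<lambda>q. L q + (- v / N) * L0 q)" by (rule affine_fun_add_scale[OF that L0(1)])
  show "L p + (- v / N) * L0 p = L p - v" using N by (simp add: N_def)
  assume "v < 0" "i \<in> I"
  hence "- v / N >= 0" using N by (intro divide_nonneg_pos) auto
  moreover have "L0 (w i) <= 0" using L0(2,3) L0(4)[OF \<open>i \<in> I\<close>] by (cases "i \<in> {j, k}") auto
  ultimately have "(- v / N) * L0 (w i) <= 0" by (rule mult_nonneg_nonpos)
  thus "L (w i) + (- v / N) * L0 (w i) <= L (w i)" by linarith
 qed
 have triple: "cert ?I ?w (h u) {j, k, m}" if u: "u \<in> H" "u ~= z" for u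
 proof -
  obtain L where L: "affine_fun L" "\<forall>i\<in>{j, k}. h u i + L (w i) = 0" "\<forall>i\<in>I - {j, k}. h u i + L (w i) < 0" "h u m + L p < 0"
   using evp[OF u(1) edge[OF u(1)]] u(2) by blast
  let ?v = "h u m + L p"
  show ?thesis
  proof (rule cert_extendI[OF _ m tilt(1)[OF L(1), of ?v]])
   show "{j, k, m} \<subseteq> ?I" using jk by auto
   show "h u i + (L (w i) + (- ?v / N) * L0 (w i)) = 0" if "i \<in> {j, k, m}" "i ~= m" for i
    using that L(2) L0(2,3) by auto
   show "h u i + (L (w i) + (- ?v / N) * L0 (w i)) < 0" if "i \<in> I" "i \<notin> {j, k, m}" for i
    using tilt(3)[OF L(1,4) that(1)] L(3) that by force
   show "h u m + (L p + (- ?v / N) * L0 p) = 0" unfolding tilt(2)[OF L(1)] by simp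
  qed simp
 qed
 \<comment> \<open>Tilting the certificate of the single vertex \<open>i\<close> brings in
   \<open>m\<close>. The other end of the edge stays strictly negative, because \<open>L0\<close>
   vanishes there.\<close>
 have shadow: "cert ?I ?w (h z) {i, m}" if i: "i \<in> {j, k}" for i
 proof -
  have iI: "i \<in> I" using i jk by auto
  have "\<not> {j, k} \<subseteq> {i}" using jk by auto
  then obtain L where L: "affine_fun L" "\<forall>i'\<in>{i}. h z i' + L (w i') = 0" "\<forall>i'\<in>I - {i}. h z i' + L (w i') < 0" "h z m + L p < 0"
   using evp[OF z(1) singles[OF iI]] by blast
  let ?v = "h z m + L p"
  show ?thesis
  proof (rule cert_extendI[OF _ m tilt(1)[OF L(1), of ?v]])
   show "{i, m} \<subseteq> ?I" using iI by auto
   show "h z i' + (L (w i') + (- ?v / N) * L0 (w i')) = 0" if "i' \<in> {i, m}" "i' ~= m" for i'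
    using that L(2) L0(2,3) i by auto
   show "h z i' + (L (w i') + (- ?v / N) * L0 (w i')) < 0" if "i' \<in> I" "i' \<notin> {i, m}" for i'
    using tilt(3)[OF L(1,4) that(1)] L(3) that by force
   show "h z m + (L p + (- ?v / N) * L0 p) = 0" unfolding tilt(2)[OF L(1)] by simp
  qed simp
 qed
 have shadow0: "cert ?I ?w (\<lambda>_. 0) {i, m}" if "i \<in> {j, k}" for i
  using shadow[OF that] unfolding hz .
 have pairs: "cert ?I ?w (h u) {i, m}" if u: "u \<in> H" and i: "i \<in> {j, k}" for u i
 proof (cases "u = z")
  case True
  thus ?thesis using shadow[OF i] by simp
 next
  case False
  have "{j, k, m} \<inter> {i, m} = {i, m}" using i by auto
  thus ?thesis using cert_inter[OF triple[OF u False] shadow0[OF i]] by simp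
 qed
 have "{j, m} \<inter> {k, m} = {m}" using jk m by auto
 hence single: "cert ?I ?w (h z) {m}"
  using cert_inter[OF shadow[of j] shadow0[of k]] by simp
 show ?thesis
 proof (rule that[of p])
  show "cert ?I ?w (h u) {m, k}" if "u \<in> H" for u
   using pairs[OF that, of k] by (simp add: insert_commute)
 qed (use old triple pairs single in auto)
qed

text \<open>The points \<open>j\<close>, \<open>k\<close>, \<open>a\<close>, \<open>b\<close> form a frustum: the lines \<open>w j w k\<close> and \<open>w a w b\<close> meet in
 \<open>2 w k - w j\<close>, where the heights extrapolate to \<open>0\<close> if \<open>h u k = h u j / 2\<close>.\<close>

lemma attach_pair:
 fixes h :: "'u => nat => real"
 assumes fin: "finite I" "finite H" and jk: "j \<in> I" "k \<in> I" "j ~= k" and third: "i0 \<in> I" "i0 \<notin> {j, k}"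
  and ab: "a \<notin> I" "b \<notin> I" "a ~= b" and z: "z \<in> H" "\<And>i. h z i = 0"
  and singles: "\<And>i. i \<in> I ==> cert I w (h z) {i}"
  and edge: "\<And>u. u \<in> H ==> cert I w (h u) {j, k}"
  and height: "\<And>u. u \<in> H ==> u ~= z ==> h u a < 3/4 * h u j + 1/4 * h u k"
   "\<And>u. u \<in> H ==> u ~= z ==> h u b < 1/2 * h u j + 1/2 * h u k"
 obtains w' where "\<And>i. i \<in> I ==> w' i = w i"
  "w' b = (6/7) *R w' a + (1/7) *R (2 *R w k - w j)"
  "\<And>u K. u \<in> H ==> cert I w (h u) K ==> u ~= z \<or> \<not> {j, k} \<subseteq> K ==> cert (insert b (insert a I)) w' (h u) K"
  "\<And>u. u \<in> H ==> u ~= z ==> h u k = h u j / 2 ==> h u b = 6/7 * h u a ==> cert (insert b (insert a I)) w' (h u) {j, k, a, b}"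
  "cert (insert b (insert a I)) w' (h z) {a}" "cert (insert b (insert a I)) w' (h z) {b}"
proof -
 have hz: "h z = (\<lambda>_. 0)" using z(2) by auto
 have edgez: "cert I w (\<lambda>_. 0) {j, k}" using edge[OF z(1)] unfolding hz .
 obtain L0 r where L0: "affine_fun L0" "L0 (w j) = 0" "L0 (w k) = 0" "\<And>i. i \<in> I ==> i \<notin> {j, k} ==> L0 (w i) < 0"
  and r: "L0 r - L0 0 > 0"
  by (rule shadow_edge_normal[OF edgez third]) (rule that)
 \<comment> \<open>The new points start at one quarter and one half of the edge and are pushed out
   by \<open>r\<close> and \<open>(6/7) r\<close>. Since \<open>6/7 * 3/4 - 1/7 = 1/2\<close> and
   \<open>6/7 * 1/4 + 2/7 = 1/2\<close>, \<open>b\<close> divides the segment from \<open>a\<close>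
   to \<open>2 w k - w j\<close> as required.\<close>
 define s :: "nat => real" where "s m = (if m = a then 1/4 else 1/2)" for m
 define rr where "rr m = (if m = a then r else (6/7) *R r)" for m
 define x where "x m e = (1 - s m) *R w j + s m *R w k + e *R rr m" for m and e :: real
 have hs: "h u m < (1 - s m) * h u j + s m * h u k" if "u \<in> H" "u ~= z" "m \<in> {a, b}" for u m
  using height(1)[OF that(1,2)] height(2)[OF that(1,2)] that(3) ab(3) by (auto simp: s_def)
 have s01: "0 < s m & s m < 1" for m by (simp add: s_def)
 obtain d where d: "d > 0" and ev: "\<forall>u\<in>H. \<forall>K e. cert I w (h u) K --> (u ~= z \<or> \<not> {j, k} \<subseteq> K) --> 0 < e --> e <= d -->
   (\<exists>L. affine_fun L & (\<forall>i\<in>K. h u i + L (w i) = 0) & (\<forall>i\<in>I - K. h u i + L (w i) < 0) & (\<forall>m\<in>{a, b}. h u m + L (x m e) < 0))"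
  using attach_eventually[of I H j k "{a, b}" s z h w rr, OF fin jk(1,2) _ s01 hs z(2)]
  unfolding x_def by blast
 define pa where "pa = x a d"
 define pb where "pb = x b d"
 have evp: "\<exists>L. affine_fun L & (\<forall>i\<in>K. h u i + L (w i) = 0) & (\<forall>i\<in>I - K. h u i + L (w i) < 0) & h u a + L pa < 0 & h u b + L pb < 0"
  if "u \<in> H" "cert I w (h u) K" "u ~= z \<or> \<not> {j, k} \<subseteq> K" for u K
  using ev that d unfolding pa_def pb_def by blast
 have pb: "pb = (6/7) *R pa + (1/7) *R (2 *R w k - w j)"
  using ab(3) by (simp add: pa_def pb_def x_def s_def rr_def prod_eq_iff algebra_simps)
 have Lpb: "L pb = 6/7 * L pa + 1/7 * (2 * L (w k) - L (w j))" if L: "affine_fun L" for L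
 proof -
  obtain a' b' c' where "L = (\<lambda>p. a' * fst p + b' * snd p + c')" using L unfolding affine_fun_def by blast
  thus ?thesis by (simp add: pb algebra_simps)
 qed
 define N where "N = L0 pa"
 have N: "N > 0"
  unfolding N_def pa_def x_def affine_fun_comb[OF L0(1)] using L0(2,3) r d by (simp add: rr_def)
 have Nb: "L0 pb = 6/7 * N" using Lpb[OF L0(1)] L0(2,3) by (simp add: N_def)
 let ?I = "insert b (insert a I)"
 define w' where "w' = w(a := pa, b := pb)"
 have w': "w' a = pa" "w' b = pb" "\<And>i. i \<in> I ==> w' i = w i" using ab by (auto simp: w'_def)
 have certI: "cert ?I w' (h u) K" if "K \<subseteq> ?I" "affine_fun L" "\<And>i. i \<in> K ==> i \<in> I ==> h u i + L (w i) = 0"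
  "\<And>i. i \<in> I ==> i \<notin> K ==> h u i + L (w i) < 0"
  "if a \<in> K then h u a + L pa = 0 else h u a + L pa < 0" "if b \<in> K then h u b + L pb = 0 else h u b + L pb < 0" for u K L
  unfolding cert_def
 proof (intro conjI exI[of _ L] ballI)
  show "K \<subseteq> ?I" "affine_fun L" by fact+
  show "h u i + L (w' i) = 0" if "i \<in> K" for i
  proof -
   consider "i = a" | "i = b" | "i \<in> I" using \<open>K \<subseteq> ?I\<close> \<open>i \<in> K\<close> by blast
   thus ?thesis using \<open>i \<in> K\<close> \<open>\<And>i. i \<in> K ==> i \<in> I ==> h u i + L (w i) = 0\<close>
     \<open>if a \<in> K then h u a + L pa = 0 else h u a + L pa < 0\<close> \<open>if b \<in> K then h u b + L pb = 0 else h u b + L pb < 0\<close>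
    by cases (simp_all add: w')
  qed
  show "h u i + L (w' i) < 0" if "i \<in> ?I - K" for i
  proof -
   consider "i = a" | "i = b" | "i \<in> I" using \<open>i \<in> ?I - K\<close> by blast
   thus ?thesis using \<open>i \<in> ?I - K\<close> \<open>\<And>i. i \<in> I ==> i \<notin> K ==> h u i + L (w i) < 0\<close>
     \<open>if a \<in> K then h u a + L pa = 0 else h u a + L pa < 0\<close> \<open>if b \<in> K then h u b + L pb = 0 else h u b + L pb < 0\<close>
    by cases (simp_all add: w')
  qed
 qed
 have old: "cert ?I w' (h u) K" if u: "u \<in> H" "cert I w (h u) K" "u ~= z \<or> \<not> {j, k} \<subseteq> K" for u K
 proof -
  obtain L where L: "affine_fun L" "\<forall>i\<in>K. h u i + L (w i) = 0" "\<forall>i\<in>I - K. h u i + L (w i) < 0" "h u a + L pa < 0" "h u b + L pb < 0"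
   using evp[OF u] by blast
  have K: "K \<subseteq> I" using u(2) by (simp add: cert_def)
  hence "a \<notin> K" "b \<notin> K" using ab by auto
  thus ?thesis
   by (intro certI[OF _ L(1)]) (use L K in auto)
 qed
 have tilt: "affine_fun (\<lambda>q. L q + (- v / t) * L0 q)"
  "v < 0 ==> t > 0 ==> i \<in> I ==> L (w i) + (- v / t) * L0 (w i) <= L (w i)" if "affine_fun L" for L v i t
 proof -
  show "affine_fun (\<lambda>q. L q + (- v / t) * L0 q)" by (rule affine_fun_add_scale[OF that L0(1)])
  assume "v < 0" "t > 0" "i \<in> I"
  hence "- v / t >= 0" by (intro divide_nonneg_pos) auto
  moreover have "L0 (w i) <= 0" using L0(2,3) L0(4)[OF \<open>i \<in> I\<close>] by (cases "i \<in> {j, k}") auto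
  ultimately have "(- v / t) * L0 (w i) <= 0" by (rule mult_nonneg_nonpos)
  thus "L (w i) + (- v / t) * L0 (w i) <= L (w i)" by linarith
 qed
 have quad: "cert ?I w' (h u) {j, k, a, b}" if u: "u \<in> H" "u ~= z" "h u k = h u j / 2" "h u b = 6/7 * h u a" for u
 proof -
  obtain L where L: "affine_fun L" "\<forall>i\<in>{j, k}. h u i + L (w i) = 0" "\<forall>i\<in>I - {j, k}. h u i + L (w i) < 0" "h u a + L pa < 0"
   using evp[OF u(1) edge[OF u(1)]] u(2) by blast
  let ?v = "h u a + L pa"
  let ?L = "\<lambda>q. L q + (- ?v / N) * L0 q"
  have a0: "h u a + ?L pa = 0" using N by (simp add: N_def)
  have jk0: "h u j + ?L (w j) = 0" "h u k + ?L (w k) = 0" using L(2) L0(2,3) by simp_all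
  have b0: "h u b + ?L pb = 0"
  proof -
   have lin: "B = 6/7 * A + 1/7 * (2 * K - J) ==> ha + A = 0 ==> hj + J = 0 ==> hk + K = 0 ==>
     hk = hj / 2 ==> hb = 6/7 * ha ==> hb + B = 0" for A B J K ha hb hj hk :: real
   proof -
    assume *: "B = 6/7 * A + 1/7 * (2 * K - J)" "ha + A = 0" "hj + J = 0" "hk + K = 0" "hk = hj / 2" "hb = 6/7 * ha"
    have "2 * K - J = 0" using *(3-5) by linarith
    hence "B = 6/7 * A" using *(1) by simp
    thus "hb + B = 0" using *(2,6) by simp
   qed
   show ?thesis
    by (rule lin[OF Lpb[OF tilt(1)[OF L(1), of ?v N]] a0 jk0 u(3,4)])
  qed
  show ?thesis
  proof (rule certI[OF _ tilt(1)[OF L(1), of ?v N]])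
   show "{j, k, a, b} \<subseteq> ?I" using jk by auto
   show "h u i + ?L (w i) = 0" if "i \<in> {j, k, a, b}" "i \<in> I" for i
    using that jk0 ab by blast
   show "h u i + ?L (w i) < 0" if "i \<in> I" "i \<notin> {j, k, a, b}" for i
    using tilt(2)[OF L(1,4) N that(1)] L(3) that by force
   show "if a \<in> {j, k, a, b} then h u a + ?L pa = 0 else h u a + ?L pa < 0" using a0 by simp
   show "if b \<in> {j, k, a, b} then h u b + ?L pb = 0 else h u b + ?L pb < 0" using b0 by simp
  qed
 qed
 have neq: "j ~= a" "j ~= b" "k ~= a" "k ~= b" using jk ab by auto
 \<comment> \<open>\<open>A\<close>, \<open>B\<close>, \<open>J\<close>, \<open>K\<close> are the
   values of an affine function at \<open>a\<close>, \<open>b\<close>, \<open>j\<close>,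
   \<open>k\<close>, related by the position of \<open>b\<close>. One vanishing at \<open>a\<close>
   and \<open>j\<close> is negative at \<open>b\<close>, one vanishing at \<open>b\<close> and
   \<open>k\<close> is negative at \<open>a\<close>. This yields the planar edges
   \<open>{j, a}\<close> and \<open>{k, b}\<close>, and from them the vertices \<open>a\<close> and
   \<open>b\<close>.\<close>
 have lin1: "B < 0" if "B = 6/7 * A + 1/7 * (2 * K - J)" "A = 0" "J = 0" "K < 0" for A B J K :: real
  using that by simp
 have lin2: "A < 0" if "B = 6/7 * A + 1/7 * (2 * K - J)" "B = 0" "K = 0" "J < 0" for A B J K :: real
 proof -
  have "6/7 * A = 1/7 * J" using that by simp
  thus ?thesis using that(4) by simp
 qed
 obtain Lj where Lj: "affine_fun Lj" "\<forall>i\<in>{j}. h z i + Lj (w i) = 0" "\<forall>i\<in>I - {j}. h z i + Lj (w i) < 0" "h z a + Lj pa < 0" "h z b + Lj pb < 0"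
  using evp[OF z(1) singles[OF jk(1)]] jk by blast
 obtain Lk where Lk: "affine_fun Lk" "\<forall>i\<in>{k}. h z i + Lk (w i) = 0" "\<forall>i\<in>I - {k}. h z i + Lk (w i) < 0" "h z a + Lk pa < 0" "h z b + Lk pb < 0"
  using evp[OF z(1) singles[OF jk(2)]] jk by blast
 have ja: "cert ?I w' (h z) {j, a}"
 proof -
  let ?L = "\<lambda>q. Lj q + (- Lj pa / N) * L0 q"
  have v: "Lj pa < 0" using Lj(4) z(2) by simp
  have a0: "?L pa = 0" using N by (simp add: N_def)
  have j0: "?L (w j) = 0" "?L (w k) < 0" using Lj(2,3) L0(2,3) z(2) jk by auto
  have b0: "?L pb < 0" by (rule lin1[OF Lpb[OF tilt(1)[OF Lj(1), of "Lj pa" N]] a0 j0])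
  show ?thesis
  proof (rule certI[OF _ tilt(1)[OF Lj(1), of "Lj pa" N]])
   show "{j, a} \<subseteq> ?I" using jk by auto
   show "h z i + ?L (w i) = 0" if "i \<in> {j, a}" "i \<in> I" for i using that j0 ab z(2) by auto
   show "h z i + ?L (w i) < 0" if "i \<in> I" "i \<notin> {j, a}" for i
    using tilt(2)[OF Lj(1) v N that(1)] Lj(3) that z(2) by force
   show "if a \<in> {j, a} then h z a + ?L pa = 0 else h z a + ?L pa < 0" using a0 z(2) by simp
   show "if b \<in> {j, a} then h z b + ?L pb = 0 else h z b + ?L pb < 0" using b0 z(2) neq ab(3) by simp
  qed
 qed
 have kb: "cert ?I w' (h z) {k, b}"
 proof -
  let ?L = "\<lambda>q. Lk q + (- Lk pb / (6/7 * N)) * L0 q"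
  have v: "Lk pb < 0" using Lk(5) z(2) by simp
  have N': "6/7 * N > 0" using N by simp
  have b0: "?L pb = 0" using N by (simp add: Nb)
  have j0: "?L (w k) = 0" "?L (w j) < 0" using Lk(2,3) L0(2,3) z(2) jk by auto
  have a0: "?L pa < 0" by (rule lin2[OF Lpb[OF tilt(1)[OF Lk(1), of "Lk pb" "6/7 * N"]] b0 j0])
  show ?thesis
  proof (rule certI[OF _ tilt(1)[OF Lk(1), of "Lk pb" "6/7 * N"]])
   show "{k, b} \<subseteq> ?I" using jk by auto
   show "h z i + ?L (w i) = 0" if "i \<in> {k, b}" "i \<in> I" for i using that j0 ab z(2) by auto
   show "h z i + ?L (w i) < 0" if "i \<in> I" "i \<notin> {k, b}" for i
    using tilt(2)[OF Lk(1) v N' that(1)] Lk(3) that z(2) by force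
   show "if a \<in> {k, b} then h z a + ?L pa = 0 else h z a + ?L pa < 0" using a0 z(2) neq ab(3) by simp
   show "if b \<in> {k, b} then h z b + ?L pb = 0 else h z b + ?L pb < 0" using b0 z(2) by simp
  qed
 qed
 have "w' j ~= w' a" "w' k ~= w' b"
  using Lj(2,4) Lk(2,5) z(2) w' jk by auto
 moreover have finI: "finite ?I" using fin by simp
 ultimately have "cert ?I w' (h z) {a}" "cert ?I w' (h z) {b}"
  using cert_vertex[of ?I w' j a] cert_vertex[of ?I w' k b] ja kb unfolding hz by auto
 thus ?thesis
  using that[of w'] w' pb old quad by blast
qed

section \<open>Fibred configurations\<close>

type_synonym 'a config = "nat set \<times> (nat => real \<times> real) \<times> (nat => 'a set)"

abbreviation idx :: "'a config => nat set" where "idx C \<equiv> fst C"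
abbreviation shadow :: "'a config => nat => real \<times> real" where "shadow C \<equiv> fst (snd C)"
abbreviation fibre :: "'a config => nat => 'a set" where "fibre C \<equiv> snd (snd C)"

text \<open>The value at an empty fibre is a default; well-formed configurations have nonempty
  fibres.\<close>

definition height :: "(nat => 'a set) => ('a => real) => nat => real" where
 "height V u i = (if V i = {} then 0 else Max (u ` V i))"

definition fcert :: "'a config => ('a => real) => nat set => bool" where
 "fcert C u K \<longleftrightarrow> cert (idx C) (shadow C) (height (fibre C) u) K"

text \<open>Its faces are those of the planar hull of the shadows, with the entire fibres above
  them.\<close>

abbreviation zf :: "'a => real" where "zf \<equiv> \<lambda>_. 0"

lemma height_zf [simp]: "height V zf = (\<lambda>_. 0)"
 by (rule ext) (simp add: height_def image_constant_conv)

text \<open>The condition on \<open>{i}\<close> makes every shadow a vertex of the planar hull, so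
  each whole fibre spans a face and different indices have different shadows.\<close>

definition wf_config :: "'a config => bool" where
 "wf_config C \<longleftrightarrow> finite (idx C) & (\<forall>i\<in>idx C. finite (fibre C i) & fibre C i ~= {} & fcert C zf {i})"

text \<open>The edges to which something can be attached. The zero functional is included because
  the new shadow has to leave the planar hull through this edge.\<close>

definition avail :: "('a => real) set => 'a config => nat => nat => bool" where
 "avail U C j k \<longleftrightarrow> j ~= k & (\<forall>u\<in>insert zf U. fcert C u {j, k})"

definition extends :: "('a => real) set => 'a config => 'a config => bool" where
 "extends U C C' \<longleftrightarrow> idx C \<subseteq> idx C' & (\<forall>i\<in>idx C. shadow C' i = shadow C i & fibre C' i = fibre C i) &
   (\<forall>u\<in>U. \<forall>K. fcert C u K --> fcert C' u K)"

lemma extends_refl: "extends U C C"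
 by (simp add: extends_def)

lemma extends_trans:
 assumes "extends U C C'" "extends U C' C''"
 shows "extends U C C''"
 unfolding extends_def
proof (intro conjI ballI allI impI)
 show "idx C \<subseteq> idx C''" using assms unfolding extends_def by blast
 fix i assume "i \<in> idx C"
 hence "i \<in> idx C'" "shadow C' i = shadow C i" "fibre C' i = fibre C i"
  using assms(1) unfolding extends_def by auto
 thus "shadow C'' i = shadow C i" "fibre C'' i = fibre C i"
  using assms(2) unfolding extends_def by auto
next
 fix u K assume "u \<in> U" "fcert C u K"
 thus "fcert C'' u K" using assms unfolding extends_def by blast
qed

lemma fcert_idx: "fcert C u K ==> K \<subseteq> idx C"
 by (simp add: fcert_def cert_def)

lemma fcert_inter: "fcert C u K ==> fcert C zf K' ==> fcert C u (K \<inter> K')"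
 unfolding fcert_def height_zf by (rule cert_inter)

lemma avail_idx: "avail U C j k ==> j \<in> idx C & k \<in> idx C"
 unfolding avail_def using fcert_idx[of C zf "{j, k}"] by blast

lemma avail_commute: "avail U C j k ==> avail U C k j"
 unfolding avail_def by (auto simp: insert_commute)

text \<open>Bounds the dimension of the final polytope from above by confining all fibres to one
  subspace.\<close>

definition inside :: "'a set => 'a config => bool" where
 "inside W C \<longleftrightarrow> (\<forall>i\<in>idx C. fibre C i \<subseteq> W)"

lemma inside_extends:
 assumes "extends U C C'" "inside W C" "\<And>i. i \<in> idx C' - idx C ==> fibre C' i \<subseteq> W"
 shows "inside W C'"
 unfolding inside_def
proof
 fix i assume i: "i \<in> idx C'"
 show "fibre C' i \<subseteq> W"
 proof (cases "i \<in> idx C")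
  case True
  thus ?thesis using assms(1,2) unfolding extends_def inside_def by simp
 next
  case False
  thus ?thesis using assms(3) i by blast
 qed
qed

lemma config_attach_fibre:
 assumes wf: "wf_config C" and U: "finite U" "zf \<notin> U" and av: "avail U C j k"
  and third: "i0 \<in> idx C" "i0 \<notin> {j, k}" and D: "finite D" "D ~= {}"
  and hD: "\<And>u x. u \<in> U ==> x \<in> D ==> u x < (height (fibre C) u j + height (fibre C) u k) / 2"
 obtains C' m where "wf_config C'" "extends U C C'" "m \<notin> idx C" "m \<in> idx C'" "fibre C' m = D"
  "\<And>u. u \<in> U ==> fcert C' u {j, k, m}" "avail U C' j m" "avail U C' m k"
  "\<And>K. fcert C zf K ==> \<not> {j, k} \<subseteq> K ==> fcert C' zf K" "idx C' = insert m (idx C)"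
proof -
 obtain I w V where C: "C = (I, w, V)" by (cases C) auto
 have finI: "finite I" using wf by (simp add: wf_config_def C)
 obtain m where m: "m \<notin> I" using finI ex_new_if_finite[OF infinite_UNIV_nat] by blast
 define V' where "V' = V(m := D)"
 have jk: "j \<in> I" "k \<in> I" "j ~= k" using avail_idx[OF av] av by (auto simp: C avail_def)
 have hold: "height V' u i = height V u i" if "i \<in> I" for u i
  using that m by (auto simp: height_def V'_def)
 have conv: "cert I w (height V' u) K \<longleftrightarrow> fcert C u K" for u K
  unfolding fcert_def C by (simp add: cert_cong[of I "height V' u" "height V u" w w] hold)
 have h1: "cert I w (height V' zf) {i}" if "i \<in> I" for i
  unfolding conv using wf that by (auto simp: wf_config_def C)
 have h2: "cert I w (height V' u) {j, k}" if "u \<in> insert zf U" for u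
  unfolding conv using av that by (auto simp: avail_def)
 have h3: "height V' u m < (height V' u j + height V' u k) / 2" if "u \<in> insert zf U" "u ~= zf" for u
 proof -
  have u: "u \<in> U" using that by blast
  have "\<forall>y\<in>u ` D. y < (height V' u j + height V' u k) / 2"
   using hD[OF u] hold jk by (auto simp: C)
  hence "Max (u ` D) < (height V' u j + height V' u k) / 2"
   using D by (subst Max_less_iff) auto
  thus ?thesis using D by (simp add: height_def V'_def)
 qed
 have finH: "finite (insert zf U)" using U by simp
 have iC: "idx C = I" "fibre C = V" "shadow C = w" by (simp_all add: C)
 obtain p where p:
  "\<And>u K. u \<in> insert zf U ==> cert I w (height V' u) K ==> u ~= zf \<or> \<not> {j, k} \<subseteq> K ==> cert (insert m I) (w(m := p)) (height V' u) K"
  "\<And>u. u \<in> insert zf U ==> u ~= zf ==> cert (insert m I) (w(m := p)) (height V' u) {j, k, m}"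
  "\<And>u. u \<in> insert zf U ==> cert (insert m I) (w(m := p)) (height V' u) {j, m}"
  "\<And>u. u \<in> insert zf U ==> cert (insert m I) (w(m := p)) (height V' u) {m, k}"
  "cert (insert m I) (w(m := p)) (height V' zf) {m}"
  by (rule attach_fibre[of I "insert zf U" j k i0 m zf "height V'" w])
   (use finI finH jk third m h1 h2 h3 in \<open>auto simp: C\<close>)
 define C' where "C' = (insert m I, w(m := p), V')"
 have conv': "fcert C' u K \<longleftrightarrow> cert (insert m I) (w(m := p)) (height V' u) K" for u K
  by (simp add: fcert_def C'_def)
 have old: "fcert C' u K" if "u \<in> insert zf U" "fcert C u K" "u ~= zf \<or> \<not> {j, k} \<subseteq> K" for u K
  unfolding conv' using p(1)[OF that(1) _ that(3)] that(2) by (simp add: conv)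
 have single: "fcert C' zf {i}" if "i \<in> insert m I" for i
 proof (cases "i = m")
  case True
  thus ?thesis using p(5) by (simp add: conv')
 next
  case False
  hence "i \<in> I" using that by simp
  hence "fcert C zf {i}" using wf by (simp add: wf_config_def iC)
  thus ?thesis using jk(3) by (intro old) auto
 qed
 have "wf_config C'"
  unfolding wf_config_def
 proof (intro conjI ballI)
  show "finite (idx C')" using finI by (simp add: C'_def)
  fix i assume "i \<in> idx C'"
  hence i: "i \<in> insert m I" by (simp add: C'_def)
  show "fcert C' zf {i}" by (rule single[OF i])
  show "finite (fibre C' i)" "fibre C' i ~= {}"
   using i D wf by (auto simp: C'_def V'_def wf_config_def C)
 qed
 moreover have "extends U C C'"
  unfolding extends_def
 proof (intro conjI ballI allI impI)
  show "fcert C' u K" if "u \<in> U" "fcert C u K" for u K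
   using old[of u K] that U(2) by blast
 qed (use m in \<open>auto simp: C C'_def V'_def\<close>)
 moreover have "avail U C' j m" "avail U C' m k"
  unfolding avail_def using p(3,4) jk m by (auto simp: conv')
 moreover have "m \<notin> idx C" "m \<in> idx C'" "fibre C' m = D"
  using m by (auto simp: C C'_def V'_def)
 moreover have "fcert C' u {j, k, m}" if "u \<in> U" for u
  unfolding conv' using p(2)[of u] that U(2) by blast
 moreover have "fcert C' zf K" if "fcert C zf K" "\<not> {j, k} \<subseteq> K" for K
  using old[of zf K] that by blast
 moreover have "idx C' = insert m (idx C)" by (simp add: C C'_def)
 ultimately show ?thesis using that[of C' m] by blast
qed

lemma config_attach_pair:
 assumes wf: "wf_config C" and U: "finite U" "zf \<notin> U" "\<And>u. u \<in> U ==> linear u" and av: "avail U C j k"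
  and third: "i0 \<in> idx C" "i0 \<notin> {j, k}"
  and h: "\<And>u. u \<in> U ==> u \<alpha> < 3/4 * height (fibre C) u j + 1/4 * height (fibre C) u k"
   "\<And>u. u \<in> U ==> u ((6/7) *R \<alpha>) < 1/2 * height (fibre C) u j + 1/2 * height (fibre C) u k"
 obtains C' a b where "wf_config C'" "extends U C C'" "a \<notin> idx C" "b \<notin> idx C" "a ~= b" "a \<in> idx C'" "b \<in> idx C'"
  "fibre C' a = {\<alpha>}" "fibre C' b = {(6/7) *R \<alpha>}"
  "shadow C' b = (6/7) *R shadow C' a + (1/7) *R (2 *R shadow C k - shadow C j)"
  "\<And>u. u \<in> U ==> height (fibre C) u k = height (fibre C) u j / 2 ==> fcert C' u {j, k, a, b}"
  "\<And>K. fcert C zf K ==> \<not> {j, k} \<subseteq> K ==> fcert C' zf K" "idx C' = insert b (insert a (idx C))"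
proof -
 obtain I w V where C: "C = (I, w, V)" by (cases C) auto
 have finI: "finite I" using wf by (simp add: wf_config_def C)
 obtain a where a: "a \<notin> I" using finI ex_new_if_finite[OF infinite_UNIV_nat] by blast
 have "finite (insert a I)" using finI by simp
 then obtain b where b: "b \<notin> insert a I" using ex_new_if_finite[OF infinite_UNIV_nat] by blast
 define V' where "V' = V(a := {\<alpha>}, b := {(6/7) *R \<alpha>})"
 have ab: "a \<notin> I" "b \<notin> I" "a ~= b" using a b by auto
 have jk: "j \<in> I" "k \<in> I" "j ~= k" using avail_idx[OF av] av by (auto simp: C avail_def)
 have hold: "height V' u i = height V u i" if "i \<in> I" for u i
  using that ab by (auto simp: height_def V'_def)
 have conv: "cert I w (height V' u) K \<longleftrightarrow> fcert C u K" for u K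
  unfolding fcert_def C by (simp add: cert_cong[of I "height V' u" "height V u" w w] hold)
 have h1: "cert I w (height V' zf) {i}" if "i \<in> I" for i
  unfolding conv using wf that by (auto simp: wf_config_def C)
 have h2: "cert I w (height V' u) {j, k}" if "u \<in> insert zf U" for u
  unfolding conv using av that by (auto simp: avail_def)
 have ha: "height V' u a = u \<alpha>" "height V' u b = u ((6/7) *R \<alpha>)" for u :: "'a => real"
  using ab by (auto simp: height_def V'_def)
 have h3: "height V' u a < 3/4 * height V' u j + 1/4 * height V' u k"
  "height V' u b < 1/2 * height V' u j + 1/2 * height V' u k" if "u \<in> insert zf U" "u ~= zf" for u
  using that h(1)[of u] h(2)[of u] hold jk by (auto simp: ha C)
 have finH: "finite (insert zf U)" using U by simp
 have iC: "idx C = I" "fibre C = V" "shadow C = w" by (simp_all add: C)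
 obtain w' where w': "\<And>i. i \<in> I ==> w' i = w i"
  "w' b = (6/7) *R w' a + (1/7) *R (2 *R w k - w j)"
  and p: "\<And>u K. u \<in> insert zf U ==> cert I w (height V' u) K ==> u ~= zf \<or> \<not> {j, k} \<subseteq> K ==> cert (insert b (insert a I)) w' (height V' u) K"
  "\<And>u. u \<in> insert zf U ==> u ~= zf ==> height V' u k = height V' u j / 2 ==> height V' u b = 6/7 * height V' u a ==> cert (insert b (insert a I)) w' (height V' u) {j, k, a, b}"
  "cert (insert b (insert a I)) w' (height V' zf) {a}" "cert (insert b (insert a I)) w' (height V' zf) {b}"
  by (rule attach_pair[of I "insert zf U" j k i0 a b zf "height V'" w])
   (use finI finH jk third ab h1 h2 h3 in \<open>auto simp: C\<close>)
 define C' where "C' = (insert b (insert a I), w', V')"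
 have conv': "fcert C' u K \<longleftrightarrow> cert (insert b (insert a I)) w' (height V' u) K" for u K
  by (simp add: fcert_def C'_def)
 have old: "fcert C' u K" if "u \<in> insert zf U" "fcert C u K" "u ~= zf \<or> \<not> {j, k} \<subseteq> K" for u K
  unfolding conv' using p(1)[OF that(1) _ that(3)] that(2) by (simp add: conv)
 have single: "fcert C' zf {i}" if "i \<in> insert b (insert a I)" for i
 proof (cases "i \<in> {a, b}")
  case True
  thus ?thesis using p(3,4) by (auto simp: conv')
 next
  case False
  hence "i \<in> I" using that by simp
  hence "fcert C zf {i}" using wf by (simp add: wf_config_def iC)
  thus ?thesis using jk(3) by (intro old) auto
 qed
 have "wf_config C'"
  unfolding wf_config_def
 proof (intro conjI ballI)
  show "finite (idx C')" using finI by (simp add: C'_def)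
  fix i assume "i \<in> idx C'"
  hence i: "i \<in> insert b (insert a I)" by (simp add: C'_def)
  show "fcert C' zf {i}" by (rule single[OF i])
  show "finite (fibre C' i)" "fibre C' i ~= {}"
   using i wf by (auto simp: C'_def V'_def wf_config_def C)
 qed
 moreover have "extends U C C'"
  unfolding extends_def
 proof (intro conjI ballI allI impI)
  show "fcert C' u K" if "u \<in> U" "fcert C u K" for u K
   using old[of u K] that U(2) by blast
 qed (use ab w' in \<open>auto simp: C C'_def V'_def\<close>)
 moreover have "a \<notin> idx C" "b \<notin> idx C" "a ~= b" "a \<in> idx C'" "b \<in> idx C'" "fibre C' a = {\<alpha>}" "fibre C' b = {(6/7) *R \<alpha>}"
  "shadow C' b = (6/7) *R shadow C' a + (1/7) *R (2 *R shadow C k - shadow C j)"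
  using ab w'(2) by (auto simp: C C'_def V'_def)
 moreover have "fcert C' u {j, k, a, b}" if "u \<in> U" "height (fibre C) u k = height (fibre C) u j / 2" for u
 proof -
  have "height V' u k = height V' u j / 2" using that(2) hold jk by (simp add: C)
  moreover have "height V' u b = 6/7 * height V' u a"
   unfolding ha using U(3)[OF that(1)] by (simp add: linear_scale)
  ultimately show ?thesis unfolding conv' using p(2)[of u] that(1) U(2) by blast
 qed
 moreover have "fcert C' zf K" if "fcert C zf K" "\<not> {j, k} \<subseteq> K" for K
  using old[of zf K] that by blast
 moreover have "idx C' = insert b (insert a (idx C))" by (simp add: C C'_def)
 ultimately show ?thesis using that[of C' a b] by blast
qed

section \<open>Chains, copies of the hub, and slots\<close>

abbreviation scaled :: "real => 'a::real_vector set => 'a set" where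
 "scaled c A \<equiv> (\<lambda>x. c *R x) ` A"

text \<open>In a chain, every fibre is a copy, shrunk by the factor \<open>1/2\<close>, of a subset of its
 predecessor, and the pair \<open>a\<close>, \<open>b\<close> ties the two copies together by a homothety. All of them
 stay adjacent to the fibre \<open>g\<close>.\<close>

fun chain_ok :: "('a::real_vector => real) set => 'a config => nat => nat => real => 'a set list => bool" where
 "chain_ok U C m g c [] = True"
| "chain_ok U C m g c (J # Js) = (\<exists>m' a b \<alpha>. {m', a, b} \<subseteq> idx C & m' \<notin> {0, m, g} & a \<notin> {m, m'} & b \<notin> {m, m'} & a ~= b &
   fibre C m' = scaled (c / 2) J & fibre C a = {\<alpha>} & fibre C b = {(6/7) *R \<alpha>} &
   shadow C b = (6/7) *R shadow C a + (1/7) *R (2 *R shadow C m' - shadow C m) &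
   (\<forall>u\<in>U. fcert C u {m, g, m'} & fcert C u {m, m'} & fcert C u {m', g}) &
   (\<forall>u\<in>U. height (fibre C) u m' = height (fibre C) u m / 2 --> fcert C u {m, m', a, b}) &
   chain_ok U C m' g (c / 2) Js)"

text \<open>Halved copies of the hub, each in a common face with the hub and an earlier copy, so
  that a concurrency of parallel edges can be passed on from copy to copy.\<close>

inductive reach :: "('a::real_vector => real) set => 'a set => 'a config => nat => bool" for U Z C where
 start: "1 \<in> idx C ==> fibre C 1 = scaled (1/2) Z ==> (\<And>u. u \<in> U ==> fcert C u {0, 1}) ==> reach U Z C 1"
| step: "reach U Z C F ==> F' \<in> idx C ==> F' \<notin> {0, F} ==> fibre C F' = scaled (1/2) Z ==>
  (\<And>u. u \<in> U ==> fcert C u {0, F, F'} & fcert C u {0, F'} & fcert C u {F, F'}) ==> reach U Z C F'"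

text \<open>A fibre with two chains of subsets, one for each of the two copies of the hub between
  which the fibre will be attached.\<close>

type_synonym 'a gadget = "'a set \<times> 'a set list \<times> 'a set list"

text \<open>The fibre sits between two copies of the hub because concurrency is inferred for a third
  line from two lines that already have the common point.\<close>

definition slot_ok :: "('a::real_vector => real) set => 'a set => 'a config => 'a gadget => bool" where
 "slot_ok U Z C g \<longleftrightarrow> (\<exists>F F' m c. reach U Z C F & reach U Z C F' & F ~= F' & m \<in> idx C & m \<notin> {0, F, F'} & c > 0 &
   fibre C m = scaled c (fst g) &
   (\<forall>u\<in>U. fcert C u {F, F', m} & fcert C u {F, F'} & fcert C u {F, m} & fcert C u {m, F'}) &
   chain_ok U C m F' c (fst (snd g)) & chain_ok U C m F c (snd (snd g)))"

lemma extends_height: "extends U C C' ==> i \<in> idx C ==> height (fibre C') u i = height (fibre C) u i"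
 by (simp add: extends_def height_def)

lemma extendsD:
 assumes "extends U C C'"
 shows "i \<in> idx C ==> i \<in> idx C'" "i \<in> idx C ==> fibre C' i = fibre C i" "i \<in> idx C ==> shadow C' i = shadow C i"
  "u \<in> U ==> fcert C u K ==> fcert C' u K"
 using assms unfolding extends_def by blast+

lemma chain_ok_extends:
 assumes "extends U C C'"
 shows "chain_ok U C m g c Js ==> m \<in> idx C ==> chain_ok U C' m g c Js"
proof (induction Js arbitrary: m c)
 case Nil
 thus ?case by simp
next
 case (Cons J Js)
 obtain m' a b \<alpha> where *: "{m', a, b} \<subseteq> idx C" "m' \<notin> {0, m, g} & a \<notin> {m, m'} & b \<notin> {m, m'} & a ~= b"
   "fibre C m' = scaled (c / 2) J" "fibre C a = {\<alpha>}" "fibre C b = {(6/7) *R \<alpha>}"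
   "shadow C b = (6/7) *R shadow C a + (1/7) *R (2 *R shadow C m' - shadow C m)"
   "\<forall>u\<in>U. fcert C u {m, g, m'} & fcert C u {m, m'} & fcert C u {m', g}"
   "\<forall>u\<in>U. height (fibre C) u m' = height (fibre C) u m / 2 --> fcert C u {m, m', a, b}"
   "chain_ok U C m' g (c / 2) Js"
  using Cons.prems(1) by auto
 have in': "m' \<in> idx C" "a \<in> idx C" "b \<in> idx C" using *(1) by auto
 have "chain_ok U C' m' g (c / 2) Js" by (rule Cons.IH[OF *(9) in'(1)])
 moreover have "{m', a, b} \<subseteq> idx C'" using in' extendsD(1)[OF assms] by blast
 moreover have "\<forall>u\<in>U. fcert C' u {m, g, m'} & fcert C' u {m, m'} & fcert C' u {m', g}"
  using *(7) extendsD(4)[OF assms] by blast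
 moreover have "\<forall>u\<in>U. height (fibre C') u m' = height (fibre C') u m / 2 --> fcert C' u {m, m', a, b}"
  unfolding extends_height[OF assms in'(1)] extends_height[OF assms Cons.prems(2)]
  using *(8) extendsD(4)[OF assms] by blast
 ultimately show ?case
  unfolding chain_ok.simps using *(2-6)
  by - (rule exI[of _ m'], rule exI[of _ a], rule exI[of _ b], rule exI[of _ \<alpha>],
   simp add: extendsD(2,3)[OF assms] in' Cons.prems(2))
qed

lemma reach_extends:
 assumes "extends U C C'"
 shows "reach U Z C F ==> reach U Z C' F"
proof (induction rule: reach.induct)
 case start
 thus ?case
  by (intro reach.start) (auto simp: extendsD[OF assms])
next
 case (step F F')
 show ?case
  by (rule reach.step[OF step.IH]) (use step.hyps extendsD[OF assms] in auto)
qed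

lemma reach_idx: "reach U Z C F ==> F \<in> idx C & F ~= 0 & fibre C F = scaled (1/2) Z & (\<forall>u\<in>U. fcert C u {0, F})"
 by (induction rule: reach.induct) auto

lemma slot_ok_extends:
 assumes "extends U C C'" "slot_ok U Z C g"
 shows "slot_ok U Z C' g"
proof -
 obtain F F' m c where *: "reach U Z C F" "reach U Z C F'" "F ~= F'" "m \<in> idx C" "m \<notin> {0, F, F'}" "c > 0"
   "fibre C m = scaled c (fst g)"
   "\<forall>u\<in>U. fcert C u {F, F', m} & fcert C u {F, F'} & fcert C u {F, m} & fcert C u {m, F'}"
   "chain_ok U C m F' c (fst (snd g))" "chain_ok U C m F c (snd (snd g))"
  using assms(2) unfolding slot_ok_def by blast
 show ?thesis
  unfolding slot_ok_def
 proof (rule exI[of _ F], rule exI[of _ F'], rule exI[of _ m], rule exI[of _ c], intro conjI)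
  show "reach U Z C' F" "reach U Z C' F'" using reach_extends[OF assms(1)] *(1,2) by auto
  show "F ~= F'" "m \<notin> {0, F, F'}" "c > 0" using * by auto
  show "m \<in> idx C'" "fibre C' m = scaled c (fst g)" using extendsD[OF assms(1)] *(4,7) by auto
  show "\<forall>u\<in>U. fcert C' u {F, F', m} & fcert C' u {F, F'} & fcert C' u {F, m} & fcert C' u {m, F'}"
   using *(8) extendsD(4)[OF assms(1)] by blast
  show "chain_ok U C' m F' c (fst (snd g))" "chain_ok U C' m F c (snd (snd g))"
   using chain_ok_extends[OF assms(1)] *(4,9,10) by blast+
 qed
qed

text \<open>Functionals must not be constant on the members, for then the centroid would not be
  strictly below the maximum and the pair of auxiliary points would not fit under the edge.\<close>

fun chain_adm :: "('a::real_vector => real) set => 'a set => 'a set list => bool" where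
 "chain_adm U J [] = True"
| "chain_adm U J (J' # Js) = (J' \<subseteq> J & (\<forall>u\<in>U. \<exists>x\<in>J'. \<exists>y\<in>J'. u x ~= u y) & J' ~= {} & chain_adm U J' Js)"

lemma centroid_less_Max:
 fixes u :: "'a::real_vector => real"
 assumes "finite J" "linear u" "x \<in> J" "y \<in> J" "u x ~= u y"
 shows "u ((1 / card J) *R \<Sum>J) < Max (u ` J)"
proof -
 define M where "M = Max (u ` J)"
 have le: "u x <= M" if "x \<in> J" for x using that assms(1) by (simp add: M_def)
 have "u x < M \<or> u y < M" using le[OF assms(3)] le[OF assms(4)] assms(5) by linarith
 hence "\<exists>v\<in>J. u v < M" using assms(3,4) by blast
 hence "(\<Sum>v\<in>J. u v) < (\<Sum>v\<in>J. M)" using le by (intro sum_strict_mono_ex1[OF assms(1)]) auto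
 hence "(\<Sum>v\<in>J. u v) < card J * M" by simp
 moreover have "card J > 0" using assms(1,3) by (auto simp: card_gt_0_iff)
 moreover have "u ((1 / card J) *R \<Sum>J) = (\<Sum>v\<in>J. u v) / card J"
  using assms(2) by (simp add: linear_scale linear_sum sum_divide_distrib)
 ultimately show ?thesis by (simp add: M_def[symmetric] pos_divide_less_eq mult.commute)
qed

lemma height_scaled:
 fixes u :: "'a::real_vector => real"
 assumes "V i = scaled c A" "linear u" "c >= 0" "finite A" "A ~= {}"
 shows "height V u i = c * Max (u ` A)"
proof -
 have "u ` V i = (\<lambda>t. c * t) ` (u ` A)"
  using assms(1,2) by (auto simp: image_image linear_scale)
 moreover have "Max ((\<lambda>t. c * t) ` (u ` A)) = c * Max (u ` A)"
  using assms(3-5) by (intro mono_Max_commute[symmetric]) (auto simp: mono_def mult_left_mono)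
 ultimately show ?thesis using assms(1,5) by (simp add: height_def)
qed

lemma scaled_subset: "subspace W ==> A \<subseteq> W ==> scaled c A \<subseteq> W"
 using subspace_scale by blast

text \<open>The bound \<open>hZ u / 8\<close> keeps the chain small against the hub copy
  \<open>g\<close>, whose height is \<open>hZ u / 2\<close>: the next fibre then lies strictly below
  the edge from \<open>m\<close> to \<open>g\<close>, and the bound is inherited by halving. Planar
  faces not containing \<open>{m, g}\<close> survive, which leaves the other edges at the slot
  usable.\<close>

lemma chain_build:
 assumes U: "finite U" "zf \<notin> U" "\<And>u. u \<in> U ==> linear u"
  and hZ: "\<And>u. u \<in> U ==> hZ u > 0" and W: "subspace W"
 shows "wf_config C ==> avail U C m g ==> 0 \<in> idx C ==> i0 \<in> idx C ==> i0 \<notin> {m, g} ==> fibre C m = scaled c J ==> c > 0 ==> finite J ==> J ~= {} ==>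
  (\<And>u. u \<in> U ==> height (fibre C) u g = hZ u / 2) ==> (\<And>u x. u \<in> U ==> x \<in> J ==> c * \<bar>u x\<bar> <= hZ u / 8) ==>
  chain_adm U J Js ==> inside W C ==> J \<subseteq> W ==>
  \<exists>C'. wf_config C' & extends U C C' & inside W C' & chain_ok U C' m g c Js & (\<forall>K. fcert C zf K --> \<not> {m, g} \<subseteq> K --> fcert C' zf K)"
proof (induction Js arbitrary: C m c J i0)
 case Nil
 thus ?case by (intro exI[of _ C]) (simp add: extends_refl)
next
 case (Cons J' Js)
 have J': "J' \<subseteq> J" "J' ~= {}" "\<And>u. u \<in> U ==> \<exists>x\<in>J'. \<exists>y\<in>J'. u x ~= u y" "chain_adm U J' Js"
  using Cons.prems(12) by auto
 moreover have "finite J'" by (rule finite_subset[OF J'(1) Cons.prems(8)])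
 ultimately have J': "J' \<subseteq> J" "J' ~= {}" "\<And>u. u \<in> U ==> \<exists>x\<in>J'. \<exists>y\<in>J'. u x ~= u y" "chain_adm U J' Js" "finite J'"
  by auto
 have mg: "m ~= g" "m \<in> idx C" "g \<in> idx C" using avail_idx[OF Cons.prems(2)] Cons.prems(2) by (auto simp: avail_def)
 have hm: "height (fibre C) u m = c * Max (u ` J)" if "u \<in> U" for u
  using height_scaled[of "fibre C" m, OF Cons.prems(6) U(3)[OF that] _ Cons.prems(8,9)] Cons.prems(7) by simp
 have hm_le: "c * Max (u ` J') <= height (fibre C) u m" "height (fibre C) u m >= - (hZ u / 8)" if u: "u \<in> U" for u
 proof -
  have "Max (u ` J') <= Max (u ` J)" using J' Cons.prems(8) by (intro Max_mono) auto
  thus "c * Max (u ` J') <= height (fibre C) u m" using hm[OF u] Cons.prems(7) by simp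
  obtain x where "x \<in> J" using Cons.prems(9) by blast
  hence "u x <= Max (u ` J)" "c * \<bar>u x\<bar> <= hZ u / 8" using Cons.prems(8,11) u by auto
  moreover have "c * u x >= - (c * \<bar>u x\<bar>)" using Cons.prems(7) by (simp add: abs_if)
  moreover have "c * u x <= c * Max (u ` J)" using calculation(1) Cons.prems(7) by simp
  ultimately show "height (fibre C) u m >= - (hZ u / 8)" using hm[OF u] by linarith
 qed
 have "u x < (height (fibre C) u m + height (fibre C) u g) / 2" if u: "u \<in> U" and x: "x \<in> scaled (c / 2) J'" for u x
 proof -
  obtain y where y: "y \<in> J'" "x = (c / 2) *R y" using x by blast
  have "u x = c * u y / 2" using y U(3)[OF u] by (simp add: linear_scale)
  also have "... <= c * \<bar>u y\<bar> / 2" using Cons.prems(7) by (simp add: abs_if)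
  also have "... <= hZ u / 16" using Cons.prems(11)[OF u, of y] y J' by auto
  also have "... < (- (hZ u / 8) + hZ u / 2) / 2" using hZ[OF u] by simp
  also have "... <= (height (fibre C) u m + height (fibre C) u g) / 2"
   using hm_le(2)[OF u] Cons.prems(10)[OF u] by simp
  finally show ?thesis .
 qed
 moreover have "finite (scaled (c / 2) J')" "scaled (c / 2) J' ~= {}" using J' by auto
 ultimately obtain C1 m' where C1: "wf_config C1" "extends U C C1" "m' \<notin> idx C" "m' \<in> idx C1" "fibre C1 m' = scaled (c / 2) J'"
  "\<And>u. u \<in> U ==> fcert C1 u {m, g, m'}" "avail U C1 m m'" "avail U C1 m' g"
  "\<And>K. fcert C zf K ==> \<not> {m, g} \<subseteq> K ==> fcert C1 zf K" "idx C1 = insert m' (idx C)"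
  using config_attach_fibre[OF Cons.prems(1) U(1,2) Cons.prems(2,4,5), of "scaled (c / 2) J'"] by metis
 have m': "m' ~= m" "m' ~= g" "m' ~= 0" using C1(3) mg Cons.prems(3) by metis+
 have h1m: "height (fibre C1) u m = height (fibre C) u m" for u by (rule extends_height[OF C1(2) mg(2)])
 have h1m': "height (fibre C1) u m' = c / 2 * Max (u ` J')" if "u \<in> U" for u
  using height_scaled[of "fibre C1" m', OF C1(5) U(3)[OF that] _ J'(5,2)] Cons.prems(7) by simp
 define z where "z = (1 / card J') *R \<Sum>J'"
 \<comment> \<open>On the edge from \<open>m\<close> to \<open>m'\<close> the heights at one quarter
   and one half are at least \<open>(3/4 + 1/8) c\<close> and \<open>(1/2 + 1/4) c\<close> times the
   maximum over \<open>J'\<close>. The factors 7/8 and \<open>6/7 * 7/8 = 3/4\<close> match these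
   bounds, and the centroid makes the inequality strict.\<close>
 define \<alpha> where "\<alpha> = (7/8 * c) *R z"
 have uz: "u z < Max (u ` J')" if u: "u \<in> U" for u
  using J'(3)[OF u] centroid_less_Max[OF J'(5) U(3)[OF u]] unfolding z_def by blast
 have ha: "u \<alpha> < 3/4 * height (fibre C1) u m + 1/4 * height (fibre C1) u m'"
  "u ((6/7) *R \<alpha>) < 1/2 * height (fibre C1) u m + 1/2 * height (fibre C1) u m'" if u: "u \<in> U" for u
 proof -
  have 1: "u \<alpha> = 7/8 * (c * u z)" using U(3)[OF u] by (simp add: \<alpha>_def linear_scale)
  have 2: "c * u z < c * Max (u ` J')" using uz[OF u] Cons.prems(7) by simp
  show "u \<alpha> < 3/4 * height (fibre C1) u m + 1/4 * height (fibre C1) u m'"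
   using 1 2 hm_le(1)[OF u] by (simp add: h1m h1m'[OF u])
  have "u ((6/7) *R \<alpha>) = 3/4 * (c * u z)" using U(3)[OF u] 1 by (simp add: linear_scale)
  thus "u ((6/7) *R \<alpha>) < 1/2 * height (fibre C1) u m + 1/2 * height (fibre C1) u m'"
   using 2 hm_le(1)[OF u] by (simp add: h1m h1m'[OF u])
 qed
 have gI: "g \<in> idx C1" "m \<in> idx C1" using extendsD(1)[OF C1(2)] mg by auto
 have g3: "g \<notin> {m, m'}" using m' mg by auto
 obtain C2 a b where C2: "wf_config C2" "extends U C1 C2" "a \<notin> idx C1" "b \<notin> idx C1" "a ~= b" "a \<in> idx C2" "b \<in> idx C2"
  "fibre C2 a = {\<alpha>}" "fibre C2 b = {(6/7) *R \<alpha>}"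
  "shadow C2 b = (6/7) *R shadow C2 a + (1/7) *R (2 *R shadow C1 m' - shadow C1 m)"
  "\<And>u. u \<in> U ==> height (fibre C1) u m' = height (fibre C1) u m / 2 ==> fcert C2 u {m, m', a, b}"
  "\<And>K. fcert C1 zf K ==> \<not> {m, m'} \<subseteq> K ==> fcert C2 zf K" "idx C2 = insert b (insert a (idx C1))"
  using config_attach_pair[OF C1(1) U C1(7) gI(1) g3 ha] by metis
 have ext2: "extends U C C2" by (rule extends_trans[OF C1(2) C2(2)])
 have mI2: "m' \<in> idx C2" "m \<in> idx C2" "g \<in> idx C2" using extendsD(1)[OF C2(2)] C1(4) gI by auto
 have av2: "avail U C2 m' g"
  unfolding avail_def
 proof (intro conjI ballI)
  show "m' ~= g" by (rule m'(2))
  fix u assume u: "u \<in> insert zf U"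
  have "fcert C1 u {m', g}" using C1(8) u unfolding avail_def by blast
  moreover have "\<not> {m, m'} \<subseteq> {m', g}" using m' mg by auto
  ultimately show "fcert C2 u {m', g}" using C2(12) extendsD(4)[OF C2(2)] u by blast
 qed
 have fib2: "fibre C2 m' = scaled (c / 2) J'" using extendsD(2)[OF C2(2) C1(4)] C1(5) by simp
 have hg2: "height (fibre C2) u g = hZ u / 2" if "u \<in> U" for u
  using extends_height[OF ext2 mg(3)] Cons.prems(10)[OF that] by simp
 have small: "c / 2 * \<bar>u x\<bar> <= hZ u / 8" if "u \<in> U" "x \<in> J'" for u x
 proof -
  have "c * \<bar>u x\<bar> <= hZ u / 8" using Cons.prems(11)[OF that(1)] that(2) J' by blast
  moreover have "c * \<bar>u x\<bar> >= 0" using Cons.prems(7) by simp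
  ultimately show ?thesis by linarith
 qed
 have m3: "m \<notin> {m', g}" using m' mg by auto
 have c2: "c / 2 > 0" using Cons.prems(7) by simp
 have J'W: "J' \<subseteq> W" using J'(1) Cons.prems(14) by blast
 have w1: "inside W C1"
  by (rule inside_extends[OF C1(2) Cons.prems(13)]) (use C1(3,5,10) scaled_subset[OF W J'W, of "c / 2"] in auto)
 have "z \<in> W"
  unfolding z_def using J'W by (intro subspace_scale[OF W] subspace_sum[OF W]) auto
 hence aW: "\<alpha> \<in> W" "(6/7) *R \<alpha> \<in> W" unfolding \<alpha>_def using subspace_scale[OF W] by blast+
 have in2: "inside W C2"
  by (rule inside_extends[OF C2(2) w1]) (use C2(8,9,13) aW in auto)
 obtain C3 where C3: "wf_config C3" "extends U C2 C3" "chain_ok U C3 m' g (c / 2) Js"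
  "\<And>K. fcert C2 zf K ==> \<not> {m', g} \<subseteq> K ==> fcert C3 zf K" "inside W C3"
  using Cons.IH[OF C2(1) av2 extendsD(1)[OF ext2 Cons.prems(3)] mI2(2) m3 fib2 c2 J'(5,2) hg2 small J'(4) in2 J'W] by blast
 have ext3: "extends U C1 C3" "extends U C C3" using extends_trans C1(2) C2(2) C3(2) by blast+
 have "chain_ok U C3 m g c (J' # Js)"
  unfolding chain_ok.simps
 proof (rule exI[of _ m'], rule exI[of _ a], rule exI[of _ b], rule exI[of _ \<alpha>], intro conjI)
  show "{m', a, b} \<subseteq> idx C3" using mI2 C2(6,7) extendsD(1)[OF C3(2)] by blast
  show "m' \<notin> {0, m, g}" using m' by auto
  show "a \<notin> {m, m'}" "b \<notin> {m, m'}" using C2(3,4) gI C1(4) by auto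
  show "a ~= b" by (rule C2(5))
  show "fibre C3 m' = scaled (c / 2) J'" using fib2 extendsD(2)[OF C3(2) mI2(1)] by simp
  show "fibre C3 a = {\<alpha>}" "fibre C3 b = {(6/7) *R \<alpha>}" using C2(6-9) extendsD(2)[OF C3(2)] by auto
  show "shadow C3 b = (6/7) *R shadow C3 a + (1/7) *R (2 *R shadow C3 m' - shadow C3 m)"
   using C2(10) extendsD(3)[OF C3(2) C2(6)] extendsD(3)[OF C3(2) C2(7)] extendsD(3)[OF ext3(1) C1(4)] extendsD(3)[OF ext3(1) gI(2)]
   by simp
  show "\<forall>u\<in>U. fcert C3 u {m, g, m'} & fcert C3 u {m, m'} & fcert C3 u {m', g}"
  proof (intro ballI conjI)
   fix u assume u: "u \<in> U"
   show "fcert C3 u {m, g, m'}" using C1(6)[OF u] extendsD(4)[OF ext3(1) u] by blast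
   show "fcert C3 u {m, m'}" using C1(7) u extendsD(4)[OF ext3(1) u] unfolding avail_def by blast
   show "fcert C3 u {m', g}" using av2 u extendsD(4)[OF C3(2) u] unfolding avail_def by blast
  qed
  show "\<forall>u\<in>U. height (fibre C3) u m' = height (fibre C3) u m / 2 --> fcert C3 u {m, m', a, b}"
   unfolding extends_height[OF ext3(1) C1(4)] extends_height[OF ext3(1) gI(2)]
   using C2(11) extendsD(4)[OF C3(2)] by blast
  show "chain_ok U C3 m' g (c / 2) Js" by (rule C3(3))
 qed
 moreover have "fcert C3 zf K" if K: "fcert C zf K" "\<not> {m, g} \<subseteq> K" for K
 proof -
  have "m' \<notin> K" using fcert_idx[OF K(1)] C1(3) by blast
  thus ?thesis using C1(9)[OF K] C2(12)[of K] C3(4)[of K] by blast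
 qed
 ultimately show ?case using C3(1,5) ext3(2) by blast
qed

text \<open>A triangle is the smallest polygon in which an edge has a third point beside it, as
  attaching requires. Its corners also supply the two extra dimensions.\<close>

definition start_config :: "'a::real_vector set => 'a config" where
 "start_config Z = ({0, 1, 2}, (\<lambda>i. if i = 0 then (0, 0) else if i = 1 then (1, 0) else (0, 1)),
   (\<lambda>i. if i = 0 then Z else scaled (1/2) Z))"

text \<open>An affine function takes arbitrary values at the corners of a triangle, so every subset
  of the corners is certified for every functional.\<close>

lemma start_config_cert:
 assumes "K \<subseteq> {0, 1, 2}"
 shows "fcert (start_config Z) u K"
proof -
 define h where "h = height (fibre (start_config Z)) u"
 define c where "c i = - h i - (if i \<in> K then 0 else 1)" for i
 define L :: "real \<times> real => real" where "L p = (c 1 - c 0) * fst p + (c 2 - c 0) * snd p + c 0" for p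
 have L: "L (shadow (start_config Z) i) = c i" if "i \<in> {0, 1, 2}" for i
  using that by (auto simp: L_def start_config_def)
 have "affine_fun L" unfolding affine_fun_def L_def by blast
 moreover have "\<forall>i\<in>K. h i + L (shadow (start_config Z) i) = 0"
  using assms by (auto simp: L c_def subset_iff)
 moreover have "\<forall>i\<in>idx (start_config Z) - K. h i + L (shadow (start_config Z) i) < 0"
 proof
  fix i assume i: "i \<in> idx (start_config Z) - K"
  hence "i \<in> {0, 1, 2}" by (simp add: start_config_def)
  with i show "h i + L (shadow (start_config Z) i) < 0" by (simp add: L c_def)
 qed
 moreover have "K \<subseteq> idx (start_config Z)" using assms by (simp add: start_config_def)
 ultimately show ?thesis unfolding fcert_def cert_def h_def by blast
qed

lemma start_config_wf:
 assumes "finite Z" "Z ~= {}"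
 shows "wf_config (start_config Z)"
 unfolding wf_config_def
proof (intro conjI ballI)
 show "finite (idx (start_config Z))" by (simp add: start_config_def)
 fix i assume i: "i \<in> idx (start_config Z)"
 show "finite (fibre (start_config Z) i)" "fibre (start_config Z) i ~= {}"
  using assms by (auto simp: start_config_def)
 show "fcert (start_config Z) zf {i}"
  using i by (intro start_config_cert) (simp add: start_config_def)
qed

lemma zf_persists: "(\<And>K. fcert C zf K ==> \<not> {m, g} \<subseteq> K ==> fcert C' zf K) ==> extends U C C' ==>
  avail U C j k ==> \<not> {m, g} \<subseteq> {j, k} ==> avail U C' j k"
 unfolding avail_def using extendsD(4)[of U C C'] by blast

definition gadget_adm :: "('a::real_vector => real) set => 'a gadget => bool" where
 "gadget_adm U g \<longleftrightarrow> finite (fst g) & fst g ~= {} & chain_adm U (fst g) (fst (snd g)) & chain_adm U (fst g) (snd (snd g))"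

text \<open>Inserting a copy \<open>F'\<close> between the hub and \<open>F\<close> creates two
  edges: the one from the hub to \<open>F'\<close> is reserved for the next slot, the one from
  \<open>F'\<close> to \<open>F\<close> receives the gadget.\<close>

lemma slot_build:
 assumes U: "finite U" "zf \<notin> U" "\<And>u. u \<in> U ==> linear u"
  and Z: "finite Z" "Z ~= {}" "\<And>u. u \<in> U ==> Max (u ` Z) > 0"
  and C: "wf_config C" "0 \<in> idx C" "fibre C 0 = Z" "reach U Z C F" "avail U C 0 F" "i0 \<in> idx C" "i0 \<notin> {0, F}"
  and g: "gadget_adm U g" and W: "subspace W" "Z \<subseteq> W" "inside W C" "fst g \<subseteq> W"
 obtains C' F' where "inside W C'" "wf_config C'" "extends U C C'" "reach U Z C' F'" "avail U C' 0 F'" "F' \<notin> {0, F}" "slot_ok U Z C' g"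
proof -
 obtain Q Rs Ls where gQ: "g = (Q, Rs, Ls)" by (cases g) auto
 have Q: "finite Q" "Q ~= {}" "chain_adm U Q Rs" "chain_adm U Q Ls" using g by (auto simp: gadget_adm_def gQ)
 have F: "F \<in> idx C" "F ~= 0" "fibre C F = scaled (1/2) Z" using reach_idx[OF C(4)] by auto
 have h0: "height (fibre C) u 0 = Max (u ` Z)" for u using C(3) Z(2) by (simp add: height_def)
 have hF: "height (fibre C) u F = Max (u ` Z) / 2" if "u \<in> U" for u
  using height_scaled[of "fibre C" F, OF F(3) U(3)[OF that] _ Z(1,2)] by simp
 have hD: "u x < (height (fibre C) u 0 + height (fibre C) u F) / 2" if u: "u \<in> U" and x: "x \<in> scaled (1/2) Z" for u x
 proof -
  obtain z where z: "z \<in> Z" "x = (1/2) *R z" using x by blast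
  have "u x = u z / 2" using z U(3)[OF u] by (simp add: linear_scale)
  also have "... <= Max (u ` Z) / 2" using z Z(1) by simp
  finally show ?thesis using Z(3)[OF u] hF[OF u] h0[of u] by simp
 qed
 have sZ: "finite (scaled (1/2) Z)" "scaled (1/2) Z ~= {}" using Z by auto
 obtain C1 F' where C1: "wf_config C1" "extends U C C1" "F' \<notin> idx C" "F' \<in> idx C1" "fibre C1 F' = scaled (1/2) Z"
  "\<And>u. u \<in> U ==> fcert C1 u {0, F, F'}" "avail U C1 0 F'" "avail U C1 F' F"
  "\<And>K. fcert C zf K ==> \<not> {0, F} \<subseteq> K ==> fcert C1 zf K" "idx C1 = insert F' (idx C)"
  using config_attach_fibre[OF C(1) U(1,2) C(5,6,7) sZ hD] by metis
 have F': "F' ~= 0" "F' ~= F" using C1(3) C(2) F(1) by metis+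
 have reach1: "reach U Z C1 F" by (rule reach_extends[OF C1(2) C(4)])
 have reach1': "reach U Z C1 F'"
  by (rule reach.step[OF reach1 C1(4) _ C1(5)]) (use F' C1(6-8) in \<open>auto simp: avail_def insert_commute\<close>)
 have hF1: "height (fibre C1) u F = Max (u ` Z) / 2" if "u \<in> U" for u
  using hF[OF that] extends_height[OF C1(2) F(1)] by simp
 have hF1': "height (fibre C1) u F' = Max (u ` Z) / 2" if "u \<in> U" for u
  using height_scaled[of "fibre C1" F', OF C1(5) U(3)[OF that] _ Z(1,2)] by simp
 \<comment> \<open>Finitely many functionals and points have to be compared with the hub, so some
   positive scale meets the smallness bound of \<open>chain_build\<close>.\<close>
 obtain \<kappa> where \<kappa>: "\<kappa> > 0" "\<And>u x. u \<in> U ==> x \<in> Q ==> \<kappa> * \<bar>u x\<bar> <= Max (u ` Z) / 8"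
 proof -
  have fin: "finite (U \<times> Q)" using U(1) Q(1) by simp
  have pos: "Max (fst a ` Z) / 8 > 0" if "a \<in> U \<times> Q" for a using Z(3)[of "fst a"] that by auto
  obtain d where d: "d > 0" "\<And>e a. 0 < e ==> e <= d ==> a \<in> U \<times> Q ==> Max (fst a ` Z) / 8 + e * (- \<bar>fst a (snd a)\<bar>) > 0"
   using small_perturbation[OF fin, of "\<lambda>a. Max (fst a ` Z) / 8" "\<lambda>a. - \<bar>fst a (snd a)\<bar>"] pos by metis
  have "d * \<bar>u x\<bar> <= Max (u ` Z) / 8" if "u \<in> U" "x \<in> Q" for u x
   using d(2)[OF d(1) order_refl, of "(u, x)"] that by simp
  thus ?thesis using d(1) that by blast
 qed
 have avF: "avail U C1 F F'" by (rule avail_commute[OF C1(8)])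
 have i0: "0 \<in> idx C1" "0 \<notin> {F, F'}" using extendsD(1)[OF C1(2) C(2)] F F' by auto
 have hQ: "u x < (height (fibre C1) u F + height (fibre C1) u F') / 2" if u: "u \<in> U" and x: "x \<in> scaled \<kappa> Q" for u x
 proof -
  obtain z where z: "z \<in> Q" "x = \<kappa> *R z" using x by blast
  have "u x = \<kappa> * u z" using z U(3)[OF u] by (simp add: linear_scale)
  also have "... <= \<kappa> * \<bar>u z\<bar>" using \<kappa>(1) by (simp add: abs_if)
  also have "... <= Max (u ` Z) / 8" by (rule \<kappa>(2)[OF u z(1)])
  also have "... < Max (u ` Z) / 2" using Z(3)[OF u] by simp
  finally show ?thesis using hF1[OF u] hF1'[OF u] by simp
 qed
 have sQ: "finite (scaled \<kappa> Q)" "scaled \<kappa> Q ~= {}" using Q by auto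
 obtain C2 m where C2: "wf_config C2" "extends U C1 C2" "m \<notin> idx C1" "m \<in> idx C2" "fibre C2 m = scaled \<kappa> Q"
  "\<And>u. u \<in> U ==> fcert C2 u {F, F', m}" "avail U C2 F m" "avail U C2 m F'"
  "\<And>K. fcert C1 zf K ==> \<not> {F, F'} \<subseteq> K ==> fcert C2 zf K" "idx C2 = insert m (idx C1)"
  using config_attach_fibre[OF C1(1) U(1,2) avF i0 sQ hQ] by metis
 have m: "m \<notin> {0, F, F'}" using C2(3) i0(1) C1(4) extendsD(1)[OF C1(2) F(1)] by (metis empty_iff insert_iff)
 have av2: "avail U C2 0 F'" by (rule zf_persists[OF C2(9) C2(2) C1(7)]) (use F F' in auto)
 have avm: "avail U C2 m F" by (rule avail_commute[OF C2(7)])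
 have in2: "0 \<in> idx C2" "F \<in> idx C2" "F' \<in> idx C2"
  using extendsD(1)[OF C2(2)] i0(1) C1(4) extendsD(1)[OF C1(2) F(1)] by auto
 have h2: "height (fibre C2) u F = Max (u ` Z) / 2" "height (fibre C2) u F' = Max (u ` Z) / 2" if "u \<in> U" for u
  using hF1[OF that] hF1'[OF that] extends_height[OF C2(2)] C1(4) extendsD(1)[OF C1(2) F(1)] by auto
 have i2: "0 \<notin> {m, F'}" "0 \<notin> {m, F}" using m F F' by auto
 have QW: "Q \<subseteq> W" using W(4) gQ by simp
 have w1: "inside W C1"
  by (rule inside_extends[OF C1(2) W(3)]) (use C1(3,5,10) scaled_subset[OF W(1,2), of "1/2"] in auto)
 have w2: "inside W C2"
  by (rule inside_extends[OF C2(2) w1]) (use C2(3,5,10) scaled_subset[OF W(1) QW, of \<kappa>] in auto)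
 obtain C3 where C3: "wf_config C3" "extends U C2 C3" "chain_ok U C3 m F' \<kappa> Rs"
  "\<And>K. fcert C2 zf K ==> \<not> {m, F'} \<subseteq> K ==> fcert C3 zf K" "inside W C3"
  using chain_build[of U "\<lambda>u. Max (u ` Z)", OF U Z(3) W(1) C2(1) C2(8) in2(1) in2(1) i2(1) C2(5) \<kappa>(1) Q(1,2) h2(2) \<kappa>(2) Q(3) w2 QW] by blast
 have av3: "avail U C3 0 F'" by (rule zf_persists[OF C3(4) C3(2) av2]) (use m in auto)
 have avm3: "avail U C3 m F" by (rule zf_persists[OF C3(4) C3(2) avm]) (use m F' in auto)
 have h3: "height (fibre C3) u F = Max (u ` Z) / 2" if "u \<in> U" for u
  using h2[OF that] extends_height[OF C3(2) in2(2)] by simp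
 have in3: "0 \<in> idx C3" "m \<in> idx C3" using extendsD(1)[OF C3(2)] in2 C2(4) by auto
 have f3: "fibre C3 m = scaled \<kappa> Q" using extendsD(2)[OF C3(2) C2(4)] C2(5) by simp
 obtain C4 where C4: "wf_config C4" "extends U C3 C4" "chain_ok U C4 m F \<kappa> Ls"
  "\<And>K. fcert C3 zf K ==> \<not> {m, F} \<subseteq> K ==> fcert C4 zf K" "inside W C4"
  using chain_build[of U "\<lambda>u. Max (u ` Z)", OF U Z(3) W(1) C3(1) avm3 in3(1) in3(1) i2(2) f3 \<kappa>(1) Q(1,2) h3 \<kappa>(2) Q(4) C3(5) QW] by blast
 have av4: "avail U C4 0 F'" by (rule zf_persists[OF C4(4) C4(2) av3]) (use m in auto)
 have e24: "extends U C2 C4" by (rule extends_trans[OF C3(2) C4(2)])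
 have e14: "extends U C1 C4" by (rule extends_trans[OF C2(2) e24])
 have e04: "extends U C C4" by (rule extends_trans[OF C1(2) e14])
 have "slot_ok U Z C4 g"
  unfolding slot_ok_def
 proof (rule exI[of _ F], rule exI[of _ F'], rule exI[of _ m], rule exI[of _ \<kappa>], intro conjI)
  show "reach U Z C4 F" "reach U Z C4 F'" using reach_extends[OF e14] reach1 reach1' by blast+
  show "F ~= F'" "m \<notin> {0, F, F'}" "\<kappa> > 0" using F' m \<kappa> by auto
  show "m \<in> idx C4" using extendsD(1)[OF C4(2) in3(2)] .
  show "fibre C4 m = scaled \<kappa> (fst g)" using extendsD(2)[OF C4(2) in3(2)] f3 gQ by simp
  show "chain_ok U C4 m F' \<kappa> (fst (snd g))" using chain_ok_extends[OF C4(2) C3(3) in3(2)] gQ by simp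
  show "chain_ok U C4 m F \<kappa> (snd (snd g))" using C4(3) gQ by simp
  show "\<forall>u\<in>U. fcert C4 u {F, F', m} & fcert C4 u {F, F'} & fcert C4 u {F, m} & fcert C4 u {m, F'}"
  proof (intro ballI conjI)
   fix u assume u: "u \<in> U"
   show "fcert C4 u {F, F', m}" by (rule extendsD(4)[OF e24 u C2(6)[OF u]])
   show "fcert C4 u {F, F'}" using extendsD(4)[OF e14 u] avF u by (simp add: avail_def)
   show "fcert C4 u {F, m}" "fcert C4 u {m, F'}" using extendsD(4)[OF e24 u] C2(7,8) u by (simp_all add: avail_def)
  qed
 qed
 moreover have "reach U Z C4 F'" by (rule reach_extends[OF e14 reach1'])
 moreover have "F' \<notin> {0, F}" using F' by simp
 ultimately show ?thesis using that[OF C4(5,1) e04 _ av4] by blast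
qed

text \<open>The invariant of the induction over the gadgets is an available edge between the hub and
  a reachable copy, together with a third point beside it.\<close>

lemma ring_build:
 assumes U: "finite U" "zf \<notin> U" "\<And>u. u \<in> U ==> linear u"
  and Z: "finite Z" "Z ~= {}" "\<And>u. u \<in> U ==> Max (u ` Z) > 0"
  and gs: "\<And>g. g \<in> set gs ==> gadget_adm U g & fst g \<subseteq> W" and W: "subspace W" "Z \<subseteq> W"
 shows "\<exists>C. wf_config C & inside W C & extends U (start_config Z) C & (\<forall>g\<in>set gs. slot_ok U Z C g)"
proof -
 have "\<exists>C F. wf_config C & inside W C & extends U (start_config Z) C & reach U Z C F & avail U C 0 F & (\<exists>i0\<in>idx C. i0 \<notin> {0, F}) &
   (\<forall>g\<in>set gs. slot_ok U Z C g)"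
  using gs
 proof (induction gs)
  case Nil
  have "reach U Z (start_config Z) 1"
  proof (rule reach.start)
   show "fcert (start_config Z) u {0, 1}" for u by (rule start_config_cert) simp
  qed (auto simp: start_config_def)
  moreover have "avail U (start_config Z) 0 1"
   by (simp add: avail_def start_config_cert)
  moreover have "\<exists>i0\<in>idx (start_config Z). i0 \<notin> {0, 1}"
   by (rule bexI[of _ 2]) (simp_all add: start_config_def)
  moreover have "inside W (start_config Z)"
   using W(2) scaled_subset[OF W, of "1/2"] by (auto simp: inside_def start_config_def)
  ultimately have "wf_config (start_config Z) & inside W (start_config Z) & extends U (start_config Z) (start_config Z) & reach U Z (start_config Z) 1 &
    avail U (start_config Z) 0 1 & (\<exists>i0\<in>idx (start_config Z). i0 \<notin> {0, 1}) & (\<forall>g\<in>set []. slot_ok U Z (start_config Z) g)"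
   using start_config_wf[OF Z(1,2)] extends_refl[of U "start_config Z"] by simp
  thus ?case by blast
 next
  case (Cons g gs)
  obtain C F i0 where C: "wf_config C" "extends U (start_config Z) C" "reach U Z C F" "avail U C 0 F" "i0 \<in> idx C" "i0 \<notin> {0, F}"
   "\<forall>g\<in>set gs. slot_ok U Z C g" "inside W C"
   using Cons by auto
  have "0 \<in> idx (start_config Z)" "fibre (start_config Z) 0 = Z" by (auto simp: start_config_def)
  hence C0: "0 \<in> idx C" "fibre C 0 = Z" using extendsD(1,2)[OF C(2)] by auto
  have g: "gadget_adm U g" "fst g \<subseteq> W" using Cons.prems by simp_all
  obtain C' F' where C'W: "inside W C'" and C': "wf_config C'" "extends U C C'" "reach U Z C' F'" "avail U C' 0 F'" "F' \<notin> {0, F}" "slot_ok U Z C' g"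
   by (rule slot_build[OF U Z C(1) C0 C(3-6) g(1) W C(8) g(2)])
  have "\<forall>g\<in>set (g # gs). slot_ok U Z C' g" using C(7) C'(6) slot_ok_extends[OF C'(2)] by auto
  moreover have "F \<in> idx C'" "F \<notin> {0, F'}" using reach_idx[OF reach_extends[OF C'(2) C(3)]] C'(5) by auto
  ultimately show ?case using C'W C'(1,3,4) extends_trans[OF C(2) C'(2)] by blast
 qed
 thus ?thesis by blast
qed

section \<open>Incidences forced by the face lattice\<close>

text \<open>Coplanarity of four points given by homogeneous coordinates; coincidences among the
  points are allowed.\<close>

definition rel4 :: "'c::real_vector => 'c => 'c => 'c => bool" where
 "rel4 a b c d \<longleftrightarrow> (\<exists>\<alpha> \<beta> \<gamma> \<delta>. (\<alpha>, \<beta>, \<gamma>, \<delta>) ~= (0, 0, 0, 0) & \<alpha> *R a + \<beta> *R b + \<gamma> *R c + \<delta> *R d = 0)"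

lemma rel4_middle: "rel4 a b c d ==> rel4 a c b d"
 unfolding rel4_def
proof (elim exE conjE)
 fix \<alpha> \<beta> \<gamma> \<delta> :: real
 assume "(\<alpha>, \<beta>, \<gamma>, \<delta>) ~= (0, 0, 0, 0)" "\<alpha> *R a + \<beta> *R b + \<gamma> *R c + \<delta> *R d = 0"
 hence "(\<alpha>, \<gamma>, \<beta>, \<delta>) ~= (0, 0, 0, 0) & \<alpha> *R a + \<gamma> *R c + \<beta> *R b + \<delta> *R d = 0"
  by (simp add: ac_simps)
 thus "\<exists>\<alpha> \<beta> \<gamma> \<delta>. (\<alpha>, \<beta>, \<gamma>, \<delta>) ~= (0, 0, 0, 0) & \<alpha> *R a + \<beta> *R c + \<gamma> *R b + \<delta> *R d = 0"
  by blast
qed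

lemma span_pairI: "\<alpha> *R a + \<beta> *R b \<in> span {a, b}"
 by (intro span_add span_scale span_base) auto

lemma span_pairE:
 assumes "x \<in> span {a, b}"
 obtains \<alpha> \<beta> where "x = \<alpha> *R a + \<beta> *R b"
proof -
 obtain k where "x - k *R a \<in> span {b}" using assms span_breakdown_eq by blast
 then obtain l where "x - k *R a = l *R b" by (auto simp: span_singleton)
 hence "x = k *R a + l *R b" by (simp add: algebra_simps)
 thus ?thesis by (rule that)
qed

text \<open>Modulo \<open>H\<close> only the multiple of \<open>p\<close> remains, and it has to
  vanish. This is the recurring way of intersecting a span with a subspace that misses one
  generator.\<close>

lemma span_drop:
 assumes "x \<in> span (insert p S)" "S \<subseteq> H" "subspace H" "x \<in> H" "p \<notin> H"
 shows "x \<in> span S"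
proof -
 obtain k where k: "x - k *R p \<in> span S" using assms(1) span_breakdown_eq by blast
 moreover have "span S \<subseteq> H" using assms(2,3) by (simp add: span_minimal)
 ultimately have "x - (x - k *R p) \<in> H" using assms(3,4) by (meson subsetD subspace_diff)
 hence kp: "k *R p \<in> H" by simp
 have "k = 0"
 proof (rule ccontr)
  assume "k ~= 0"
  hence "p = (1 / k) *R (k *R p)" by simp
  hence "p \<in> H" using subspace_scale[OF assms(3) kp, of "1 / k"] by simp
  thus False using assms(5) by simp
 qed
 thus ?thesis using k by simp
qed

lemma span_two_exchange:
 assumes "s \<in> span {p, q}" "t \<in> span {p, q}" "s ~= 0" "t \<notin> span {s}"
 shows "p \<in> span {s, t}" "q \<in> span {s, t}"
proof -
 have main: "p \<in> span {s, t} & q \<in> span {s, t}"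
 proof (cases "s \<in> span {q}")
  case True
  then obtain k where k: "s = k *R q" by (auto simp: span_singleton)
  hence "k ~= 0" using assms(3) by auto
  hence q: "q = (1 / k) *R s" using k by simp
  hence qs: "q \<in> span {s}" by (simp add: span_scale span_base)
  have "{p, q} \<subseteq> span {p, s}" using qs span_mono[of "{s}" "{p, s}"] by (auto intro: span_base)
  hence "t \<in> span {p, s}" using assms(2) span_minimal[OF _ subspace_span] by blast
  hence "p \<in> span {t, s}" using assms(4) by (rule in_span_insert)
  moreover have "q \<in> span {s, t}" using qs span_mono[of "{s}" "{s, t}"] by auto
  ultimately show ?thesis by (simp add: insert_commute)
 next
  case False
  have p: "p \<in> span {s, q}" by (rule in_span_insert[OF assms(1) False])
  hence "{p, q} \<subseteq> span {q, s}" by (auto intro: span_base simp: insert_commute)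
  hence "t \<in> span {q, s}" using assms(2) span_minimal[OF _ subspace_span] by blast
  hence q: "q \<in> span {t, s}" using assms(4) by (rule in_span_insert)
  hence "{s, q} \<subseteq> span {s, t}" by (auto intro: span_base simp: insert_commute)
  hence "p \<in> span {s, t}" using p span_minimal[OF _ subspace_span] by blast
  thus ?thesis using q by (simp add: insert_commute)
 qed
 show "p \<in> span {s, t}" "q \<in> span {s, t}" using main by auto
qed

text \<open>Two independent points of a projective line span it; if both lay in \<open>H\<close>, so
  would \<open>p\<close>.\<close>

lemma line_meet:
 assumes "t \<in> span {p, q}" "t' \<in> span {p, q}" "t \<in> H" "t' \<in> H" "subspace H" "p \<notin> H" "t ~= 0"
 shows "t' \<in> span {t}"
proof (rule ccontr)
 assume "t' \<notin> span {t}"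
 hence "p \<in> span {t, t'}" by (rule span_two_exchange(1)[OF assms(1,2,7)])
 moreover have "span {t, t'} \<subseteq> H" using assms(3-5) by (simp add: span_minimal)
 ultimately show False using assms(6) by blast
qed

lemma span_singleton_sym:
 assumes "t' \<in> span {t}" "t' ~= 0"
 shows "t \<in> span {t'}"
proof -
 obtain k where k: "t' = k *R t" using assms(1) by (auto simp: span_singleton)
 hence "k ~= 0" using assms(2) by auto
 hence "t = (1 / k) *R t'" using k by simp
 thus ?thesis by (metis span_base span_scale singletonI)
qed

lemma span_singleton_in:
 assumes "t' \<in> span {t}" "t' ~= 0" "t' \<in> span S"
 shows "t \<in> span S"
proof -
 have "span {t'} \<subseteq> span S" using assms(3) by (simp add: span_minimal)
 thus ?thesis using span_singleton_sym[OF assms(1,2)] by blast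
qed

text \<open>One half of the dependence, equal to minus the other half, is the common point of the
  two lines; it is nonzero because each pair is independent.\<close>

lemma rel4_meet:
 assumes "rel4 p q p' q'" "p \<notin> span {q}" "q ~= 0" "p' \<notin> span {q'}" "q' ~= 0"
 obtains t where "t ~= 0" "t \<in> span {p, q}" "t \<in> span {p', q'}"
proof -
 obtain \<alpha> \<beta> \<gamma> \<delta> where c: "(\<alpha>, \<beta>, \<gamma>, \<delta>) ~= (0, 0, 0, 0)" "\<alpha> *R p + \<beta> *R q + \<gamma> *R p' + \<delta> *R q' = 0"
  using assms(1) unfolding rel4_def by blast
 have ind: "\<alpha> = 0 & \<beta> = 0" if "\<alpha> *R p + \<beta> *R q = 0" "p \<notin> span {q}" "q ~= 0" for \<alpha> \<beta> and p q :: 'a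
 proof -
  have "\<alpha> = 0"
  proof (rule ccontr)
   assume a: "\<alpha> ~= 0"
   have "\<alpha> *R p = (- \<beta>) *R q" using that(1) by (simp add: eq_neg_iff_add_eq_0)
   hence "(1 / \<alpha>) *R (\<alpha> *R p) \<in> span {q}" by (metis span_base span_scale singletonI)
   thus False using a that(2) by simp
  qed
  thus ?thesis using that by simp
 qed
 define t where "t = \<alpha> *R p + \<beta> *R q"
 have t': "t = (- \<gamma>) *R p' + (- \<delta>) *R q'"
  using c(2) unfolding t_def by (simp add: algebra_simps eq_neg_iff_add_eq_0)
 have "t ~= 0"
 proof
  assume "t = 0"
  hence "\<alpha> = 0 & \<beta> = 0" "- \<gamma> = 0 & - \<delta> = 0"
   using ind[of \<alpha> p \<beta> q] ind[of "- \<gamma>" p' "- \<delta>" q'] t' assms(2-5) unfolding t_def by auto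
  thus False using c(1) by simp
 qed
 moreover have "t \<in> span {p, q}" unfolding t_def by (rule span_pairI)
 moreover have "t \<in> span {p', q'}" unfolding t' by (rule span_pairI)
 ultimately show ?thesis by (rule that)
qed

text \<open>The third line is not in the plane of the first two, hence meets it only once. Its
  intersections with both of them are points of that plane, so they coincide. The last two
  conclusions make the point unique, so that it can be identified with points found
  elsewhere.\<close>

lemma concurrent:
 assumes "rel4 p1 q1 p2 q2" "rel4 p1 q1 p3 q3" "rel4 p2 q2 p3 q3"
  "p1 \<notin> span {q1}" "q1 ~= 0" "p2 \<notin> span {q2}" "q2 ~= 0" "p3 \<notin> span {q3}" "q3 ~= 0"
  and off: "p3 \<notin> span {p1, q1, p2, q2}" "p1 \<notin> span {p2, q2}"
 obtains t where "t ~= 0" "t \<in> span {p1, q1}" "t \<in> span {p2, q2}" "t \<in> span {p3, q3}"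
  "\<And>s. s \<in> span {p1, q1} ==> s \<in> span {p2, q2} ==> s \<in> span {t}"
  "\<And>s. s \<in> span {p1, q1} ==> s \<in> span {p3, q3} ==> s \<in> span {t}"
proof -
 obtain t where t: "t ~= 0" "t \<in> span {p1, q1}" "t \<in> span {p2, q2}"
  using rel4_meet[OF assms(1) assms(4-7)] by blast
 obtain s where s: "s ~= 0" "s \<in> span {p1, q1}" "s \<in> span {p3, q3}"
  using rel4_meet[OF assms(2) assms(4,5,8,9)] by blast
 obtain q where q: "q ~= 0" "q \<in> span {p2, q2}" "q \<in> span {p3, q3}"
  using rel4_meet[OF assms(3) assms(6-9)] by blast
 have big: "span {p1, q1} \<subseteq> span {p1, q1, p2, q2}" "span {p2, q2} \<subseteq> span {p1, q1, p2, q2}"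
  by (intro span_mono; auto)+
 have "q \<in> span {s}"
  by (rule line_meet[OF s(3) q(3) _ _ subspace_span off(1) s(1)]) (use big s q in auto)
 hence s2: "s \<in> span {p2, q2}" by (rule span_singleton_in[OF _ q(1,2)])
 have one: "x \<in> span {t}" if "x \<in> span {p1, q1}" "x \<in> span {p2, q2}" for x
  by (rule line_meet[OF t(2) that(1) t(3) that(2) subspace_span off(2) t(1)])
 have t3: "t \<in> span {p3, q3}" by (rule span_singleton_in[OF one[OF s(2) s2] s(1,3)])
 have two: "x \<in> span {t}" if x: "x \<in> span {p1, q1}" "x \<in> span {p3, q3}" for x
  by (rule line_meet[OF t3 x(2) _ _ subspace_span off(1) t(1)]) (use big t x in auto)
 show ?thesis by (rule that[OF t t3]) (rule one two; assumption)+
qed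

section \<open>Incidences of a realization, detached from the polytope\<close>

definition faceset :: "'a config => ('a => real) => nat set => (nat \<times> 'a) set" where
 "faceset C u K = {(i, x). i \<in> K & x \<in> fibre C i & u x = height (fibre C) u i}"

definition point :: "'a config => nat \<times> 'a => 'a \<times> real \<times> real" where
 "point C p = (snd p, shadow C (fst p))"

definition top_set :: "('a => real) => 'a set => 'a set" where
 "top_set u J = {x\<in>J. \<forall>y\<in>J. u y <= u x}"

lemma faceset_insert: "faceset C u (insert i K) = faceset C u {i} \<union> faceset C u K"
 by (auto simp: faceset_def)

lemma faceset_zf: "faceset C zf {i} = Pair i ` fibre C i"
 by (auto simp: faceset_def)

lemma faceset_scaled:
 assumes "fibre C m = scaled c J" "linear u" "c > 0" "finite J" "J ~= {}"
 shows "faceset C u {m} = (\<lambda>v. (m, c *R v)) ` top_set u J"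
proof -
 have h: "height (fibre C) u m = c * Max (u ` J)"
  by (rule height_scaled[of "fibre C", OF assms(1,2) _ assms(4,5)]) (use assms(3) in simp)
 have eq: "u (c *R v) = height (fibre C) u m \<longleftrightarrow> (\<forall>y\<in>J. u y <= u v)" if "v \<in> J" for v
 proof -
  have "u (c *R v) = height (fibre C) u m \<longleftrightarrow> Max (u ` J) = u v"
   using assms(2,3) by (auto simp: h linear_scale)
  also have "... \<longleftrightarrow> (\<forall>y\<in>J. u y <= u v)"
   using assms(4,5) that by (subst Max_eq_iff) auto
  finally show ?thesis .
 qed
 have "faceset C u {m} = (\<lambda>v. (m, c *R v)) ` {v\<in>J. u (c *R v) = height (fibre C) u m}"
  by (auto simp: faceset_def assms(1) image_iff)
 also have "{v\<in>J. u (c *R v) = height (fibre C) u m} = top_set u J"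
  unfolding top_set_def by (rule Collect_cong) (simp add: eq cong: conj_cong)
 finally show ?thesis .
qed

lemma top_set_subset:
 assumes "top_set u J = T" "T \<subseteq> J'" "J' \<subseteq> J" "T ~= {}"
 shows "top_set u J' = T"
proof -
 obtain t where t: "t \<in> T" using assms(4) by blast
 have t': "t \<in> J'" "\<forall>y\<in>J. u y <= u t" using t assms by (auto simp: top_set_def)
 have "x \<in> T" if "x \<in> J'" "\<forall>y\<in>J'. u y <= u x" for x
 proof -
  have "\<forall>y\<in>J. u y <= u x" using that t' by force
  thus ?thesis using that assms(1,3) by (auto simp: top_set_def)
 qed
 moreover have "T \<subseteq> top_set u J'" using assms by (auto simp: top_set_def)
 ultimately show ?thesis by (auto simp: top_set_def)
qed

text \<open>\<open>r\<close> assigns homogeneous coordinates to the realized vertices, and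
  \<open>Vt\<close> holds the labels that are vertices. The labels \<open>p\<close> and
  \<open>q\<close> in \<open>vert\<close> may coincide, which treats edges and single vertices at
  once.\<close>

locale incidence =
 fixes U :: "('a::real_vector => real) set" and Z E :: "'a set" and C :: "'a config"
  and Vt :: "(nat \<times> 'a) set" and r :: "nat \<times> 'a => 'c::real_vector"
 assumes linU: "u \<in> U ==> linear u" and wf: "wf_config C"
  and hub: "0 \<in> idx C" "fibre C 0 = Z"
  and hub_top: "u \<in> U ==> e \<in> E ==> u e = 0 ==> \<exists>z. top_set u Z = {z + e, z - e}"
  and E0: "0 \<notin> E"
  and vert: "linear u ==> fcert C u {i} ==> faceset C u {i} = {p, q} ==> p \<in> Vt & q \<in> Vt"
  and VtC: "p \<in> Vt ==> snd p \<in> fibre C (fst p)"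
  and ind: "p \<in> Vt ==> q \<in> Vt ==> p ~= q ==> r p \<notin> span {r q}"
  and nz: "p \<in> Vt ==> r p ~= 0"
  and off: "linear u ==> fcert C u K ==> p \<in> Vt ==> p \<notin> faceset C u K ==> r p \<notin> span (r ` (faceset C u K \<inter> Vt))"
  and quad: "linear u ==> fcert C u K ==> faceset C u K = {p1, p2, p3, p4} ==> {p1, p2, p3, p4} \<subseteq> Vt ==>
   rel4 (hat (point C p1)) (hat (point C p2)) (hat (point C p3)) (hat (point C p4)) ==> rel4 (r p1) (r p2) (r p3) (r p4)"
begin

definition lin :: "('a => real) => nat => 'c set" where
 "lin u i = span (r ` faceset C u {i})"

definition full :: "nat => 'c set" where
 "full i = span (r ` (Pair i ` fibre C i \<inter> Vt))"

definition ridge :: "'a => ('a => real) => nat => bool" where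
 "ridge e u i \<longleftrightarrow> (\<exists>x y c. faceset C u {i} = {(i, x), (i, y)} & c ~= 0 & x - y = c *R e)"

lemma cert_single: "fcert C u K ==> i \<in> K ==> fcert C u {i}"
proof -
 assume a: "fcert C u K" "i \<in> K"
 hence "fcert C zf {i}" using fcert_idx[OF a(1)] wf by (auto simp: wf_config_def)
 hence "fcert C u (K \<inter> {i})" by (rule fcert_inter[OF a(1)])
 thus ?thesis using a(2) by (simp add: Int_absorb1)
qed

lemma full_off:
 assumes "i \<in> idx C" "p \<in> Vt" "fst p ~= i"
 shows "r p \<notin> full i"
proof -
 have "fcert C zf {i}" using assms(1) wf by (simp add: wf_config_def)
 moreover have "p \<notin> faceset C zf {i}" using assms(3) by (auto simp: faceset_def)
 moreover have "linear (zf :: 'a => real)" by (simp add: linear_iff)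
 ultimately have "r p \<notin> span (r ` (faceset C zf {i} \<inter> Vt))" using assms(2) by (intro off)
 thus ?thesis unfolding full_def faceset_zf .
qed

lemma ridgeE:
 assumes "ridge e u i" "u \<in> U" "fcert C u {i}" "e \<in> E"
 obtains x y c where "faceset C u {i} = {(i, x), (i, y)}" "c ~= 0" "x - y = c *R e" "(i, x) \<in> Vt" "(i, y) \<in> Vt"
  "r (i, x) \<notin> span {r (i, y)}" "r (i, y) ~= 0" "lin u i = span {r (i, x), r (i, y)}"
proof -
 obtain x y c where f: "faceset C u {i} = {(i, x), (i, y)}" "c ~= 0" "x - y = c *R e"
  using assms(1) unfolding ridge_def by blast
 have v: "(i, x) \<in> Vt" "(i, y) \<in> Vt" using vert[OF linU[OF assms(2)] assms(3) f(1)] by auto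
 have "e ~= 0" using assms(4) E0 by auto
 hence "x ~= y" using f by auto
 hence "r (i, x) \<notin> span {r (i, y)}" using v by (intro ind) auto
 thus ?thesis using that[OF f v _ nz[OF v(2)]] f by (simp add: lin_def)
qed

lemma lin_full:
 assumes "ridge e u i" "u \<in> U" "fcert C u {i}" "e \<in> E"
 shows "lin u i \<subseteq> full i"
proof -
 obtain x y c where f: "faceset C u {i} = {(i, x), (i, y)}" "c ~= 0" "x - y = c *R e" "(i, x) \<in> Vt" "(i, y) \<in> Vt"
  "r (i, x) \<notin> span {r (i, y)}" "r (i, y) ~= 0" "lin u i = span {r (i, x), r (i, y)}"
  by (rule ridgeE[OF assms])
 have "{r (i, x), r (i, y)} \<subseteq> r ` (Pair i ` fibre C i \<inter> Vt)" using f(4,5) VtC by force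
 thus ?thesis unfolding f(8) full_def by (rule span_mono)
qed

lemma ridge_rel4:
 assumes "fcert C u {i, j}" "u \<in> U" "faceset C u {i} = {(i, x), (i, y)}" "c ~= 0" "x - y = c *R e"
  "faceset C u {j} = {(j, x'), (j, y')}" "x' - y' = c' *R e"
 shows "rel4 (r (i, x)) (r (i, y)) (r (j, x')) (r (j, y'))"
proof (rule quad[OF linU[OF assms(2)] assms(1)])
 show "faceset C u {i, j} = {(i, x), (i, y), (j, x'), (j, y')}"
  using faceset_insert[of C u i "{j}"] assms(3,6) by auto
 show "{(i, x), (i, y), (j, x'), (j, y')} \<subseteq> Vt"
  using vert[OF linU[OF assms(2)] cert_single[OF assms(1)] assms(3)] vert[OF linU[OF assms(2)] cert_single[OF assms(1)] assms(6)] by blast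
 \<comment> \<open>Points over the same index have the same shadow, so differences within a fibre
   only see the parallel vectors \<open>c e\<close> and \<open>c' e\<close>; the crosswise multiples
   cancel.\<close>
 have "(- c') *R hat (point C (i, x)) + c' *R hat (point C (i, y)) + c *R hat (point C (j, x')) + (- c) *R hat (point C (j, y'))
   = ((c *R (x' - y') - c' *R (x - y), 0, 0), 0)"
  by (simp add: hat_def point_def scaleR_diff_right zero_prod_def)
 also have "... = 0" unfolding assms(5,7) by (simp add: prod_eq_iff)
 finally show "rel4 (hat (point C (i, x))) (hat (point C (i, y))) (hat (point C (j, x'))) (hat (point C (j, y')))"
  unfolding rel4_def using assms(4)
  by - (rule exI[of _ "- c'"], rule exI[of _ c'], rule exI[of _ c], rule exI[of _ "- c"], simp)
qed

lemma ridge_meet: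
 assumes "ridge e u i" "ridge e u j" "fcert C u {i, j}" "u \<in> U" "e \<in> E"
 obtains t where "t ~= 0" "t \<in> lin u i" "t \<in> lin u j"
proof -
 have ci: "fcert C u {i}" "fcert C u {j}" using cert_single[OF assms(3)] by auto
 obtain x y c where f: "faceset C u {i} = {(i, x), (i, y)}" "c ~= 0" "x - y = c *R e" "(i, x) \<in> Vt" "(i, y) \<in> Vt"
  "r (i, x) \<notin> span {r (i, y)}" "r (i, y) ~= 0" "lin u i = span {r (i, x), r (i, y)}"
  by (rule ridgeE[OF assms(1,4) ci(1) assms(5)])
 obtain x' y' c' where f': "faceset C u {j} = {(j, x'), (j, y')}" "c' ~= 0" "x' - y' = c' *R e" "(j, x') \<in> Vt" "(j, y') \<in> Vt"
  "r (j, x') \<notin> span {r (j, y')}" "r (j, y') ~= 0" "lin u j = span {r (j, x'), r (j, y')}"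
  by (rule ridgeE[OF assms(2,4) ci(2) assms(5)])
 show ?thesis
  using rel4_meet[OF ridge_rel4[OF assms(3,4) f(1-3) f'(1,3)] f(6,7) f'(6,7)] that f(8) f'(8) by metis
qed

text \<open>The edges are pairwise coplanar as parallels in common faces. A vertex over
  \<open>k\<close> is off the face over \<open>{i, j}\<close>, hence off its span, so the three
  lines are not all in one plane.\<close>

lemma ridge_concurrent:
 assumes "ridge e u i" "ridge e u j" "ridge e u k" "fcert C u {i, j}" "fcert C u {i, k}" "fcert C u {j, k}"
  "i ~= j" "i ~= k" "j ~= k" "u \<in> U" "e \<in> E" "t \<in> lin u i" "t \<in> lin u j"
 shows "t \<in> lin u k"
proof -
 have ci: "fcert C u {i}" "fcert C u {j}" "fcert C u {k}" using cert_single assms(4,5) by auto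
 obtain x y c where f: "faceset C u {i} = {(i, x), (i, y)}" "c ~= 0" "x - y = c *R e" "(i, x) \<in> Vt" "(i, y) \<in> Vt"
  "r (i, x) \<notin> span {r (i, y)}" "r (i, y) ~= 0" "lin u i = span {r (i, x), r (i, y)}"
  by (rule ridgeE[OF assms(1,10) ci(1) assms(11)])
 obtain x' y' c' where f': "faceset C u {j} = {(j, x'), (j, y')}" "c' ~= 0" "x' - y' = c' *R e" "(j, x') \<in> Vt" "(j, y') \<in> Vt"
  "r (j, x') \<notin> span {r (j, y')}" "r (j, y') ~= 0" "lin u j = span {r (j, x'), r (j, y')}"
  by (rule ridgeE[OF assms(2,10) ci(2) assms(11)])
 obtain x'' y'' c'' where f'': "faceset C u {k} = {(k, x''), (k, y'')}" "c'' ~= 0" "x'' - y'' = c'' *R e" "(k, x'') \<in> Vt" "(k, y'') \<in> Vt"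
  "r (k, x'') \<notin> span {r (k, y'')}" "r (k, y'') ~= 0" "lin u k = span {r (k, x''), r (k, y'')}"
  by (rule ridgeE[OF assms(3,10) ci(3) assms(11)])
 have "faceset C u {i, j} \<inter> Vt = {(i, x), (i, y), (j, x'), (j, y')}"
  using faceset_insert[of C u i "{j}"] f(1,4,5) f'(1,4,5) by auto
 moreover have "(k, x'') \<notin> faceset C u {i, j}" using assms(8,9) by (simp add: faceset_def)
 ultimately have o1: "r (k, x'') \<notin> span {r (i, x), r (i, y), r (j, x'), r (j, y')}"
  using off[OF linU[OF assms(10)] assms(4) f''(4)] by simp
 have "faceset C u {j} \<inter> Vt = {(j, x'), (j, y')}" using f'(1,4,5) by auto
 moreover have "(i, x) \<notin> faceset C u {j}" using assms(7) by (simp add: faceset_def)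
 ultimately have o2: "r (i, x) \<notin> span {r (j, x'), r (j, y')}"
  using off[OF linU[OF assms(10)] ci(2) f(4)] by simp
 obtain s where s: "s ~= 0" "s \<in> span {r (i, x), r (i, y)}" "s \<in> span {r (j, x'), r (j, y')}" "s \<in> span {r (k, x''), r (k, y'')}"
  "\<And>t. t \<in> span {r (i, x), r (i, y)} ==> t \<in> span {r (j, x'), r (j, y')} ==> t \<in> span {s}"
  using concurrent[OF ridge_rel4[OF assms(4,10) f(1-3) f'(1,3)] ridge_rel4[OF assms(5,10) f(1-3) f''(1,3)]
   ridge_rel4[OF assms(6,10) f'(1-3) f''(1,3)] f(6,7) f'(6,7) f''(6,7) o1 o2] by metis
 have "t \<in> span {s}" by (rule s(5)) (use assms(12,13) f(8) f'(8) in auto)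
 moreover have "span {s} \<subseteq> lin u k" using s(4) f''(8) by (simp add: span_minimal)
 ultimately show ?thesis by blast
qed

end

section \<open>Ideal points of directions, and chains of fibres\<close>

definition vis :: "('a::real_vector => real) set => 'a set => 'a set => ('a => real) => 'a => 'a => 'a => bool" where
 "vis U E J u e v w \<longleftrightarrow> u \<in> U & e \<in> E & u e = 0 & top_set u J = {v, w} & v ~= w & v - w \<in> span {e}"

text \<open>Connectivity of \<open>J'\<close> by edges of the larger set \<open>J\<close>. Such
  edges are exposed in both sets by the same functional, so two successive fibres of a chain share
  them.\<close>

definition linked :: "('a::real_vector => real) set => 'a set => 'a set => 'a set => bool" where
 "linked U E J J' \<longleftrightarrow> (\<forall>v\<in>J'. \<forall>w\<in>J'. (v, w) \<in> {(v, w). v \<in> J' & w \<in> J' & (\<exists>u e. vis U E J u e v w)}\<^sup>*)"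

text \<open>The counterpart of \<open>chain_adm\<close>: those conditions serve the construction of
  a chain, these the incidences in its realizations.\<close>

fun chain_static :: "('a::real_vector => real) set => 'a set => 'a set => 'a set list => bool" where
 "chain_static U E J [] = True"
| "chain_static U E J (J' # Js) = (J' \<subseteq> J & (\<exists>v\<in>J'. \<exists>w\<in>J'. v ~= w) & (\<forall>v\<in>J'. \<exists>u\<in>U. top_set u J = {v}) &
   linked U E J J' & chain_static U E J' Js)"

lemma vis_subset:
 assumes "vis U E J u e v w" "J' \<subseteq> J" "v \<in> J'" "w \<in> J'"
 shows "vis U E J' u e v w"
proof -
 have "top_set u J' = {v, w}" by (rule top_set_subset[of u J]) (use assms in \<open>auto simp: vis_def\<close>)
 thus ?thesis using assms(1) by (simp add: vis_def)
qed

lemma reach_one: "reach U Z C F ==> reach U Z C 1"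
proof (induction rule: reach.induct)
 case start
 thus ?case by (rule reach.start)
qed

context incidence
begin

lemma Z_props: "finite Z" "Z ~= {}"
 using wf hub by (auto simp: wf_config_def)

lemma hub_ridge:
 assumes "u \<in> U" "e \<in> E" "u e = 0" "fibre C i = scaled c Z" "c > 0"
 shows "ridge e u i"
proof -
 obtain z where z: "top_set u Z = {z + e, z - e}" using hub_top[OF assms(1-3)] by blast
 have "faceset C u {i} = {(i, c *R (z + e)), (i, c *R (z - e))}"
  using faceset_scaled[OF assms(4) linU[OF assms(1)] assms(5) Z_props] z by simp
 moreover have "c *R (z + e) - c *R (z - e) = (2 * c) *R e" by (simp add: algebra_simps scaleR_2[symmetric])
 ultimately show ?thesis unfolding ridge_def using assms(5)
  by - (rule exI[of _ "c *R (z + e)"], rule exI[of _ "c *R (z - e)"], rule exI[of _ "2 * c"], simp)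
qed

lemma hub_ridge0: "u \<in> U ==> e \<in> E ==> u e = 0 ==> ridge e u 0"
 by (rule hub_ridge[of _ _ _ 1]) (simp_all add: hub)

text \<open>The lines over the hub and over copy 1 meet once; along \<open>reach\<close>,
  concurrency with the hub and an earlier copy passes the point on to every other copy.\<close>

lemma hub_line:
 assumes "u \<in> U" "e \<in> E" "u e = 0" "reach U Z C G"
 obtains t where "t ~= 0" "t \<in> lin u 0" "\<And>F. reach U Z C F ==> t \<in> lin u F"
proof -
 have r1: "reach U Z C 1" by (rule reach_one[OF assms(4)])
 have rF: "ridge e u F" if "reach U Z C F" for F
  by (rule hub_ridge[OF assms(1-3), of _ "1/2"]) (use reach_idx[OF that] in auto)
 have r0: "ridge e u 0" by (rule hub_ridge0[OF assms(1-3)])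
 have "fcert C u {0, 1}" using reach_idx[OF r1] assms(1) by blast
 then obtain t where t: "t ~= 0" "t \<in> lin u 0" "t \<in> lin u 1"
  using ridge_meet[OF r0 rF[OF r1] _ assms(1,2)] by blast
 have "t \<in> lin u F" if "reach U Z C F" for F
  using that
 proof (induction rule: reach.induct)
  case start
  show ?case by (rule t(3))
 next
  case (step F F')
  have F: "F ~= 0" "fcert C u {0, F}" using reach_idx[OF step.hyps(1)] assms(1) by auto
  have F': "fcert C u {0, F'}" "fcert C u {F, F'}" using step.hyps(5)[OF assms(1)] by auto
  have "reach U Z C F'" by (rule reach.step[OF step.hyps])
  thus ?case
   using ridge_concurrent[OF r0 rF[OF step.hyps(1)] rF F(2) F'] F(1) step.hyps(3) assms(1,2) t(2) step.IH by auto
 qed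
 thus ?thesis using that t by blast
qed

lemma slot_line:
 assumes "u \<in> U" "e \<in> E" "u e = 0" "reach U Z C F" "reach U Z C F'" "F ~= F'" "m \<notin> {0, F, F'}"
  "fcert C u {F, F'}" "fcert C u {F, m}" "fcert C u {m, F'}" "ridge e u m" "t \<in> lin u F" "t \<in> lin u F'"
 shows "t \<in> lin u m"
proof -
 have rF: "ridge e u F" if "reach U Z C F" for F
  by (rule hub_ridge[OF assms(1-3), of _ "1/2"]) (use reach_idx[OF that] in auto)
 have "fcert C u {F', m}" using assms(10) by (simp add: insert_commute)
 thus ?thesis
  using ridge_concurrent[OF rF[OF assms(4)] rF[OF assms(5)] assms(11) assms(8,9)] assms(1,2,6,7,12,13) by auto
qed

lemma lin0_full: "u \<in> U ==> e \<in> E ==> u e = 0 ==> reach U Z C G ==> lin u 0 \<subseteq> full 0"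
 using lin_full[OF hub_ridge0[of u e]] reach_idx[of U Z C G] cert_single[of u "{0, G}" 0] by blast

text \<open>The fibre \<open>{0, e}\<close> is its own top edge for every \<open>u\<close> vanishing
  on \<open>e\<close>, so its line does not depend on \<open>u\<close>. It has a point off the span
  of the hub, hence meets that span only once, and the points obtained from different
  \<open>u\<close> agree up to a factor.\<close>

lemma direction_exists:
 assumes "slot_ok U Z C ({0, e}, [], [])" "e \<in> E"
 obtains x where "\<And>u. u \<in> U ==> u e = 0 ==> x ~= 0 & x \<in> lin u 0 & (\<forall>F. reach U Z C F --> x \<in> lin u F)"
proof -
 obtain F F' m c where s: "reach U Z C F" "reach U Z C F'" "F ~= F'" "m \<in> idx C" "m \<notin> {0, F, F'}" "c > 0"
   "fibre C m = scaled c {0, e}"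
   "\<forall>u\<in>U. fcert C u {F, F', m} & fcert C u {F, F'} & fcert C u {F, m} & fcert C u {m, F'}"
  using assms(1) unfolding slot_ok_def fst_conv snd_conv by blast
 have fs: "faceset C u {m} = {(m, 0), (m, c *R e)}" if "u \<in> U" "u e = 0" for u
 proof -
  have "u 0 = 0" by (rule linear_0[OF linU[OF that(1)]])
  hence "top_set u {0, e} = {0, e}" using that by (auto simp: top_set_def)
  thus ?thesis using faceset_scaled[OF s(7) linU[OF that(1)] s(6)] by simp
 qed
 have rm: "ridge e u m" if "u \<in> U" "u e = 0" for u
  unfolding ridge_def using fs[OF that] s(6)
  by - (rule exI[of _ 0], rule exI[of _ "c *R e"], rule exI[of _ "- c"], simp)
 have key: "\<exists>t. t ~= 0 & t \<in> lin u 0 & (\<forall>F. reach U Z C F --> t \<in> lin u F) & t \<in> full 0 & t \<in> span {r (m, 0), r (m, c *R e)}"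
  if u: "u \<in> U" "u e = 0" for u
 proof -
  obtain t where t: "t ~= 0" "t \<in> lin u 0" "\<And>F. reach U Z C F ==> t \<in> lin u F"
   using hub_line[OF u(1) assms(2) u(2) s(1)] by metis
  have "t \<in> lin u m"
   by (rule slot_line[OF u(1) assms(2) u(2) s(1-3,5) _ _ _ rm[OF u] t(3)[OF s(1)] t(3)[OF s(2)]]) (use s(8) u in auto)
  hence "t \<in> span {r (m, 0), r (m, c *R e)}" unfolding lin_def fs[OF u] by simp
  thus ?thesis using t lin0_full[OF u(1) assms(2) u(2) s(1)] by blast
 qed
 show ?thesis
 proof (cases "\<exists>u\<in>U. u e = 0")
  case False
  thus ?thesis using that[of 0] by blast
 next
  case True
  then obtain u0 where u0: "u0 \<in> U" "u0 e = 0" by blast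
  obtain x where x: "x ~= 0" "x \<in> full 0" "x \<in> span {r (m, 0), r (m, c *R e)}" using key[OF u0] by blast
  have "fcert C u0 {m}" using cert_single[of u0 "{F, m}" m] s(8) u0 by auto
  hence "(m, 0) \<in> Vt" using vert[OF linU[OF u0(1)] _ fs[OF u0]] by blast
  hence r0: "r (m, 0) \<notin> full 0" using s(5) by (intro full_off) (auto simp: hub)
  have sub: "subspace (full 0)" unfolding full_def by (rule subspace_span)
  have "x ~= 0 & x \<in> lin u 0 & (\<forall>F. reach U Z C F --> x \<in> lin u F)" if u: "u \<in> U" "u e = 0" for u
  proof -
   obtain t where t: "t ~= 0" "t \<in> lin u 0" "\<And>F. reach U Z C F ==> t \<in> lin u F" "t \<in> full 0" "t \<in> span {r (m, 0), r (m, c *R e)}"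
    using key[OF u] by blast
   have "x \<in> span {t}" by (rule line_meet[OF t(5) x(3) t(4) x(2) sub r0 t(1)])
   hence "x \<in> span S" if "t \<in> span S" for S using that span_minimal[of "{t}" "span S"] by auto
   thus ?thesis using x(1) t(2,3) unfolding lin_def by blast
  qed
  thus ?thesis by (rule that)
 qed
qed

end

locale incidence_directions = incidence U Z E C Vt r
 for U :: "('a::real_vector => real) set" and Z E C Vt and r :: "nat \<times> 'a => 'c::real_vector" +
 fixes X :: "'a => 'c"
 assumes X: "u \<in> U ==> e \<in> E ==> u e = 0 ==> X e ~= 0 & X e \<in> lin u 0 & (\<forall>F. reach U Z C F --> X e \<in> lin u F)"
begin

text \<open>The invariant carried along a chain; its last conjunct says that the realized copy of
  \<open>J\<close> points in the right directions along all its visible edges.\<close>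

definition node :: "nat => real => 'a set => nat => bool" where
 "node m c J g \<longleftrightarrow> m \<in> idx C & m ~= g & m ~= 0 & reach U Z C g & c > 0 & finite J & J ~= {} & fibre C m = scaled c J &
   (\<forall>u\<in>U. fcert C u {m, g}) & (\<forall>u e v w. vis U E J u e v w --> X e \<in> span {r (m, c *R v), r (m, c *R w)})"

lemma vis_faceset:
 assumes "vis U E J u e v w" "fibre C m = scaled c J" "c > 0" "finite J"
 shows "faceset C u {m} = {(m, c *R v), (m, c *R w)}" "ridge e u m" "lin u m = span {r (m, c *R v), r (m, c *R w)}"
proof -
 have u: "u \<in> U" and J: "J ~= {}" using assms(1) by (auto simp: vis_def top_set_def)
 show f: "faceset C u {m} = {(m, c *R v), (m, c *R w)}"
  using faceset_scaled[OF assms(2) linU[OF u] assms(3,4) J] assms(1) by (simp add: vis_def)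
 obtain k where k: "v - w = k *R e" using assms(1) by (auto simp: vis_def span_singleton)
 hence "k ~= 0" using assms(1) by (auto simp: vis_def)
 moreover have "c *R v - c *R w = (c * k) *R e" using k by (metis scaleR_diff_right scaleR_scaleR)
 ultimately show "ridge e u m" unfolding ridge_def using f assms(3)
  by - (rule exI[of _ "c *R v"], rule exI[of _ "c *R w"], rule exI[of _ "c * k"], simp)
 show "lin u m = span {r (m, c *R v), r (m, c *R w)}" unfolding lin_def f by simp
qed

lemma X_full0: "u \<in> U ==> e \<in> E ==> u e = 0 ==> reach U Z C g ==> X e \<in> full 0"
 using X lin0_full by blast

lemma X_full_reach:
 assumes "u \<in> U" "e \<in> E" "u e = 0" "reach U Z C g"
 shows "X e \<in> full g" "X e \<in> lin u g" "ridge e u g"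
proof -
 show r: "ridge e u g" by (rule hub_ridge[OF assms(1-3), of _ "1/2"]) (use reach_idx[OF assms(4)] in auto)
 show l: "X e \<in> lin u g" using X[OF assms(1-3)] assms(4) by blast
 have "fcert C u {g}" using cert_single[of u "{0, g}" g] reach_idx[OF assms(4)] assms(1) by blast
 thus "X e \<in> full g" using lin_full[OF r assms(1) _ assms(2)] l by blast
qed

end

context incidence_directions
begin

text \<open>For the node at \<open>m'\<close>: edges linking \<open>J'\<close> are shared by both
  fibres and retain their ideal points \<open>KX\<close>, so the new copy is spanned by one vertex
  and \<open>KX\<close>. The line of a new edge meets that of the hub copy \<open>g\<close> in a
  point \<open>y\<close>; dropping the vertex leaves \<open>y\<close> in the span of
  \<open>KX\<close>, hence in the span of the hub, where the line over \<open>g\<close> has only the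
  ideal point of \<open>e\<close>. For the transfer back to \<open>m\<close>: the auxiliary pair
  makes all lines joining corresponding vertices pass through one point \<open>ctr\<close>. A point
  of the span of \<open>KX\<close> lies in the spans of both fibres, so the perspectivity from
  \<open>ctr\<close> fixes it and maps a line through it to a line through it.\<close>

lemma chain_step:
 assumes node: "node m c J g" and ix: "{m', a, b} \<subseteq> idx C" "m' \<notin> {0, m, g}" "a \<notin> {m, m'}" "b \<notin> {m, m'}" "a ~= b"
  and fib: "fibre C m' = scaled (c / 2) J'" "fibre C a = {\<alpha>}" "fibre C b = {(6/7) *R \<alpha>}"
  and sh: "shadow C b = (6/7) *R shadow C a + (1/7) *R (2 *R shadow C m' - shadow C m)"
  and c1: "\<forall>u\<in>U. fcert C u {m, g, m'} & fcert C u {m, m'} & fcert C u {m', g}"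
  and c2: "\<forall>u\<in>U. height (fibre C) u m' = height (fibre C) u m / 2 --> fcert C u {m, m', a, b}"
  and J': "J' \<subseteq> J" "\<exists>v\<in>J'. \<exists>w\<in>J'. v ~= w" "\<forall>v\<in>J'. \<exists>u\<in>U. top_set u J = {v}" "linked U E J J'"
 shows "node m' (c / 2) J' g"
  and "\<And>v w x. v \<in> J' ==> w \<in> J' ==> x \<in> full 0 ==> x \<in> span {r (m', (c / 2) *R v), r (m', (c / 2) *R w)} ==>
   x \<in> span {r (m, c *R v), r (m, c *R w)}"
proof -
 have nd: "m \<in> idx C" "m ~= g" "m ~= 0" "reach U Z C g" "c > 0" "finite J" "J ~= {}" "fibre C m = scaled c J"
  "\<And>u. u \<in> U ==> fcert C u {m, g}"
  "\<And>u e v w. vis U E J u e v w ==> X e \<in> span {r (m, c *R v), r (m, c *R w)}"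
  using node by (auto simp: node_def)
 have fJ': "finite J'" "J' ~= {}" using J' nd(6) finite_subset by auto
 have c': "c / 2 > 0" using nd(5) by simp
 have cert: "fcert C u {m, m'}" "fcert C u {m', g}" "fcert C u {g, m'}" if "u \<in> U" for u
  using c1 that by (auto simp: insert_commute)
 define P where "P v = r (m, c *R v)" for v
 define P' where "P' v = r (m', (c / 2) *R v)" for v
 have sub0: "subspace (full i)" for i unfolding full_def by (rule subspace_span)
 \<comment> \<open>A functional exposing \<open>v\<close> in \<open>J\<close> exposes it in the
   subset \<open>J'\<close> as well, so corresponding vertices are seen by the same
   functional.\<close>
 have ex: "\<exists>u\<in>U. faceset C u {m} = {(m, c *R v)} & faceset C u {m'} = {(m', (c / 2) *R v)} & top_set u J = {v} & top_set u J' = {v}"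
  if v: "v \<in> J'" for v
 proof -
  obtain u where u: "u \<in> U" "top_set u J = {v}" using J'(3) v by blast
  have "top_set u J' = {v}" by (rule top_set_subset[OF u(2)]) (use v J' in auto)
  thus ?thesis
   using u faceset_scaled[OF nd(8) linU[OF u(1)] nd(5-7)] faceset_scaled[OF fib(1) linU[OF u(1)] c' fJ'] by (intro bexI[of _ u]) auto
 qed
 have vt: "(m, c *R v) \<in> Vt" "(m', (c / 2) *R v) \<in> Vt" if v: "v \<in> J'" for v
 proof -
  obtain u where u: "u \<in> U" "faceset C u {m} = {(m, c *R v), (m, c *R v)}" "faceset C u {m'} = {(m', (c / 2) *R v), (m', (c / 2) *R v)}"
   using ex[OF v] by auto
  have "fcert C u {m}" "fcert C u {m'}" using cert_single cert(1)[OF u(1)] by auto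
  thus "(m, c *R v) \<in> Vt" "(m', (c / 2) *R v) \<in> Vt" using vert[OF linU[OF u(1)]] u(2,3) by blast+
 qed
 have Pfull: "P v \<in> full m" "P' v \<in> full m'" if v: "v \<in> J'" for v
 proof -
  have "c *R v \<in> fibre C m" "(c / 2) *R v \<in> fibre C m'" using v J'(1) nd(8) fib(1) by auto
  thus "P v \<in> full m" "P' v \<in> full m'"
   unfolding P_def P'_def full_def using vt[OF v] by (auto intro!: span_base)
 qed
 have out: "P' v \<notin> full i" if "v \<in> J'" "i \<in> idx C" "i ~= m'" for v i
  unfolding P'_def by (rule full_off[OF that(2) vt(2)[OF that(1)]]) (use that in simp)
 have common: "X e \<in> span {P' v, P' w}" if vs: "vis U E J u e v w" "v \<in> J'" "w \<in> J'" for u e v w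
 proof -
  have vs': "vis U E J' u e v w" by (rule vis_subset[OF vs(1) J'(1) vs(2,3)])
  have u: "u \<in> U" "e \<in> E" "u e = 0" using vs(1) by (auto simp: vis_def)
  note f = vis_faceset[OF vs(1) nd(8,5,6)] and f' = vis_faceset[OF vs' fib(1) c' fJ'(1)]
  have "X e \<in> lin u m" using nd(10)[OF vs(1)] f(3) by simp
  hence "X e \<in> lin u m'"
   using ridge_concurrent[OF f(2) X_full_reach(3)[OF u nd(4)] f'(2) nd(9)[OF u(1)] cert(1,3)[OF u(1)]] ix(2) nd(2) u
    X_full_reach(2)[OF u nd(4)] by auto
  thus ?thesis using f'(3) by (simp add: P'_def)
 qed
 define KX where "KX = {X e | u e v w. vis U E J u e v w & v \<in> J' & w \<in> J'}"
 have KX0: "KX \<subseteq> full 0" "KX \<subseteq> full g"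
  unfolding KX_def vis_def using X_full0 X_full_reach(1) nd(4) by blast+
 have KXm: "KX \<subseteq> full m"
 proof
  fix x assume "x \<in> KX"
  then obtain u e v w where vw: "x = X e" "vis U E J u e v w" "v \<in> J'" "w \<in> J'" unfolding KX_def by blast
  have "{P v, P w} \<subseteq> full m" using Pfull(1) vw by simp
  hence "span {P v, P w} \<subseteq> full m" by (rule span_minimal[OF _ sub0])
  thus "x \<in> full m" using nd(10)[OF vw(2)] vw(1) by (auto simp: P_def)
 qed
 obtain v0 where v0: "v0 \<in> J'" using fJ' by blast
 have path: "(v0, v) \<in> {(v, w). v \<in> J' & w \<in> J' & (\<exists>u e. vis U E J u e v w)}\<^sup>*" if "v \<in> J'" for v
  using J'(4) v0 that unfolding linked_def by blast
 have span': "P' v \<in> span (insert (P' v0) KX)" if "v \<in> J'" for v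
  using path[OF that]
 proof (induction rule: rtrancl_induct)
  case base
  show ?case by (simp add: span_base)
 next
  case (step v w)
  then obtain u e where vw: "v \<in> J'" "w \<in> J'" "vis U E J u e v w" by blast
  have u: "u \<in> U" "e \<in> E" "u e = 0" using vw(3) by (auto simp: vis_def)
  have "X e \<notin> span {P' v}"
  proof
   assume "X e \<in> span {P' v}"
   hence "P' v \<in> span {X e}" using span_singleton_sym X[OF u] by blast
   moreover have "span {X e} \<subseteq> full 0" using X_full0[OF u nd(4)] sub0 by (simp add: span_minimal)
   ultimately show False using out[OF vw(1) hub(1)] ix(2) by auto
  qed
  moreover have "X e \<in> span {P' w, P' v}" using common[OF vw(3,1,2)] by (simp add: insert_commute)
  ultimately have "P' w \<in> span {X e, P' v}" by (metis in_span_insert)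
  moreover have "X e \<in> KX" using vw unfolding KX_def by blast
  hence "{X e, P' v} \<subseteq> span (insert (P' v0) KX)" using step.IH by (auto intro: span_base)
  hence "span {X e, P' v} \<subseteq> span (insert (P' v0) KX)" by (rule span_minimal[OF _ subspace_span])
  ultimately show ?case by blast
 qed
 have spans': "span {P' v, P' w} \<subseteq> span (insert (P' v0) KX)" if "v \<in> J'" "w \<in> J'" for v w
  using span'[OF that(1)] span'[OF that(2)] by (simp add: span_minimal)
 have g: "g \<in> idx C" "g ~= 0" using reach_idx[OF nd(4)] by auto
 show "node m' (c / 2) J' g"
  unfolding node_def
 proof (intro conjI allI impI ballI)
  fix u e v w assume vs: "vis U E J' u e v w"
  have u: "u \<in> U" "e \<in> E" "u e = 0" and vw: "v \<in> J'" "w \<in> J'" using vs by (auto simp: vis_def top_set_def)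
  note f' = vis_faceset[OF vs fib(1) c' fJ'(1)]
  obtain y where y: "y ~= 0" "y \<in> lin u m'" "y \<in> lin u g"
   by (rule ridge_meet[OF f'(2) X_full_reach(3)[OF u nd(4)] cert(2)[OF u(1)] u(1,2)])
  have cg: "fcert C u {g}" using cert_single[OF cert(2)[OF u(1)]] by blast
  have yg: "y \<in> full g" using lin_full[OF X_full_reach(3)[OF u nd(4)] u(1) cg u(2)] y(3) by blast
  have "y \<in> span {P' v, P' w}" using y(2) f'(3) by (simp add: P'_def)
  hence "y \<in> span (insert (P' v0) KX)" using spans'[OF vw] by blast
  \<comment> \<open>\<open>P' v0\<close> is off the span of \<open>g\<close>, which contains both
    \<open>y\<close> and \<open>KX\<close>; its coefficient in \<open>y\<close> therefore
    vanishes.\<close>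
  hence "y \<in> span KX" by (rule span_drop[OF _ KX0(2) sub0 yg out[OF v0 g(1)]]) (use ix(2) in auto)
  hence y0: "y \<in> full 0" using span_minimal[OF KX0(1) sub0] by blast
  obtain p q cc where pq: "faceset C u {g} = {(g, p), (g, q)}" "cc ~= 0" "p - q = cc *R e" "(g, p) \<in> Vt" "(g, q) \<in> Vt"
   "r (g, p) \<notin> span {r (g, q)}" "r (g, q) ~= 0" "lin u g = span {r (g, p), r (g, q)}"
   by (rule ridgeE[OF X_full_reach(3)[OF u nd(4)] u(1) cg u(2)])
  have "r (g, p) \<notin> full 0" by (rule full_off[OF hub(1) pq(4)]) (use g in simp)
  hence "X e \<in> span {y}"
   using line_meet[OF _ _ y0 X_full0[OF u nd(4)] sub0 _ y(1)] y(3) X_full_reach(2)[OF u nd(4)] unfolding pq(8) by blast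
  moreover have "span {y} \<subseteq> lin u m'" using y(2) unfolding lin_def by (simp add: span_minimal)
  ultimately show "X e \<in> span {r (m', (c / 2) *R v), r (m', (c / 2) *R w)}" using f'(3) by blast
 qed (use ix nd fJ' fib cert c' in auto)
 have zfc: "fcert C zf {i}" if "i \<in> idx C" for i using that wf by (simp add: wf_config_def)
 have lzf: "linear (zf :: 'a => real)" by (simp add: linear_iff)
 have ab: "(a, \<alpha>) \<in> Vt" "(b, (6/7) *R \<alpha>) \<in> Vt"
  using vert[OF lzf zfc[of a], of "(a, \<alpha>)" "(a, \<alpha>)"] vert[OF lzf zfc[of b], of "(b, (6/7) *R \<alpha>)" "(b, (6/7) *R \<alpha>)"]
   ix(1) fib(2,3) faceset_zf[of C a] faceset_zf[of C b] by auto
 have fab: "faceset C u {a} = {(a, \<alpha>)}" "faceset C u {b} = {(b, (6/7) *R \<alpha>)}" for u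
  using fib(2,3) by (auto simp: faceset_def height_def)
 define ra where "ra = r (a, \<alpha>)"
 define rb where "rb = r (b, (6/7) *R \<alpha>)"
 have rab: "ra \<notin> span {rb}" "rb ~= 0"
  using ind[OF ab] nz[OF ab(2)] ix(5) by (auto simp: ra_def rb_def)
 have PP: "P v \<notin> span {P' v}" "P' v ~= 0" if "v \<in> J'" for v
  using ind[OF vt[OF that]] nz[OF vt(2)[OF that]] ix(2) by (auto simp: P_def P'_def)
 \<comment> \<open>The same vertex \<open>v\<close> is on top in both fibres and the second is half
   the size of the first, so the heights have exactly the ratio under which the four fibres form a
   common face.\<close>
 have quadv: "rel4 (P v) (P' v) ra rb" if v: "v \<in> J'" for v
 proof -
  obtain u where u: "u \<in> U" "faceset C u {m} = {(m, c *R v)}" "faceset C u {m'} = {(m', (c / 2) *R v)}" "top_set u J = {v}" "top_set u J' = {v}"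
   using ex[OF v] by blast
  have "(m, c *R v) \<in> faceset C u {m}" "(m', (c / 2) *R v) \<in> faceset C u {m'}" using u(2,3) by auto
  hence "height (fibre C) u m = u (c *R v)" "height (fibre C) u m' = u ((c / 2) *R v)" by (auto simp: faceset_def)
  hence "height (fibre C) u m' = height (fibre C) u m / 2" using linU[OF u(1)] by (simp add: linear_scale)
  hence fc: "fcert C u {m, m', a, b}" using c2 u(1) by blast
  have fs: "faceset C u {m, m', a, b} = {(m, c *R v), (m', (c / 2) *R v), (a, \<alpha>), (b, (6/7) *R \<alpha>)}"
   using faceset_insert[of C u m "{m', a, b}"] faceset_insert[of C u m' "{a, b}"] faceset_insert[of C u a "{b}"] u(2,3) fab by auto
  \<comment> \<open>The relation between the shadows, moved to one side. On the fibre coordinate the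
    halving of \<open>v\<close> cancels 1/7 against 2/7, and the factor 6/7 in the fibre of
    \<open>b\<close> cancels that of \<open>a\<close>; the coefficients add up to 0.\<close>
  have "(1/7) *R hat (point C (m, c *R v)) + (- 2/7) *R hat (point C (m', (c / 2) *R v)) + (- 6/7) *R hat (point C (a, \<alpha>)) +
    1 *R hat (point C (b, (6/7) *R \<alpha>)) = 0"
   using sh by (simp add: hat_def point_def prod_eq_iff algebra_simps)
  hence "rel4 (hat (point C (m, c *R v))) (hat (point C (m', (c / 2) *R v))) (hat (point C (a, \<alpha>))) (hat (point C (b, (6/7) *R \<alpha>)))"
   unfolding rel4_def
   by - (rule exI[of _ "1/7"], rule exI[of _ "-2/7"], rule exI[of _ "-6/7"], rule exI[of _ 1], simp)
  moreover have "{(m, c *R v), (m', (c / 2) *R v), (a, \<alpha>), (b, (6/7) *R \<alpha>)} \<subseteq> Vt" using vt[OF v] ab by simp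
  ultimately show ?thesis unfolding P_def P'_def ra_def rb_def by (intro quad[OF linU[OF u(1)] fc fs])
 qed
 have offL: "P v \<notin> span {P w, P' w}" if vw: "v \<in> J'" "w \<in> J'" "v ~= w" for v w
 proof -
  obtain u where u: "u \<in> U" "faceset C u {m} = {(m, c *R w)}" "faceset C u {m'} = {(m', (c / 2) *R w)}"
   using ex[OF vw(2)] by blast
  have fs: "faceset C u {m, m'} = {(m, c *R w), (m', (c / 2) *R w)}"
   using faceset_insert[of C u m "{m'}"] u(2,3) by auto
  have "(m, c *R v) \<notin> faceset C u {m, m'}" unfolding fs using vw(3) nd(5) ix(2) by auto
  from off[OF linU[OF u(1)] cert(1)[OF u(1)] vt(1)[OF vw(1)] this]
  show ?thesis unfolding fs using vt[OF vw(2)] by (simp add: P_def P'_def)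
 qed
 obtain ctr where ctr: "ctr ~= 0" "ctr \<in> span {P v0, P' v0}" "ctr \<in> span {ra, rb}"
  using rel4_meet[OF quadv[OF v0] PP[OF v0] rab] by blast
 \<comment> \<open>Along a linking edge the two joining lines are coplanar, and both are coplanar
   with the line of the auxiliary pair. Since \<open>a\<close> is off the face over
   \<open>{m, m'}\<close>, the three are concurrent, and the common point is inherited from the
   previous vertex.\<close>
 have oL: "ctr \<in> span {P v, P' v}" if "v \<in> J'" for v
  using path[OF that]
 proof (induction rule: rtrancl_induct)
  case base
  show ?case by (rule ctr(2))
 next
  case (step v w)
  then obtain u e where vw: "v \<in> J'" "w \<in> J'" "vis U E J u e v w" by blast
  have u: "u \<in> U" "e \<in> E" "u e = 0" "v ~= w" using vw(3) by (auto simp: vis_def)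
  have vs': "vis U E J' u e v w" by (rule vis_subset[OF vw(3) J'(1) vw(1,2)])
  note f = vis_faceset[OF vw(3) nd(8,5,6)] and f' = vis_faceset[OF vs' fib(1) c' fJ'(1)]
  obtain k where k: "v - w = k *R e" using vw(3) by (auto simp: vis_def span_singleton)
  have k': "c *R v - c *R w = (c * k) *R e" "(c / 2) *R v - (c / 2) *R w = (c / 2 * k) *R e"
   using k by (metis scaleR_diff_right scaleR_scaleR)+
  have "k ~= 0" using k u(4) by auto
  hence ck: "c * k ~= 0" using nd(5) by simp
  have r1: "rel4 (P v) (P' v) (P w) (P' w)"
   unfolding P_def P'_def by (rule rel4_middle[OF ridge_rel4[OF cert(1)[OF u(1)] u(1) f(1) ck k'(1) f'(1) k'(2)]])
  have fs: "faceset C u {m, m'} = {(m, c *R v), (m', (c / 2) *R v), (m, c *R w), (m', (c / 2) *R w)}"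
   using faceset_insert[of C u m "{m'}"] f(1) f'(1) by auto
  have "(a, \<alpha>) \<notin> faceset C u {m, m'}" using ix(3) by (auto simp: faceset_def)
  from off[OF linU[OF u(1)] cert(1)[OF u(1)] ab(1) this]
  have o1: "ra \<notin> span {P v, P' v, P w, P' w}" unfolding fs using vt[OF vw(1)] vt[OF vw(2)] by (simp add: P_def P'_def ra_def)
  obtain t where t: "t \<in> span {P w, P' w}" "\<And>s. s \<in> span {P v, P' v} ==> s \<in> span {ra, rb} ==> s \<in> span {t}"
   using concurrent[OF r1 quadv[OF vw(1)] quadv[OF vw(2)] PP[OF vw(1)] PP[OF vw(2)] rab o1 offL[OF vw(1,2) u(4)]] by metis
  have "ctr \<in> span {t}" by (rule t(2)[OF step.IH ctr(3)])
  moreover have "span {t} \<subseteq> span {P w, P' w}" using t(1) by (simp add: span_minimal)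
  ultimately show ?case by blast
 qed
 have P'ctr: "P' v \<in> span {ctr, P v}" if v: "v \<in> J'" for v
 proof -
  obtain w where w: "w \<in> J'" "v ~= w" using J'(2) by metis
  have "ctr \<notin> span {P v}"
  proof
   assume "ctr \<in> span {P v}"
   hence "P v \<in> span {ctr}" using span_singleton_sym ctr(1) by blast
   moreover have "span {ctr} \<subseteq> span {P w, P' w}" using oL[OF w(1)] by (simp add: span_minimal)
   ultimately show False using offL[OF v w] by blast
  qed
  moreover have "ctr \<in> span {P' v, P v}" using oL[OF v] by (simp add: insert_commute)
  ultimately show ?thesis by (metis in_span_insert)
 qed
 \<comment> \<open>Otherwise the span of the fibre over \<open>m\<close> would contain
   \<open>ctr\<close> and \<open>P v0\<close>, and with them the foreign vertex
   \<open>P' v0\<close>.\<close>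
 have om: "ctr \<notin> full m"
 proof
  assume "ctr \<in> full m"
  hence "span {ctr, P v0} \<subseteq> full m" using Pfull(1)[OF v0] sub0 by (simp add: span_minimal)
  thus False using P'ctr[OF v0] out[OF v0 nd(1)] ix(2) by auto
 qed
 fix v w x assume vw: "v \<in> J'" "w \<in> J'" and x: "x \<in> full 0" "x \<in> span {r (m', (c / 2) *R v), r (m', (c / 2) *R w)}"
 have x': "x \<in> span {P' v, P' w}" using x(2) by (simp add: P'_def)
 have "x \<in> span KX"
  by (rule span_drop[OF _ KX0(1) sub0 x(1) out[OF v0 hub(1)]]) (use spans'[OF vw] x' ix(2) in auto)
 hence xm: "x \<in> full m" using span_minimal[OF KXm sub0] by blast
 have "span {ctr, P v} \<subseteq> span {ctr, P v, P w}" "span {ctr, P w} \<subseteq> span {ctr, P v, P w}" by (intro span_mono; auto)+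
 hence "{P' v, P' w} \<subseteq> span {ctr, P v, P w}" using P'ctr vw by auto
 hence "x \<in> span (insert ctr {P v, P w})" using x' span_minimal[OF _ subspace_span] by blast
 hence "x \<in> span {P v, P w}" by (rule span_drop[OF _ _ sub0 xm om]) (use Pfull(1) vw in auto)
 thus "x \<in> span {r (m, c *R v), r (m, c *R w)}" by (simp add: P_def)
qed

end

section \<open>Parallelograms and the ideal points of their diagonals\<close>

definition propto :: "'c::real_vector => 'c => bool" where
 "propto x y \<longleftrightarrow> (\<exists>c. c ~= 0 & x = c *R y)"

text \<open>The ideal points of the diagonals are harmonic conjugates with respect to those of the
  sides. The same \<open>\<alpha>\<close> and \<open>\<beta>\<close> in both clauses express this,
  while absorbing the arbitrary scales of \<open>X a\<close> and \<open>X b\<close>.\<close>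

definition par :: "('a::real_vector => 'c::real_vector) => 'a => 'a => bool" where
 "par X a b \<longleftrightarrow> X a \<notin> span {X b} & X b ~= 0 & (\<exists>\<alpha> \<beta>. \<alpha> ~= 0 & \<beta> ~= 0 &
   propto (X (a + b)) (\<alpha> *R X a + \<beta> *R X b) & propto (X (a - b)) (\<alpha> *R X a - \<beta> *R X b))"

lemma subspace_coeff_zero:
 assumes "subspace L" "k *R p + x \<in> L" "x \<in> L" "p \<notin> L"
 shows "k = 0"
proof (rule ccontr)
 assume "k ~= 0"
 have "k *R p + x - x \<in> L" by (rule subspace_diff[OF assms(1-3)])
 hence "k *R p \<in> L" by simp
 hence "(1 / k) *R (k *R p) \<in> L" by (rule subspace_scale[OF assms(1)])
 thus False using \<open>k ~= 0\<close> assms(4) by simp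
qed

lemma line_through:
 assumes "subspace L" "x \<in> L" "x ~= 0" "p \<notin> L" "q \<notin> L" "x \<in> span {p, q}"
 obtains s t where "s ~= 0" "q = s *R (p + t *R x)"
proof -
 obtain \<alpha> \<beta> where x: "x = \<alpha> *R p + \<beta> *R q" using assms(6) by (rule span_pairE)
 have "\<beta> ~= 0"
 proof
  assume "\<beta> = 0"
  hence "\<alpha> *R p + 0 \<in> L" using x assms(2) by simp
  hence "\<alpha> = 0" using subspace_coeff_zero[OF assms(1) _ subspace_0[OF assms(1)] assms(4)] by blast
  thus False using x \<open>\<beta> = 0\<close> assms(3) by simp
 qed
 have "\<alpha> ~= 0"
 proof
  assume "\<alpha> = 0"
  hence "\<beta> *R q + 0 \<in> L" using x assms(2) by simp
  hence "\<beta> = 0" using subspace_coeff_zero[OF assms(1) _ subspace_0[OF assms(1)] assms(5)] by blast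
  thus False using \<open>\<beta> ~= 0\<close> by simp
 qed
 have "(- \<alpha> / \<beta>) *R (p + (- 1 / \<alpha>) *R x) = (- \<alpha> / \<beta>) *R p + (1 / \<beta>) *R x"
  using \<open>\<alpha> ~= 0\<close> by (simp add: algebra_simps)
 also have "... = q" using \<open>\<beta> ~= 0\<close> by (simp add: x algebra_simps)
 finally have "q = (- \<alpha> / \<beta>) *R (p + (- 1 / \<alpha>) *R x)" ..
 moreover have "- \<alpha> / \<beta> ~= 0" using \<open>\<alpha> ~= 0\<close> \<open>\<beta> ~= 0\<close> by simp
 ultimately show ?thesis using that by blast
qed

lemma independent_pair_coeff:
 assumes "x \<notin> span {y}" "y ~= 0" "a *R x + b *R y = c *R x + d *R y"
 shows "a = c" "b = d"
proof -
 have e: "(a - c) *R x + (b - d) *R y = 0" using assms(3) by (simp add: algebra_simps)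
 hence "(a - c) *R x + (b - d) *R y \<in> span {y}" by (simp add: span_zero)
 hence "a - c = 0"
  by (rule subspace_coeff_zero[OF subspace_span _ _ assms(1)]) (simp add: span_scale span_base)
 thus "a = c" "b = d" using e assms(2) by auto
qed

text \<open>With \<open>L\<close> as the space at infinity, \<open>Ra\<close> and \<open>Rb\<close>
  are up to factors \<open>R0 + \<alpha> xa\<close> and \<open>R0 + \<beta> xb\<close>. The fourth
  vertex has two descriptions, from \<open>Ra\<close> and from \<open>Rb\<close>; comparing them
  makes it a multiple of \<open>R0 + \<alpha> xa + \<beta> xb\<close>. Intersecting the diagonals
  with \<open>L\<close> leaves the sum and the difference.\<close>

lemma parallelogram_relation:
 assumes L: "subspace L" and out: "R0 \<notin> L" "Ra \<notin> L" "Rb \<notin> L" "Rs \<notin> L"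
  and xL: "xa \<in> L" "xb \<in> L" "xs \<in> L" "xd \<in> L" and x0: "xa ~= 0" "xb ~= 0" "xs ~= 0" "xd ~= 0"
  and lines: "xa \<in> span {R0, Ra}" "xa \<in> span {Rb, Rs}" "xb \<in> span {R0, Rb}" "xb \<in> span {Ra, Rs}"
   "xs \<in> span {R0, Rs}" "xd \<in> span {Ra, Rb}"
  and off: "Rb \<notin> span {R0, Ra}" "Ra \<notin> span {R0}"
 shows "xa \<notin> span {xb} & xb ~= 0 & (\<exists>\<alpha> \<beta>. \<alpha> ~= 0 & \<beta> ~= 0 &
   propto xs (\<alpha> *R xa + \<beta> *R xb) & propto xd (\<alpha> *R xa - \<beta> *R xb))"
proof -
 obtain sa \<alpha> where a: "sa ~= 0" "Ra = sa *R (R0 + \<alpha> *R xa)" by (rule line_through[OF L xL(1) x0(1) out(1,2) lines(1)])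
 obtain sb \<beta> where b: "sb ~= 0" "Rb = sb *R (R0 + \<beta> *R xb)" by (rule line_through[OF L xL(2) x0(2) out(1,3) lines(3)])
 obtain k1 \<tau> where k1: "k1 ~= 0" "Rs = k1 *R (Ra + \<tau> *R xb)" by (rule line_through[OF L xL(2) x0(2) out(2,4) lines(4)])
 obtain k2 \<tau>' where k2: "k2 ~= 0" "Rs = k2 *R (Rb + \<tau>' *R xa)" by (rule line_through[OF L xL(1) x0(1) out(3,4) lines(2)])
 have \<alpha>: "\<alpha> ~= 0" using off(2) a by (auto simp: span_scale span_base)
 have \<beta>: "\<beta> ~= 0"
 proof
  assume "\<beta> = 0"
  hence "Rb = sb *R R0 + 0 *R Ra" using b by simp
  thus False using off(1) span_pairI[of sb R0 0 Ra] by simp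
 qed
 have indep: "xa \<notin> span {xb}"
 proof
  assume "xa \<in> span {xb}"
  then obtain k where k: "xb = k *R xa" using span_singleton_sym[OF _ x0(1)] by (auto simp: span_singleton)
  have "Rb = (sb - sb * \<beta> * k / \<alpha>) *R R0 + (sb * \<beta> * k / (sa * \<alpha>)) *R Ra"
   unfolding b(2) k a(2) using a(1) \<alpha> by (simp add: algebra_simps)
  thus False using off(1) span_pairI by metis
 qed
 have e1: "Rs = (k1 * sa) *R R0 + ((k1 * sa * \<alpha>) *R xa + (k1 * \<tau>) *R xb)"
  unfolding k1(2) a(2) by (simp add: algebra_simps)
 have e2: "Rs = (k2 * sb) *R R0 + ((k2 * \<tau>') *R xa + (k2 * sb * \<beta>) *R xb)"
  unfolding k2(2) b(2) by (simp add: algebra_simps)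
 have inL: "p *R xa + q *R xb \<in> L" for p q
  using L xL by (simp add: subspace_add subspace_scale)
 have "(k1 * sa - k2 * sb) *R R0 + ((k1 * sa * \<alpha> - k2 * \<tau>') *R xa + (k1 * \<tau> - k2 * sb * \<beta>) *R xb) = 0"
  using e1 e2 by (simp add: algebra_simps)
 hence "(k1 * sa - k2 * sb) *R R0 + ((k1 * sa * \<alpha> - k2 * \<tau>') *R xa + (k1 * \<tau> - k2 * sb * \<beta>) *R xb) \<in> L"
  using subspace_0[OF L] by simp
 hence "k1 * sa - k2 * sb = 0" by (rule subspace_coeff_zero[OF L _ inL out(1)])
 hence kk: "k2 * sb = k1 * sa" by simp
 hence "(k1 * sa * \<alpha>) *R xa + (k1 * \<tau>) *R xb = (k2 * \<tau>') *R xa + (k1 * sa * \<beta>) *R xb"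
  using e1 e2 by simp
 hence "k1 * \<tau> = k1 * sa * \<beta>" by (rule independent_pair_coeff(2)[OF indep x0(2)])
 hence Rs: "Rs = (k1 * sa) *R (R0 + (\<alpha> *R xa + \<beta> *R xb))"
  unfolding e1 by (simp add: scaleR_add_right)
 have "propto xs (\<alpha> *R xa + \<beta> *R xb)"
 proof -
  obtain p q where xs: "xs = p *R R0 + q *R Rs" using lines(5) by (rule span_pairE)
  define q' where "q' = q * (k1 * sa)"
  have xs: "xs = (p + q') *R R0 + q' *R (\<alpha> *R xa + \<beta> *R xb)"
   unfolding xs Rs q'_def by (simp add: algebra_simps)
  have "p + q' = 0"
   by (rule subspace_coeff_zero[OF L _ subspace_scale[OF L inL, of q' \<alpha> \<beta>] out(1)]) (use xs xL(3) in simp)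
  hence "xs = q' *R (\<alpha> *R xa + \<beta> *R xb)" using xs by simp
  moreover hence "q' ~= 0" using x0(3) by auto
  ultimately show ?thesis unfolding propto_def by blast
 qed
 moreover have "propto xd (\<alpha> *R xa - \<beta> *R xb)"
 proof -
  obtain p q where xd: "xd = p *R Ra + q *R Rb" using lines(6) by (rule span_pairE)
  define p' q' where "p' = p * sa" and "q' = q * sb"
  have xd: "xd = (p' + q') *R R0 + ((p' * \<alpha>) *R xa + (q' * \<beta>) *R xb)"
   unfolding xd a(2) b(2) p'_def q'_def by (simp add: algebra_simps)
  have "p' + q' = 0"
   by (rule subspace_coeff_zero[OF L _ inL[of "p' * \<alpha>" "q' * \<beta>"] out(1)]) (use xd xL(4) in simp)
  hence "q' = - p'" by simp
  hence "xd = p' *R (\<alpha> *R xa - \<beta> *R xb)" using xd by (simp add: algebra_simps)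
  moreover hence "p' ~= 0" using x0(4) by auto
  ultimately show ?thesis unfolding propto_def by blast
 qed
 ultimately show ?thesis using indep x0(2) \<alpha> \<beta> by blast
qed

text \<open>\<open>slot_ok\<close> with the index and the scale of the fibre made visible, for slots
  whose vertices are spoken of later.\<close>

definition slot_at :: "('a::real_vector => real) set => 'a set => 'a config => 'a gadget => nat => real => bool" where
 "slot_at U Z C g m c \<longleftrightarrow> (\<exists>F F'. reach U Z C F & reach U Z C F' & F ~= F' & m \<in> idx C & m \<notin> {0, F, F'} & c > 0 &
   fibre C m = scaled c (fst g) &
   (\<forall>u\<in>U. fcert C u {F, F', m} & fcert C u {F, F'} & fcert C u {F, m} & fcert C u {m, F'}) &
   chain_ok U C m F' c (fst (snd g)) & chain_ok U C m F c (snd (snd g)))"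

lemma slot_ok_at: "slot_ok U Z C g ==> \<exists>m c. slot_at U Z C g m c"
 unfolding slot_ok_def slot_at_def by blast

context incidence_directions
begin

text \<open>Every member of the chain is a node, so its visible edges have their ideal points in its
  own copy; the perspectivities of \<open>chain_step\<close> carry these lines back to the copy at
  the start.\<close>

lemma chain_lines:
 assumes "node m c J g" "chain_ok U C m g c Js" "chain_static U E J Js" "J' \<in> set Js" "vis U E J' u e v w"
 shows "X e \<in> span {r (m, c *R v), r (m, c *R w)}"
 using assms
proof (induction Js arbitrary: m c J)
 case Nil
 thus ?case by simp
next
 case (Cons K Js)
 obtain m' a b \<alpha> where d: "{m', a, b} \<subseteq> idx C" "m' \<notin> {0, m, g}" "a \<notin> {m, m'}" "b \<notin> {m, m'}" "a ~= b"
  "fibre C m' = scaled (c / 2) K" "fibre C a = {\<alpha>}" "fibre C b = {(6/7) *R \<alpha>}"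
  "shadow C b = (6/7) *R shadow C a + (1/7) *R (2 *R shadow C m' - shadow C m)"
  "\<forall>u\<in>U. fcert C u {m, g, m'} & fcert C u {m, m'} & fcert C u {m', g}"
  "\<forall>u\<in>U. height (fibre C) u m' = height (fibre C) u m / 2 --> fcert C u {m, m', a, b}"
  "chain_ok U C m' g (c / 2) Js"
  using Cons.prems(2) unfolding chain_ok.simps by blast
 have st: "K \<subseteq> J" "\<exists>v\<in>K. \<exists>w\<in>K. v ~= w" "\<forall>v\<in>K. \<exists>u\<in>U. top_set u J = {v}" "linked U E J K" "chain_static U E K Js"
  using Cons.prems(3) by auto
 note step = chain_step[OF Cons.prems(1) d(1-11) st(1-4)]
 have u: "u \<in> U" "e \<in> E" "u e = 0" and vw: "v \<in> J'" "w \<in> J'"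
  using Cons.prems(5) by (auto simp: vis_def top_set_def)
 have x0: "X e \<in> full 0" using X_full0[OF u, of g] Cons.prems(1) unfolding node_def by blast
 have sub: "J' \<subseteq> K" if "J' \<in> set Js"
  using st(5) that by (induction Js arbitrary: K) auto
 show ?case
 proof (cases "J' = K")
  case True
  have "X e \<in> span {r (m', (c / 2) *R v), r (m', (c / 2) *R w)}"
   using step(1) Cons.prems(5) unfolding node_def True by blast
  thus ?thesis using step(2)[OF _ _ x0] vw True by blast
 next
  case False
  hence J': "J' \<in> set Js" using Cons.prems(4) by simp
  have "X e \<in> span {r (m', (c / 2) *R v), r (m', (c / 2) *R w)}"
   by (rule Cons.IH[OF step(1) d(12) st(5) J' Cons.prems(5)])
  thus ?thesis using step(2)[OF _ _ x0] vw sub[OF J'] by blast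
 qed
qed

lemma slot_lines:
 assumes "slot_at U Z C (Q, Rs, Ls) m c" "finite Q" "Q ~= {}" "chain_static U E Q Rs" "chain_static U E Q Ls"
 obtains F where "m \<in> idx C" "m ~= 0" "c > 0" "fibre C m = scaled c Q" "reach U Z C F" "\<forall>u\<in>U. fcert C u {m}"
  "\<forall>J\<in>insert Q (set Rs \<union> set Ls). \<forall>u e v w. vis U E J u e v w --> X e \<in> span {r (m, c *R v), r (m, c *R w)}"
proof -
 obtain F F' where s: "reach U Z C F" "reach U Z C F'" "F ~= F'" "m \<in> idx C" "m \<notin> {0, F, F'}" "c > 0"
   "fibre C m = scaled c Q"
   "\<forall>u\<in>U. fcert C u {F, F', m} & fcert C u {F, F'} & fcert C u {F, m} & fcert C u {m, F'}"
   "chain_ok U C m F' c Rs" "chain_ok U C m F c Ls"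
  using assms(1) unfolding slot_at_def fst_conv snd_conv by blast
 have lines: "\<forall>u e v w. vis U E Q u e v w --> X e \<in> span {r (m, c *R v), r (m, c *R w)}"
 proof (intro allI impI)
  fix u e v w assume vs: "vis U E Q u e v w"
  have u: "u \<in> U" "e \<in> E" "u e = 0" using vs by (auto simp: vis_def)
  note f = vis_faceset[OF vs s(7,6) assms(2)]
  have "X e \<in> lin u m"
   by (rule slot_line[OF u s(1-3,5) _ _ _ f(2)]) (use s(8) u X[OF u] s(1,2) in auto)
  thus "X e \<in> span {r (m, c *R v), r (m, c *R w)}" using f(3) by simp
 qed
 have "node m c Q F'" "node m c Q F"
  unfolding node_def using s lines assms(2,3) by (auto simp: insert_commute)
 hence "\<forall>J\<in>set Rs \<union> set Ls. \<forall>u e v w. vis U E J u e v w --> X e \<in> span {r (m, c *R v), r (m, c *R w)}"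
  using chain_lines s(9,10) assms(4,5) by blast
 hence all: "\<forall>J\<in>insert Q (set Rs \<union> set Ls). \<forall>u e v w. vis U E J u e v w --> X e \<in> span {r (m, c *R v), r (m, c *R w)}"
  using lines by blast
 have "\<forall>u\<in>U. fcert C u {m}"
 proof
  fix u assume "u \<in> U"
  hence "fcert C u {F, m}" using s(8) by blast
  thus "fcert C u {m}" by (rule cert_single) simp
 qed
 thus ?thesis using that[OF s(4) _ s(6,7,1) _ all] s(5) by simp
qed

lemma slot_vertex:
 assumes "m \<in> idx C" "m ~= 0" "c > 0" "fibre C m = scaled c Q" "\<forall>u\<in>U. fcert C u {m}" "finite Q" "u \<in> U" "top_set u Q = {v}"
 shows "(m, c *R v) \<in> Vt" "r (m, c *R v) \<notin> full 0"
proof -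
 have "Q ~= {}" using assms(8) by (auto simp: top_set_def)
 hence "faceset C u {m} = {(m, c *R v), (m, c *R v)}"
  using faceset_scaled[OF assms(4) linU[OF assms(7)] assms(3,6)] assms(8) by simp
 thus v: "(m, c *R v) \<in> Vt" using vert[OF linU[OF assms(7)]] assms(5,7) by blast
 show "r (m, c *R v) \<notin> full 0" by (rule full_off[OF hub(1) v]) (use assms(2) in simp)
qed

lemma slot_off:
 assumes "m \<in> idx C" "m ~= 0" "c > 0" "fibre C m = scaled c Q" "\<forall>u\<in>U. fcert C u {m}" "finite Q"
  "\<forall>v\<in>Q. \<exists>u\<in>U. top_set u Q = {v}" "u \<in> U" "p \<in> Q" "p \<notin> top_set u Q"
 shows "r (m, c *R p) \<notin> span ((\<lambda>v. r (m, c *R v)) ` top_set u Q)"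
proof -
 have vt: "(m, c *R v) \<in> Vt" if "v \<in> Q" for v
  using slot_vertex(1)[OF assms(1-6)] assms(7) that by blast
 have "Q ~= {}" using assms(9) by blast
 hence f: "faceset C u {m} = (\<lambda>v. (m, c *R v)) ` top_set u Q"
  by (rule faceset_scaled[OF assms(4) linU[OF assms(8)] assms(3,6)])
 have "(m, c *R p) \<notin> faceset C u {m}" unfolding f using assms(3,10) by auto
 hence "r (m, c *R p) \<notin> span (r ` (faceset C u {m} \<inter> Vt))"
  using off[OF linU[OF assms(8)] _ vt[OF assms(9)]] assms(5,8) by blast
 moreover have "faceset C u {m} \<inter> Vt = (\<lambda>v. (m, c *R v)) ` top_set u Q"
  unfolding f using vt by (auto simp: top_set_def)
 ultimately show ?thesis by (simp add: image_image)
qed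

text \<open>A diagonal becomes an edge only in a triangle obtained by cutting off a vertex beside
  it. The two diagonals need different triangles, neither inside the other, hence the two chains of
  the gadget.\<close>

lemma parallelogram:
 assumes slot: "slot_ok U Z C ({0, a, a + b, b}, [{0, a, a + b}], [{a, a + b, b}])"
  and st: "chain_static U E {0, a, a + b, b} [{0, a, a + b}]" "chain_static U E {0, a, a + b, b} [{a, a + b, b}]"
  and ex: "\<forall>v\<in>{0, a, a + b, b}. \<exists>u\<in>U. top_set u {0, a, a + b, b} = {v}"
  and vs: "vis U E {0, a, a + b, b} u1 ea 0 a" "vis U E {0, a, a + b, b} u2 ea b (a + b)"
   "vis U E {0, a, a + b, b} u3 eb 0 b" "vis U E {0, a, a + b, b} u4 eb a (a + b)"
   "vis U E {0, a, a + b} u5 es 0 (a + b)" "vis U E {a, a + b, b} u6 ed a b"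
  and ab: "a ~= 0" "b ~= 0" "a ~= b" "a + b ~= 0"
 shows "X ea \<notin> span {X eb} & X eb ~= 0 & (\<exists>\<alpha> \<beta>. \<alpha> ~= 0 & \<beta> ~= 0 &
   propto (X es) (\<alpha> *R X ea + \<beta> *R X eb) & propto (X ed) (\<alpha> *R X ea - \<beta> *R X eb))"
proof -
 let ?Q = "{0, a, a + b, b}"
 have Q: "finite ?Q" "?Q ~= {}" by auto
 obtain m c where at: "slot_at U Z C (?Q, [{0, a, a + b}], [{a, a + b, b}]) m c" using slot_ok_at[OF slot] by blast
 obtain F where s: "m \<in> idx C" "m ~= 0" "c > 0" "fibre C m = scaled c ?Q" "reach U Z C F" "\<forall>u\<in>U. fcert C u {m}"
  "\<forall>J\<in>insert ?Q (set [{0, a, a + b}] \<union> set [{a, a + b, b}]). \<forall>u e v w. vis U E J u e v w --> X e \<in> span {r (m, c *R v), r (m, c *R w)}"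
  by (rule slot_lines[OF at Q st])
 have line: "X e \<in> span {r (m, c *R v), r (m, c *R w)}" if "vis U E J u e v w" "J = ?Q \<or> J = {0, a, a + b} \<or> J = {a, a + b, b}" for J u e v w
  using s(7) that by (metis insertI1 insertI2 UnI1 UnI2 list.set(2))
 have x: "X e ~= 0" "X e \<in> full 0" if "vis U E J u e v w" for J u e v w
  using that X[of u e] X_full0[of u e, OF _ _ _ s(5)] by (auto simp: vis_def)
 have out: "r (m, c *R v) \<notin> full 0" if v: "v \<in> ?Q" for v
 proof -
  obtain u where "u \<in> U" "top_set u ?Q = {v}" using bspec[OF ex v] by blast
  thus ?thesis by (rule slot_vertex(2)[OF s(1-4,6) Q(1)])
 qed
 have sub: "subspace (full 0)" unfolding full_def by (rule subspace_span)
 have u1: "u1 \<in> U" "top_set u1 ?Q = {0, a}" using vs(1) by (auto simp: vis_def)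
 have "b \<notin> top_set u1 ?Q" unfolding u1(2) using ab by auto
 hence o1: "r (m, c *R b) \<notin> span {r (m, c *R 0), r (m, c *R a)}"
  using slot_off[OF s(1-4,6) Q(1) ex u1(1), of b] unfolding u1(2) by simp
 obtain u0 where u0: "u0 \<in> U" "top_set u0 ?Q = {0}" using bspec[OF ex, of 0] by blast
 have "a \<notin> top_set u0 ?Q" unfolding u0(2) using ab by auto
 hence o2: "r (m, c *R a) \<notin> span {r (m, c *R 0)}"
  using slot_off[OF s(1-4,6) Q(1) ex u0(1), of a] unfolding u0(2) by simp
 have inQ: "0 \<in> ?Q" "a \<in> ?Q" "b \<in> ?Q" "a + b \<in> ?Q" by auto
 show ?thesis
  by (rule parallelogram_relation[OF sub out[OF inQ(1)] out[OF inQ(2)] out[OF inQ(3)] out[OF inQ(4)]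
    x(2)[OF vs(1)] x(2)[OF vs(3)] x(2)[OF vs(5)] x(2)[OF vs(6)] x(1)[OF vs(1)] x(1)[OF vs(3)] x(1)[OF vs(5)] x(1)[OF vs(6)]
    line[OF vs(1)] line[OF vs(2)] line[OF vs(3)] line[OF vs(4)] line[OF vs(5)] line[OF vs(6)] o1 o2]) auto
qed

end

section \<open>Algebraic numbers from midpoints and squares\<close>

text \<open>Only finitely many relations can be built into one polytope, so \<open>\<phi>\<close> is
  required to respect midpoints and squares for arguments from \<open>T\<close> only, rather than to
  be a ring homomorphism.\<close>

definition good :: "real set => (real => real) => bool" where
 "good T \<phi> \<longleftrightarrow> \<phi> 0 = 0 & \<phi> 1 = 1 & (\<forall>s\<in>T. \<forall>t\<in>T. \<phi> ((s + t) / 2) = (\<phi> s + \<phi> t) / 2) & (\<forall>t\<in>T. \<phi> (t\<^sup>2) = (\<phi> t)\<^sup>2)"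

text \<open>Records that finitely many relations suffice for a property of \<open>\<phi>\<close>,
  without saying which. Being closed under conjunction and consequence, it permits arguing as if
  \<open>\<phi>\<close> were a homomorphism.\<close>

definition forced :: "((real => real) => bool) => bool" where
 "forced \<psi> \<longleftrightarrow> (\<exists>T. finite T & (\<forall>\<phi>. good T \<phi> --> \<psi> \<phi>))"

lemma good_mono: "good T \<phi> ==> S \<subseteq> T ==> good S \<phi>"
 by (auto simp: good_def)

lemma forced_mono: "forced \<psi> ==> (\<And>\<phi>. \<psi> \<phi> ==> \<eta> \<phi>) ==> forced \<eta>"
 unfolding forced_def by blast

lemma forced_conj:
 assumes "forced \<psi>" "forced \<eta>"
 shows "forced (\<lambda>\<phi>. \<psi> \<phi> & \<eta> \<phi>)"
proof -
 obtain S T where "finite S" "\<And>\<phi>. good S \<phi> ==> \<psi> \<phi>" "finite T" "\<And>\<phi>. good T \<phi> ==> \<eta> \<phi>"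
  using assms unfolding forced_def by blast
 moreover have "good S \<phi>" "good T \<phi>" if "good (S \<union> T) \<phi>" for \<phi> using good_mono[OF that] by auto
 ultimately show ?thesis unfolding forced_def by (intro exI[of _ "S \<union> T"]) auto
qed

lemma forced_conj_mono: "forced \<psi> ==> forced \<eta> ==> (\<And>\<phi>. \<psi> \<phi> ==> \<eta> \<phi> ==> \<rho> \<phi>) ==> forced \<rho>"
 by (rule forced_mono[OF forced_conj[of \<psi> \<eta>]]) auto

lemma forced_base: "forced (\<lambda>\<phi>. \<phi> 0 = 0 & \<phi> 1 = 1)"
 unfolding forced_def good_def by (intro exI[of _ "{}"]) auto

lemma forced_half: "forced (\<lambda>\<phi>. \<phi> (x / 2) = \<phi> x / 2)"
 unfolding forced_def good_def by (intro exI[of _ "{0, x}"]) auto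

text \<open>\<open>x + y\<close> is the midpoint of \<open>2 x\<close> and \<open>2 y\<close>, and
  these are compared with \<open>x\<close> and \<open>y\<close> through their midpoints with
  0.\<close>

lemma forced_add: "forced (\<lambda>\<phi>. \<phi> (x + y) = \<phi> x + \<phi> y)"
proof -
 have "forced (\<lambda>\<phi>. \<phi> ((2 * x + 2 * y) / 2) = (\<phi> (2 * x) + \<phi> (2 * y)) / 2)"
  unfolding forced_def good_def by (intro exI[of _ "{2 * x, 2 * y}"]) blast
 moreover have "forced (\<lambda>\<phi>. \<phi> (2 * x / 2) = \<phi> (2 * x) / 2 & \<phi> (2 * y / 2) = \<phi> (2 * y) / 2)"
  by (rule forced_conj[OF forced_half forced_half])
 ultimately show ?thesis
  by (rule forced_conj_mono) (simp add: add_divide_distrib)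
qed

lemma forced_neg: "forced (\<lambda>\<phi>. \<phi> (- x) = - \<phi> x)"
 by (rule forced_conj_mono[OF forced_add[of x "- x"] forced_base]) simp

lemma forced_diff: "forced (\<lambda>\<phi>. \<phi> (x - y) = \<phi> x - \<phi> y)"
 by (rule forced_conj_mono[OF forced_add[of x "- y"] forced_neg[of y]]) simp

lemma forced_square: "forced (\<lambda>\<phi>. \<phi> (x\<^sup>2) = (\<phi> x)\<^sup>2)"
 unfolding forced_def good_def by (intro exI[of _ "{x}"]) blast

text \<open>Polarisation: the square of \<open>x + y\<close> determines \<open>x y\<close> from the
  squares of \<open>x\<close> and \<open>y\<close>.\<close>

lemma forced_mult: "forced (\<lambda>\<phi>. \<phi> (x * y) = \<phi> x * \<phi> y)"
proof -
 have a: "forced (\<lambda>\<phi>. \<phi> ((x + y)\<^sup>2) = (\<phi> x + \<phi> y)\<^sup>2)"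
  by (rule forced_conj_mono[OF forced_square[of "x + y"] forced_add[of x y]]) simp
 have b: "forced (\<lambda>\<phi>. \<phi> (x\<^sup>2 + y\<^sup>2) = (\<phi> x)\<^sup>2 + (\<phi> y)\<^sup>2)"
  by (rule forced_conj_mono[OF forced_add[of "x\<^sup>2" "y\<^sup>2"] forced_conj[OF forced_square[of x] forced_square[of y]]]) simp
 have e: "(x + y)\<^sup>2 = (x\<^sup>2 + y\<^sup>2) + (x * y + x * y)" by (simp add: power2_eq_square algebra_simps)
 have c: "forced (\<lambda>\<phi>. \<phi> ((x + y)\<^sup>2) = \<phi> (x\<^sup>2 + y\<^sup>2) + (\<phi> (x * y) + \<phi> (x * y)))"
  unfolding e by (rule forced_conj_mono[OF forced_add[of "x\<^sup>2 + y\<^sup>2" "x * y + x * y"] forced_add[of "x * y" "x * y"]]) simp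
 show ?thesis
  by (rule forced_conj_mono[OF forced_conj[OF a b] c]) (simp add: power2_eq_square algebra_simps)
qed

lemma forced_nat: "forced (\<lambda>\<phi>. \<phi> (of_nat n) = of_nat n)"
proof (induction n)
 case 0
 show ?case by (rule forced_mono[OF forced_base]) simp
next
 case (Suc n)
 show ?case
  by (rule forced_conj_mono[OF forced_conj[OF Suc forced_base] forced_add[of "of_nat n" 1]]) (simp add: add.commute)
qed

lemma forced_Ints:
 assumes "x \<in> \<int>"
 shows "forced (\<lambda>\<phi>. \<phi> x = x)"
proof -
 obtain z where z: "x = of_int z" using assms by (auto elim: Ints_cases)
 obtain n where "z = int n \<or> z = - int n" by (metis int_cases2)
 thus ?thesis
 proof
  assume "z = int n"
  thus ?thesis using z forced_nat[of n] by simp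
 next
  assume "z = - int n"
  hence x: "x = - of_nat n" using z by simp
  show ?thesis unfolding x by (rule forced_conj_mono[OF forced_nat[of n] forced_neg[of "of_nat n"]]) simp
 qed
qed

lemma forced_quotient:
 assumes "forced (\<lambda>\<phi>. \<phi> x = x)" "forced (\<lambda>\<phi>. \<phi> y = y)" "y ~= 0"
 shows "forced (\<lambda>\<phi>. \<phi> (x / y) = x / y)"
proof -
 have m: "forced (\<lambda>\<phi>. \<phi> x = \<phi> (x / y) * \<phi> y)"
  using forced_mult[of "x / y" y] assms(3) by simp
 show ?thesis
  by (rule forced_conj_mono[OF forced_conj[OF assms(1,2)] m]) (metis assms(3) nonzero_eq_divide_eq)
qed

lemma forced_Rats:
 assumes "x \<in> \<rat>"
 shows "forced (\<lambda>\<phi>. \<phi> x = x)"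
proof -
 obtain a b where "x = of_int a / of_int b" "b ~= 0" using assms by (metis Rats_cases' less_irrefl)
 thus ?thesis using forced_quotient[OF forced_Ints forced_Ints] by simp
qed

lemma forced_poly:
 fixes p :: "real poly"
 assumes "\<forall>i. coeff p i \<in> \<int>"
 shows "forced (\<lambda>\<phi>. \<phi> (poly p x) = poly p (\<phi> x))"
 using assms
proof (induction p)
 case 0
 show ?case by (rule forced_mono[OF forced_base]) simp
next
 case (pCons c p)
 have c: "c \<in> \<int>" using pCons.prems by (metis coeff_pCons_0)
 have "\<forall>i. coeff p i \<in> \<int>" using pCons.prems by (metis coeff_pCons_Suc)
 hence IH: "forced (\<lambda>\<phi>. \<phi> (poly p x) = poly p (\<phi> x))" by (rule pCons.IH)
 have m: "forced (\<lambda>\<phi>. \<phi> (x * poly p x) = \<phi> x * poly p (\<phi> x))"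
  by (rule forced_conj_mono[OF forced_mult[of x "poly p x"] IH]) simp
 have "forced (\<lambda>\<phi>. \<phi> (c + x * poly p x) = c + \<phi> x * poly p (\<phi> x))"
  by (rule forced_conj_mono[OF forced_conj[OF forced_add[of c "x * poly p x"] forced_Ints[OF c]] m]) simp
 thus ?case by simp
qed

text \<open>The difference \<open>y - x\<close> is a square, and \<open>\<phi>\<close> maps it to a
  square. The root need not be algebraic, as test points may be arbitrary reals.\<close>

lemma forced_le:
 assumes "x <= y"
 shows "forced (\<lambda>\<phi>. \<phi> x <= \<phi> y)"
proof -
 define s where "s = sqrt (y - x)"
 have s: "y = x + s\<^sup>2" using assms by (simp add: s_def)
 show ?thesis
  unfolding s by (rule forced_conj_mono[OF forced_add[of x "s\<^sup>2"] forced_square[of s]]) simp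
qed

text \<open>\<open>\<phi> x\<close> is a root of an integer polynomial of \<open>x\<close>. Rational
  numbers around \<open>x\<close> that exclude all other roots are fixed by \<open>\<phi>\<close>,
  and monotonicity keeps \<open>\<phi> x\<close> between them.\<close>

lemma forced_algebraic:
 fixes x :: real
 assumes "algebraic x"
 shows "forced (\<lambda>\<phi>. \<phi> x = x)"
proof -
 obtain p where p: "\<And>i. coeff p i \<in> \<int>" "p ~= 0" "poly p x = 0"
  using assms by (auto simp: algebraic_def)
 define R where "R = {y. poly p y = 0} - {x}"
 have fin: "finite R" unfolding R_def using poly_roots_finite[OF p(2)] by simp
 obtain d where d: "d > 0" "\<And>y. y \<in> R ==> \<bar>y - x\<bar> >= d"
 proof (cases "R = {}")
  case True
  thus ?thesis using that[of 1] by simp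
 next
  case False
  have "Min ((\<lambda>y. \<bar>y - x\<bar>) ` R) \<in> (\<lambda>y. \<bar>y - x\<bar>) ` R" using fin False by (intro Min_in) auto
  hence "Min ((\<lambda>y. \<bar>y - x\<bar>) ` R) > 0" by (auto simp: R_def)
  thus ?thesis using that[of "Min ((\<lambda>y. \<bar>y - x\<bar>) ` R)"] fin by simp
 qed
 obtain q where q: "q \<in> \<rat>" "x - d < q" "q < x" using Rats_dense_in_real[of "x - d" x] d(1) by auto
 obtain q' where q': "q' \<in> \<rat>" "x < q'" "q' < x + d" using Rats_dense_in_real[of x "x + d"] d(1) by auto
 have a: "forced (\<lambda>\<phi>. q <= \<phi> x)"
  by (rule forced_conj_mono[OF forced_Rats[OF q(1)] forced_le[of q x]]) (use q in auto)
 have b: "forced (\<lambda>\<phi>. \<phi> x <= q')"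
  by (rule forced_conj_mono[OF forced_Rats[OF q'(1)] forced_le[of x q']]) (use q' in auto)
 have pI: "\<forall>i. coeff p i \<in> \<int>" using p(1) by blast
 have c: "forced (\<lambda>\<phi>. poly p (\<phi> x) = 0)"
  by (rule forced_conj_mono[OF forced_poly[OF pI, of x] forced_base]) (use p(3) in auto)
 show ?thesis
 proof (rule forced_conj_mono[OF forced_conj[OF a b] c])
  fix \<phi> :: "real => real" assume h: "q <= \<phi> x & \<phi> x <= q'" "poly p (\<phi> x) = 0"
  show "\<phi> x = x"
  proof (rule ccontr)
   assume "\<phi> x ~= x"
   hence "\<bar>\<phi> x - x\<bar> >= d" using d(2) h(2) by (auto simp: R_def)
   thus False using h(1) q q' by (auto simp: abs_if split: if_splits)
  qed
 qed
qed

section \<open>Maps of directions that respect parallelograms\<close>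

lemma propto_refl [simp]: "propto x x"
 unfolding propto_def by (rule exI[of _ 1]) simp

lemma propto_scale: "c ~= 0 ==> propto x y ==> propto x (c *R y)"
proof -
 assume "c ~= 0" "propto x y"
 then obtain d where "d ~= 0" "x = d *R y" by (auto simp: propto_def)
 hence "d / c ~= 0 & x = (d / c) *R (c *R y)" using \<open>c ~= 0\<close> by simp
 thus ?thesis unfolding propto_def by blast
qed

lemma propto_unscale: "c ~= 0 ==> propto x (c *R y) ==> propto x y"
 using propto_scale[of "1 / c" x "c *R y"] by simp

definition nondeg :: "'a::real_vector => 'a => bool" where
 "nondeg a b \<longleftrightarrow> a \<notin> span {b} & b ~= 0"

lemma nondeg_coeff:
 assumes "nondeg x y" "a *R x + b *R y = c *R x + d *R y"
 shows "a = c" "b = d"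
 using independent_pair_coeff[of x y a b c d] assms by (auto simp: nondeg_def)

lemma nondeg_comb:
 assumes "nondeg v w" "a * d - b * c ~= (0::real)"
 shows "nondeg (a *R v + b *R w) (c *R v + d *R w)"
 unfolding nondeg_def
proof
 show "a *R v + b *R w \<notin> span {c *R v + d *R w}"
 proof
  assume "a *R v + b *R w \<in> span {c *R v + d *R w}"
  then obtain k where "a *R v + b *R w = k *R (c *R v + d *R w)" by (auto simp: span_singleton)
  hence "a *R v + b *R w = (k * c) *R v + (k * d) *R w" by (simp add: algebra_simps)
  hence "a = k * c" "b = k * d" using nondeg_coeff[OF assms(1)] by blast+
  thus False using assms(2) by simp
 qed
 show "c *R v + d *R w ~= 0"
 proof
  assume "c *R v + d *R w = 0"
  hence "c *R v + d *R w = 0 *R v + 0 *R w" by simp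
  hence "c = 0" "d = 0" using nondeg_coeff[OF assms(1)] by blast+
  thus False using assms(2) by simp
 qed
qed

lemma nondeg_propto:
 assumes "nondeg x y" "propto x x'" "propto y y'"
 shows "nondeg x' y'"
proof -
 obtain p q where p: "p ~= 0" "x = p *R x'" "q ~= 0" "y = q *R y'" using assms(2,3) by (auto simp: propto_def)
 have "nondeg ((1/p) *R x + 0 *R y) (0 *R x + (1/q) *R y)"
  by (rule nondeg_comb[OF assms(1)]) (use p in simp)
 thus ?thesis using p by simp
qed

lemma par_nondeg: "par X a b ==> nondeg (X a) (X b)"
 by (simp add: par_def nondeg_def)

lemma parE:
 assumes "par X a b" "propto (X a) x" "propto (X b) y"
 obtains \<alpha> \<beta> where "\<alpha> ~= 0" "\<beta> ~= 0" "propto (X (a + b)) (\<alpha> *R x + \<beta> *R y)" "propto (X (a - b)) (\<alpha> *R x - \<beta> *R y)"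
proof -
 obtain \<alpha> \<beta> where "\<alpha> ~= 0" "\<beta> ~= 0" "propto (X (a + b)) (\<alpha> *R X a + \<beta> *R X b)" "propto (X (a - b)) (\<alpha> *R X a - \<beta> *R X b)"
  using assms(1) unfolding par_def by blast
 moreover obtain p q where "p ~= 0" "X a = p *R x" "q ~= 0" "X b = q *R y" using assms(2,3) by (auto simp: propto_def)
 ultimately show ?thesis using that[of "\<alpha> * p" "\<beta> * q"] by simp
qed

text \<open>The pairs \<open>(v, t w)\<close> define \<open>\<phi> t\<close> and show that
  \<open>- t\<close> goes to its negative. For \<open>(v + s w, v + t w)\<close> the difference is a
  multiple of \<open>w\<close>, which equates the two coefficients, so the sum yields the midpoint.
  The third family has sum \<open>2 t (v + w)\<close> and difference \<open>2 (v + t^2 w)\<close>: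
  the known image of \<open>v + w\<close> fixes the ratio of the coefficients, and the difference
  yields the square. The excluded values of \<open>t\<close> would make these pairs
  degenerate.\<close>

definition plane_pairs :: "real set => 'a::real_vector => 'a => ('a \<times> 'a) set" where
 "plane_pairs T v w = (\<lambda>t. (v, t *R w)) ` (T - {0}) \<union> (\<lambda>(s, t). (v + s *R w, v + t *R w)) ` {(s, t) \<in> T \<times> T. s ~= t} \<union>
   (\<lambda>t. ((t + 1) *R (v + t *R w), (t - 1) *R (v - t *R w))) ` (T - {0, 1, -1})"

lemma finite_plane_pairs: "finite T ==> finite (plane_pairs T v w)"
 unfolding plane_pairs_def
 by (intro finite_UnI finite_imageI finite_Diff) (auto intro: finite_subset[of _ "T \<times> T"])

lemma plane_pairs_nondeg:
 assumes "nondeg v w" "(a, b) \<in> plane_pairs T v w"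
 shows "nondeg a b" "a \<in> span {v, w}" "b \<in> span {v, w}"
proof -
 have "\<exists>p q r s. a = p *R v + q *R w & b = r *R v + s *R w & p * s - q * r ~= 0"
  using assms(2) unfolding plane_pairs_def
 proof (elim UnE imageE)
  fix t assume "(a, b) = (v, t *R w)" "t \<in> T - {0}"
  thus ?thesis
   by - (rule exI[of _ 1], rule exI[of _ 0], rule exI[of _ 0], rule exI[of _ t], simp)
 next
  fix x assume "(a, b) = (case x of (s, t) => (v + s *R w, v + t *R w))" "x \<in> {(s, t) \<in> T \<times> T. s ~= t}"
  then obtain s t where "a = v + s *R w" "b = v + t *R w" "s ~= t" by auto
  thus ?thesis
   by - (rule exI[of _ 1], rule exI[of _ s], rule exI[of _ 1], rule exI[of _ t], simp)
 next
  fix t assume t: "(a, b) = ((t + 1) *R (v + t *R w), (t - 1) *R (v - t *R w))" "t \<in> T - {0, 1, -1}"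
  have "(t + 1) * (- (t - 1) * t) - (t + 1) * t * (t - 1) = - 2 * t * (t + 1) * (t - 1)" by (simp add: algebra_simps)
  moreover have "... ~= 0" using t(2) by auto
  ultimately have "(t + 1) * (- (t - 1) * t) - (t + 1) * t * (t - 1) ~= 0" by simp
  moreover have "a = (t + 1) *R v + ((t + 1) * t) *R w" "b = (t - 1) *R v + (- (t - 1) * t) *R w"
   using t(1) by (auto simp: algebra_simps)
  ultimately show ?thesis by blast
 qed
 then obtain p q r s where pq: "a = p *R v + q *R w" "b = r *R v + s *R w" "p * s - q * r ~= 0" by blast
 show "nondeg a b" unfolding pq(1,2) by (rule nondeg_comb[OF assms(1) pq(3)])
 show "a \<in> span {v, w}" "b \<in> span {v, w}" unfolding pq(1,2) by (rule span_pairI)+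
qed

lemma comb_sum: "p *R (v + t *R w) + q *R (v - t *R w) = (p + q) *R v + ((p - q) * t) *R w"
 and comb_diff: "p *R (v + t *R w) - q *R (v - t *R w) = (p - q) *R v + ((p + q) * t) *R w"
 for v w :: "'a::real_vector"
 by (simp_all add: algebra_simps)

text \<open>\<open>\<phi> t\<close> is the coordinate of the image of \<open>v + t w\<close> on the
  projective line through \<open>yv\<close> and \<open>yw\<close>; the condition on
  \<open>v + w\<close> chooses the unit, so that \<open>\<phi> 1 = 1\<close>.\<close>

lemma plane_good:
 fixes X :: "'a::real_vector => 'c::real_vector"
 assumes sc: "\<And>c v. c ~= 0 ==> X (c *R v) = X v"
  and pp: "\<And>a b. (a, b) \<in> plane_pairs T v w ==> par X a b" "par X v w"
  and y: "propto (X v) yv" "propto (X w) yw" "propto (X (v + w)) (yv + yw)"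
 shows "\<exists>\<phi>. good T \<phi> & (\<forall>t\<in>T. propto (X (v + t *R w)) (yv + \<phi> t *R yw))"
proof -
 define R where "R t s \<longleftrightarrow> propto (X (v + t *R w)) (yv + s *R yw)" for t s
 have nd: "nondeg yv yw" by (rule nondeg_propto[OF par_nondeg[OF pp(2)] y(1,2)])
 have comb: "R t (q / p)" if "propto (X (v + t *R w)) (p *R yv + q *R yw)" "p ~= 0" for t p q
 proof -
  have "p *R yv + q *R yw = p *R (yv + (q / p) *R yw)" using that(2) by (simp add: scaleR_add_right)
  thus ?thesis unfolding R_def using propto_unscale that by metis
 qed
 have uniq: "s = s'" if st: "R t s" "R t s'" for t s s'
 proof -
  obtain p q where p: "p ~= 0" "X (v + t *R w) = p *R (yv + s *R yw)" "X (v + t *R w) = q *R (yv + s' *R yw)"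
   using st unfolding R_def propto_def by blast
  hence "p *R yv + (p * s) *R yw = q *R yv + (q * s') *R yw" by (simp add: scaleR_add_right)
  hence "p = q" "p * s = q * s'" using nondeg_coeff[OF nd] by blast+
  thus ?thesis using p(1) by simp
 qed
 have R0: "R 0 0" unfolding R_def using y(1) by simp
 have R1: "R 1 1" unfolding R_def using y(3) by simp
 have ex: "\<exists>s. R t s & R (- t) (- s)" if t: "t \<in> T" for t
 proof (cases "t = 0")
  case True
  thus ?thesis using R0 by (intro exI[of _ 0]) simp
 next
  case False
  have "(v, t *R w) \<in> plane_pairs T v w" using t False by (auto simp: plane_pairs_def)
  hence "par X v (t *R w)" by (rule pp(1))
  moreover have "propto (X (t *R w)) yw" using sc[OF False, of w] y(2) by simp
  ultimately obtain \<alpha> \<beta> where ab: "\<alpha> ~= 0" "propto (X (v + t *R w)) (\<alpha> *R yv + \<beta> *R yw)"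
   "propto (X (v - t *R w)) (\<alpha> *R yv - \<beta> *R yw)"
   using parE[of X v "t *R w" yv yw] y(1) by metis
  have "R (- t) (- \<beta> / \<alpha>)" by (rule comb[OF _ ab(1)]) (use ab(3) in simp)
  thus ?thesis using comb[OF ab(2,1)] by auto
 qed
 define \<phi> where "\<phi> t = (SOME s. R t s)" for t
 have \<phi>: "\<phi> t = s" if "R t s" for t s
  unfolding \<phi>_def using uniq that by (metis someI)
 have R\<phi>: "R t (\<phi> t)" "R (- t) (- \<phi> t)" if "t \<in> T" for t
  using ex[OF that] \<phi> by auto
 have mid: "R ((s + t) / 2) ((\<phi> s + \<phi> t) / 2)" if st: "s \<in> T" "t \<in> T" for s t
 proof (cases "s = t")
  case True
  thus ?thesis using R\<phi>(1)[OF st(1)] by simp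
 next
  case False
  have "(v + s *R w, v + t *R w) \<in> plane_pairs T v w" using st False by (auto simp: plane_pairs_def)
  then obtain \<alpha> \<beta> where ab: "\<alpha> ~= 0" "\<beta> ~= 0"
   "propto (X ((v + s *R w) + (v + t *R w))) (\<alpha> *R (yv + \<phi> s *R yw) + \<beta> *R (yv + \<phi> t *R yw))"
   "propto (X ((v + s *R w) - (v + t *R w))) (\<alpha> *R (yv + \<phi> s *R yw) - \<beta> *R (yv + \<phi> t *R yw))"
   using parE[OF pp(1)] R\<phi>(1)[OF st(1)] R\<phi>(1)[OF st(2)] unfolding R_def by metis
  have "(v + s *R w) - (v + t *R w) = (s - t) *R w" by (simp add: algebra_simps)
  hence "X ((v + s *R w) - (v + t *R w)) = X w" using sc[of "s - t" w] False by simp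
  hence "propto (X w) (\<alpha> *R (yv + \<phi> s *R yw) - \<beta> *R (yv + \<phi> t *R yw))" using ab(4) by simp
  then obtain k l where k: "k ~= 0" "X w = k *R yw" "l ~= 0" "X w = l *R (\<alpha> *R (yv + \<phi> s *R yw) - \<beta> *R (yv + \<phi> t *R yw))"
   using y(2) unfolding propto_def by blast
  hence "0 *R yv + k *R yw = (l * (\<alpha> - \<beta>)) *R yv + (l * (\<alpha> * \<phi> s - \<beta> * \<phi> t)) *R yw"
   by (simp add: algebra_simps)
  hence "0 = l * (\<alpha> - \<beta>)" using nondeg_coeff[OF nd] by blast
  \<comment> \<open>The difference is proportional to \<open>w\<close>, so its component along
    \<open>yv\<close> vanishes.\<close>
  hence ba: "\<beta> = \<alpha>" using k(3) by simp
  have "\<alpha> *R (yv + \<phi> s *R yw) + \<beta> *R (yv + \<phi> t *R yw) = (\<alpha> + \<beta>) *R yv + (\<alpha> * \<phi> s + \<beta> * \<phi> t) *R yw"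
   by (simp add: algebra_simps)
  also have "... = (2 * \<alpha>) *R (yv + ((\<phi> s + \<phi> t) / 2) *R yw)"
   unfolding ba by (simp add: scaleR_add_right distrib_left)
  finally have e: "\<alpha> *R (yv + \<phi> s *R yw) + \<beta> *R (yv + \<phi> t *R yw) = (2 * \<alpha>) *R (yv + ((\<phi> s + \<phi> t) / 2) *R yw)" .
  have "(v + s *R w) + (v + t *R w) = 2 *R v + (s + t) *R w" by (simp add: scaleR_2 scaleR_add_left)
  also have "... = 2 *R (v + ((s + t) / 2) *R w)" by (simp add: scaleR_add_right)
  finally have "(v + s *R w) + (v + t *R w) = 2 *R (v + ((s + t) / 2) *R w)" .
  hence "X ((v + s *R w) + (v + t *R w)) = X (v + ((s + t) / 2) *R w)" using sc[of 2] by simp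
  hence "propto (X (v + ((s + t) / 2) *R w)) ((2 * \<alpha>) *R (yv + ((\<phi> s + \<phi> t) / 2) *R yw))"
   using ab(3) e by simp
  thus ?thesis unfolding R_def by (rule propto_unscale[rotated]) (use ab(1) in simp)
 qed
 have sqr: "R (t\<^sup>2) ((\<phi> t)\<^sup>2)" if t: "t \<in> T" for t
 proof (cases "t \<in> {0, 1, -1}")
  case True
  have "R (-1) (-1)" if "-1 \<in> T"
  proof -
   have "R 1 (- \<phi> (-1))" using R\<phi>(2)[OF that] by simp
   hence "- \<phi> (-1) = 1" using uniq R1 by blast
   thus ?thesis using R\<phi>(1)[OF that] by simp
  qed
  hence "\<phi> t = t" using True t \<phi> R0 R1 by auto
  thus ?thesis using True R0 R1 by auto
 next
  case False
  have t3: "t + 1 ~= 0" "t - 1 ~= 0" "2 * t ~= 0" using False by auto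
  have "((t + 1) *R (v + t *R w), (t - 1) *R (v - t *R w)) \<in> plane_pairs T v w"
   using t False by (auto simp: plane_pairs_def)
  moreover have "propto (X ((t + 1) *R (v + t *R w))) (yv + \<phi> t *R yw)"
   using sc[OF t3(1)] R\<phi>(1)[OF t] by (simp add: R_def)
  moreover have "propto (X ((t - 1) *R (v - t *R w))) (yv - \<phi> t *R yw)"
   using sc[OF t3(2)] R\<phi>(2)[OF t] by (simp add: R_def)
  ultimately obtain \<alpha> \<beta> where ab: "\<alpha> ~= 0" "\<beta> ~= 0"
   "propto (X ((t + 1) *R (v + t *R w) + (t - 1) *R (v - t *R w))) (\<alpha> *R (yv + \<phi> t *R yw) + \<beta> *R (yv - \<phi> t *R yw))"
   "propto (X ((t + 1) *R (v + t *R w) - (t - 1) *R (v - t *R w))) (\<alpha> *R (yv + \<phi> t *R yw) - \<beta> *R (yv - \<phi> t *R yw))"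
   using parE[OF pp(1)] by metis
  have n: "(t + 1) + (t - 1) = 2 * t" "((t + 1) - (t - 1)) * t = 2 * t" "(t + 1) - (t - 1) = 2" "((t + 1) + (t - 1)) * t = 2 * t\<^sup>2"
   by (simp_all add: power2_eq_square)
  have e1: "(t + 1) *R (v + t *R w) + (t - 1) *R (v - t *R w) = (2 * t) *R (v + w)"
   unfolding comb_sum n by (simp add: scaleR_add_right)
  have e2: "(t + 1) *R (v + t *R w) - (t - 1) *R (v - t *R w) = 2 *R (v + t\<^sup>2 *R w)"
   unfolding comb_diff n by (simp add: scaleR_add_right power2_eq_square)
  have "propto (X (v + w)) (\<alpha> *R (yv + \<phi> t *R yw) + \<beta> *R (yv - \<phi> t *R yw))"
   using ab(3) sc[OF t3(3)] unfolding e1 by simp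
  then obtain k l where k: "k ~= 0" "X (v + w) = k *R (yv + yw)" "l ~= 0"
   "X (v + w) = l *R (\<alpha> *R (yv + \<phi> t *R yw) + \<beta> *R (yv - \<phi> t *R yw))"
   using y(3) unfolding propto_def by blast
  have "k *R yv + k *R yw = (l * (\<alpha> + \<beta>)) *R yv + (l * (\<phi> t * (\<alpha> - \<beta>))) *R yw"
   using k(2,4) by (simp add: algebra_simps)
  hence kk: "k = l * (\<alpha> + \<beta>)" "k = l * (\<phi> t * (\<alpha> - \<beta>))" using nondeg_coeff[OF nd] by blast+
  \<comment> \<open>From the sum, a multiple of \<open>v + w\<close>, whose components along
    \<open>yv\<close> and \<open>yw\<close> are equal. Inserted into the difference, it turns
    \<open>\<phi> t (\<alpha> + \<beta>)\<close> into
    \<open>(\<phi> t)^2 (\<alpha> - \<beta>)\<close>.\<close>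
  have eq: "\<alpha> + \<beta> = \<phi> t * (\<alpha> - \<beta>)" using kk k(3) by simp
  have ne: "\<alpha> - \<beta> ~= 0" using kk(2) k(1) by auto
  have "\<alpha> *R (yv + \<phi> t *R yw) - \<beta> *R (yv - \<phi> t *R yw) = (\<alpha> - \<beta>) *R yv + (\<phi> t * (\<alpha> + \<beta>)) *R yw"
   by (simp add: algebra_simps)
  also have "... = (\<alpha> - \<beta>) *R (yv + (\<phi> t)\<^sup>2 *R yw)"
   unfolding eq by (simp add: algebra_simps power2_eq_square)
  finally have "propto (X (v + t\<^sup>2 *R w)) ((\<alpha> - \<beta>) *R (yv + (\<phi> t)\<^sup>2 *R yw))"
   using ab(4) sc[of 2] unfolding e2 by simp
  thus ?thesis unfolding R_def by (rule propto_unscale[OF ne])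
 qed
 have "good T \<phi>"
  unfolding good_def using \<phi>[OF R0] \<phi>[OF R1] \<phi>[OF mid] \<phi>[OF sqr] by blast
 thus ?thesis using R\<phi>(1) unfolding R_def by blast
qed

text \<open>\<open>PL\<close> depends on \<open>v\<close>, \<open>w\<close> and \<open>t\<close> but
  not on \<open>X\<close>: the parallelograms must be built into the polytope before any realization
  is given.\<close>

lemma plane_forced:
 fixes v w :: "'a::real_vector"
 assumes "nondeg v w" "forced (\<lambda>\<phi>. \<phi> t = t)"
 obtains PL where "finite PL" "\<And>a b. (a, b) \<in> PL ==> nondeg a b & a \<in> span {v, w} & b \<in> span {v, w}"
  "\<And>(X :: 'a => 'c::real_vector) yv yw. (\<And>c v. c ~= 0 ==> X (c *R v) = X v) ==> (\<And>a b. (a, b) \<in> PL ==> par X a b) ==>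
   propto (X v) yv ==> propto (X w) yw ==> propto (X (v + w)) (yv + yw) ==>
   propto (X (v + t *R w)) (yv + t *R yw)"
proof -
 obtain T where T: "finite T" "\<And>\<phi>. good T \<phi> ==> \<phi> t = t" using assms(2) unfolding forced_def by blast
 define PL where "PL = insert (v, w) (plane_pairs (insert t T) v w)"
 have "finite PL" unfolding PL_def using T(1) by (simp add: finite_plane_pairs)
 moreover have "nondeg a b & a \<in> span {v, w} & b \<in> span {v, w}" if "(a, b) \<in> PL" for a b
  using that plane_pairs_nondeg[OF assms(1)] assms(1) by (auto simp: PL_def span_base)
 moreover have "propto (X (v + t *R w)) (yv + t *R yw)"
  if X: "\<And>c v. c ~= 0 ==> X (c *R v) = X v" "\<And>a b. (a, b) \<in> PL ==> par X a b" "propto (X v) yv" "propto (X w) yw"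
   "propto (X (v + w)) (yv + yw)" for X :: "'a => 'c" and yv yw
 proof -
  have "par X a b" if "(a, b) \<in> plane_pairs (insert t T) v w" for a b using X(2) that by (simp add: PL_def)
  moreover have "par X v w" using X(2) by (simp add: PL_def)
  ultimately obtain \<phi> where \<phi>: "good (insert t T) \<phi>" "\<forall>t\<in>insert t T. propto (X (v + t *R w)) (yv + \<phi> t *R yw)"
   using plane_good[of X "insert t T" v w yv yw, OF X(1) _ _ X(3-5)] by blast
  have "\<phi> t = t" by (rule T(2)[OF good_mono[OF \<phi>(1)]]) blast
  thus ?thesis using \<phi>(2) by (metis insertI1)
 qed
 ultimately show ?thesis by (rule that)
qed

section \<open>From planes to arbitrary dimension\<close>

definition indep_family :: "'k set => ('k => 'a::real_vector) => bool" where
 "indep_family K b \<longleftrightarrow> finite K & (\<forall>c. (\<Sum>k\<in>K. c k *R b k) = 0 --> (\<forall>k\<in>K. c k = 0))"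

lemma indep_family_eq:
 assumes "indep_family K b" "S \<subseteq> K" "k \<in> K - S"
  "(\<Sum>j\<in>S. c j *R b j) + x *R b k = (\<Sum>j\<in>S. c' j *R b j) + x' *R b k"
 shows "\<forall>j\<in>S. c j = c' j" "x = x'"
proof -
 have fin: "finite K" "finite S" using assms(1,2) finite_subset by (auto simp: indep_family_def)
 define f where "f j = (if j = k then x - x' else if j \<in> S then c j - c' j else 0)" for j
 have "(\<Sum>j\<in>K. f j *R b j) = (\<Sum>j\<in>insert k S. f j *R b j)"
  by (rule sum.mono_neutral_right) (use fin assms(2,3) in \<open>auto simp: f_def\<close>)
 also have "... = f k *R b k + (\<Sum>j\<in>S. f j *R b j)" using fin assms(3) by simp
 also have "(\<Sum>j\<in>S. f j *R b j) = (\<Sum>j\<in>S. c j *R b j - c' j *R b j)"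
  by (rule sum.cong) (use assms(3) in \<open>auto simp: f_def scaleR_diff_left\<close>)
 also have "f k *R b k + ... = 0" using assms(4) by (simp add: f_def sum_subtractf algebra_simps)
 finally have "\<forall>j\<in>K. f j = 0" using assms(1) unfolding indep_family_def by blast
 hence z: "f j = 0" if "j \<in> K" for j using that by blast
 show "x = x'" using z[of k] assms(3) by (simp add: f_def)
 show "\<forall>j\<in>S. c j = c' j"
 proof
  fix j assume j: "j \<in> S"
  hence "j ~= k" "j \<in> K" using assms(2,3) by auto
  thus "c j = c' j" using z[of j] j by (simp add: f_def)
 qed
qed

lemma indep_family_nondeg:
 assumes "indep_family K b" "S \<subseteq> K" "k \<in> K - S" "j \<in> S" "c j ~= 0" "x ~= 0"
 shows "nondeg (\<Sum>j\<in>S. c j *R b j) (x *R b k)"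
 unfolding nondeg_def
proof
 show "(\<Sum>j\<in>S. c j *R b j) \<notin> span {x *R b k}"
 proof
  assume "(\<Sum>j\<in>S. c j *R b j) \<in> span {x *R b k}"
  then obtain m where "(\<Sum>j\<in>S. c j *R b j) = m *R x *R b k" by (auto simp: span_singleton)
  hence "(\<Sum>j\<in>S. c j *R b j) + 0 *R b k = (\<Sum>j\<in>S. 0 *R b j) + (m * x) *R b k" by simp
  hence "\<forall>j\<in>S. c j = 0" by (rule indep_family_eq(1)[OF assms(1-3)])
  thus False using assms(4,5) by blast
 qed
 show "x *R b k ~= 0"
 proof
  assume "x *R b k = 0"
  hence "(\<Sum>j\<in>S. 0 *R b j) + x *R b k = (\<Sum>j\<in>S. 0 *R b j) + 0 *R b k" by simp
  hence "x = 0" by (rule indep_family_eq(2)[OF assms(1-3)])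
  thus False using assms(6) by blast
 qed
qed

lemma indep_family_pair:
 assumes "indep_family K b" "k \<in> K" "l \<in> K" "k ~= l"
 shows "nondeg (b k) (b l)"
 using indep_family_nondeg[OF assms(1), of "{k}" l k "\<lambda>_. 1" 1] assms by simp

lemma indep_family_triple:
 assumes "indep_family K b" "i \<in> K" "k \<in> K" "l \<in> K" "i ~= k" "i ~= l" "k ~= l"
  "p *R b i + q *R b k + r *R b l = p' *R b i + q' *R b k + r' *R b l"
 shows "p = p'" "q = q'" "r = r'"
proof -
 let ?c = "\<lambda>j. if j = i then p else q" and ?c' = "\<lambda>j. if j = i then p' else q'"
 have "(\<Sum>j\<in>{i, k}. ?c j *R b j) + r *R b l = (\<Sum>j\<in>{i, k}. ?c' j *R b j) + r' *R b l"
  using assms by simp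
 hence "\<forall>j\<in>{i, k}. ?c j = ?c' j" "r = r'"
  by (rule indep_family_eq[OF assms(1), rotated 2]; use assms in auto)+
 thus "p = p'" "q = q'" "r = r'" using assms(5) by auto
qed

lemma propto_normalize:
 fixes X :: "'a::real_vector => 'c::real_vector"
 assumes "par X a b"
 obtains \<gamma> where "\<gamma> ~= 0" "propto (X (a + b)) (X a + \<gamma> *R X b)"
proof -
 obtain \<alpha> \<beta> where ab: "\<alpha> ~= 0" "\<beta> ~= 0" "propto (X (a + b)) (\<alpha> *R X a + \<beta> *R X b)"
  using assms unfolding par_def by blast
 have "\<alpha> *R X a + \<beta> *R X b = \<alpha> *R (X a + (\<beta> / \<alpha>) *R X b)" using ab(1) by (simp add: scaleR_add_right)
 hence "propto (X (a + b)) (X a + (\<beta> / \<alpha>) *R X b)" using propto_unscale ab(1,3) by metis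
 thus ?thesis using that[of "\<beta> / \<alpha>"] ab by simp
qed

text \<open>\<open>b k - b l\<close> arises as a difference in two ways. Through
  \<open>b i + b k\<close> and \<open>b i + b l\<close> the component along \<open>y i\<close> must
  vanish, so the weights there are equal; comparison makes the weights in the pair
  \<open>b k\<close>, \<open>b l\<close> equal too.\<close>

lemma pair_sum_normalized:
 fixes X :: "'a::real_vector => 'c::real_vector"
 assumes y: "indep_family K y" and ikl: "i \<in> K" "k \<in> K" "l \<in> K" "i ~= k" "i ~= l" "k ~= l"
  and pr: "par X (b k) (b l)" "par X (b i + b k) (b i + b l)"
  and n: "propto (X (b k)) (y k)" "propto (X (b l)) (y l)"
   "propto (X (b i + b k)) (y i + y k)" "propto (X (b i + b l)) (y i + y l)"
 shows "propto (X (b k + b l)) (y k + y l)"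
proof -
 obtain \<alpha> \<beta> where 1: "\<alpha> ~= 0" "\<beta> ~= 0" "propto (X (b k + b l)) (\<alpha> *R y k + \<beta> *R y l)"
  "propto (X (b k - b l)) (\<alpha> *R y k - \<beta> *R y l)"
  by (rule parE[OF pr(1) n(1,2)])
 obtain \<alpha>' \<beta>' where 2: "\<alpha>' ~= 0" "\<beta>' ~= 0"
  "propto (X ((b i + b k) - (b i + b l))) (\<alpha>' *R (y i + y k) - \<beta>' *R (y i + y l))"
  by (rule parE[OF pr(2) n(3,4)])
 have "(b i + b k) - (b i + b l) = b k - b l" by simp
 then obtain p q where pq: "p ~= 0" "X (b k - b l) = p *R (\<alpha> *R y k - \<beta> *R y l)" "q ~= 0"
  "X (b k - b l) = q *R (\<alpha>' *R (y i + y k) - \<beta>' *R (y i + y l))"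
  using 1(4) 2(3) unfolding propto_def by auto
 have "0 *R y i + (p * \<alpha>) *R y k + (- p * \<beta>) *R y l = (q * (\<alpha>' - \<beta>')) *R y i + (q * \<alpha>') *R y k + (- q * \<beta>') *R y l"
  using pq(2,4) by (simp add: algebra_simps)
 note c = indep_family_triple[OF y ikl this]
 have "\<alpha>' = \<beta>'" using c(1) pq(3) by simp
 hence "p * \<alpha> = p * \<beta>" using c(2,3) by simp
 hence "\<alpha> = \<beta>" using pq(1) by simp
 hence "propto (X (b k + b l)) (\<alpha> *R (y k + y l))" using 1(3) by (simp add: scaleR_add_right)
 thus ?thesis by (rule propto_unscale[OF 1(1)])
qed

lemma par_span: "par X a b ==> X (a + b) \<in> span {X a, X b}"
 unfolding par_def propto_def by (elim conjE exE) (simp add: span_scale span_pairI)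

lemma par_sum_nonzero:
 assumes "par X a b"
 shows "X (a + b) ~= 0"
proof
 assume "X (a + b) = 0"
 obtain \<alpha> \<beta> where ab: "\<alpha> ~= 0" "\<beta> ~= 0" "propto (X (a + b)) (\<alpha> *R X a + \<beta> *R X b)"
  using assms unfolding par_def by blast
 hence "\<alpha> *R X a + \<beta> *R X b = 0 *R X a + 0 *R X b" using \<open>X (a + b) = 0\<close> by (auto simp: propto_def)
 hence "\<alpha> = 0" by (rule nondeg_coeff(1)[OF par_nondeg[OF assms]])
 thus False using ab(1) by blast
qed

text \<open>\<open>X\<close> is proportional to a linear map on every vector whose coordinates are all forced; the
 induction on the support needs two of the planes that span a given vector.\<close>

lemma support_induction:
 fixes X :: "'a::real_vector => 'c::real_vector"
 assumes sc: "\<And>c v. c ~= 0 ==> X (c *R v) = X v" and y: "indep_family K y"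
  and single: "\<And>k. k \<in> K ==> propto (X (b k)) (y k)"
  and pair: "\<And>k l. k \<in> K ==> l \<in> K ==> k ~= l ==> c k ~= 0 ==> c l ~= 0 ==> propto (X (b k + (c l / c k) *R b l)) (y k + (c l / c k) *R y l)"
  and pr: "\<And>S k. S \<subseteq> K ==> k \<in> K - S ==> c k ~= 0 ==> \<exists>j\<in>S. c j ~= 0 ==> par X (\<Sum>j\<in>S. c j *R b j) (c k *R b k)"
  and S: "S \<subseteq> K" "S ~= {}" "\<forall>j\<in>S. c j ~= 0"
 shows "propto (X (\<Sum>j\<in>S. c j *R b j)) (\<Sum>j\<in>S. c j *R y j)"
proof -
 have finK: "finite K" using y by (simp add: indep_family_def)
 have singlec: "propto (X (c k *R b k)) (y k)" if "k \<in> K" "c k ~= 0" for k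
  using sc[OF that(2)] single[OF that(1)] by simp
 show ?thesis
  using S
 proof (induction "card S" arbitrary: S rule: less_induct)
  case less
  have finS: "finite S" using less.prems(1) finK finite_subset by blast
  obtain k where k: "k \<in> S" using less.prems(2) by blast
  show ?case
  proof (cases "S = {k}")
   case True
   thus ?thesis using singlec[of k] propto_scale[of "c k"] less.prems by simp
  next
   case False
   then obtain l where l: "l \<in> S" "l ~= k" using k by blast
   show ?thesis
   proof (cases "S = {k, l}")
    case True
    have nz: "c k ~= 0" "c l ~= 0" "k \<in> K" "l \<in> K" using less.prems k l by auto
    have e: "c k *R x + c l *R z = c k *R (x + (c l / c k) *R z)" for x z :: "'d::real_vector"
     using nz(1) by (simp add: scaleR_add_right)
    have "(\<Sum>j\<in>S. c j *R b j) = c k *R (b k + (c l / c k) *R b l)"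
     "(\<Sum>j\<in>S. c j *R y j) = c k *R (y k + (c l / c k) *R y l)"
     unfolding True e[symmetric] using l by simp_all
    thus ?thesis
     using propto_scale[OF nz(1) pair[OF nz(3,4) _ nz(1,2)]] sc[OF nz(1)] l(2) by metis
   next
    case False
    then obtain m where m: "m \<in> S" "m ~= k" "m ~= l" using k l by blast
    have step: "\<exists>p q. X (\<Sum>j\<in>S. c j *R b j) = p *R (\<Sum>j\<in>S - {i}. c j *R y j) + q *R y i & X (\<Sum>j\<in>S. c j *R b j) ~= 0"
     if i: "i \<in> S" "S - {i} ~= {}" for i
    proof -
     have iK: "i \<in> K - (S - {i})" "S - {i} \<subseteq> K" "c i ~= 0" using i less.prems by auto
     have "card (S - {i}) < card S" using finS i by (rule_tac card_Diff1_less)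
     hence IH: "propto (X (\<Sum>j\<in>S - {i}. c j *R b j)) (\<Sum>j\<in>S - {i}. c j *R y j)"
      using less.hyps less.prems i iK by blast
     have "\<exists>j\<in>S - {i}. c j ~= 0" using i less.prems by blast
     hence pa: "par X (\<Sum>j\<in>S - {i}. c j *R b j) (c i *R b i)" by (rule pr[OF iK(2,1,3)])
     have "(\<Sum>j\<in>S - {i}. c j *R b j) + c i *R b i = (\<Sum>j\<in>S. c j *R b j)"
      using finS i(1) by (simp add: sum.remove add.commute)
     moreover have "propto (X (c i *R b i)) (y i)" by (rule singlec) (use iK in auto)
     ultimately obtain \<alpha> \<beta> where "propto (X (\<Sum>j\<in>S. c j *R b j)) (\<alpha> *R (\<Sum>j\<in>S - {i}. c j *R y j) + \<beta> *R y i)"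
      "X (\<Sum>j\<in>S. c j *R b j) ~= 0"
      using parE[OF pa IH] par_sum_nonzero[OF pa] by metis
     then obtain d where "X (\<Sum>j\<in>S. c j *R b j) = d *R (\<alpha> *R (\<Sum>j\<in>S - {i}. c j *R y j) + \<beta> *R y i)"
      "X (\<Sum>j\<in>S. c j *R b j) ~= 0"
      unfolding propto_def by blast
     hence "X (\<Sum>j\<in>S. c j *R b j) = (d * \<alpha>) *R (\<Sum>j\<in>S - {i}. c j *R y j) + (d * \<beta>) *R y i & X (\<Sum>j\<in>S. c j *R b j) ~= 0"
      by (simp add: scaleR_add_right)
     thus ?thesis by blast
    qed
    \<comment> \<open>The image is written twice, once with \<open>k\<close> and once with
      \<open>l\<close> split off. The coefficient at a third index \<open>m\<close> makes the two
      factors equal, and the coefficient at \<open>k\<close> then fits in as well.\<close>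
    obtain p q where pq: "X (\<Sum>j\<in>S. c j *R b j) = p *R (\<Sum>j\<in>S - {k}. c j *R y j) + q *R y k" "X (\<Sum>j\<in>S. c j *R b j) ~= 0"
     using step[of k] k l by blast
    obtain p' q' where pq': "X (\<Sum>j\<in>S. c j *R b j) = p' *R (\<Sum>j\<in>S - {l}. c j *R y j) + q' *R y l"
     using step[of l] k l by blast
    let ?f = "\<lambda>j. p * c j" and ?g = "\<lambda>j. if j = l then q' else p' * c j"
    have l': "l \<in> S - {k}" "finite (S - {k})" using l finS by auto
    have k': "k \<in> S - {l}" "finite (S - {l})" using k l finS by auto
    have comm: "S - {l} - {k} = S - {k} - {l}" by auto
    have "p' *R (\<Sum>j\<in>S - {l}. c j *R y j) + q' *R y l = (p' * c k) *R y k + (\<Sum>j\<in>S - {k} - {l}. (p' * c j) *R y j) + q' *R y l"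
     using sum.remove[OF k'(2,1), of "\<lambda>j. c j *R y j"] unfolding comm by (simp add: scaleR_add_right scaleR_sum_right)
    also have "(\<Sum>j\<in>S - {k} - {l}. (p' * c j) *R y j) = (\<Sum>j\<in>S - {k} - {l}. ?g j *R y j)"
     by (rule sum.cong) auto
    also have "(p' * c k) *R y k + ... + q' *R y l = (\<Sum>j\<in>S - {k}. ?g j *R y j) + (p' * c k) *R y k"
     using sum.remove[OF l'(2,1), of "\<lambda>j. ?g j *R y j"] by simp
    finally have "(\<Sum>j\<in>S - {k}. ?f j *R y j) + q *R y k = (\<Sum>j\<in>S - {k}. ?g j *R y j) + (p' * c k) *R y k"
     using pq(1) pq' by (simp add: scaleR_sum_right)
    hence fg: "\<forall>j\<in>S - {k}. ?f j = ?g j" "q = p' * c k"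
     by (rule indep_family_eq[OF y, rotated 2]; use less.prems k in auto)+
    have "p * c m = p' * c m" using fg(1) m by auto
    hence "p = p'" using less.prems(3) m by simp
    hence "X (\<Sum>j\<in>S. c j *R b j) = p *R (c k *R y k + (\<Sum>j\<in>S - {k}. c j *R y j))"
     using pq(1) fg(2) by (simp add: scaleR_add_right)
    also have "c k *R y k + (\<Sum>j\<in>S - {k}. c j *R y j) = (\<Sum>j\<in>S. c j *R y j)"
     using sum.remove[OF finS k, of "\<lambda>j. c j *R y j"] by simp
    finally have X: "X (\<Sum>j\<in>S. c j *R b j) = p *R (\<Sum>j\<in>S. c j *R y j)" .
    moreover have "p ~= 0" using X pq(2) by auto
    ultimately show ?thesis unfolding propto_def by blast
   qed
  qed
 qed
qed

text \<open>Does not presuppose that the images of the basis are independent; combined with the rank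
  assumption it is what proves that independence.\<close>

lemma weak_support:
 fixes X :: "'a::real_vector => 'c::real_vector"
 assumes sc: "\<And>c v. c ~= 0 ==> X (c *R v) = X v"
  and pr: "\<And>S k. S \<subseteq> K ==> k \<in> K - S ==> c k ~= 0 ==> \<exists>j\<in>S. c j ~= 0 ==> par X (\<Sum>j\<in>S. c j *R b j) (c k *R b k)"
  and S: "finite S" "S \<subseteq> K" "\<exists>j\<in>S. c j ~= 0"
 shows "X (\<Sum>j\<in>S. c j *R b j) \<in> span ((\<lambda>k. X (b k)) ` S)"
 using S
proof (induction S rule: finite_induct)
 case empty
 thus ?case by simp
next
 case (insert k S)
 have mono: "span ((\<lambda>k. X (b k)) ` S) \<subseteq> span ((\<lambda>k. X (b k)) ` insert k S)" by (intro span_mono) auto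
 show ?case
 proof (cases "c k = 0")
  case True
  hence "\<exists>j\<in>S. c j ~= 0" using insert.prems by auto
  thus ?thesis using insert True mono by auto
 next
  case False
  have Xk: "X (c k *R b k) = X (b k)" by (rule sc[OF False])
  show ?thesis
  proof (cases "\<exists>j\<in>S. c j ~= 0")
   case False
   hence "(\<Sum>j\<in>S. c j *R b j) = 0" by (intro sum.neutral) auto
   thus ?thesis using insert.hyps Xk by (simp add: span_base)
  next
   case True
   have "par X (\<Sum>j\<in>S. c j *R b j) (c k *R b k)"
    by (rule pr) (use insert True False in auto)
   from par_span[OF this]
   have "X ((\<Sum>j\<in>S. c j *R b j) + c k *R b k) \<in> span {X (\<Sum>j\<in>S. c j *R b j), X (b k)}"
    unfolding Xk .
   moreover have "{X (\<Sum>j\<in>S. c j *R b j), X (b k)} \<subseteq> span ((\<lambda>k. X (b k)) ` insert k S)"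
    using insert True mono by (auto intro: span_base)
   hence "span {X (\<Sum>j\<in>S. c j *R b j), X (b k)} \<subseteq> span ((\<lambda>k. X (b k)) ` insert k S)"
    by (rule span_minimal[OF _ subspace_span])
   ultimately show ?thesis using insert.hyps by (auto simp: add.commute)
  qed
 qed
qed

lemma parallel_family_independent:
 fixes x :: "'k => 'c::real_vector"
 assumes "finite K" "\<And>S. finite S ==> x ` K \<subseteq> span S ==> card K <= card S"
 shows "indep_family K x"
 unfolding indep_family_def
proof (intro conjI allI impI ballI)
 fix c k assume c: "(\<Sum>k\<in>K. c k *R x k) = 0" and k: "k \<in> K"
 show "c k = 0"
 proof (rule ccontr)
  assume ck: "c k ~= 0"
  have "c k *R x k = - (\<Sum>j\<in>K - {k}. c j *R x j)"
   using c sum.remove[OF assms(1) k, of "\<lambda>j. c j *R x j"] by (simp add: eq_neg_iff_add_eq_0)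
  moreover have "... \<in> span (x ` (K - {k}))" by (intro span_neg span_sum span_scale span_base) auto
  ultimately have "(1 / c k) *R (c k *R x k) \<in> span (x ` (K - {k}))" by (metis span_scale)
  hence "x k \<in> span (x ` (K - {k}))" using ck by simp
  hence "x ` K \<subseteq> span (x ` (K - {k}))" by (auto intro: span_base)
  hence "card K <= card (x ` (K - {k}))" using assms(1) by (intro assms(2)) auto
  also have "... <= card (K - {k})" using assms(1) by (intro card_image_le) auto
  also have "... < card K" using card_Diff1_less[OF assms(1) k] .
  finally show False by simp
 qed
qed (rule assms(1))

text \<open>\<open>PL1\<close> handles partial sums, \<open>PL2\<close> pairs of basis vectors,
  \<open>PL3\<close> the comparison of the sums with a fixed \<open>b i\<close>, and the planes
  treat the forced ratios \<open>c l / c k\<close>. The rank condition excludes collapsed images: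
  each \<open>X\<close> of the given vectors lies in the span of the \<open>X (b k)\<close>, so
  these must be independent.\<close>

lemma algebra_main:
 fixes b :: "'k => 'a::real_vector"
 assumes b: "indep_family K b" and K: "card K >= 2" and Cs: "finite Cs"
  and alg: "\<And>c k. c \<in> Cs ==> k \<in> K ==> forced (\<lambda>\<phi>. \<phi> (c k) = c k)" and ne: "\<And>c. c \<in> Cs ==> \<exists>k\<in>K. c k ~= 0"
 obtains PL where "finite PL" "\<And>p q. (p, q) \<in> PL ==> nondeg p q & p \<in> span (b ` K) & q \<in> span (b ` K)"
  "\<And>X :: 'a => 'c::real_vector. (\<And>c v. c ~= 0 ==> X (c *R v) = X v) ==> (\<And>p q. (p, q) \<in> PL ==> par X p q) ==>
   \<forall>S. finite S --> (\<forall>c\<in>Cs. X (\<Sum>k\<in>K. c k *R b k) \<in> span S) --> card K <= card S ==>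
   \<exists>y. indep_family K y & (\<forall>c\<in>Cs. propto (X (\<Sum>k\<in>K. c k *R b k)) (\<Sum>k\<in>K. c k *R y k))"
proof -
 have finK: "finite K" using b by (simp add: indep_family_def)
 have "K ~= {}" using K by auto
 then obtain i where i: "i \<in> K" by blast
 have bK: "b k \<in> span (b ` K)" if "k \<in> K" for k using that by (intro span_base) auto
 define J where "J = {(c, k, l). c \<in> Cs & k \<in> K & l \<in> K & k ~= l & c k ~= 0}"
 have finJ: "finite J" by (rule finite_subset[of _ "Cs \<times> K \<times> K"]) (use Cs finK in \<open>auto simp: J_def\<close>)
 have plane: "\<exists>PL. finite PL & (\<forall>p q. (p, q) \<in> PL --> nondeg p q & p \<in> span (b ` K) & q \<in> span (b ` K)) &
  (\<forall>(X :: 'a => 'c) yv yw. (\<forall>c v. c ~= 0 --> X (c *R v) = X v) --> (\<forall>a b. (a, b) \<in> PL --> par X a b) -->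
   propto (X (b k)) yv --> propto (X (b l)) yw --> propto (X (b k + b l)) (yv + yw) -->
   propto (X (b k + (c l / c k) *R b l)) (yv + (c l / c k) *R yw))"
  if "(c, k, l) \<in> J" for c k l
 proof -
  have ckl: "c \<in> Cs" "k \<in> K" "l \<in> K" "k ~= l" "c k ~= 0" using that by (auto simp: J_def)
  have nd: "nondeg (b k) (b l)" by (rule indep_family_pair[OF b ckl(2-4)])
  have f: "forced (\<lambda>\<phi>. \<phi> (c l / c k) = c l / c k)"
   by (rule forced_quotient[OF alg[OF ckl(1,3)] alg[OF ckl(1,2)] ckl(5)])
  have sp: "span {b k, b l} \<subseteq> span (b ` K)" using ckl by (intro span_mono) auto
  obtain PL where "finite PL" "\<And>p q. (p, q) \<in> PL ==> nondeg p q & p \<in> span {b k, b l} & q \<in> span {b k, b l}"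
   "\<And>(X :: 'a => 'c) yv yw. (\<And>c v. c ~= 0 ==> X (c *R v) = X v) ==> (\<And>a b. (a, b) \<in> PL ==> par X a b) ==>
   propto (X (b k)) yv ==> propto (X (b l)) yw ==> propto (X (b k + b l)) (yv + yw) ==>
   propto (X (b k + (c l / c k) *R b l)) (yv + (c l / c k) *R yw)"
   using plane_forced[OF nd f, where 'c = 'c] by metis
  thus ?thesis using sp by (intro exI[of _ PL]) blast
 qed
 define good_pairs where "good_pairs j PL \<longleftrightarrow> finite PL & (\<forall>p q. (p, q) \<in> PL --> nondeg p q & p \<in> span (b ` K) & q \<in> span (b ` K)) &
  (case j of (c, k, l) => \<forall>(X :: 'a => 'c) yv yw. (\<forall>c v. c ~= 0 --> X (c *R v) = X v) --> (\<forall>a b. (a, b) \<in> PL --> par X a b) -->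
   propto (X (b k)) yv --> propto (X (b l)) yw --> propto (X (b k + b l)) (yv + yw) -->
   propto (X (b k + (c l / c k) *R b l)) (yv + (c l / c k) *R yw))" for j :: "('k => real) \<times> 'k \<times> 'k" and PL
 have "\<forall>j\<in>J. \<exists>PL. good_pairs j PL" unfolding good_pairs_def using plane by (auto split: prod.split)
 then obtain PLf where PLf: "\<forall>j\<in>J. good_pairs j (PLf j)" by (rule bchoice[THEN exE])
 define PL1 where "PL1 = (\<lambda>(c, S, k). (\<Sum>j\<in>S. c j *R b j, c k *R b k)) `
  {(c, S, k). c \<in> Cs & S \<subseteq> K & k \<in> K - S & c k ~= 0 & (\<exists>j\<in>S. c j ~= 0)}"
 define PL2 where "PL2 = (\<lambda>(k, l). (b k, b l)) ` {(k, l). k \<in> K & l \<in> K & k ~= l}"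
 define PL3 where "PL3 = (\<lambda>(k, l). (b i + b k, b i + b l)) ` {(k, l). k \<in> K - {i} & l \<in> K - {i} & k ~= l}"
 define PL where "PL = PL1 \<union> PL2 \<union> PL3 \<union> \<Union> (PLf ` J)"
 have "finite PL"
 proof -
  have "finite PL1" unfolding PL1_def
   by (rule finite_imageI, rule finite_subset[of _ "Cs \<times> Pow K \<times> K"]) (use Cs finK in auto)
  moreover have "finite PL2" unfolding PL2_def
   by (rule finite_imageI, rule finite_subset[of _ "K \<times> K"]) (use finK in auto)
  moreover have "finite PL3" unfolding PL3_def
   by (rule finite_imageI, rule finite_subset[of _ "K \<times> K"]) (use finK in auto)
  moreover have "finite (\<Union> (PLf ` J))" using finJ PLf by (auto simp: good_pairs_def)
  ultimately show ?thesis by (simp add: PL_def)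
 qed
 moreover have "nondeg p q & p \<in> span (b ` K) & q \<in> span (b ` K)" if pq: "(p, q) \<in> PL" for p q
 proof -
  consider "(p, q) \<in> PL1" | "(p, q) \<in> PL2" | "(p, q) \<in> PL3" | "\<exists>j\<in>J. (p, q) \<in> PLf j" using pq by (auto simp: PL_def)
  thus ?thesis
  proof cases
   case 1
   then obtain c S k j where c: "p = (\<Sum>j\<in>S. c j *R b j)" "q = c k *R b k" "S \<subseteq> K" "k \<in> K - S" "c k ~= 0" "j \<in> S" "c j ~= 0"
    by (auto simp: PL1_def)
   have "p \<in> span (b ` K)" unfolding c(1) using c(3) by (intro span_sum span_scale bK) auto
   moreover have "q \<in> span (b ` K)" unfolding c(2) using c(4) by (intro span_scale bK) auto
   ultimately show ?thesis using indep_family_nondeg[of K b S k j c, OF b c(3,4,6,7,5)] c(1,2) by blast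
  next
   case 2
   thus ?thesis using indep_family_pair[OF b] bK by (auto simp: PL2_def)
  next
   case 3
   then obtain k l where kl: "p = b i + b k" "q = b i + b l" "k \<in> K" "l \<in> K" "k ~= i" "l ~= i" "k ~= l" by (auto simp: PL3_def)
   have "nondeg p q"
    unfolding nondeg_def
   proof
    show "p \<notin> span {q}"
    proof
     assume "p \<in> span {q}"
     then obtain m where "b i + b k = m *R (b i + b l)" by (auto simp: span_singleton kl)
     hence e: "1 *R b i + 1 *R b k + 0 *R b l = m *R b i + 0 *R b k + m *R b l" by (simp add: algebra_simps)
     have "(1 :: real) = 0" by (rule indep_family_triple(2)[OF b i kl(3,4) _ _ kl(7) e]) (use kl in auto)
     thus False by simp
    qed
    show "q ~= 0"
    proof
     assume "q = 0"
     hence e: "1 *R b i + 0 *R b k + 1 *R b l = 0 *R b i + 0 *R b k + 0 *R b l" by (simp add: kl)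
     have "(1 :: real) = 0" by (rule indep_family_triple(1)[OF b i kl(3,4) _ _ kl(7) e]) (use kl in auto)
     thus False by simp
    qed
   qed
   thus ?thesis using kl bK i by (auto intro: span_add)
  next
   case 4
   thus ?thesis using PLf unfolding good_pairs_def by blast
  qed
 qed
 moreover have "\<exists>y. indep_family K y & (\<forall>c\<in>Cs. propto (X (\<Sum>k\<in>K. c k *R b k)) (\<Sum>k\<in>K. c k *R y k))"
  if sc: "\<And>c v. c ~= 0 ==> X (c *R v) = X v" and pr: "\<And>p q. (p, q) \<in> PL ==> par X p q"
   and rank: "\<forall>S. finite S --> (\<forall>c\<in>Cs. X (\<Sum>k\<in>K. c k *R b k) \<in> span S) --> card K <= card S"
  for X :: "'a => 'c"
 proof -
  have pr1: "par X (\<Sum>j\<in>S. c j *R b j) (c k *R b k)" if "c \<in> Cs" "S \<subseteq> K" "k \<in> K - S" "c k ~= 0" "\<exists>j\<in>S. c j ~= 0" for c S k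
  proof -
   have "(\<Sum>j\<in>S. c j *R b j, c k *R b k) \<in> PL1"
    unfolding PL1_def by (rule image_eqI[of _ _ "(c, S, k)"]) (use that in auto)
   thus ?thesis by (intro pr) (simp add: PL_def)
  qed
  have pr2: "par X (b k) (b l)" if "k \<in> K" "l \<in> K" "k ~= l" for k l
   by (rule pr) (use that in \<open>auto simp: PL_def PL2_def\<close>)
  have pr3: "par X (b i + b k) (b i + b l)" if "k \<in> K - {i}" "l \<in> K - {i}" "k ~= l" for k l
   by (rule pr) (use that in \<open>auto simp: PL_def PL3_def\<close>)
  have weak: "X (\<Sum>k\<in>K. c k *R b k) \<in> span ((\<lambda>k. X (b k)) ` K)" if "c \<in> Cs" for c
   by (rule weak_support[of X K c b, OF sc pr1[OF that] finK order_refl ne[OF that]])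
  have indX: "indep_family K (\<lambda>k. X (b k))"
  proof (rule parallel_family_independent[OF finK])
   fix S assume S: "finite S" "(\<lambda>k. X (b k)) ` K \<subseteq> span S"
   hence "span ((\<lambda>k. X (b k)) ` K) \<subseteq> span S" by (simp add: span_minimal)
   thus "card K <= card S" using weak rank S(1) by blast
  qed
  have "\<exists>\<gamma>. \<gamma> ~= 0 & propto (X (b i + b k)) (X (b i) + \<gamma> *R X (b k))" if "k \<in> K - {i}" for k
  proof -
   have "par X (b i) (b k)" by (rule pr2) (use that i in auto)
   thus ?thesis by (rule propto_normalize) blast
  qed
  hence "\<forall>k\<in>K - {i}. \<exists>\<gamma>. \<gamma> ~= 0 & propto (X (b i + b k)) (X (b i) + \<gamma> *R X (b k))" by blast
  then obtain \<gamma> where \<gamma>: "\<forall>k\<in>K - {i}. \<gamma> k ~= 0 & propto (X (b i + b k)) (X (b i) + \<gamma> k *R X (b k))"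
   by (rule bchoice[THEN exE])
  \<comment> \<open>The images of the basis vectors are only known up to factors; these are chosen
    to make \<open>b i + b k\<close> go to the sum for every \<open>k\<close>.\<close>
  define g where "g k = (if k = i then 1 else \<gamma> k)" for k
  define y where "y k = g k *R X (b k)" for k
  have g: "g k ~= 0" if "k \<in> K" for k using \<gamma> that by (auto simp: g_def)
  have yi: "indep_family K y"
   unfolding indep_family_def
  proof (intro conjI allI impI ballI)
   fix c k assume "(\<Sum>k\<in>K. c k *R y k) = 0" and k: "k \<in> K"
   hence "(\<Sum>k\<in>K. (c k * g k) *R X (b k)) = 0" by (simp add: y_def)
   moreover have "\<forall>c. (\<Sum>k\<in>K. c k *R X (b k)) = 0 --> (\<forall>k\<in>K. c k = 0)"
    using indX by (simp add: indep_family_def)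
   ultimately have "\<forall>k\<in>K. c k * g k = 0" using spec[of _ "\<lambda>k. c k * g k"] by fast
   thus "c k = 0" using g k by auto
  qed (rule finK)
  have single: "propto (X (b k)) (y k)" if "k \<in> K" for k
   unfolding y_def by (rule propto_scale[OF g[OF that]]) simp
  have base: "propto (X (b i + b k)) (y i + y k)" if "k \<in> K" "k ~= i" for k
   using \<gamma> that by (auto simp: y_def g_def)
  have pair: "propto (X (b k + b l)) (y k + y l)" if kl: "k \<in> K" "l \<in> K" "k ~= l" for k l
  proof (cases "k = i \<or> l = i")
   case True
   thus ?thesis
   proof
    assume "k = i"
    thus ?thesis using base[OF kl(2)] kl(3) by simp
   next
    assume "l = i"
    thus ?thesis using base[OF kl(1)] kl(3) by (simp add: add.commute)
   qed
  next
   case False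
   show ?thesis
    by (rule pair_sum_normalized[OF yi i kl(1,2) _ _ kl(3) pr2[OF kl] pr3 single[OF kl(1)] single[OF kl(2)] base base])
     (use False kl in auto)
  qed
  have "propto (X (\<Sum>k\<in>K. c k *R b k)) (\<Sum>k\<in>K. c k *R y k)" if c: "c \<in> Cs" for c
  proof -
   define S where "S = {k \<in> K. c k ~= 0}"
   have S: "S \<subseteq> K" "S ~= {}" "\<forall>j\<in>S. c j ~= 0" using ne[OF c] by (auto simp: S_def)
   have eq: "(\<Sum>k\<in>K. c k *R f k) = (\<Sum>k\<in>S. c k *R f k)" for f :: "'k => 'd::real_vector"
    by (rule sum.mono_neutral_right) (use finK in \<open>auto simp: S_def\<close>)
   have pairc: "propto (X (b k + (c l / c k) *R b l)) (y k + (c l / c k) *R y l)"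
    if kl: "k \<in> K" "l \<in> K" "k ~= l" "c k ~= 0" "c l ~= 0" for k l
   proof -
    have j: "(c, k, l) \<in> J" using kl c by (simp add: J_def)
    hence "good_pairs (c, k, l) (PLf (c, k, l))" using PLf by blast
    moreover have "\<forall>a b. (a, b) \<in> PLf (c, k, l) --> par X a b" using pr j by (auto simp: PL_def)
    ultimately show ?thesis
     unfolding good_pairs_def using sc single[OF kl(1)] single[OF kl(2)] pair[OF kl(1-3)] by simp
   qed
   show ?thesis
    unfolding eq[of b] eq[of y] by (rule support_induction[of X K y b c, OF sc yi single pairc pr1[OF c] S])
  qed
  thus ?thesis using yi by blast
 qed
 ultimately show ?thesis by (rule that) auto
qed

lemma lookup_scaleR: "coord (r *R x) i = r * coord x i"
 for x :: rvec
 unfolding scaleR_poly_mapping_def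
 by (subst Abs_poly_mapping_inverse) (auto intro: finite_subset[OF _ finite_lookup[of x]])

text \<open>The coefficients are coordinates of the vector itself, hence algebraic if its entries are.\<close>

lemma dual_coordinates:
 fixes B :: "rvec set"
 assumes "finite B" "independent B"
 obtains K b where "finite K" "card K = card B" "\<And>k l. k \<in> K ==> l \<in> K ==> coord (b k) l = (if k = l then 1 else 0)"
  "\<And>v. v \<in> span B ==> v = (\<Sum>k\<in>K. coord v k *R b k)" "b ` K \<subseteq> span B"
proof -
 have "\<exists>K b. finite K & card K = card B & (\<forall>k\<in>K. \<forall>l\<in>K. coord (b k) l = (if k = l then 1 else 0)) &
  (\<forall>v\<in>span B. v = (\<Sum>k\<in>K. coord v k *R b k)) & b ` K \<subseteq> span B"
  using assms
 proof (induction B rule: finite_induct)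
  case empty
  thus ?case by (intro exI[of _ "{}"]) simp
 next
  case (insert v B)
  have "independent B" using insert.prems by (rule independent_mono) blast
  from insert.IH[OF this]
  obtain K b where KB: "finite K & card K = card B & (\<forall>k\<in>K. \<forall>l\<in>K. coord (b k) l = (if k = l then 1 else 0)) &
   (\<forall>v\<in>span B. v = (\<Sum>k\<in>K. coord v k *R b k)) & b ` K \<subseteq> span B"
   by (elim exE)
  have Kb4: "w = (\<Sum>k\<in>K. coord w k *R b k)" if "w \<in> span B" for w
   by (rule bspec[OF conjunct1[OF conjunct2[OF conjunct2[OF conjunct2[OF KB]]]] that])
  have Kb: "finite K" "card K = card B" "b ` K \<subseteq> span B"
   using KB by blast+
  have Kb3: "coord (b k) l = (if k = l then 1 else 0)" if "k \<in> K" "l \<in> K" for k l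
   using KB that by blast+
  have vB: "v \<notin> span B" using insert by (auto simp: independent_insert)
  \<comment> \<open>One step of elimination: \<open>v'\<close> is \<open>v\<close> with its entries
    in \<open>K\<close> cleared, any nonzero entry \<open>m\<close> of it becomes the new pivot, and
    that entry is then cleared in the old basis vectors.\<close>
  define v' where "v' = v - (\<Sum>k\<in>K. coord v k *R b k)"
  have sB: "(\<Sum>k\<in>K. coord v k *R b k) \<in> span B" using Kb(3) by (intro span_sum span_scale) auto
  have "v \<in> span B" if "v' \<in> span B" using span_add[OF that sB] by (simp add: v'_def)
  hence v'B: "v' \<notin> span B" using vB by blast
  have lsum: "coord (\<Sum>k\<in>K. c k *R b k) l = (\<Sum>k\<in>K. c k * coord (b k) l)" for c l
   using Kb(1) by (induction K rule: finite_induct) (simp_all add: lookup_add lookup_scaleR)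
  have v'0: "coord v' l = 0" if l: "l \<in> K" for l
  proof -
   have "(\<Sum>k\<in>K. coord v k * coord (b k) l) = (\<Sum>k\<in>K. if k = l then coord v k else 0)"
    by (rule sum.cong) (use Kb3 l in auto)
   also have "... = coord v l" using Kb(1) l by simp
   finally show ?thesis by (simp add: v'_def lookup_minus lsum)
  qed
  have "v' ~= 0" using v'B span_zero by auto
  then obtain m where m: "coord v' m ~= 0" by (metis lookup_zero poly_mapping_eqI)
  hence mK: "m \<notin> K" using v'0 by auto
  define bm where "bm = (1 / coord v' m) *R v'"
  define b' where "b' k = (if k = m then bm else b k - coord (b k) m *R bm)" for k
  have bm: "coord bm m = 1" "\<And>l. l \<in> K ==> coord bm l = 0"
   using m v'0 by (simp_all add: bm_def lookup_scaleR)
  have dual: "coord (b' k) l = (if k = l then 1 else 0)" if "k \<in> insert m K" "l \<in> insert m K" for k l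
   using that mK bm Kb3 by (auto simp: b'_def lookup_minus lookup_scaleR)
  have spB: "span B \<subseteq> span (insert v B)" by (rule span_mono) blast
  have "v \<in> span (insert v B)" by (simp add: span_base)
  hence "v' \<in> span (insert v B)" unfolding v'_def by (rule span_diff) (use sB spB in blast)
  hence bms: "bm \<in> span (insert v B)" unfolding bm_def by (rule span_scale)
  have bs: "b' ` insert m K \<subseteq> span (insert v B)"
   using bms Kb(3) spB by (auto simp: b'_def intro!: span_diff span_scale)
  have old: "w = (\<Sum>k\<in>insert m K. coord w k *R b' k)" if w: "w \<in> span B" for w
  proof -
   have "(\<Sum>k\<in>K. coord w k *R b' k) = (\<Sum>k\<in>K. coord w k *R b k - (coord w k * coord (b k) m) *R bm)"
    by (rule sum.cong) (use mK in \<open>auto simp: b'_def scaleR_diff_right\<close>)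
   also have "... = w - (\<Sum>k\<in>K. coord w k * coord (b k) m) *R bm"
    using Kb4[OF w] by (simp add: sum_subtractf scaleR_sum_left)
   also have "(\<Sum>k\<in>K. coord w k * coord (b k) m) = coord w m"
    using lsum[of "coord w" m] Kb4[OF w] by simp
   finally show ?thesis using Kb(1) mK by (simp add: b'_def)
  qed
  have rep: "w = (\<Sum>k\<in>insert m K. coord w k *R b' k)" if ws: "w \<in> span (insert v B)" for w
  proof -
   obtain t where t: "w - t *R v \<in> span B" using ws span_breakdown_eq by blast
   define z where "z = w - t *R v'"
   have "z = (w - t *R v) + t *R (\<Sum>k\<in>K. coord v k *R b k)" by (simp add: z_def v'_def algebra_simps)
   hence z: "z \<in> span B" using t Kb(3) by (auto intro!: span_add span_scale span_sum)
   have "(\<Sum>k\<in>insert m K. coord v' k *R b' k) = coord v' m *R bm"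
    using Kb(1) mK v'0 by (simp add: b'_def)
   hence v'r: "(\<Sum>k\<in>insert m K. coord v' k *R b' k) = v'" using m by (simp add: bm_def)
   have w: "w = z + t *R v'" by (simp add: z_def)
   have "(\<Sum>k\<in>insert m K. coord w k *R b' k) =
     (\<Sum>k\<in>insert m K. coord z k *R b' k) + t *R (\<Sum>k\<in>insert m K. coord v' k *R b' k)"
    unfolding w by (simp only: lookup_add lookup_scaleR scaleR_add_left sum.distrib scaleR_sum_right scaleR_scaleR)
   thus ?thesis unfolding v'r using old[OF z] w by simp
  qed
  have "card (insert m K) = card (insert v B)" using Kb(1,2) mK insert.hyps by simp
  moreover have "finite (insert m K)" using Kb(1) by simp
  moreover have "\<forall>k\<in>insert m K. \<forall>l\<in>insert m K. coord (b' k) l = (if k = l then 1 else 0)" using dual by blast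
  moreover have "\<forall>v\<in>span (insert v B). v = (\<Sum>k\<in>insert m K. coord v k *R b' k)"
   by (intro ballI) (rule rep)
  ultimately show ?case using bs by - (rule exI[of _ "insert m K"], rule exI[of _ b'], intro conjI)
 qed
 then obtain K b where KB: "finite K & card K = card B & (\<forall>k\<in>K. \<forall>l\<in>K. coord (b k) l = (if k = l then 1 else 0)) &
  (\<forall>v\<in>span B. v = (\<Sum>k\<in>K. coord v k *R b k)) & b ` K \<subseteq> span B"
  by (elim exE)
 show ?thesis
 proof (rule that[of K b])
  show "v = (\<Sum>k\<in>K. coord v k *R b k)" if "v \<in> span B" for v
   by (rule bspec[OF conjunct1[OF conjunct2[OF conjunct2[OF conjunct2[OF KB]]]] that])
 qed (use KB in blast)+
qed

section \<open>Choice of functionals and gadgets\<close>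

text \<open>One vector for each direction, shared by all nonzero multiples, so that an ideal point
  attached to it depends on the direction only.\<close>

definition rep :: "'a::real_vector set => 'a => 'a" where
 "rep D v = (SOME e. e \<in> D & span {e} = span {v})"

lemma rep_props: "v \<in> D ==> rep D v \<in> D & span {rep D v} = span {v}"
 unfolding rep_def by (rule someI[of _ v]) simp

lemma span_scale_singleton: "c ~= 0 ==> span {c *R v} = span {v}"
proof -
 assume c: "c ~= 0"
 have "v \<in> span {c *R v}" using span_scale[of "c *R v" "{c *R v}" "1 / c"] c by (simp add: span_base)
 hence "span {v} \<subseteq> span {c *R v}" by (simp add: span_minimal)
 moreover have "span {c *R v} \<subseteq> span {v}" by (intro span_minimal) (auto simp: span_scale span_base)
 ultimately show ?thesis by blast
qed

lemma rep_scale: "c ~= 0 ==> rep D (c *R v) = rep D v"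
 by (simp add: rep_def span_scale_singleton)

lemma rep_rep:
 assumes "v \<in> D"
 shows "rep D (rep D v) = rep D v"
 using rep_props[OF assms] unfolding rep_def[of D "rep D v"] by (simp add: rep_def)

lemma rep_unique:
 assumes "e \<in> rep D ` D" "e' \<in> rep D ` D" "0 \<notin> D" "e \<in> span {e'}"
 shows "e = e'"
proof -
 have D: "e \<in> D" "e' \<in> D" using assms(1,2) rep_props by blast+
 hence "e ~= 0" using assms(3) by auto
 hence "e' \<in> span {e}" by (rule span_singleton_sym[OF assms(4)])
 hence "span {e} = span {e'}" using assms(4) by (simp add: span_minimal subset_antisym)
 hence "rep D e = rep D e'" by (simp add: rep_def)
 moreover have "rep D e = e" "rep D e' = e'" using assms(1,2) rep_rep by blast+
 ultimately show ?thesis by simp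
qed

lemma top_set_singletonI:
 assumes "v \<in> J" "\<And>x. x \<in> J - {v} ==> u x < u v"
 shows "top_set u J = {v}"
 using assms unfolding top_set_def by force

lemma top_set_pairI:
 assumes "v \<in> J" "w \<in> J" "u v = u w" "\<And>x. x \<in> J - {v, w} ==> u x < u v"
 shows "top_set u J = {v, w}"
proof
 have le: "u x <= u v" if "x \<in> J" for x using assms(3) assms(4)[of x] that by (cases "x \<in> {v, w}") (auto simp: less_imp_le)
 show "{v, w} \<subseteq> top_set u J" using assms(1-3) le by (auto simp: top_set_def)
 show "top_set u J \<subseteq> {v, w}" using assms(1,4) unfolding top_set_def by force
qed

text \<open>What \<open>U\<close> has to offer for a fibre: its vertices and edges are exposed by
  members of \<open>U\<close>, and no member is constant on it, the latter for the strict height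
  inequalities.\<close>

definition adequate :: "('a::real_vector => real) set => 'a set => 'a set => 'a set => bool" where
 "adequate U E D J \<longleftrightarrow> (\<forall>v\<in>J. \<exists>u\<in>U. top_set u J = {v}) & (\<forall>v w. is_edge J v w --> (\<exists>u. vis U E J u (rep D (v - w)) v w)) &
   (\<forall>u\<in>U. \<exists>x\<in>J. \<exists>y\<in>J. u x ~= u y)"

definition directions :: "'a::real_vector set set => 'a set" where
 "directions \<L> = {p - q | p q. \<exists>J\<in>\<L>. p \<in> J & q \<in> J & p ~= q}"

lemma finite_directions:
 assumes "finite \<L>" "\<And>J. J \<in> \<L> ==> finite J"
 shows "finite (directions \<L>)"
proof (rule finite_subset)
 show "directions \<L> \<subseteq> (\<lambda>(p, q). p - q) ` (\<Union>\<L> \<times> \<Union>\<L>)" by (auto simp: directions_def)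
 show "finite ((\<lambda>(p, q). p - q) ` (\<Union>\<L> \<times> \<Union>\<L>))" using assms by auto
qed

lemma is_edge_two_directions:
 assumes "convex_position J" "card J >= 3"
 obtains v w w' where "v \<in> J" "w \<in> J" "w' \<in> J" "v ~= w" "v ~= w'" "v - w' \<notin> span {v - w}"
proof -
 have "J ~= {}" using assms(2) by auto
 then obtain v where v: "v \<in> J" by blast
 obtain w w' where w: "is_edge J v w" "is_edge J v w'" "w ~= w'" by (rule is_edge_two[OF assms(1) v assms(2)])
 have J: "w \<in> J" "w' \<in> J" "v ~= w" "v ~= w'" using w by (auto simp: is_edge_def)
 obtain u :: "'a => real" where u: "linear u" "u v = u w" "u w' < u v" using w J unfolding is_edge_def by blast
 have "v - w' \<notin> span {v - w}"
 proof
  assume "v - w' \<in> span {v - w}"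
  then obtain k where "v - w' = k *R (v - w)" by (auto simp: span_singleton)
  hence "u (v - w') = k * u (v - w)" using u(1) by (simp add: linear_scale)
  thus False using u by (simp add: linear_diff)
 qed
 thus ?thesis using that v J by blast
qed

text \<open>One generic functional for every vertex, vanishing on no direction, and one for every
  edge, vanishing on the direction of that edge alone. Seeing at most one direction makes the top of
  the zonotope a segment. It also excludes functionals that are constant on some \<open>J\<close>,
  as each \<open>J\<close> has edges in two directions.\<close>

lemma select_functionals:
 assumes fin: "finite \<L>" "\<L> ~= {}" and cp: "\<And>J. J \<in> \<L> ==> convex_position J & card J >= 3"
 defines "D \<equiv> directions \<L>"
 defines "E \<equiv> rep D ` D"
 obtains U :: "('a::real_vector => real) set" where "finite U" "\<And>u. u \<in> U ==> linear u" "zf \<notin> U" "\<And>J. J \<in> \<L> ==> adequate U E D J"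
  "\<And>u e e'. u \<in> U ==> e \<in> E ==> e' \<in> E ==> u e = 0 ==> u e' = 0 ==> e = e'"
proof -
 have finJ: "finite J" if "J \<in> \<L>" for J using cp[OF that] by (simp add: convex_position_def)
 have finD: "finite D" unfolding D_def by (rule finite_directions[OF fin(1) finJ])
 have D0: "0 \<notin> D" by (auto simp: D_def directions_def)
 have finE: "finite E" unfolding E_def using finD by simp
 have E0: "0 \<notin> E"
 proof
  assume "0 \<in> E"
  then obtain v where "v \<in> D" "rep D v = 0" unfolding E_def by auto
  thus False using rep_props[of v D] D0 by simp
 qed
 have dir: "p - q \<in> D" if "J \<in> \<L>" "p \<in> J" "q \<in> J" "p ~= q" for J p q using that by (auto simp: D_def directions_def)
 define P1 where "P1 j u \<longleftrightarrow> linear u & top_set u (fst j) = {snd j} & (\<forall>e\<in>E. u e ~= 0)" for j :: "'a set \<times> 'a" and u :: "'a => real"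
 define P2 where "P2 j u \<longleftrightarrow> (case j of (J, v, w) => linear u & top_set u J = {v, w} & u (rep D (v - w)) = 0 & (\<forall>e\<in>E - {rep D (v - w)}. u e ~= 0))"
  for j :: "'a set \<times> 'a \<times> 'a" and u :: "'a => real"
 define I1 where "I1 = Sigma \<L> (\<lambda>J. J)"
 define I2 where "I2 = {(J, v, w). J \<in> \<L> & is_edge J v w}"
 have fin1: "finite I1" unfolding I1_def using fin finJ by blast
 have fin2: "finite I2"
  by (rule finite_subset[of _ "\<L> \<times> \<Union>\<L> \<times> \<Union>\<L>"]) (use fin finJ in \<open>auto simp: I2_def is_edge_def\<close>)
 have ex1: "\<exists>u. P1 j u" if j1: "j \<in> I1" for j
 proof -
  obtain J v where j: "j = (J, v)" "J \<in> \<L>" "v \<in> J" using j1 by (auto simp: I1_def)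
  have cJ: "convex_position J" using cp[OF j(2)] by blast
  have "\<exists>u :: 'a => real. linear u & (\<forall>x\<in>J - {v}. u x < u v) & (\<forall>e\<in>E. u e ~= 0)"
   by (rule convex_position_vertex[OF cJ j(3) finE E0]) blast
  then obtain u :: "'a => real" where u0: "linear u" "\<forall>x\<in>J - {v}. u x < u v" "\<forall>e\<in>E. u e ~= 0" by blast
  note u = u0(1) u0(2,3)[rule_format]
  have "top_set u J = {v}" using j(3) u(2) by (intro top_set_singletonI)
  thus ?thesis using u j by (auto simp: P1_def)
 qed
 have ex2: "\<exists>u. P2 j u" if j2: "j \<in> I2" for j
 proof -
  obtain J v w where j: "j = (J, v, w)" "J \<in> \<L>" "is_edge J v w" using j2 by (auto simp: I2_def)
  have vw: "v \<in> J" "w \<in> J" "v ~= w" using j(3) by (auto simp: is_edge_def)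
  have d: "v - w \<in> D" by (rule dir[OF j(2) vw])
  have r: "rep D (v - w) \<in> E" "span {rep D (v - w)} = span {v - w}" using rep_props[OF d] d by (auto simp: E_def)
  have out: "e \<notin> span {v - w}" if "e \<in> E - {rep D (v - w)}" for e
   using rep_unique[OF _ _ D0, of e "rep D (v - w)"] that r by (auto simp: E_def)
  have finE': "finite (E - {rep D (v - w)})" using finE by simp
  have "\<exists>u :: 'a => real. linear u & u v = u w & (\<forall>x\<in>J - {v, w}. u x < u v) & (\<forall>e\<in>E - {rep D (v - w)}. u e ~= 0)"
   by (rule is_edge_generic[OF j(3) finJ[OF j(2)] finE']) (use out in blast)+
  then obtain u :: "'a => real" where u0: "linear u" "u v = u w" "\<forall>x\<in>J - {v, w}. u x < u v" "\<forall>e\<in>E - {rep D (v - w)}. u e ~= 0" by blast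
  note u = u0(1,2) u0(3,4)[rule_format]
  have "rep D (v - w) \<in> span {v - w}" using r(2) by (metis span_base singletonI)
  then obtain k where "rep D (v - w) = k *R (v - w)" by (auto simp: span_singleton)
  hence "u (rep D (v - w)) = 0" using u(1,2) by (simp add: linear_scale linear_diff)
  moreover have "top_set u J = {v, w}" using vw(1,2) u(2,3) by (intro top_set_pairI)
  ultimately show ?thesis using u(1,4) j(1) by (auto simp: P2_def)
 qed
 have "\<forall>j\<in>I1. \<exists>u. P1 j u" "\<forall>j\<in>I2. \<exists>u. P2 j u" using ex1 ex2 by blast+
 then obtain f1 f2 where f1: "\<forall>j\<in>I1. P1 j (f1 j)" and f2: "\<forall>j\<in>I2. P2 j (f2 j)"
  by (elim bchoice[THEN exE])
 define U where "U = f1 ` I1 \<union> f2 ` I2"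
 have lin: "linear u" if "u \<in> U" for u using that f1 f2 by (auto simp: U_def P1_def P2_def)
 have one: "e = e'" if "u \<in> U" "e \<in> E" "e' \<in> E" "u e = 0" "u e' = 0" for u e e'
 proof -
  from that(1) show ?thesis
   unfolding U_def
  proof (elim UnE imageE)
   fix j assume "u = f1 j" "j \<in> I1"
   hence "P1 j u" using f1 by simp
   thus ?thesis using that by (simp add: P1_def)
  next
   fix j assume "u = f2 j" "j \<in> I2"
   hence "P2 j u" using f2 by simp
   moreover obtain J v w where "j = (J, v, w)" by (cases j)
   ultimately have "\<forall>e\<in>E - {rep D (v - w)}. u e ~= 0" by (simp add: P2_def)
   thus ?thesis using that(2-5) by blast
  qed
 qed
 have nonconst: "\<exists>x\<in>J. \<exists>y\<in>J. u x ~= u y" if u: "linear u" "\<And>e e'. e \<in> E ==> e' \<in> E ==> u e = 0 ==> u e' = 0 ==> e = e'" and J: "J \<in> \<L>"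
  for u :: "'a => real" and J
 proof (rule ccontr)
  assume "\<not> ?thesis"
  hence c: "u x = u y" if "x \<in> J" "y \<in> J" for x y using that by blast
  have cJ: "convex_position J" "card J >= 3" using cp[OF J] by auto
  obtain v w w' where v: "v \<in> J" "w \<in> J" "w' \<in> J" "v ~= w" "v ~= w'" "v - w' \<notin> span {v - w}"
   by (rule is_edge_two_directions[OF cJ])
  have z: "rep D (v - z) \<in> E & span {rep D (v - z)} = span {v - z} & u (rep D (v - z)) = 0" if "z \<in> J" "v ~= z" for z
  proof -
   have d: "v - z \<in> D" by (rule dir[OF J v(1) that])
   have r: "rep D (v - z) \<in> E" "span {rep D (v - z)} = span {v - z}" using rep_props[OF d] d by (auto simp: E_def)
   have "rep D (v - z) \<in> span {v - z}" using r(2) by (metis span_base singletonI)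
   then obtain k where "rep D (v - z) = k *R (v - z)" by (auto simp: span_singleton)
   hence "u (rep D (v - z)) = 0" using u(1) c[OF v(1) that(1)] by (simp add: linear_scale linear_diff)
   thus ?thesis using r by blast
  qed
  have "rep D (v - w) = rep D (v - w')" using u(2) z[OF v(2,4)] z[OF v(3,5)] by blast
  hence "span {v - w} = span {v - w'}" using z[OF v(2,4)] z[OF v(3,5)] by metis
  thus False using v(6) by (metis span_base singletonI)
 qed
 have "zf \<notin> U"
 proof
  assume "zf \<in> U"
  hence "linear (zf :: 'a => real)" "\<And>e e'. e \<in> E ==> e' \<in> E ==> e = e'" using lin one by auto
  moreover obtain J where "J \<in> \<L>" using fin(2) by blast
  ultimately show False using nonconst[of zf J] by blast
 qed
 moreover have "adequate U E D J" if J: "J \<in> \<L>" for J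
  unfolding adequate_def
 proof (intro conjI ballI allI impI)
  fix v assume v: "v \<in> J"
  hence "(J, v) \<in> I1" using J by (simp add: I1_def)
  hence "f1 (J, v) \<in> U" "top_set (f1 (J, v)) J = {v}" using f1 by (auto simp: U_def P1_def)
  thus "\<exists>u\<in>U. top_set u J = {v}" by blast
 next
  fix v w assume e: "is_edge J v w"
  hence j: "(J, v, w) \<in> I2" using J by (simp add: I2_def)
  hence p: "P2 (J, v, w) (f2 (J, v, w))" using f2 by blast
  have vw: "v \<in> J" "w \<in> J" "v ~= w" using e by (auto simp: is_edge_def)
  have d: "v - w \<in> D" by (rule dir[OF J vw])
  have "vis U E J (f2 (J, v, w)) (rep D (v - w)) v w"
   unfolding vis_def using p j vw(3) d rep_props[OF d] by (auto simp: P2_def U_def E_def span_base)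
  thus "\<exists>u. vis U E J u (rep D (v - w)) v w" by blast
 next
  fix u assume "u \<in> U"
  thus "\<exists>x\<in>J. \<exists>y\<in>J. u x ~= u y" using nonconst[of u J] lin one J by blast
 qed
 moreover have "finite U" unfolding U_def using fin1 fin2 by simp
 ultimately show ?thesis using that[of U] lin one by blast
qed

lemma vis_commute: "vis U E J u e v w ==> vis U E J u e w v"
proof -
 assume v: "vis U E J u e v w"
 have "w - v = - (v - w)" by simp
 hence "w - v \<in> span {e}" using v span_neg unfolding vis_def by metis
 thus ?thesis using v by (auto simp: vis_def insert_commute)
qed

lemma linkedI:
 assumes m: "m \<in> J'" "\<And>v. v \<in> J' ==> (v, m) \<in> {(v, w). v \<in> J' & w \<in> J' & (\<exists>u e. vis U E J u e v w)}\<^sup>*"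
 shows "linked U E J J'"
 unfolding linked_def
proof (intro ballI)
 let ?R = "{(v, w). v \<in> J' & w \<in> J' & (\<exists>u e. vis U E J u e v w)}"
 fix v w assume "v \<in> J'" "w \<in> J'"
 hence vm: "(v, m) \<in> ?R\<^sup>*" and wm: "(w, m) \<in> ?R\<^sup>*" using m(2) by auto
 have "sym ?R" unfolding sym_def using vis_commute by fast
 hence "sym (?R\<^sup>*)" by (rule sym_rtrancl)
 hence "(m, w) \<in> ?R\<^sup>*" using wm by (rule symD)
 thus "(v, w) \<in> ?R\<^sup>*" using vm by (rule rtrancl_trans[rotated])
qed

text \<open>Descent along edges of \<open>J\<close> on which \<open>f\<close> decreases leads from
  any vertex to the minimum and never leaves the lower set \<open>J'\<close>.\<close>

lemma linked_lower:
 fixes f :: "'a::real_vector => real"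
 assumes J: "convex_position J" "adequate U E D J" "linear f" "inj_on f J" "J' \<subseteq> J" "J' ~= {}"
  and low: "\<And>x y. x \<in> J' ==> y \<in> J ==> f y < f x ==> y \<in> J'"
 shows "linked U E J J'"
proof -
 let ?R = "{(v, w). v \<in> J' & w \<in> J' & (\<exists>u e. vis U E J u e v w)}"
 have fin: "finite J'" using J(1,5) finite_subset by (auto simp: convex_position_def)
 have "Min (f ` J') \<in> f ` J'" using fin J(6) by (intro Min_in) auto
 then obtain m where m: "m \<in> J'" "f m = Min (f ` J')" by auto
 have mle: "f m <= f x" if "x \<in> J'" for x using m(2) fin that by simp
 have "(v, m) \<in> ?R\<^sup>*" if "v \<in> J'" for v
  using that
 proof (induction "card {x \<in> J'. f x < f v}" arbitrary: v rule: less_induct)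
  case less
  show ?case
  proof (cases "v = m")
   case True
   thus ?thesis by simp
  next
   case False
   have "f m ~= f v" using J(4,5) m(1) less.prems False unfolding inj_on_def by blast
   hence "f m < f v" using mle[OF less.prems] by simp
   then obtain w where w: "is_edge J v w" "f w < f v"
    using is_edge_improve[OF J(1) _ J(3), of v m] less.prems m(1) J(5) by blast
   hence wJ: "w \<in> J'" using low[OF less.prems] by (auto simp: is_edge_def)
   have "{x \<in> J'. f x < f w} \<subset> {x \<in> J'. f x < f v}" using w(2) wJ by force
   hence "card {x \<in> J'. f x < f w} < card {x \<in> J'. f x < f v}" using fin by (intro psubset_card_mono) auto
   hence "(w, m) \<in> ?R\<^sup>*" using less.hyps wJ by blast
   moreover have "\<exists>u. vis U E J u (rep D (v - w)) v w" using J(2) w(1) unfolding adequate_def by (elim conjE) simp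
   hence "(v, w) \<in> ?R" using less.prems wJ by auto
   ultimately show ?thesis by (rule converse_rtrancl_into_rtrancl[rotated])
  qed
 qed
 thus ?thesis by (rule linkedI[OF m(1)])
qed

section \<open>Cutting off vertices; parallelograms and zonotopes\<close>

definition drop_top :: "('a => real) => 'a set => 'a set" where
 "drop_top f J = {x \<in> J. \<exists>y\<in>J. f x < f y}"

text \<open>Used with \<open>n = card J - 3\<close>, so that the list, when nonempty, ends in a
  triangle. Each removed vertex has two edges in the level it is removed from, and they suffice to
  reconstruct it from the next level.\<close>

fun levels :: "('a => real) => nat => 'a set => 'a set list" where
 "levels f 0 J = []"
| "levels f (Suc n) J = drop_top f J # levels f n (drop_top f J)"

lemma drop_top_eq:
 assumes "finite J" "J ~= {}" "inj_on f J"
 obtains p where "p \<in> J" "drop_top f J = J - {p}" "\<And>x. x \<in> J - {p} ==> f x < (f p :: real)"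
proof -
 have "Max (f ` J) \<in> f ` J" using assms by (intro Max_in) auto
 then obtain p where p: "p \<in> J" "f p = Max (f ` J)" by auto
 have le: "f x <= f p" if "x \<in> J" for x using p assms(1) that by simp
 have lt: "f x < f p" if "x \<in> J - {p}" for x using le[of x] that assms(3) p(1) unfolding inj_on_def by (metis DiffE insertI1 order_less_le)
 have "drop_top f J = J - {p}" unfolding drop_top_def using lt p(1) le by (force simp: not_less)
 thus ?thesis using that p lt by blast
qed

lemma levels_props:
 assumes "convex_position J" "card J = n + 3" "inj_on f J"
 shows "\<forall>K\<in>set (levels f n J). convex_position K & card K >= 3 & K \<subseteq> J"
 using assms
proof (induction n arbitrary: J)
 case 0
 thus ?case by simp
next
 case (Suc n)
 have J: "finite J" "J ~= {}" using Suc.prems by (auto simp: convex_position_def)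
 obtain p where p: "p \<in> J" "drop_top f J = J - {p}" "\<And>x. x \<in> J - {p} ==> f x < f p" by (rule drop_top_eq[OF J Suc.prems(3)]) blast
 have K: "convex_position (drop_top f J)" "card (drop_top f J) = n + 3" "inj_on f (drop_top f J)" "drop_top f J \<subseteq> J"
  using convex_position_subset[OF Suc.prems(1), of "J - {p}"] Suc.prems p J by (auto simp: inj_on_diff)
 show ?case using Suc.IH[OF K(1-3)] K by auto
qed

lemma levels_static:
 fixes f :: "'a::real_vector => real"
 assumes "convex_position J" "card J = n + 3" "inj_on f J" "linear f"
  "\<And>K. K \<in> insert J (set (levels f n J)) ==> adequate U E D K"
 shows "chain_static U E J (levels f n J) & chain_adm U J (levels f n J)"
 using assms
proof (induction n arbitrary: J)
 case 0
 thus ?case by simp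
next
 case (Suc n)
 have J: "finite J" "J ~= {}" using Suc.prems by (auto simp: convex_position_def)
 obtain p where p: "p \<in> J" "drop_top f J = J - {p}" "\<And>x. x \<in> J - {p} ==> f x < f p" by (rule drop_top_eq[OF J Suc.prems(3)]) blast
 define J' where "J' = drop_top f J"
 have K: "convex_position J'" "card J' = n + 3" "inj_on f J'" "J' \<subseteq> J"
  using convex_position_subset[OF Suc.prems(1), of "J - {p}"] Suc.prems p J by (auto simp: inj_on_diff J'_def)
 have "adequate U E D K" if "K \<in> insert J' (set (levels f n J'))" for K
  using Suc.prems(5)[of K] that by (auto simp: J'_def)
 hence IH: "chain_static U E J' (levels f n J')" "chain_adm U J' (levels f n J')"
  using Suc.IH[OF K(1-3) Suc.prems(4)] by blast+
 have ad: "adequate U E D J" "adequate U E D J'" using Suc.prems(5) by (auto simp: J'_def)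
 have ne: "J' ~= {}" using K(2) by auto
 have two: "\<exists>v\<in>J'. \<exists>w\<in>J'. v ~= w"
 proof (rule ccontr)
  assume "\<not> ?thesis"
  hence "\<forall>v\<in>J'. \<forall>w\<in>J'. v = w" by blast
  hence "card J' <= Suc 0" using card_le_Suc0_iff_eq[OF finite_subset[OF K(4) J(1)]] by blast
  thus False using K(2) by simp
 qed
 have low: "y \<in> J'" if "x \<in> J'" "y \<in> J" "f y < f x" for x y
  using that p(2,3) unfolding J'_def p(2) by fastforce
 have lk: "linked U E J J'" by (rule linked_lower[OF Suc.prems(1) ad(1) Suc.prems(4,3) K(4) ne low])
 have ex: "\<forall>v\<in>J'. \<exists>u\<in>U. top_set u J = {v}" using ad(1) K(4) unfolding adequate_def by blast
 have nc: "\<forall>u\<in>U. \<exists>x\<in>J'. \<exists>y\<in>J'. u x ~= u y" using ad(2) unfolding adequate_def by blast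
 show ?case unfolding levels.simps J'_def[symmetric] using IH K(4) ne two lk ex nc by simp
qed

lemma convex_positionI:
 assumes "finite J" "\<And>v. v \<in> J ==> \<exists>u :: 'a::real_vector => real. linear u & (\<forall>x\<in>J - {v}. u x < u v)"
 shows "convex_position J"
 unfolding convex_position_def
proof (intro conjI ballI assms(1) notI)
 fix v assume v: "v \<in> J" "v \<in> convex hull (J - {v})"
 obtain u :: "'a => real" where u: "linear u" "\<forall>x\<in>J - {v}. u x < u v" using assms(2)[OF v(1)] by blast
 have "u y < u v" if "y \<in> convex hull (J - {v})" for y
 proof -
  have "convex {y. u y < u v}"
   unfolding convex_alt using u(1) by (auto simp: linear_add linear_scale convex_bound_lt)
  hence "convex hull (J - {v}) \<subseteq> {y. u y < u v}" using u(2) by (intro hull_minimal) auto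
  thus ?thesis using that by blast
 qed
 thus False using v(2) by blast
qed

lemma nondeg_dual:
 assumes "nondeg a b"
 obtains \<alpha> \<beta> :: "'a::real_vector => real" where "linear \<alpha>" "linear \<beta>" "\<alpha> a = 1" "\<alpha> b = 0" "\<beta> a = 0" "\<beta> b = 1"
proof -
 have ab: "a \<notin> span {b}" "b \<notin> span {a}"
  using assms span_singleton_sym[of b a] by (auto simp: nondeg_def)
 obtain \<alpha> :: "'a => real" where "linear \<alpha>" "\<forall>x\<in>span {b}. \<alpha> x = 0" "\<alpha> a = 1"
  by (rule exists_linear_functional[OF ab(1)]) blast
 moreover obtain \<beta> :: "'a => real" where "linear \<beta>" "\<forall>x\<in>span {a}. \<beta> x = 0" "\<beta> b = 1"
  by (rule exists_linear_functional[OF ab(2)]) blast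
 ultimately show ?thesis using that by (simp add: span_base)
qed

lemma parallelogram_edges:
 fixes a b :: "'a::real_vector"
 assumes "nondeg a b"
 shows "a ~= 0" "b ~= 0" "a ~= b" "a + b ~= 0" "convex_position {0, a, a + b, b}" "card {0, a, a + b, b} = 4"
  "is_edge {0, a, a + b, b} 0 a" "is_edge {0, a, a + b, b} b (a + b)" "is_edge {0, a, a + b, b} 0 b" "is_edge {0, a, a + b, b} a (a + b)"
  "is_edge {0, a, a + b} 0 (a + b)" "is_edge {a, a + b, b} a b"
proof -
 obtain \<alpha> \<beta> :: "'a => real" where ab: "linear \<alpha>" "linear \<beta>" "\<alpha> a = 1" "\<alpha> b = 0" "\<beta> a = 0" "\<beta> b = 1"
  by (rule nondeg_dual[OF assms])
 have z: "\<alpha> 0 = 0" "\<beta> 0 = 0" "\<alpha> (a + b) = 1" "\<beta> (a + b) = 1" using ab by (simp_all add: linear_0 linear_add)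
 show n: "a ~= 0" "b ~= 0" "a ~= b" "a + b ~= 0" using ab z by auto
 thus "card {0, a, a + b, b} = 4" by auto
 define u where "u s t = (\<lambda>x. s * \<alpha> x + t * \<beta> x)" for s t
 have lin: "linear (u s t)" for s t
  unfolding u_def using ab(1,2) by (auto simp: linear_iff algebra_simps)
 have uv: "u s t 0 = 0" "u s t a = s" "u s t b = t" "u s t (a + b) = s + t" for s t
  using ab z by (simp_all add: u_def)
 show "is_edge {0, a, a + b, b} 0 a" unfolding is_edge_def using n
  by (intro conjI exI[of _ "u 0 (-1)"] lin) (auto simp: uv)
 show "is_edge {0, a, a + b, b} b (a + b)" unfolding is_edge_def using n
  by (intro conjI exI[of _ "u 0 1"] lin) (auto simp: uv)
 show "is_edge {0, a, a + b, b} 0 b" unfolding is_edge_def using n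
  by (intro conjI exI[of _ "u (-1) 0"] lin) (auto simp: uv)
 show "is_edge {0, a, a + b, b} a (a + b)" unfolding is_edge_def using n
  by (intro conjI exI[of _ "u 1 0"] lin) (auto simp: uv)
 show "is_edge {0, a, a + b} 0 (a + b)" unfolding is_edge_def using n
  by (intro conjI exI[of _ "u (-1) 1"] lin) (auto simp: uv)
 show "is_edge {a, a + b, b} a b" unfolding is_edge_def using n
  by (intro conjI exI[of _ "u (-1) (-1)"] lin) (auto simp: uv)
 show "convex_position {0, a, a + b, b}"
 proof (rule convex_positionI)
  fix v assume "v \<in> {0, a, a + b, b}"
  then consider "v = 0" | "v = a" | "v = a + b" | "v = b" by blast
  thus "\<exists>u :: 'a => real. linear u & (\<forall>x\<in>{0, a, a + b, b} - {v}. u x < u v)"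
  proof cases
   case 1 thus ?thesis by (intro exI[of _ "u (-1) (-1)"] conjI lin) (auto simp: uv)
  next
   case 2 thus ?thesis by (intro exI[of _ "u 1 (-1)"] conjI lin) (auto simp: uv)
  next
   case 3 thus ?thesis by (intro exI[of _ "u 1 1"] conjI lin) (auto simp: uv)
  next
   case 4 thus ?thesis by (intro exI[of _ "u (-1) 1"] conjI lin) (auto simp: uv)
  qed
 qed simp
qed

text \<open>All signed sums are kept, including those that are no vertices; only the sets on which
  functionals are maximal matter. The central symmetry makes these maxima positive.\<close>

definition zonotope :: "'a::real_vector set => 'a set" where
 "zonotope E = (\<lambda>A. \<Sum>e\<in>E. (if e \<in> A then e else - e)) ` Pow E"

lemma zonotope_max:
 fixes u :: "'a::real_vector => real"
 assumes "finite E" "linear u" "e \<in> E" "u e ~= 0"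
 shows "finite (zonotope E)" "zonotope E ~= {}" "Max (u ` zonotope E) > 0"
proof -
 show f: "finite (zonotope E)" "zonotope E ~= {}" using assms(1) by (auto simp: zonotope_def)
 define A where "A = {e \<in> E. u e > 0}"
 define z where "z = (\<Sum>e\<in>E. (if e \<in> A then e else - e))"
 have "u z = (\<Sum>e\<in>E. \<bar>u e\<bar>)"
  unfolding z_def linear_sum[OF assms(2)] using assms(2) by (intro sum.cong) (auto simp: A_def linear_neg)
 moreover have "(\<Sum>e\<in>E. \<bar>u e\<bar>) > 0" using assms by (intro sum_pos2[of E e]) auto
 moreover have "z \<in> zonotope E" unfolding z_def zonotope_def by (rule image_eqI[of _ _ A]) (auto simp: A_def)
 hence "u z <= Max (u ` zonotope E)" using f by simp
 ultimately show "Max (u ` zonotope E) > 0" by linarith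
qed

text \<open>At a maximum the sign of every other vector is dictated by \<open>u\<close>, and that of
  \<open>e\<close> is free.\<close>

lemma zonotope_top:
 fixes u :: "'a::real_vector => real"
 assumes "finite E" "linear u" "e \<in> E" "u e = 0" "\<And>e'. e' \<in> E - {e} ==> u e' ~= 0"
 shows "\<exists>z. top_set u (zonotope E) = {z + e, z - e}"
proof -
 define s where "s A = (\<Sum>e\<in>E. (if e \<in> A then e else - e))" for A
 define A where "A = {e \<in> E. u e > 0}"
 define z where "z = (\<Sum>e\<in>E - {e}. (if e \<in> A then e else - e))"
 have eA: "e \<notin> A" using assms(4) by (simp add: A_def)
 have u: "u (s B) = (\<Sum>e\<in>E. if e \<in> B then u e else - u e)" for B
  unfolding s_def linear_sum[OF assms(2)] using assms(2) by (intro sum.cong) (auto simp: linear_neg)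
 have le: "u (s B) <= (\<Sum>e\<in>E. \<bar>u e\<bar>)" for B unfolding u by (rule sum_mono) auto
 have s1: "s A = z - e"
  unfolding s_def z_def using sum.remove[OF assms(1,3), of "\<lambda>e. if e \<in> A then e else - e"] eA by simp
 have "(\<Sum>e\<in>E - {e}. (if e \<in> insert e' A then e else - e)) = z" if "e' = e" for e'
  unfolding z_def by (rule sum.cong) (use that in auto)
 hence s2: "s (insert e A) = z + e"
  unfolding s_def using sum.remove[OF assms(1,3), of "\<lambda>x. if x \<in> insert e A then x else - x"] by simp
 have eq: "u (s B) = (\<Sum>e\<in>E. \<bar>u e\<bar>)" if "B \<in> {A, insert e A}" for B
  unfolding u by (rule sum.cong) (use that assms(4) in \<open>auto simp: A_def\<close>)
 have conv: "B \<in> {A, insert e A}" if B: "B \<subseteq> E" "u (s B) = (\<Sum>e\<in>E. \<bar>u e\<bar>)" for B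
 proof -
  have "(if x \<in> B then u x else - u x) = \<bar>u x\<bar>" if "x \<in> E" for x
  proof (rule ccontr)
   assume "(if x \<in> B then u x else - u x) ~= \<bar>u x\<bar>"
   hence "(if x \<in> B then u x else - u x) < \<bar>u x\<bar>" by (auto simp: abs_if split: if_splits)
   hence "u (s B) < (\<Sum>e\<in>E. \<bar>u e\<bar>)" unfolding u using that assms(1) by (intro sum_strict_mono_ex1 bexI[of _ x]) auto
   thus False using B(2) by simp
  qed
  hence "x \<in> B \<longleftrightarrow> x \<in> A" if "x \<in> E - {e}" for x
   using assms(5)[OF that] that by (fastforce simp: A_def abs_if split: if_splits)
  hence "B - {e} = A - {e}" using B(1) by (auto simp: A_def)
  thus ?thesis using eA by blast
 qed
 have Z: "zonotope E = s ` Pow E" by (simp add: zonotope_def s_def)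
 have AE: "A \<subseteq> E" "insert e A \<subseteq> E" using assms(3) by (auto simp: A_def)
 have "top_set u (zonotope E) = s ` {A, insert e A}"
 proof
  show "top_set u (zonotope E) \<subseteq> s ` {A, insert e A}"
  proof
   fix x assume "x \<in> top_set u (zonotope E)"
   then obtain B where B: "B \<subseteq> E" "x = s B" "u (s A) <= u (s B)" unfolding top_set_def Z using AE by auto
   hence "u (s B) = (\<Sum>e\<in>E. \<bar>u e\<bar>)" using le[of B] eq[of A] by simp
   thus "x \<in> s ` {A, insert e A}" using conv[OF B(1)] B(2) by blast
  qed
  show "s ` {A, insert e A} \<subseteq> top_set u (zonotope E)"
   unfolding top_set_def Z using AE eq le by auto
 qed
 hence "top_set u (zonotope E) = {z + e, z - e}" using s1 s2 by auto
 thus ?thesis by blast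
qed

section \<open>The polytope over a configuration and its realizations\<close>

lemma rel4_trivial:
 assumes "\<not> rel4 a b c d"
 shows "card {a, b, c, d} = 4" "independent {a, b, c, d}"
proof -
 have r: "\<alpha> = 0 & \<beta> = 0 & \<gamma> = 0 & \<delta> = 0" if "\<alpha> *R a + \<beta> *R b + \<gamma> *R c + \<delta> *R d = 0" for \<alpha> \<beta> \<gamma> \<delta>
  using assms that unfolding rel4_def by auto
 have n: "a ~= b" "a ~= c" "a ~= d" "b ~= c" "b ~= d" "c ~= d"
  using r[of 1 "-1" 0 0] r[of 1 0 "-1" 0] r[of 1 0 0 "-1"] r[of 0 1 "-1" 0] r[of 0 1 0 "-1"] r[of 0 0 1 "-1"] by auto
 thus "card {a, b, c, d} = 4" by simp
 have fin: "finite {a, b, c, d}" by simp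
 have "f v = 0" if f: "(\<Sum>v\<in>{a, b, c, d}. f v *R v) = 0" "v \<in> {a, b, c, d}" for f v
 proof -
  have "f a *R a + f b *R b + f c *R c + f d *R d = 0" using f(1) n by (simp add: add.assoc)
  thus ?thesis using r f(2) by auto
 qed
 thus "independent {a, b, c, d}"
  unfolding dependent_finite[OF fin] by blast
qed

lemma rel4_dim:
 assumes "finite S" "card S <= 3" "{a, b, c, d} \<subseteq> span S"
 shows "rel4 a b c d"
proof (rule ccontr)
 assume "\<not> rel4 a b c d"
 hence "card {a, b, c, d} = 4" "independent {a, b, c, d}" by (rule rel4_trivial)+
 thus False using independent_span_bound[OF assms(1) _ assms(3)] assms(2) by simp
qed

lemma rel4_dependent:
 assumes "rel4 a b c d"
 obtains S where "finite S" "card S <= 3" "{a, b, c, d} \<subseteq> span S"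
proof -
 obtain \<alpha> \<beta> \<gamma> \<delta> where c: "(\<alpha>, \<beta>, \<gamma>, \<delta>) ~= (0, 0, 0, 0)" "\<alpha> *R a + \<beta> *R b + \<gamma> *R c + \<delta> *R d = 0"
  using assms unfolding rel4_def by blast
 have main: "x \<in> span {y, z, w}" if "p ~= 0" "p *R x + q *R y + s *R z + t *R w = 0" for p q s t and x y z w :: 'a
 proof -
  have "p *R x + (q *R y + s *R z + t *R w) = 0" using that(2) by (simp add: add.assoc)
  hence "p *R x = - (q *R y + s *R z + t *R w)" by (rule eq_neg_iff_add_eq_0[THEN iffD2])
  also have "... \<in> span {y, z, w}" by (intro span_neg span_add span_scale span_base) auto
  finally have "(1 / p) *R (p *R x) \<in> span {y, z, w}" by (rule span_scale)
  thus ?thesis using that(1) by simp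
 qed
 have three: "card {y, z, w} <= 3" for y z w :: 'a by (simp add: card_insert_if)
 consider "\<alpha> ~= 0" | "\<beta> ~= 0" | "\<gamma> ~= 0" | "\<delta> ~= 0" using c(1) by auto
 thus ?thesis
 proof cases
  case 1
  hence "a \<in> span {b, c, d}" using main[of \<alpha> a \<beta> b \<gamma> c \<delta> d] c(2) by simp
  thus ?thesis using that[of "{b, c, d}"] three by (simp add: span_base)
 next
  case 2
  hence "b \<in> span {a, c, d}" using main[of \<beta> b \<alpha> a \<gamma> c \<delta> d] c(2) by (simp add: ac_simps)
  thus ?thesis using that[of "{a, c, d}"] three by (simp add: span_base)
 next
  case 3
  hence "c \<in> span {a, b, d}" using main[of \<gamma> c \<alpha> a \<beta> b \<delta> d] c(2) by (simp add: ac_simps)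
  thus ?thesis using that[of "{a, b, d}"] three by (simp add: span_base)
 next
  case 4
  hence "d \<in> span {a, b, c}" using main[of \<delta> d \<alpha> a \<beta> b \<gamma> c] c(2) by (simp add: ac_simps)
  thus ?thesis using that[of "{a, b, c}"] three by (simp add: span_base)
 qed
qed

lemma has_aff_dim_singleton: "has_aff_dim {v} 0"
 unfolding has_aff_dim_def by (rule exI[of _ "{v}"]) (simp add: affine_independent_1)

lemma has_aff_dim_zero:
 assumes "has_aff_dim V 0"
 obtains x where "V = {x}"
proof -
 obtain B where B: "B \<subseteq> V" "finite B" "independent (hat ` B)" "span (hat ` B) = span (hat ` V)" "int (card B) = 0 + 1"
  by (rule has_aff_dim_subset[OF assms])
 then obtain x where x: "B = {x}" by (metis add_0 card_1_singletonE of_nat_eq_1_iff)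
 have "y = x" if "y \<in> V" for y
 proof -
  have "hat y \<in> span (hat ` {x})" using B(4) x that by (metis imageI span_base)
  thus ?thesis by (auto simp: span_singleton hat_def)
 qed
 hence "V = {x}" using B(1) x by blast
 thus ?thesis by (rule that)
qed

lemma has_aff_dim_minus_one:
 assumes "has_aff_dim V (-1)"
 shows "V = {}"
proof -
 obtain B where B: "finite B" "affine hull B = affine hull V" "int (card B) = -1 + 1"
  using assms unfolding has_aff_dim_def by blast
 hence "affine hull V = {}" by simp
 thus ?thesis using hull_subset[of V affine] by simp
qed

lemma has_aff_dim_empty: "has_aff_dim {} (-1)"
 unfolding has_aff_dim_def by (rule exI[of _ "{}"]) (simp add: affine_dependent_def)

text \<open>The part of an isomorphism of face lattices that is used later, stated for the vertices
  of \<open>B\<close>; \<open>\<rho>\<close> is arbitrary elsewhere. The last clause, for disjoint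
  faces, serves to control signs.\<close>

definition vertex_map :: "'a::real_vector set => 'b::real_vector set => ('a => 'b) => bool" where
 "vertex_map B S \<rho> \<longleftrightarrow>
   (\<forall>G v. G face_of B --> v \<in> vertices B - G --> hat (\<rho> v) \<notin> span (hat ` \<rho> ` (vertices B \<inter> G))) &
   (\<forall>G k. G face_of B --> has_aff_dim G k --> has_aff_dim (\<rho> ` (vertices B \<inter> G)) k) &
   (\<forall>G G' x. G face_of B --> G' face_of B --> G \<inter> G' = {} --> x \<in> convex hull (\<rho> ` (vertices B \<inter> G')) -->
    hat x \<notin> span (hat ` \<rho> ` (vertices B \<inter> G)))"

text \<open>Dimension is an invariant of the lattice, so faces of dimension 0 correspond and define
  \<open>\<rho>\<close>. If a point of one of two disjoint faces were in the span of the other,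
  their realizations would have a nonempty intersection, a face whose counterpart in
  \<open>B\<close> could only be empty.\<close>

lemma realization_vertex_map:
 assumes R0: "realization r B F0" and R: "realization r S F"
 obtains \<rho> where "vertex_map B S \<rho>" "\<forall>a\<in>Field r. F a = convex hull (\<rho> ` (vertices B \<inter> F0 a))"
proof -
 have B: "polytope B" "bij_betw F0 (Field r) {G. G face_of B}" "\<And>a b. a \<in> Field r ==> b \<in> Field r ==> (a, b) \<in> r \<longleftrightarrow> F0 a \<subseteq> F0 b"
  using R0 by (auto simp: realization_def)
 have S: "polytope S" "bij_betw F (Field r) {G. G face_of S}" "\<And>a b. a \<in> Field r ==> b \<in> Field r ==> (a, b) \<in> r \<longleftrightarrow> F a \<subseteq> F b"
  using R by (auto simp: realization_def)
 have face0: "\<exists>a\<in>Field r. F0 a = G" if "G face_of B" for G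
  using bij_betw_imp_surj_on[OF B(2)] that by (metis (mono_tags, lifting) imageE mem_Collect_eq)
 have face1: "\<exists>a\<in>Field r. F a = G" if "G face_of S" for G
  using bij_betw_imp_surj_on[OF S(2)] that by (metis (mono_tags, lifting) imageE mem_Collect_eq)
 have fF: "F a face_of S" "F0 a face_of B" if "a \<in> Field r" for a
  using that bij_betwE[OF S(2)] bij_betwE[OF B(2)] by blast+
 have "\<exists>x. \<exists>a\<in>Field r. F0 a = {v} & F a = {x}" if v: "v \<in> vertices B" for v
 proof -
  obtain a where a: "a \<in> Field r" "F0 a = {v}" using face0[of "{v}"] v by (auto simp: vertices_def)
  have "has_aff_dim (F a) 0" by (rule realization_dim[OF R0 R a(1)]) (simp add: a(2) has_aff_dim_singleton)
  then obtain x where "F a = {x}" by (rule has_aff_dim_zero)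
  thus ?thesis using a by blast
 qed
 hence "\<forall>v\<in>vertices B. \<exists>x. \<exists>a\<in>Field r. F0 a = {v} & F a = {x}" by blast
 then obtain \<rho> where \<rho>: "\<forall>v\<in>vertices B. \<exists>a\<in>Field r. F0 a = {v} & F a = {\<rho> v}" by (rule bchoice[THEN exE])
 have mem: "v \<in> F0 a \<longleftrightarrow> \<rho> v \<in> F a" if mv: "v \<in> vertices B" and ma: "a \<in> Field r" for v a
 proof -
  obtain b where b: "b \<in> Field r" "F0 b = {v}" "F b = {\<rho> v}" using bspec[OF \<rho> mv] by blast
  show ?thesis using B(3)[OF b(1) ma] S(3)[OF b(1) ma] b by simp
 qed
 have \<rho>S: "\<rho> v \<in> S" if v: "v \<in> vertices B" for v
 proof -
  obtain b where b: "b \<in> Field r" "F b = {\<rho> v}" using bspec[OF \<rho> v] by blast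
  thus ?thesis using face_of_imp_subset[OF fF(1)[OF b(1)]] by simp
 qed
 have hull: "F a = convex hull (\<rho> ` (vertices B \<inter> F0 a))" if a: "a \<in> Field r" for a
 proof
  have "polytope (F a)" by (rule polytope_face_polytope[OF S(1) fF(1)[OF a]])
  hence eq: "convex hull (vertices (F a)) = F a" by (rule polytope_vertices(2))
  have "x \<in> \<rho> ` (vertices B \<inter> F0 a)" if x: "x \<in> vertices (F a)" for x
  proof -
   have xa: "{x} face_of F a" using x by (simp add: vertices_def)
   have "{x} face_of S" by (rule face_of_trans[OF xa fF(1)[OF a]])
   then obtain b where b: "b \<in> Field r" "F b = {x}" using face1 by blast
   have "has_aff_dim (F0 b) 0" by (rule realization_dim[OF R R0 b(1)]) (simp add: b(2) has_aff_dim_singleton)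
   then obtain v where v: "F0 b = {v}" by (rule has_aff_dim_zero)
   have vB: "v \<in> vertices B" using fF(2)[OF b(1)] v by (simp add: vertices_def)
   then obtain b' where b': "b' \<in> Field r" "F0 b' = {v}" "F b' = {\<rho> v}" using bspec[OF \<rho> vB] by blast
   have "b = b'" using bij_betw_imp_inj_on[OF B(2)] b(1) b'(1,2) v unfolding inj_on_def by metis
   hence "x = \<rho> v" using b(2) b'(3) by simp
   moreover have "x \<in> F a" using xa face_of_imp_subset by blast
   ultimately show ?thesis using mem[OF vB a] vB by blast
  qed
  hence "vertices (F a) \<subseteq> \<rho> ` (vertices B \<inter> F0 a)" by blast
  thus "F a \<subseteq> convex hull (\<rho> ` (vertices B \<inter> F0 a))" using hull_mono[of _ _ convex] eq by metis
  have "\<rho> ` (vertices B \<inter> F0 a) \<subseteq> F a" using mem[OF _ a] by blast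
  thus "convex hull (\<rho> ` (vertices B \<inter> F0 a)) \<subseteq> F a"
   using face_of_imp_convex[OF fF(1)[OF a]] polytope_imp_convex[OF S(1)] by (intro hull_minimal) auto
 qed
 have sp: "span (hat ` \<rho> ` (vertices B \<inter> F0 a)) = span (hat ` F a)" if "a \<in> Field r" for a
  unfolding hull[OF that] span_hat_convex_hull ..
 have "vertex_map B S \<rho>"
  unfolding vertex_map_def
 proof (intro conjI allI impI)
  fix G v assume G: "G face_of B" and v: "v \<in> vertices B - G"
  obtain a where a: "a \<in> Field r" "F0 a = G" using face0[OF G] by blast
  show "hat (\<rho> v) \<notin> span (hat ` \<rho> ` (vertices B \<inter> G))"
  proof
   assume "hat (\<rho> v) \<in> span (hat ` \<rho> ` (vertices B \<inter> G))"
   hence "hat (\<rho> v) \<in> span (hat ` F a)" using sp[OF a(1)] a(2) by simp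
   hence "\<rho> v \<in> F a" using face_of_hat_span[OF fF(1)[OF a(1)]] \<rho>S v by blast
   thus False using mem[of v a] v a by simp
  qed
 next
  fix G k assume G: "G face_of B" "has_aff_dim G k"
  obtain a where a: "a \<in> Field r" "F0 a = G" using face0[OF G(1)] by blast
  have "has_aff_dim (F a) k" by (rule realization_dim[OF R0 R a(1)]) (simp add: a(2) G(2))
  thus "has_aff_dim (\<rho> ` (vertices B \<inter> G)) k" unfolding hull[OF a(1)] has_aff_dim_convex_hull a(2) .
 next
  fix G G' x assume G: "G face_of B" "G' face_of B" "G \<inter> G' = {}" and x: "x \<in> convex hull (\<rho> ` (vertices B \<inter> G'))"
  obtain a where a: "a \<in> Field r" "F0 a = G" using face0[OF G(1)] by blast
  obtain a' where a': "a' \<in> Field r" "F0 a' = G'" using face0[OF G(2)] by blast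
  have xa': "x \<in> F a'" using x hull[OF a'(1)] a'(2) by simp
  hence xS: "x \<in> S" using face_of_imp_subset[OF fF(1)[OF a'(1)]] by blast
  show "hat x \<notin> span (hat ` \<rho> ` (vertices B \<inter> G))"
  proof
   assume "hat x \<in> span (hat ` \<rho> ` (vertices B \<inter> G))"
   hence "hat x \<in> span (hat ` F a)" using sp[OF a(1)] a(2) by simp
   hence xa: "x \<in> F a" by (rule face_of_hat_span[OF fF(1)[OF a(1)] xS])
   have "F a \<inter> F a' face_of S" by (rule face_of_Int[OF fF(1)[OF a(1)] fF(1)[OF a'(1)]])
   then obtain c where c: "c \<in> Field r" "F c = F a \<inter> F a'" using face1 by blast
   have "F0 c \<subseteq> G \<inter> G'" using c S(3)[OF c(1) a(1)] S(3)[OF c(1) a'(1)] B(3)[OF c(1) a(1)] B(3)[OF c(1) a'(1)] a(2) a'(2) by auto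
   hence "F0 c = {}" using G(3) by simp
   hence "has_aff_dim (F0 c) (-1)" by (simp add: has_aff_dim_empty)
   hence "has_aff_dim (F c) (-1)" by (rule realization_dim[OF R0 R c(1)])
   hence "F c = {}" by (rule has_aff_dim_minus_one)
   thus False using c(2) xa xa' by blast
  qed
 qed
 thus ?thesis using that hull by blast
qed

section \<open>The polytope over a configuration\<close>

definition labels :: "'a config => (nat \<times> 'a) set" where
 "labels C = Sigma (idx C) (fibre C)"

definition body :: "'a::real_vector config => ('a \<times> real \<times> real) set" where
 "body C = convex hull (point C ` labels C)"

lemma finite_labels: "wf_config C ==> finite (labels C)"
 unfolding labels_def wf_config_def by blast

lemma inj_point:
 assumes "wf_config C"
 shows "inj_on (point C) (labels C)"
proof (rule inj_onI)
 fix p q assume p: "p \<in> labels C" and q: "q \<in> labels C" and eq: "point C p = point C q"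
 have s: "snd p = snd q" "shadow C (fst p) = shadow C (fst q)" using eq by (auto simp: point_def)
 have i: "fst p \<in> idx C" "fst q \<in> idx C" using p q by (auto simp: labels_def)
 have "fcert C zf {fst p}" using assms i by (simp add: wf_config_def)
 then obtain L where L: "0 + L (shadow C (fst p)) = (0::real)" "\<forall>i\<in>idx C - {fst p}. 0 + L (shadow C i) < 0"
  unfolding fcert_def cert_def by auto
 have "fst p = fst q"
 proof (rule ccontr)
  assume "fst p ~= fst q"
  hence "L (shadow C (fst q)) < 0" using L(2) i by auto
  thus False using L(1) s(2) by simp
 qed
 thus "p = q" using s(1) by (simp add: prod_eq_iff)
qed

text \<open>The functional \<open>u\<close> on the fibre coordinate plus the linear part of the
  certificate on the shadow is maximal exactly at the labels of the face.\<close>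

lemma config_face:
 assumes wf: "wf_config C" and u: "linear u" and c: "fcert C u K"
 shows "convex hull (point C ` faceset C u K) face_of body C"
  and "\<And>p. p \<in> labels C ==> point C p \<in> convex hull (point C ` faceset C u K) ==> p \<in> faceset C u K"
proof -
 obtain L where L: "affine_fun L" "\<forall>i\<in>K. height (fibre C) u i + L (shadow C i) = 0"
  "\<forall>i\<in>idx C - K. height (fibre C) u i + L (shadow C i) < 0"
  using c unfolding fcert_def cert_def by blast
 have K: "K \<subseteq> idx C" by (rule fcert_idx[OF c])
 obtain a b k where abk: "L = (\<lambda>p. a * fst p + b * snd p + k)" using L(1) unfolding affine_fun_def by blast
 define f where "f p = u (fst p) + a * fst (snd p) + b * snd (snd p)" for p :: "'a \<times> real \<times> real"
 have lf: "linear f"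
  unfolding f_def using u by (auto simp: linear_iff algebra_simps)
 have fp: "f (point C p) = u (snd p) + L (shadow C (fst p)) - k" for p by (simp add: f_def point_def abk)
 have h: "u (snd p) <= height (fibre C) u (fst p)" if "p \<in> labels C" for p
  using that wf by (auto simp: labels_def height_def wf_config_def)
 have le: "f (point C p) <= - k" if "p \<in> labels C" for p
 proof -
  have "height (fibre C) u (fst p) + L (shadow C (fst p)) <= 0"
   using L(2,3) that by (cases "fst p \<in> K") (auto simp: labels_def intro: less_imp_le)
  thus ?thesis using h[OF that] fp[of p] by simp
 qed
 have eq: "f (point C p) = - k \<longleftrightarrow> p \<in> faceset C u K" if p: "p \<in> labels C" for p
 proof
  assume "f (point C p) = - k"
  hence s: "u (snd p) + L (shadow C (fst p)) = 0" using fp[of p] by simp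
  hence "fst p \<in> K" using h[OF p] L(3) p by (force simp: labels_def)
  moreover hence "u (snd p) = height (fibre C) u (fst p)" using s L(2) by force
  ultimately show "p \<in> faceset C u K" using p by (auto simp: faceset_def labels_def)
 next
  assume "p \<in> faceset C u K"
  thus "f (point C p) = - k" using L(2) fp[of p] by (auto simp: faceset_def)
 qed
 have sub: "faceset C u K \<subseteq> labels C" using K by (auto simp: faceset_def labels_def)
 have set: "{v \<in> point C ` labels C. f v = - k} = point C ` faceset C u K" using eq sub by blast
 have fin: "finite (point C ` labels C)" using finite_labels[OF wf] by simp
 have le': "\<And>v. v \<in> point C ` labels C ==> f v <= - k" using le by blast
 show "convex hull (point C ` faceset C u K) face_of body C"
  unfolding body_def set[symmetric] by (rule supporting_face_of[OF fin lf le'])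
 fix p assume p: "p \<in> labels C" "point C p \<in> convex hull (point C ` faceset C u K)"
 hence "f (point C p) = - k"
  using convex_hull_supporting[OF fin lf le'] unfolding set by blast
 thus "p \<in> faceset C u K" using eq p(1) by blast
qed

text \<open>Fibres may contain points that are not vertices of the polytope, such as inner sums of
  the zonotope; their labels are left out.\<close>

definition vlabels :: "'a::real_vector config => (nat \<times> 'a) set" where
 "vlabels C = {p \<in> labels C. point C p \<in> vertices (body C)}"

lemma vertices_face:
 assumes wf: "wf_config C" and u: "linear u" and c: "fcert C u K"
 shows "vertices (body C) \<inter> convex hull (point C ` faceset C u K) = point C ` (faceset C u K \<inter> vlabels C)"
proof
 show "vertices (body C) \<inter> convex hull (point C ` faceset C u K) \<subseteq> point C ` (faceset C u K \<inter> vlabels C)"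
 proof
  fix v assume v: "v \<in> vertices (body C) \<inter> convex hull (point C ` faceset C u K)"
  hence "v extreme_point_of body C" by (simp add: vertices_extreme)
  hence "v \<in> point C ` labels C" unfolding body_def by (rule extreme_point_of_convex_hull)
  then obtain p where p: "p \<in> labels C" "v = point C p" by blast
  hence "p \<in> faceset C u K" using config_face(2)[OF wf u c] v by blast
  thus "v \<in> point C ` (faceset C u K \<inter> vlabels C)" using p v by (auto simp: vlabels_def)
 qed
 show "point C ` (faceset C u K \<inter> vlabels C) \<subseteq> vertices (body C) \<inter> convex hull (point C ` faceset C u K)"
  using hull_subset[of "point C ` faceset C u K" convex] by (auto simp: vlabels_def)
qed

lemma config_vertex:
 assumes wf: "wf_config C" and u: "linear u" "fcert C u {i}" "faceset C u {i} = {p, q}"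
 shows "p \<in> vlabels C & q \<in> vlabels C"
proof -
 have f: "convex hull {point C p, point C q} face_of body C" using config_face(1)[OF wf u(1,2)] u(3) by simp
 have "convex_position {point C p, point C q}" unfolding convex_position_def by (auto simp: insert_Diff_if)
 hence "vertices (convex hull {point C p, point C q}) = {point C p, point C q}" by (rule convex_position_vertices)
 hence "{x} face_of convex hull {point C p, point C q}" if "x \<in> {point C p, point C q}" for x
  using that unfolding vertices_def by blast
 hence "x \<in> vertices (body C)" if "x \<in> {point C p, point C q}" for x
  using that face_of_trans[OF _ f] unfolding vertices_def by blast
 moreover have "{p, q} \<subseteq> labels C"
  using fcert_idx[OF u(2)] u(3)[symmetric] by (auto simp: faceset_def labels_def)
 ultimately show ?thesis by (auto simp: vlabels_def)
qed

text \<open>For \<open>quad\<close>: a dependence between the four points means that the face has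
  dimension at most 2. This dimension is kept by \<open>\<rho>\<close>, so the realized vertices lie
  in the span of three vectors.\<close>

lemma incidence_realization:
 assumes wf: "wf_config C" and hub: "0 \<in> idx C" "fibre C 0 = zonotope E"
  and E: "finite E" "0 \<notin> E" and U: "\<And>u. u \<in> U ==> linear u"
  and one: "\<And>u e e'. u \<in> U ==> e \<in> E ==> e' \<in> E ==> u e = 0 ==> u e' = 0 ==> e = e'"
  and vm: "vertex_map (body C) S \<rho>"
 shows "incidence U (zonotope E) E C (vlabels C) (\<lambda>p. hat (\<rho> (point C p)))"
proof (rule incidence.intro)
 have vm1: "hat (\<rho> v) \<notin> span (hat ` \<rho> ` (vertices (body C) \<inter> G))" if "G face_of body C" "v \<in> vertices (body C) - G" for G v
  using vm that unfolding vertex_map_def by blast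
 have vm2: "has_aff_dim (\<rho> ` (vertices (body C) \<inter> G)) k" if "G face_of body C" "has_aff_dim G k" for G k
  using vm that unfolding vertex_map_def by blast
 show "linear u" if "u \<in> U" for u by (rule U[OF that])
 show "wf_config C" "0 \<in> idx C" "fibre C 0 = zonotope E" "0 \<notin> E" by fact+
 show "\<exists>z. top_set u (zonotope E) = {z + e, z - e}" if "u \<in> U" "e \<in> E" "u e = 0" for u e
  by (rule zonotope_top[OF E(1) U[OF that(1)] that(2,3)]) (use one that in blast)
 show "p \<in> vlabels C & q \<in> vlabels C" if "linear u" "fcert C u {i}" "faceset C u {i} = {p, q}" for u i p q
  by (rule config_vertex[OF wf that])
 show "snd p \<in> fibre C (fst p)" if "p \<in> vlabels C" for p using that by (auto simp: vlabels_def labels_def)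
 show "hat (\<rho> (point C p)) \<notin> span {hat (\<rho> (point C q))}" if p: "p \<in> vlabels C" "q \<in> vlabels C" "p ~= q" for p q
 proof -
  have "point C p ~= point C q" using inj_point[OF wf] p by (auto simp: vlabels_def inj_on_def)
  moreover have v: "{point C q} face_of body C" "point C q \<in> vertices (body C)" "point C p \<in> vertices (body C)"
   using p by (auto simp: vlabels_def vertices_def)
  ultimately have "hat (\<rho> (point C p)) \<notin> span (hat ` \<rho> ` (vertices (body C) \<inter> {point C q}))" by (intro vm1) auto
  thus ?thesis using v(2) by simp
 qed
 show "hat (\<rho> (point C p)) ~= 0" for p by (simp add: hat_def zero_prod_def)
 show "hat (\<rho> (point C p)) \<notin> span ((\<lambda>p. hat (\<rho> (point C p))) ` (faceset C u K \<inter> vlabels C))"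
  if u: "linear u" "fcert C u K" and p: "p \<in> vlabels C" "p \<notin> faceset C u K" for u K p
 proof -
  have "point C p \<in> vertices (body C) - convex hull (point C ` faceset C u K)"
   using config_face(2)[OF wf u, of p] p by (auto simp: vlabels_def)
  from vm1[OF config_face(1)[OF wf u] this] show ?thesis
   unfolding vertices_face[OF wf u] by (simp add: image_image)
 qed
 show "rel4 (hat (\<rho> (point C p1))) (hat (\<rho> (point C p2))) (hat (\<rho> (point C p3))) (hat (\<rho> (point C p4)))"
  if u: "linear u" "fcert C u K" and f: "faceset C u K = {p1, p2, p3, p4}" "{p1, p2, p3, p4} \<subseteq> vlabels C"
   and r4: "rel4 (hat (point C p1)) (hat (point C p2)) (hat (point C p3)) (hat (point C p4))" for u K p1 p2 p3 p4
 proof -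
  define A where "A = {point C p1, point C p2, point C p3, point C p4}"
  have A: "point C ` faceset C u K = A" unfolding f(1) A_def by simp
  have finA: "finite A" by (simp add: A_def)
  obtain n where n: "has_aff_dim A (int n - 1)" by (rule has_aff_dim_exists[OF finA])
  obtain T where T: "finite T" "card T <= 3" "hat ` A \<subseteq> span T"
   using rel4_dependent[OF r4] unfolding A_def by (metis image_empty image_insert)
  obtain B where B: "B \<subseteq> A" "finite B" "independent (hat ` B)" "int (card B) = (int n - 1) + 1"
   by (rule has_aff_dim_subset[OF n])
  have "hat ` B \<subseteq> span T" using B(1) T(3) by blast
  hence "card (hat ` B) <= card T" using independent_span_bound[OF T(1) B(3)] by blast
  hence n3: "n <= 3" using card_image[OF inj_hat, of B] T(2) B(4) by simp
  have "has_aff_dim (convex hull A) (int n - 1)" using n by (simp add: has_aff_dim_convex_hull)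
  hence "has_aff_dim (\<rho> ` (vertices (body C) \<inter> convex hull (point C ` faceset C u K))) (int n - 1)"
   using vm2[OF config_face(1)[OF wf u]] A by simp
  moreover have "faceset C u K \<inter> vlabels C = {p1, p2, p3, p4}" using f by blast
  ultimately have "has_aff_dim (\<rho> ` A) (int n - 1)" unfolding vertices_face[OF wf u] by (simp add: A_def)
  then obtain B' where B': "B' \<subseteq> \<rho> ` A" "finite B'" "span (hat ` B') = span (hat ` \<rho> ` A)" "int (card B') = (int n - 1) + 1"
   by (rule has_aff_dim_subset) blast
  have "card (hat ` B') <= 3" using card_image_le[OF B'(2), of hat] B'(4) n3 by simp
  moreover have "{hat (\<rho> (point C p1)), hat (\<rho> (point C p2)), hat (\<rho> (point C p3)), hat (\<rho> (point C p4))} \<subseteq> span (hat ` B')"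
   unfolding B'(3) by (auto simp: A_def intro!: span_base)
  ultimately show ?thesis using rel4_dim[of "hat ` B'"] B'(2) by blast
 qed
qed

lemma has_aff_dim_span_basis:
 assumes "0 \<in> V" "has_aff_dim V d"
 obtains B where "finite B" "B \<subseteq> V" "independent B" "span B = span V" "int (card B) = d"
proof -
 obtain B where B: "B \<subseteq> V" "independent B" "V \<subseteq> span B" by (rule maximal_independent_subset)
 have sp: "span B = span V" using B(1,3) by (metis span_eq span_superset subset_trans)
 obtain A where A: "finite A" "affine hull A = affine hull V"
  using assms(2) unfolding has_aff_dim_def by blast
 have hV: "affine hull V = span V" using assms(1) by (intro affine_hull_span_0 hull_inc)
 have "B \<subseteq> span A" using B(1) hull_subset[of V affine] A(2) affine_hull_subset_span[of A] by blast
 hence fin: "finite B" using independent_span_bound[OF A(1) B(2)] by blast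
 have B0: "0 \<notin> B" using B(2) dependent_zero by blast
 have "independent ((\<lambda>x. - 0 + x) ` B)" using B(2) by simp
 hence "\<not> affine_dependent (insert 0 B)" unfolding affine_dependent_iff_dependent[OF B0] .
 moreover have "affine hull (insert 0 B) = affine hull V"
  using hV sp affine_hull_span_0[of "insert 0 B"] by (simp add: hull_inc span_insert_0)
 ultimately have "has_aff_dim V (int (card B))"
  unfolding has_aff_dim_def using fin B0 by (intro exI[of _ "insert 0 B"]) simp
 hence "int (card B) = d" using has_aff_dim_unique assms(2) by blast
 thus ?thesis using that fin B(1,2) sp by blast
qed

lemma has_aff_dim_image:
 assumes T: "linear T" "inj T" and A: "\<And>x. hat (A x) = T (hat x)" and d: "has_aff_dim V d"
 shows "has_aff_dim (A ` V) d"
proof -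
 obtain B where B: "finite B" "independent (hat ` B)" "span (hat ` B) = span (hat ` V)" "int (card B) = d + 1"
  using d unfolding has_aff_dim_hat by blast
 have im: "hat ` A ` S = T ` hat ` S" for S by (simp add: image_image A)
 have "inj A"
 proof (rule injI)
  fix x y assume "A x = A y"
  hence "T (hat x) = T (hat y)" using A by metis
  thus "x = y" using T(2) by (simp add: inj_eq hat_def)
 qed
 hence "int (card (A ` B)) = d + 1" using B(4) card_image[of A B] by (metis inj_on_subset subset_UNIV)
 moreover have "independent (hat ` A ` B)"
  unfolding im using B(2) T by (rule_tac linear_independent_injective_image) (auto intro: inj_on_subset)
 moreover have "span (hat ` A ` B) = span (hat ` A ` V)" unfolding im linear_span_image[OF T(1)] B(3) ..
 ultimately show ?thesis unfolding has_aff_dim_hat using B(1) by blast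
qed

lemma has_aff_dim_two_apexes:
 fixes V :: "'a::real_vector set"
 assumes "has_aff_dim V d"
 shows "has_aff_dim (insert (0, 1, 0) (insert (0, 0, 1) ((\<lambda>x. (x, 0::real, 0::real)) ` V))) (d + 2)"
proof -
 define j where "j x = (x, 0::real, 0::real)" for x :: 'a
 have 1: "has_aff_dim (j ` V) d"
 proof (rule has_aff_dim_image[OF _ _ _ assms])
  let ?q = "\<lambda>y. ((fst y, 0, 0), snd y) :: ('a \<times> real \<times> real) \<times> real"
  show "linear ?q" by (auto simp: linear_iff)
  show "inj ?q" by (auto simp: inj_def prod_eq_iff)
  show "hat (j x) = ?q (hat x)" for x by (simp add: hat_def j_def)
 qed
 define p2 :: "('a \<times> real \<times> real) \<times> real => real" where "p2 = (\<lambda>y. snd (snd (fst y)))"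
 define p1 :: "('a \<times> real \<times> real) \<times> real => real" where "p1 = (\<lambda>y. fst (snd (fst y)))"
 have pl: "linear p1" "linear p2" by (auto simp: p1_def p2_def linear_iff)
 have zero: "g y = 0" if "linear g" "\<And>x. x \<in> A ==> g x = 0" "y \<in> span A" for g :: "('a \<times> real \<times> real) \<times> real => real" and A y
  using linear_eq_0_on_span[OF that(1,2,3)] .
 have "hat (0, 0, 1) \<notin> span (hat ` j ` V)"
 proof
  assume "hat (0, 0, 1) \<in> span (hat ` j ` V)"
  hence "p2 (hat (0, 0, 1)) = 0" by (rule zero[OF pl(2), rotated]) (auto simp: p2_def hat_def j_def)
  thus False by (simp add: p2_def hat_def)
 qed
 hence 2: "has_aff_dim (insert (0, 0, 1) (j ` V)) (d + 1)" by (rule has_aff_dim_insert[OF 1])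
 have "hat (0, 1, 0) \<notin> span (hat ` insert (0, 0, 1) (j ` V))"
 proof
  assume "hat (0, 1, 0) \<in> span (hat ` insert (0, 0, 1) (j ` V))"
  hence "p1 (hat (0, 1, 0)) = 0" by (rule zero[OF pl(1), rotated]) (auto simp: p1_def hat_def j_def)
  thus False by (simp add: p1_def hat_def)
 qed
 hence "has_aff_dim (insert (0, 1, 0) (insert (0, 0, 1) (j ` V))) (d + 1 + 1)" by (rule has_aff_dim_insert[OF 2])
 thus ?thesis by (simp add: add.assoc j_def)
qed

lemma wf_cert_single:
 assumes "wf_config C" "fcert C u K" "i \<in> K"
 shows "fcert C u {i}"
proof -
 have "fcert C zf {i}" using fcert_idx[OF assms(2)] assms(1,3) by (auto simp: wf_config_def)
 hence "fcert C u (K \<inter> {i})" by (rule fcert_inter[OF assms(2)])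
 thus ?thesis using assms(3) by (simp add: Int_absorb1)
qed

lemma zonotope_subset_span: "zonotope E \<subseteq> span E"
 unfolding zonotope_def by (rule image_subsetI, rule span_sum) (auto intro: span_neg span_base)

text \<open>\<open>z\<close> is the sum with all signs negative; changing one sign adds
  \<open>2 e\<close>. So differences of hub points recover \<open>E\<close>, which bounds the
  dimension of the polytope from below.\<close>

lemma zonotope_spans:
 assumes "finite E"
 shows "\<exists>z\<in>zonotope E. \<forall>e\<in>E. z + 2 *R e \<in> zonotope E"
proof -
 define s where "s A = (\<Sum>e\<in>E. (if e \<in> A then e else - e))" for A
 have "s {e} = s {} + 2 *R e" if "e \<in> E" for e
 proof -
  have "(\<Sum>x\<in>E - {e}. (if x \<in> {e} then x else - x)) = (\<Sum>x\<in>E - {e}. (if x \<in> {} then x else - x))"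
   by (rule sum.cong) auto
  thus ?thesis
   unfolding s_def using sum.remove[OF assms that, of "\<lambda>x. if x \<in> {e} then x else - x"]
    sum.remove[OF assms that, of "\<lambda>x. if x \<in> {} then x else - x"] by (simp add: scaleR_2)
 qed
 moreover have "s A \<in> zonotope E" if "A \<subseteq> E" for A using that by (auto simp: zonotope_def s_def)
 ultimately show ?thesis by (intro bexI[of _ "s {}"]) (metis empty_subsetI insert_subset, simp)
qed

section \<open>Assembling the gadgets\<close>

definition par_gadget :: "'a::real_vector \<times> 'a => 'a gadget" where
 "par_gadget = (\<lambda>(a, b). ({0, a, a + b, b}, [{0, a, a + b}], [{a, a + b, b}]))"

definition par_levels :: "'a::real_vector \<times> 'a => 'a set set" where
 "par_levels = (\<lambda>(a, b). {{0, a, a + b, b}, {0, a, a + b}, {a, a + b, b}})"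

lemma par_levels_convex:
 assumes "nondeg a b" "J \<in> par_levels (a, b)"
 shows "convex_position J & card J >= 3"
proof -
 note p = parallelogram_edges[OF assms(1)]
 have "convex_position {0, a, a + b}" "convex_position {a, a + b, b}"
  using convex_position_subset[OF p(5)] by auto
 moreover have "card {0, a, a + b} = 3" "card {a, a + b, b} = 3" using p(1-4) by auto
 ultimately show ?thesis using assms(2) p(5,6) unfolding par_levels_def by auto
qed

lemma vis_linked_step: "vis U E J u e v w ==> v \<in> J' ==> w \<in> J' ==> (v, w) \<in> {(v, w). v \<in> J' & w \<in> J' & (\<exists>u e. vis U E J u e v w)}\<^sup>*"
 by (rule r_into_rtrancl) auto

lemma adequate_edge: "adequate U E D J ==> is_edge J v w ==> \<exists>u. vis U E J u (rep D (v - w)) v w"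
 unfolding adequate_def by (elim conjE) simp

lemma par_static:
 assumes nd: "nondeg a b" and ad: "adequate U E D {0, a, a + b, b}"
 shows "chain_static U E {0, a, a + b, b} [{0, a, a + b}]" "chain_static U E {0, a, a + b, b} [{a, a + b, b}]"
proof -
 let ?Q = "{0, a, a + b, b}"
 note p = parallelogram_edges[OF nd]
 obtain u1 u2 u3 where u: "vis U E ?Q u1 (rep D (0 - a)) 0 a" "vis U E ?Q u2 (rep D (a - (a + b))) a (a + b)"
  "vis U E ?Q u3 (rep D (b - (a + b))) b (a + b)"
  using adequate_edge[OF ad p(7)] adequate_edge[OF ad p(10)] adequate_edge[OF ad p(8)] by blast
 have "linked U E ?Q {0, a, a + b}"
 proof (rule linkedI[of a])
  fix v assume "v \<in> {0, a, a + b}"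
  then consider "v = a" | "v = 0" | "v = a + b" by blast
  thus "(v, a) \<in> {(v, w). v \<in> {0, a, a + b} & w \<in> {0, a, a + b} & (\<exists>u e. vis U E ?Q u e v w)}\<^sup>*"
   using vis_linked_step[OF u(1), of "{0, a, a + b}"] vis_linked_step[OF vis_commute[OF u(2)], of "{0, a, a + b}"] by cases auto
 qed simp
 moreover have "linked U E ?Q {a, a + b, b}"
 proof (rule linkedI[of "a + b"])
  fix v assume "v \<in> {a, a + b, b}"
  then consider "v = a + b" | "v = a" | "v = b" by blast
  thus "(v, a + b) \<in> {(v, w). v \<in> {a, a + b, b} & w \<in> {a, a + b, b} & (\<exists>u e. vis U E ?Q u e v w)}\<^sup>*"
   using vis_linked_step[OF u(2), of "{a, a + b, b}"] vis_linked_step[OF u(3), of "{a, a + b, b}"] by cases auto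
 qed simp
 moreover have "\<forall>v\<in>?Q. \<exists>u\<in>U. top_set u ?Q = {v}" using ad unfolding adequate_def by blast
 moreover have "\<exists>v\<in>{0, a, a + b}. \<exists>w\<in>{0, a, a + b}. v ~= w" "\<exists>v\<in>{a, a + b, b}. \<exists>w\<in>{a, a + b, b}. v ~= w"
  using p(1,3) by blast+
 ultimately show "chain_static U E ?Q [{0, a, a + b}]" "chain_static U E ?Q [{a, a + b, b}]" by auto
qed

text \<open>The facts about the finished configuration on which the study of its realizations rests.
  The slot at \<open>m\<close> with scale \<open>c\<close> carries the copy of \<open>V\<close> that
  becomes the rigid face.\<close>

locale gadget_polytope =
 fixes V :: "'a::real_vector set" and PL :: "('a \<times> 'a) set" and U D E f and C :: "'a config" and m :: nat and c :: real
 assumes V: "convex_position V" "card V >= 3" "0 \<in> V"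
  and PL: "(a, b) \<in> PL ==> nondeg a b"
  and U: "u \<in> U ==> linear u" and E: "finite E" "0 \<notin> E" "E = rep D ` D"
  and one: "u \<in> U ==> e \<in> E ==> e' \<in> E ==> u e = 0 ==> u e' = 0 ==> e = e'"
  and D: "v \<in> V ==> w \<in> V ==> v ~= w ==> v - w \<in> D" "D \<subseteq> span V"
  and f: "linear f" "inj_on f V"
  and ad: "J \<in> insert V (set (levels f (card V - 3) V)) \<union> \<Union> (par_levels ` PL) ==> adequate U E D J"
  and C: "wf_config C" "extends U (start_config (zonotope E)) C" "inside (span V) C"
  and slotE: "e \<in> E ==> slot_ok U (zonotope E) C ({0, e}, [], [])"
  and slotP: "p \<in> PL ==> slot_ok U (zonotope E) C (par_gadget p)"
  and slotV: "slot_at U (zonotope E) C (V, levels f (card V - 3) V, []) m c"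

lemma gadget_polytope_exists:
 fixes V :: "'a::real_vector set"
 assumes V: "convex_position V" "card V >= 3" "0 \<in> V"
  and PL: "finite PL" "\<And>a b. (a, b) \<in> PL ==> nondeg a b & a \<in> span V & b \<in> span V"
 shows "\<exists>U D E f C m c. gadget_polytope V PL U D E f C m c"
proof -
 have finV: "finite V" using V(1) by (simp add: convex_position_def)
 have "\<exists>f :: 'a => real. linear f & (\<forall>x\<in>span {}. f x = 0) & (\<forall>a\<in>{v - w | v w. v \<in> V & w \<in> V & v ~= w}. f a ~= 0)"
 proof (rule exists_generic_functional)
  show "finite {v - w | v w. v \<in> V & w \<in> V & v ~= w}"
   by (rule finite_subset[of _ "(\<lambda>(v, w). v - w) ` (V \<times> V)"]) (use finV in auto)
 qed auto
 then obtain f :: "'a => real" where f: "linear f" "\<forall>a\<in>{v - w | v w. v \<in> V & w \<in> V & v ~= w}. f a ~= 0" by blast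
 have finj: "inj_on f V"
 proof (rule inj_onI, rule ccontr)
  fix v w assume "v \<in> V" "w \<in> V" "f v = f w" "v ~= w"
  hence "f (v - w) ~= 0" using f(2) by blast
  thus False using \<open>f v = f w\<close> f(1) by (simp add: linear_diff)
 qed
 define Js where "Js = levels f (card V - 3) V"
 have n: "card V = (card V - 3) + 3" using V(2) by simp
 have Js: "\<forall>K\<in>set Js. convex_position K & card K >= 3 & K \<subseteq> V"
  unfolding Js_def by (rule levels_props[OF V(1) n finj])
 \<comment> \<open>All sets occurring as slot fibres or chain members, apart from the segments.
   Their differences form \<open>D\<close>; the segments, and the zonotope whose generators are the
   representatives of \<open>D\<close>, come afterwards.\<close>
 define LL where "LL = insert V (set Js) \<union> \<Union> (par_levels ` PL)"
 have LL: "finite LL" "LL ~= {}" unfolding LL_def using PL(1) by (auto simp: par_levels_def)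
 have cp: "convex_position J & card J >= 3" if J: "J \<in> LL" for J
 proof -
  consider "J = V" | "J \<in> set Js" | p where "p \<in> PL" "J \<in> par_levels p" using J by (auto simp: LL_def)
  thus ?thesis
  proof cases
   case 3
   thus ?thesis using PL(2) par_levels_convex by (cases p) blast
  qed (use V Js in auto)
 qed
 have finJ: "finite J" if "J \<in> LL" for J using cp[OF that] by (simp add: convex_position_def)
 define D where "D = directions LL"
 define E where "E = rep D ` D"
 obtain U where U: "finite U" "\<And>u. u \<in> U ==> linear u" "zf \<notin> U" "\<And>J. J \<in> LL ==> adequate U E D J"
  "\<And>u e e'. u \<in> U ==> e \<in> E ==> e' \<in> E ==> u e = 0 ==> u e' = 0 ==> e = e'"
  using select_functionals[OF LL cp] unfolding D_def E_def by metis
 have finD: "finite D" unfolding D_def by (rule finite_directions[OF LL(1) finJ])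
 have D0: "0 \<notin> D" by (auto simp: D_def directions_def)
 have finE: "finite E" unfolding E_def using finD by simp
 have ED: "E \<subseteq> D" unfolding E_def using rep_props by blast
 have E0: "0 \<notin> E" using ED D0 by blast
 have LLW: "J \<subseteq> span V" if J: "J \<in> LL" for J
 proof -
  consider "J = V" | "J \<in> set Js" | p where "p \<in> PL" "J \<in> par_levels p" using J by (auto simp: LL_def)
  thus ?thesis
  proof cases
   case 1
   thus ?thesis by (simp add: span_superset)
  next
   case 2
   thus ?thesis using Js span_superset by blast
  next
   case 3
   thus ?thesis using PL(2) by (cases p) (auto simp: par_levels_def span_zero intro: span_add)
  qed
 qed
 have DW: "D \<subseteq> span V"
 proof
  fix x assume "x \<in> D"
  then obtain J p q where "J \<in> LL" "p \<in> J" "q \<in> J" "x = p - q" by (auto simp: D_def directions_def)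
  thus "x \<in> span V" using LLW[of J] by (auto intro: span_diff)
 qed
 have dirV: "v - w \<in> D" if "v \<in> V" "w \<in> V" "v ~= w" for v w
  using that unfolding D_def directions_def LL_def by blast
 define Z where "Z = zonotope E"
 have "V ~= {0}" using V(2) by auto
 then obtain v1 where v1: "v1 \<in> V" "v1 ~= 0" using V(3) by blast
 obtain v w w' where vw: "v \<in> V" "w \<in> V" "w' \<in> V" "v ~= w" "v ~= w'" "v - w' \<notin> span {v - w}"
  by (rule is_edge_two_directions[OF V(1,2)])
 \<comment> \<open>\<open>V\<close> has two directions and \<open>u\<close> vanishes on at most one
   representative, so \<open>u\<close> is positive somewhere on the hub.\<close>
 have two: "\<exists>e\<in>E. u e ~= 0" if u: "u \<in> U" for u
 proof (rule ccontr)
  assume z: "\<not> ?thesis"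
  have d: "v - w \<in> D" "v - w' \<in> D" using dirV vw by auto
  hence "rep D (v - w) \<in> E" "rep D (v - w') \<in> E" by (auto simp: E_def)
  hence "rep D (v - w) = rep D (v - w')" using z U(5)[OF u] by blast
  hence "span {v - w} = span {v - w'}" using rep_props d by metis
  thus False using vw(6) by (metis span_base singletonI)
 qed
 have Zpos: "Max (u ` Z) > 0" if u: "u \<in> U" for u
 proof -
  obtain e where "e \<in> E" "u e ~= 0" using two[OF u] by blast
  thus ?thesis unfolding Z_def by (rule zonotope_max(3)[OF finE U(2)[OF u]])
 qed
 have finZ: "finite Z" "Z ~= {}" unfolding Z_def zonotope_def using finE by auto
 have ZW: "Z \<subseteq> span V"
  unfolding Z_def using zonotope_subset_span[of E] span_minimal[of E "span V"] ED DW by auto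
 define G where "G = (\<lambda>e. ({0, e}, [], [])) ` E \<union> par_gadget ` PL \<union> {(V, Js, [])}"
 have "finite G" unfolding G_def using finE PL(1) by simp
 then obtain gs where gs: "set gs = G" using finite_list by blast
 have gadm: "gadget_adm U g & fst g \<subseteq> span V" if g: "g \<in> set gs" for g
 proof -
  consider e where "e \<in> E" "g = ({0, e}, [], [])" | a b where "(a, b) \<in> PL" "g = par_gadget (a, b)" | "g = (V, Js, [])"
   using g unfolding gs G_def by auto
  thus ?thesis
  proof cases
   case 1
   thus ?thesis using ED DW by (auto simp: gadget_adm_def span_zero)
  next
   case 2
   have L: "J \<in> LL" if "J \<in> par_levels (a, b)" for J using that 2(1) by (auto simp: LL_def)
   have "\<forall>u\<in>U. \<exists>x\<in>J. \<exists>y\<in>J. u x ~= u y" if "J \<in> par_levels (a, b)" for J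
    using U(4)[OF L[OF that]] unfolding adequate_def by blast
   hence "\<forall>u\<in>U. \<exists>x\<in>{0, a, a + b}. \<exists>y\<in>{0, a, a + b}. u x ~= u y" "\<forall>u\<in>U. \<exists>x\<in>{a, a + b, b}. \<exists>y\<in>{a, a + b, b}. u x ~= u y"
    unfolding par_levels_def by blast+
   hence "chain_adm U {0, a, a + b, b} [{0, a, a + b}]" "chain_adm U {0, a, a + b, b} [{a, a + b, b}]"
    unfolding chain_adm.simps by blast+
   moreover have "{0, a, a + b, b} \<subseteq> span V" using LLW[OF L[of "{0, a, a + b, b}"]] by (simp add: par_levels_def)
   ultimately show ?thesis unfolding 2(2) by (simp add: gadget_adm_def par_gadget_def)
  next
   case 3
   have "chain_static U E V (levels f (card V - 3) V) & chain_adm U V (levels f (card V - 3) V)"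
    by (rule levels_static[OF V(1) n finj f(1)]) (rule U(4), auto simp: LL_def Js_def)
   thus ?thesis using 3 finV V(3) span_superset by (auto simp: gadget_adm_def Js_def)
  qed
 qed
 obtain C where C: "wf_config C" "inside (span V) C" "extends U (start_config Z) C" "\<forall>g\<in>set gs. slot_ok U Z C g"
  using ring_build[OF U(1,3,2) finZ Zpos gadm subspace_span ZW] by blast
 have "slot_ok U Z C (V, Js, [])" using C(4) unfolding gs G_def by blast
 then obtain m c where mc: "slot_at U Z C (V, Js, []) m c" using slot_ok_at by blast
 have "gadget_polytope V PL U D E f C m c"
 proof (rule gadget_polytope.intro)
  show "convex_position V" "3 <= card V" "0 \<in> V" "finite E" "0 \<notin> E" "E = rep D ` D" "D \<subseteq> span V" "linear f" "inj_on f V"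
   "wf_config C" "inside (span V) C" "extends U (start_config (zonotope E)) C"
   using V finE E0 E_def DW f(1) finj C(1-3) by (simp_all add: Z_def)
  show "nondeg a b" if "(a, b) \<in> PL" for a b using PL(2)[OF that] by blast
  show "linear u" if "u \<in> U" for u by (rule U(2)[OF that])
  show "e = e'" if "u \<in> U" "e \<in> E" "e' \<in> E" "u e = 0" "u e' = 0" for u e e' by (rule U(5)[OF that])
  show "v - w \<in> D" if "v \<in> V" "w \<in> V" "v ~= w" for v w by (rule dirV[OF that])
  show "adequate U E D J" if "J \<in> insert V (set (levels f (card V - 3) V)) \<union> \<Union> (par_levels ` PL)" for J
   using U(4)[of J] that by (simp add: LL_def Js_def)
  show "slot_ok U (zonotope E) C ({0, e}, [], [])" if "e \<in> E" for e
   using C(4) that unfolding gs G_def Z_def by blast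
  show "slot_ok U (zonotope E) C (par_gadget p)" if "p \<in> PL" for p
   using C(4) that unfolding gs G_def Z_def by blast
  show "slot_at U (zonotope E) C (V, levels f (card V - 3) V, []) m c" using mc by (simp add: Z_def Js_def)
 qed
 thus ?thesis by blast
qed

context gadget_polytope
begin

lemma finV: "finite V" and neV: "V ~= {}"
 using V by (auto simp: convex_position_def)

lemma n: "card V = (card V - 3) + 3"
 using V(2) by simp

lemma hub: "0 \<in> idx C" "fibre C 0 = zonotope E"
 using extendsD(1,2)[OF C(2)] by (auto simp: start_config_def)

lemma exV: "v \<in> V ==> \<exists>u\<in>U. top_set u V = {v}"
 using ad[of V] unfolding adequate_def by blast

lemma slot: "m \<in> idx C" "m ~= 0" "c > 0" "fibre C m = scaled c V" "u \<in> U ==> fcert C u {m}"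
proof -
 obtain F where s: "m \<in> idx C & m ~= 0 & c > 0 & fibre C m = scaled c V" "\<forall>u\<in>U. fcert C u {F, m}"
  using slotV unfolding slot_at_def fst_conv snd_conv by auto
 show "m \<in> idx C" "m ~= 0" "c > 0" "fibre C m = scaled c V" using s(1) by auto
 show "fcert C u {m}" if "u \<in> U" using wf_cert_single[OF C(1)] s(2) that by blast
qed

lemma slot_vlabels:
 assumes "v \<in> V"
 shows "(m, c *R v) \<in> vlabels C"
proof -
 obtain u where u: "u \<in> U" "top_set u V = {v}" using exV[OF assms] by blast
 have "faceset C u {m} = {(m, c *R v), (m, c *R v)}"
  using faceset_scaled[OF slot(4) U[OF u(1)] slot(3) finV neV] u(2) by simp
 thus ?thesis using config_vertex[OF C(1) U[OF u(1)] slot(5)[OF u(1)]] by blast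
qed

definition slot_face :: "('a \<times> real \<times> real) set" where
 "slot_face = convex hull ((\<lambda>v. point C (m, c *R v)) ` V)"

lemma slot_face: "slot_face face_of body C" "vertices (body C) \<inter> slot_face = (\<lambda>v. point C (m, c *R v)) ` V"
proof -
 have lz: "linear (zf :: 'a => real)" by (simp add: linear_iff)
 have zc: "fcert C zf {m}" using C(1) slot(1) by (simp add: wf_config_def)
 have fs: "faceset C zf {m} = (\<lambda>v. (m, c *R v)) ` V" unfolding faceset_zf slot(4) by (simp add: image_image)
 have eq: "slot_face = convex hull (point C ` faceset C zf {m})" unfolding fs slot_face_def by (simp add: image_image)
 show "slot_face face_of body C" unfolding eq by (rule config_face(1)[OF C(1) lz zc])
 have "faceset C zf {m} \<inter> vlabels C = (\<lambda>v. (m, c *R v)) ` V" unfolding fs using slot_vlabels by blast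
 thus "vertices (body C) \<inter> slot_face = (\<lambda>v. point C (m, c *R v)) ` V"
  unfolding eq vertices_face[OF C(1) lz zc] by (simp add: image_image)
qed

text \<open>All fibres lie in the span of \<open>V\<close>, which gives the upper bound. Conversely,
  the hub recovers the span of \<open>V\<close>, and the other two corners of the initial triangle
  add the two planar directions.\<close>

lemma body_dim:
 assumes "has_aff_dim V d"
 shows "has_aff_dim (body C) (d + 2)"
proof -
 define j where "j x = (x, 0::real, 0::real)" for x :: 'a
 define h where "h x = (j x, 0::real)" for x
 have hl: "linear h" by (simp add: h_def j_def linear_iff)
 let ?P = "point C ` labels C"
 have C0: "{0, 1, 2} \<subseteq> idx C" "\<And>i. i \<in> {0, 1, 2} ==> shadow C i = shadow (start_config (zonotope E)) i & fibre C i = fibre (start_config (zonotope E)) i"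
  using extendsD[OF C(2)] by (auto simp: start_config_def)
 have EV: "span E = span V"
 proof
  have "E \<subseteq> D" unfolding E(3) using rep_props by blast
  thus "span E \<subseteq> span V" using D(2) by (intro span_minimal) auto
  have "v \<in> span E" if v: "v \<in> V" for v
  proof (cases "v = 0")
   case False
   hence d: "v \<in> D" using D(1)[OF v V(3)] by simp
   hence "v \<in> span {rep D v}" "rep D v \<in> E" using rep_props[OF d] by (auto simp: E(3) span_base)
   thus ?thesis using span_mono[of "{rep D v}" E] by blast
  qed (simp add: span_zero)
  thus "span V \<subseteq> span E" by (intro span_minimal) auto
 qed
 let ?A = "insert (0, 1, 0) (insert (0, 0, 1) (j ` V))"
 have "j = (\<lambda>x. (x, 0, 0))" by (simp add: j_def fun_eq_iff)
 hence dimA: "has_aff_dim ?A (d + 2)" using has_aff_dim_two_apexes[OF assms] by simp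
 have sub1: "hat ` ?P \<subseteq> span (hat ` ?A)"
 proof
  fix y assume "y \<in> hat ` ?P"
  then obtain i x where ix: "i \<in> idx C" "x \<in> fibre C i" "y = hat (point C (i, x))" by (auto simp: labels_def)
  have xV: "x \<in> span V" using C(3) ix(1,2) by (auto simp: inside_def)
  have h0: "hat (j 0) \<in> span (hat ` ?A)" using V(3) by (intro span_base) auto
  have "h v \<in> span (hat ` ?A)" if "v \<in> V" for v
  proof -
   have "h v = hat (j v) - hat (j 0)" by (simp add: h_def hat_def j_def zero_prod_def)
   moreover have "hat (j v) \<in> span (hat ` ?A)" using that by (intro span_base) auto
   ultimately show ?thesis using h0 by (simp add: span_diff)
  qed
  hence "h ` span V \<subseteq> span (hat ` ?A)"
   unfolding linear_span_image[OF hl, symmetric] by (intro span_minimal) auto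
  hence hx: "h x \<in> span (hat ` ?A)" using xV by blast
  have e12: "hat (0, 1, 0) \<in> span (hat ` ?A)" "hat (0, 0, 1) \<in> span (hat ` ?A)" by (intro span_base; auto)+
  have "y = h x + hat (j 0) + fst (shadow C i) *R (hat (0, 1, 0) - hat (j 0)) + snd (shadow C i) *R (hat (0, 0, 1) - hat (j 0))"
   unfolding ix(3) by (simp add: h_def j_def hat_def point_def prod_eq_iff)
  also have "... \<in> span (hat ` ?A)" using hx h0 e12 by (intro span_add span_scale span_diff)
  finally show "y \<in> span (hat ` ?A)" .
 qed
 have sub2: "hat ` ?A \<subseteq> span (hat ` ?P)"
 proof -
  have pt: "hat (x, shadow C i) \<in> span (hat ` ?P)" if "i \<in> idx C" "x \<in> fibre C i" for i x
  proof -
   have "(i, x) \<in> labels C" using that by (simp add: labels_def)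
   hence "point C (i, x) \<in> ?P" by (rule imageI)
   thus ?thesis by (intro span_base) (auto simp: point_def)
  qed
  obtain z where z: "z \<in> zonotope E" "\<forall>e\<in>E. z + 2 *R e \<in> zonotope E" using zonotope_spans[OF E(1)] by blast
  have z0: "hat (x, 0, 0) \<in> span (hat ` ?P)" if "x \<in> zonotope E" for x
   using pt[of 0 x] C0 that by (simp add: start_config_def)
  have "h e \<in> span (hat ` ?P)" if "e \<in> E" for e
  proof -
   have "h e = (1/2) *R (hat (z + 2 *R e, 0, 0) - hat (z, 0, 0))" by (simp add: h_def j_def hat_def zero_prod_def)
   also have "... \<in> span (hat ` ?P)" using z z0 that by (intro span_scale span_diff) auto
   finally show ?thesis .
  qed
  hence "h ` span E \<subseteq> span (hat ` ?P)"
   unfolding linear_span_image[OF hl, symmetric] by (intro span_minimal) auto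
  hence hs: "h x \<in> span (hat ` ?P)" if "x \<in> span V" for x using that EV by blast
  have zV: "z \<in> span V" using z(1) zonotope_subset_span[of E] EV by blast
  hence z2: "(1/2) *R z \<in> span V" by (rule span_scale)
  have jx: "hat (j x) \<in> span (hat ` ?P)" if "x \<in> span V" for x
  proof -
   have "hat (j x) = h x + (hat (z, 0, 0) - h z)" by (simp add: h_def j_def hat_def zero_prod_def)
   thus ?thesis using hs[OF that] hs[OF zV] z0[OF z(1)] by (simp add: span_add span_diff)
  qed
  have "hat ((1/2) *R z, 1, 0) \<in> span (hat ` ?P)" using pt[of 1 "(1/2) *R z"] C0 z(1) by (simp add: start_config_def)
  moreover have "hat (0, 1, 0) = hat ((1/2) *R z, 1, 0) - h ((1/2) *R z)" by (simp add: h_def j_def hat_def zero_prod_def)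
  ultimately have a: "hat (0, 1, 0) \<in> span (hat ` ?P)" using hs[OF z2] by (simp add: span_diff)
  have "hat ((1/2) *R z, 0, 1) \<in> span (hat ` ?P)" using pt[of 2 "(1/2) *R z"] C0 z(1) by (simp add: start_config_def)
  moreover have "hat (0, 0, 1) = hat ((1/2) *R z, 0, 1) - h ((1/2) *R z)" by (simp add: h_def j_def hat_def zero_prod_def)
  ultimately have b: "hat (0, 0, 1) \<in> span (hat ` ?P)" using hs[OF z2] by (simp add: span_diff)
  show ?thesis using a b jx span_superset[of V] by auto
 qed
 have "span (hat ` ?P) = span (hat ` ?A)"
  using span_minimal[OF sub1 subspace_span] span_minimal[OF sub2 subspace_span] by blast
 hence "has_aff_dim ?P (d + 2)" using dimA unfolding has_aff_dim_hat by simp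
 thus ?thesis unfolding body_def has_aff_dim_convex_hull .
qed

end

section \<open>Recovering the face over \<open>V\<close> from the ideal points of its edges\<close>

lemma edge_descent:
 fixes f :: "'a::real_vector => real"
 assumes J: "convex_position J" "linear f" "inj_on f J" and m: "m \<in> J" "\<And>x. x \<in> J ==> f m <= f x" "Q m"
  and step: "\<And>v w. is_edge J v w ==> Q w ==> Q v" and v: "v \<in> J"
 shows "Q v"
 using v
proof (induction "card {x \<in> J. f x < f v}" arbitrary: v rule: less_induct)
 case less
 have fin: "finite J" using J(1) by (simp add: convex_position_def)
 show ?case
 proof (cases "v = m")
  case True
  thus ?thesis using m(3) by simp
 next
  case False
  have "f m ~= f v" using J(3) m(1) less.prems False unfolding inj_on_def by blast
  hence "f m < f v" using m(2)[OF less.prems] by simp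
  then obtain w where w: "is_edge J v w" "f w < f v" by (rule is_edge_improve[OF J(1) less.prems J(2) m(1)])
  have wJ: "w \<in> J" using w(1) by (simp add: is_edge_def)
  have "{x \<in> J. f x < f w} \<subset> {x \<in> J. f x < f v}" using w(2) wJ by force
  hence "card {x \<in> J. f x < f w} < card {x \<in> J. f x < f v}" using fin by (intro psubset_card_mono) auto
  hence "Q w" using less.hyps wJ by blast
  thus ?thesis by (rule step[OF w(1)])
 qed
qed

lemma is_edge_nondeg:
 assumes "is_edge J v w" "z \<in> J - {v, w}"
 shows "nondeg (v - z) (v - w)"
proof -
 obtain u :: "'a => real" where u: "linear u" "u v = u w" "u z < u v" "v ~= w" using assms unfolding is_edge_def by blast
 have "v - z \<notin> span {v - w}"
 proof
  assume "v - z \<in> span {v - w}"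
  then obtain k where "v - z = k *R (v - w)" by (auto simp: span_singleton)
  hence "u (v - z) = k * u (v - w)" using u(1) by (simp add: linear_scale)
  thus False using u by (simp add: linear_diff)
 qed
 thus ?thesis using u(4) by (simp add: nondeg_def)
qed

text \<open>The vectors \<open>q v\<close> can be rescaled to an affine copy of \<open>J\<close>.\<close>

definition agree :: "('a::real_vector => 'c::real_vector) => ('a => 'c) => 'a set => bool" where
 "agree q M J \<longleftrightarrow> (\<exists>R k. k ~= 0 & (\<forall>v\<in>J. \<exists>s. s ~= 0 & q v = s *R R v) & (\<forall>v\<in>J. \<forall>w\<in>J. R v - R w = k *R M (v - w)))"

locale agreement =
 fixes L :: "'c::real_vector set" and M q :: "'a::real_vector => 'c" and V W :: "'a set"
 assumes L: "subspace L" and M: "linear M" "inj_on M W" and W: "subspace W" "V \<subseteq> W"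
  and diffL: "v \<in> V ==> w \<in> V ==> M (v - w) \<in> L" and out: "v \<in> V ==> q v \<notin> L"
  and ind: "v \<in> V ==> w \<in> V ==> v ~= w ==> q v \<notin> span {q w}"
begin

lemma diffW: "v \<in> V ==> w \<in> V ==> v - w \<in> W"
 using W subspace_diff by blast

lemma M_nonzero: "x \<in> W ==> x ~= 0 ==> M x ~= 0"
 using M linear_0[OF M(1)] subspace_0[OF W(1)] unfolding inj_on_def by metis

lemma M_nondeg:
 assumes "a \<in> W" "b \<in> W" "nondeg a b"
 shows "nondeg (M a) (M b)"
 unfolding nondeg_def
proof
 show "M b ~= 0" by (rule M_nonzero[OF assms(2)]) (use assms(3) in \<open>simp add: nondeg_def\<close>)
 show "M a \<notin> span {M b}"
 proof
  assume "M a \<in> span {M b}"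
  then obtain k where "M a = M (k *R b)" using M(1) by (auto simp: span_singleton linear_scale)
  hence "a = k *R b" using M(2) assms(1) subspace_scale[OF W(1) assms(2)] unfolding inj_on_def by blast
  thus False using assms(3) by (simp add: nondeg_def span_scale span_base)
 qed
qed

lemma agree_pair:
 assumes "v \<in> V" "w \<in> V" "v ~= w" "M (v - w) \<in> span {q v, q w}"
 shows "agree q M {v, w}"
proof -
 have x: "M (v - w) \<in> L" "M (v - w) ~= 0" using diffL assms M_nonzero diffW by auto
 obtain s t where st: "s ~= 0" "q w = s *R (q v + t *R M (v - w))"
  by (rule line_through[OF L x out[OF assms(1)] out[OF assms(2)] assms(4)])
 have t: "t ~= 0"
 proof
  assume "t = 0"
  hence "q w \<in> span {q v}" using st by (simp add: span_scale span_base)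
  thus False using ind[of w v] assms by blast
 qed
 define R where "R z = (if z = w then q v + t *R M (v - w) else q v)" for z
 have Mm: "M (w - v) = - M (v - w)" using linear_neg[OF M(1), of "v - w"] by simp
 have M0: "M 0 = 0" by (rule linear_0[OF M(1)])
 have "\<forall>z\<in>{v, w}. \<exists>s. s ~= 0 & q z = s *R R z"
 proof
  fix z assume "z \<in> {v, w}"
  then consider "z = v" | "z = w" by blast
  thus "\<exists>s. s ~= 0 & q z = s *R R z"
  proof cases
   case 1
   thus ?thesis using assms(3) by (intro exI[of _ 1]) (simp add: R_def)
  next
   case 2
   thus ?thesis using st by (intro exI[of _ s]) (simp add: R_def)
  qed
 qed
 moreover have "\<forall>z\<in>{v, w}. \<forall>z'\<in>{v, w}. R z - R z' = (- t) *R M (z - z')"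
  using assms(3) by (auto simp: R_def Mm M0)
 moreover have "- t ~= 0" using t by simp
 ultimately show ?thesis unfolding agree_def by blast
qed

text \<open>The new point lies on a line through \<open>R w\<close> and on one through
  \<open>R w'\<close>, with independent ideal points. Comparing coefficients modulo \<open>L\<close>
  and along the two directions forces equal factors and the scale \<open>k\<close> already fixed on
  \<open>J\<close>.\<close>

lemma agree_insert:
 assumes ag: "agree q M J" and J: "J \<subseteq> V" and p: "p \<in> V" "p \<notin> J" and w: "w \<in> J" "w' \<in> J"
  and lines: "M (p - w) \<in> span {q p, q w}" "M (p - w') \<in> span {q p, q w'}" and nd: "nondeg (p - w') (p - w)"
 shows "agree q M (insert p J)"
proof -
 obtain R k where R: "k ~= 0" "\<forall>v\<in>J. \<exists>s. s ~= 0 & q v = s *R R v" "\<forall>v\<in>J. \<forall>w\<in>J. R v - R w = k *R M (v - w)"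
  using ag unfolding agree_def by blast
 have key: "\<exists>a t. a ~= 0 & q p = a *R (R z + t *R M (p - z))" if z: "z \<in> J" "M (p - z) \<in> span {q p, q z}" for z
 proof -
  have zV: "z \<in> V" "p ~= z" using z J p by auto
  obtain s where s: "s ~= 0" "q z = s *R R z" using R(2) z(1) by blast
  have RL: "R z \<notin> L" using out[OF zV(1)] s subspace_scale[OF L] by metis
  have x: "M (p - z) \<in> L" "M (p - z) ~= 0" using diffL p zV M_nonzero diffW by auto
  have "{q p, q z} \<subseteq> span {R z, q p}" using s by (auto intro: span_base span_scale)
  hence "M (p - z) \<in> span {R z, q p}" using z(2) span_minimal[OF _ subspace_span] by blast
  thus ?thesis using line_through[OF L x RL out[OF p(1)]] by metis
 qed
 obtain a t where a: "a ~= 0" "q p = a *R (R w + t *R M (p - w))" using key[OF w(1) lines(1)] by blast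
 obtain a' t' where a': "a' ~= 0" "q p = a' *R (R w' + t' *R M (p - w'))" using key[OF w(2) lines(2)] by blast
 have wV: "w \<in> V" "w' \<in> V" using w J by auto
 have "M (w - w') = M ((p - w') - (p - w))" by simp
 hence Mww: "M (w - w') = M (p - w') - M (p - w)" by (simp only: linear_diff[OF M(1)])
 have Rw: "R w = R w' + k *R (M (p - w') - M (p - w))" using R(3) w Mww by (metis add.commute diff_add_cancel)
 have xL: "M (p - w) \<in> L" "M (p - w') \<in> L" using diffL p wV by auto
 obtain s where s: "s ~= 0" "q w' = s *R R w'" using R(2) w(2) by blast
 have RL: "R w' \<notin> L" using out[OF wV(2)] s subspace_scale[OF L] by metis
 have "a *R (R w + t *R M (p - w)) - a' *R (R w' + t' *R M (p - w')) = 0"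
  by (simp only: a(2)[symmetric] a'(2)[symmetric] diff_self)
 hence e: "(a - a') *R R w' + ((a * k - a' * t') *R M (p - w') + (a * t - a * k) *R M (p - w)) = 0"
  by (simp add: Rw algebra_simps)
 have inL: "(a * k - a' * t') *R M (p - w') + (a * t - a * k) *R M (p - w) \<in> L"
  using xL L by (simp add: subspace_add subspace_scale)
 have "a - a' = 0" by (rule subspace_coeff_zero[OF L _ inL RL]) (use e subspace_0[OF L] in simp)
 hence "(a * k - a' * t') *R M (p - w') + (a * t - a * k) *R M (p - w) = 0 *R M (p - w') + 0 *R M (p - w)" using e by simp
 hence "a * t - a * k = 0"
  by (rule nondeg_coeff(2)[OF M_nondeg[OF diffW[OF p(1) wV(2)] diffW[OF p(1) wV(1)] nd]])
 hence "t = k" using a(1) by simp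
 hence qp: "q p = a *R (R w + k *R M (p - w))" using a by simp
 define R' where "R' z = (if z = p then R w + k *R M (p - w) else R z)" for z
 have old: "R' v = R v" if "v \<in> J" for v using that p(2) by (auto simp: R'_def)
 have new: "R' p - R v = k *R M (p - v)" if v: "v \<in> J" for v
 proof -
  have "R' p - R v = (R w - R v) + k *R M (p - w)" by (simp add: R'_def)
  also have "... = k *R M (w - v) + k *R M (p - w)" using R(3) w(1) v by simp
  also have "... = k *R M ((w - v) + (p - w))" unfolding linear_add[OF M(1)] scaleR_add_right ..
  finally show ?thesis by simp
 qed
 have "\<forall>v\<in>insert p J. \<exists>s. s ~= 0 & q v = s *R R' v"
 proof
  fix v assume "v \<in> insert p J"
  then consider "v = p" | "v \<in> J" by blast
  thus "\<exists>s. s ~= 0 & q v = s *R R' v"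
  proof cases
   case 1
   thus ?thesis using qp a(1) by (intro exI[of _ a]) (simp add: R'_def)
  next
   case 2
   thus ?thesis using R(2) old by simp
  qed
 qed
 moreover have "R' v - R' z = k *R M (v - z)" if vz: "v \<in> insert p J" "z \<in> insert p J" for v z
 proof -
  consider "v = p" "z = p" | "v = p" "z \<in> J" | "v \<in> J" "z = p" | "v \<in> J" "z \<in> J" using vz by blast
  thus ?thesis
  proof cases
   case 1
   thus ?thesis using linear_0[OF M(1)] by simp
  next
   case 2
   thus ?thesis using new old by simp
  next
   case 3
   have "R' v - R' z = - (R' p - R v)" using 3 old by simp
   also have "... = k *R M (- (p - v))" unfolding new[OF 3(1)] linear_neg[OF M(1)] by simp
   finally show ?thesis using 3 by simp
  next
   case 4
   thus ?thesis using R(3) old by simp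
  qed
 qed
 ultimately show ?thesis unfolding agree_def using R(1) by blast
qed

text \<open>The induction starts from a triangle. The vertex with the largest value of
  \<open>f\<close> has two edges in its level whose other ends belong to the next level, as
  \<open>agree_insert\<close> requires.\<close>

lemma agree_levels:
 assumes "convex_position J" "card J = n + 3" "inj_on f J" "J \<subseteq> V"
  and lines: "\<And>K v w. K \<in> insert J (set (levels f n J)) ==> is_edge K v w ==> M (v - w) \<in> span {q v, q w}"
 shows "agree q M J"
 using assms
proof (induction n arbitrary: J)
 case (0 J)
 have J: "finite J" "J ~= {}" using 0 by (auto simp: convex_position_def)
 obtain p where p: "p \<in> J" using J by blast
 have "card (J - {p}) = 2" using 0(2) J p by simp
 then obtain v w where vw: "J - {p} = {v, w}" "v ~= w" by (auto simp: card_2_iff)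
 have vJ: "v \<in> J" "w \<in> J" "v ~= p" "w ~= p" using vw by auto
 have c3: "card J >= 3" using 0(2) by simp
 have JV: "J \<subseteq> V" and lJ: "\<And>v w. is_edge J v w ==> M (v - w) \<in> span {q v, q w}" using 0 by auto
 obtain x y where xy: "is_edge J v x" "is_edge J v y" "x ~= y" by (rule is_edge_two[OF 0(1) vJ(1) c3])
 have "x \<in> {p, w}" "y \<in> {p, w}" using xy vw by (auto simp: is_edge_def)
 hence "is_edge J v w" using xy by auto
 hence "M (v - w) \<in> span {q v, q w}" by (rule lJ)
 hence ag: "agree q M {v, w}" using agree_pair vJ JV vw(2) by blast
 obtain x y where xy: "is_edge J p x" "is_edge J p y" "x ~= y" by (rule is_edge_two[OF 0(1) p c3])
 have m: "x \<in> {v, w}" "y \<in> {v, w}" using xy vw by (auto simp: is_edge_def)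
 have nd: "nondeg (p - y) (p - x)" by (rule is_edge_nondeg[OF xy(1)]) (use xy in \<open>auto simp: is_edge_def\<close>)
 have "agree q M (insert p {v, w})"
  by (rule agree_insert[OF ag _ _ _ m lJ[OF xy(1)] lJ[OF xy(2)] nd]) (use vJ JV p in auto)
 moreover have "insert p {v, w} = J" using vw p by blast
 ultimately show ?case by simp
next
 case (Suc n)
 have J: "finite J" "J ~= {}" using Suc.prems by (auto simp: convex_position_def)
 obtain p where p: "p \<in> J" "drop_top f J = J - {p}" by (rule drop_top_eq[OF J Suc.prems(3)]) blast
 define J' where "J' = drop_top f J"
 have K: "convex_position J'" "card J' = n + 3" "inj_on f J'" "J' \<subseteq> V"
  using convex_position_subset[OF Suc.prems(1), of "J - {p}"] Suc.prems p J by (auto simp: inj_on_diff J'_def)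
 have "M (v - w) \<in> span {q v, q w}" if "K \<in> insert J' (set (levels f n J'))" "is_edge K v w" for K v w
  using Suc.prems(5)[OF _ that(2)] that(1) by (simp add: J'_def)
 hence ag: "agree q M J'" by (rule Suc.IH[OF K])
 have c3: "card J >= 3" using Suc.prems(2) by simp
 have lJ: "M (v - w) \<in> span {q v, q w}" if "is_edge J v w" for v w using Suc.prems(5)[OF _ that] by simp
 obtain x y where xy: "is_edge J p x" "is_edge J p y" "x ~= y" by (rule is_edge_two[OF Suc.prems(1) p(1) c3])
 have m: "x \<in> J'" "y \<in> J'" using xy p by (auto simp: is_edge_def J'_def)
 have nd: "nondeg (p - y) (p - x)" by (rule is_edge_nondeg[OF xy(1)]) (use xy in \<open>auto simp: is_edge_def\<close>)
 have "agree q M (insert p J')"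
  by (rule agree_insert[OF ag K(4) _ _ m lJ[OF xy(1)] lJ[OF xy(2)] nd]) (use p Suc.prems(4) in \<open>auto simp: J'_def\<close>)
 moreover have "insert p J' = J" using p by (auto simp: J'_def)
 ultimately show ?case by simp
qed

end

context gadget_polytope
begin

definition hub_face :: "('a \<times> real \<times> real) set" where
 "hub_face = convex hull (point C ` faceset C zf {0})"

lemma hub_face: "hub_face face_of body C" "hub_face \<inter> slot_face = {}"
proof -
 have lz: "linear (zf :: 'a => real)" by (simp add: linear_iff)
 have zc: "fcert C zf {0}" using C(1) hub(1) by (simp add: wf_config_def)
 show f: "hub_face face_of body C" unfolding hub_face_def by (rule config_face(1)[OF C(1) lz zc])
 have conv: "convex {x :: 'a \<times> real \<times> real. snd x = s}" for s
  unfolding convex_def by (auto simp: scaleR_left_distrib[symmetric])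
 have "hub_face \<subseteq> {x. snd x = shadow C 0}"
  unfolding hub_face_def by (rule hull_minimal) (auto simp: faceset_def point_def conv)
 moreover have "slot_face \<subseteq> {x. snd x = shadow C m}"
  unfolding slot_face_def by (rule hull_minimal) (auto simp: point_def conv)
 moreover have "shadow C 0 ~= shadow C m"
 proof
  assume eq: "shadow C 0 = shadow C m"
  obtain L where L: "\<forall>i\<in>{0}. (0::real) + L (shadow C i) = 0" "\<forall>i\<in>idx C - {0}. 0 + L (shadow C i) < 0"
   using zc unfolding fcert_def cert_def by auto
  have "0 + L (shadow C m) < 0" by (rule bspec[OF L(2)]) (use slot(1,2) in simp)
  thus False using eq L(1) by simp
 qed
 ultimately have "False" if "x \<in> hub_face" "x \<in> slot_face" for x using that by (metis (mono_tags, lifting) mem_Collect_eq subsetD)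
 thus "hub_face \<inter> slot_face = {}" by blast
qed

lemma slot_directions:
 fixes \<rho> :: "'a \<times> real \<times> real => 'b::real_vector"
 assumes vm: "vertex_map (body C) S \<rho>"
 defines "q \<equiv> \<lambda>v. hat (\<rho> (point C (m, c *R v)))"
 defines "L \<equiv> span (hat ` \<rho> ` (vertices (body C) \<inter> hub_face))"
 obtains X where "\<And>k v. k ~= 0 ==> X (k *R v) = X v" "\<And>a b. (a, b) \<in> PL ==> par X a b"
  "\<And>v. v \<in> D ==> X v \<in> L" "\<And>v. v \<in> V ==> q v \<notin> L" "\<And>v w. v \<in> V ==> w \<in> V ==> v ~= w ==> q v \<notin> span {q w}"
  "\<And>J v w. J \<in> insert V (set (levels f (card V - 3) V)) ==> is_edge J v w ==> X (v - w) \<in> span {q v, q w} & X (v - w) ~= 0"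
proof -
 let ?r = "\<lambda>p. hat (\<rho> (point C p))"
 have inc: "incidence U (zonotope E) E C (vlabels C) ?r"
  by (rule incidence_realization[OF C(1) hub E(1,2) U one vm])
 interpret inc: incidence U "zonotope E" E C "vlabels C" ?r by (rule inc)
 have "\<exists>x. \<forall>u\<in>U. u e = 0 --> x ~= 0 & x \<in> inc.lin u 0 & (\<forall>F. reach U (zonotope E) C F --> x \<in> inc.lin u F)" if e: "e \<in> E" for e
  by (rule inc.direction_exists[OF slotE[OF e] e]) blast
 hence "\<forall>e\<in>E. \<exists>x. \<forall>u\<in>U. u e = 0 --> x ~= 0 & x \<in> inc.lin u 0 & (\<forall>F. reach U (zonotope E) C F --> x \<in> inc.lin u F)" by blast
 then obtain X1 where X1: "\<forall>e\<in>E. \<forall>u\<in>U. u e = 0 --> X1 e ~= 0 & X1 e \<in> inc.lin u 0 & (\<forall>F. reach U (zonotope E) C F --> X1 e \<in> inc.lin u F)"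
  by (rule bchoice[THEN exE])
 \<comment> \<open>If no functional in \<open>U\<close> vanishes on \<open>e\<close>, nothing
   determines an ideal point. The default 0 keeps the value in the span of the hub, and no visible
   edge has such a direction.\<close>
 define X0 where "X0 e = (if \<exists>u\<in>U. u e = 0 then X1 e else 0)" for e
 interpret dir: incidence_directions U "zonotope E" E C "vlabels C" ?r X0
  by unfold_locales (use X1 in \<open>auto simp: X0_def\<close>)
 define X where "X v = X0 (rep D v)" for v
 have L: "inc.full 0 = L"
 proof -
  have lz: "linear (zf :: 'a => real)" by (simp add: linear_iff)
  have zc: "fcert C zf {0}" using C(1) hub(1) by (simp add: wf_config_def)
  have "vertices (body C) \<inter> hub_face = point C ` (Pair 0 ` fibre C 0 \<inter> vlabels C)"
   using vertices_face[OF C(1) lz zc] unfolding hub_face_def faceset_zf .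
  thus ?thesis unfolding L_def inc.full_def by (simp add: image_image)
 qed
 have n3: "card V = (card V - 3) + 3" by (rule n)
 have stat: "chain_static U E V (levels f (card V - 3) V)"
  using levels_static[OF V(1) n3 f(2,1)] ad by blast
 obtain F where s: "reach U (zonotope E) C F"
  "\<forall>J\<in>insert V (set (levels f (card V - 3) V) \<union> set []). \<forall>u e v w. vis U E J u e v w --> X0 e \<in> span {?r (m, c *R v), ?r (m, c *R w)}"
  by (rule dir.slot_lines[OF slotV finV neV stat]) auto
 have XL: "X v \<in> L" if v: "v \<in> D" for v
 proof (cases "\<exists>u\<in>U. u (rep D v) = 0")
  case True
  then obtain u where u: "u \<in> U" "u (rep D v) = 0" by blast
  have "rep D v \<in> E" using v E(3) by blast
  from dir.X_full0[OF u(1) this u(2) s(1)] show ?thesis unfolding L X_def .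
 next
  case False
  thus ?thesis unfolding X_def X0_def L_def by (simp add: span_zero)
 qed
 have sc: "X (k *R v) = X v" if "k ~= 0" for k v unfolding X_def rep_scale[OF that] ..
 have scert: "\<forall>u\<in>U. fcert C u {m}" using slot(5) by blast
 have qL: "q v \<notin> L" if v: "v \<in> V" for v
 proof -
  obtain u where "u \<in> U" "top_set u V = {v}" using exV[OF v] by blast
  from dir.slot_vertex(2)[OF slot(1-4) scert finV this] show ?thesis unfolding L q_def .
 qed
 have qind: "q v \<notin> span {q w}" if vw: "v \<in> V" "w \<in> V" "v ~= w" for v w
  unfolding q_def by (rule inc.ind[OF slot_vlabels[OF vw(1)] slot_vlabels[OF vw(2)]]) (use vw(3) slot(3) in simp)
 have lines: "X (v - w) \<in> span {q v, q w} & X (v - w) ~= 0"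
  if J: "J \<in> insert V (set (levels f (card V - 3) V))" and e: "is_edge J v w" for J v w
 proof -
  have "adequate U E D J" by (rule ad) (use J in blast)
  then obtain u where u: "vis U E J u (rep D (v - w)) v w" using adequate_edge[OF _ e] by blast
  have "X0 (rep D (v - w)) \<in> span {?r (m, c *R v), ?r (m, c *R w)}" using s(2) J u by auto
  moreover have "X0 (rep D (v - w)) ~= 0" using dir.X[of u "rep D (v - w)"] u by (simp add: vis_def)
  ultimately show ?thesis unfolding X_def q_def by blast
 qed
 have par: "par X a b" if ab: "(a, b) \<in> PL" for a b
 proof -
  let ?Q = "{0, a, a + b, b}"
  have adQ: "adequate U E D J" if "J \<in> par_levels (a, b)" for J by (rule ad) (use ab that in blast)
  have ads: "adequate U E D ?Q" "adequate U E D {0, a, a + b}" "adequate U E D {a, a + b, b}"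
   by (rule adQ, simp add: par_levels_def)+
  note nd = PL[OF ab]
  note p = parallelogram_edges[OF nd]
  have m1: "rep D (- v) = rep D v" for v using rep_scale[of "-1" D v] by simp
  have r: "rep D (0 - a) = rep D a" "rep D (b - (a + b)) = rep D a" "rep D (0 - b) = rep D b" "rep D (a - (a + b)) = rep D b"
   "rep D (0 - (a + b)) = rep D (a + b)"
   using m1[of a] m1[of b] m1[of "a + b"] by (simp_all only: diff_0 add_diff_cancel_left add_diff_cancel_right diff_add_cancel) (simp_all add: m1)
  obtain u1 u2 u3 u4 u5 u6 where
   vs: "vis U E ?Q u1 (rep D a) 0 a" "vis U E ?Q u2 (rep D a) b (a + b)" "vis U E ?Q u3 (rep D b) 0 b" "vis U E ?Q u4 (rep D b) a (a + b)"
   "vis U E {0, a, a + b} u5 (rep D (a + b)) 0 (a + b)" "vis U E {a, a + b, b} u6 (rep D (a - b)) a b"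
   using adequate_edge[OF ads(1) p(7)] adequate_edge[OF ads(1) p(8)] adequate_edge[OF ads(1) p(9)] adequate_edge[OF ads(1) p(10)]
    adequate_edge[OF ads(2) p(11)] adequate_edge[OF ads(3) p(12)] unfolding r by blast
  have sl: "slot_ok U (zonotope E) C (?Q, [{0, a, a + b}], [{a, a + b, b}])"
   using slotP[OF ab] by (simp add: par_gadget_def)
  have ex: "\<forall>v\<in>?Q. \<exists>u\<in>U. top_set u ?Q = {v}" using ads(1) unfolding adequate_def by blast
  show ?thesis
   unfolding par_def X_def
   by (rule dir.parallelogram[OF sl par_static[OF nd ads(1)] ex vs p(1-4)])
 qed
 show ?thesis by (rule that[of X]) (fact sc par XL qL qind lines)+
qed

text \<open>Descending along edges puts all realized vertices into the span of one of them and
  \<open>B\<close>. The face has dimension \<open>d\<close> in every realization, so this span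
  contains \<open>d + 1\<close> independent vectors.\<close>

lemma slot_rank:
 fixes \<rho> :: "'a \<times> real \<times> real => 'b::real_vector"
 assumes vm: "vertex_map (body C) S \<rho>" and dim: "has_aff_dim V d"
 defines "q \<equiv> \<lambda>v. hat (\<rho> (point C (m, c *R v)))"
 assumes lines: "\<And>v w. is_edge V v w ==> X (v - w) \<in> span {q v, q w} & X (v - w) ~= 0" and XL: "\<And>v. v \<in> D ==> X v \<in> L"
  and L: "subspace L" and out: "\<And>v. v \<in> V ==> q v \<notin> L" and B: "finite B" "\<And>v w. v \<in> V ==> w \<in> V ==> v ~= w ==> X (v - w) \<in> span B"
 shows "d <= int (card B)"
proof -
 have "Min (f ` V) \<in> f ` V" using finV neV by (intro Min_in) auto
 then obtain v0 where v0: "v0 \<in> V" "f v0 = Min (f ` V)" by auto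
 have le: "f v0 <= f x" if "x \<in> V" for x using v0(2) finV that by simp
 have all: "q v \<in> span (insert (q v0) B)" if v: "v \<in> V" for v
 proof (rule edge_descent[OF V(1) f v0(1) le, where Q = "\<lambda>v. q v \<in> span (insert (q v0) B)", OF _ _ _ v])
  show "q v0 \<in> span (insert (q v0) B)" by (simp add: span_base)
  fix v w assume e: "is_edge V v w" and qw: "q w \<in> span (insert (q v0) B)"
  have vw: "v \<in> V" "w \<in> V" "v ~= w" using e by (auto simp: is_edge_def)
  have x: "X (v - w) \<in> span {q v, q w}" "X (v - w) ~= 0" "X (v - w) \<in> L" using lines[OF e] XL D(1)[OF vw] by auto
  have "X (v - w) \<notin> span {q w}"
  proof
   assume "X (v - w) \<in> span {q w}"
   hence "q w \<in> span {X (v - w)}" using span_singleton_sym x(2) by blast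
   moreover have "span {X (v - w)} \<subseteq> L" using x(3) L by (simp add: span_minimal)
   ultimately show False using out[OF vw(2)] by blast
  qed
  hence "q v \<in> span {X (v - w), q w}" by (rule in_span_insert[OF x(1)])
  moreover have "span B \<subseteq> span (insert (q v0) B)" by (rule span_mono) blast
  hence "{X (v - w), q w} \<subseteq> span (insert (q v0) B)" using B(2)[OF vw] qw by blast
  hence "span {X (v - w), q w} \<subseteq> span (insert (q v0) B)" by (rule span_minimal[OF _ subspace_span])
  ultimately show "q v \<in> span (insert (q v0) B)" by blast
 qed auto
 have "has_aff_dim ((\<lambda>v. point C (m, c *R v)) ` V) d"
 proof (rule has_aff_dim_image[OF _ _ _ dim])
  let ?j = "\<lambda>y. ((c *R fst y, snd y *R shadow C m), snd y) :: ('a \<times> real \<times> real) \<times> real"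
  show "linear ?j" by (auto simp: linear_iff algebra_simps)
  show "inj ?j" using slot(3) by (auto simp: inj_def prod_eq_iff)
  show "hat (point C (m, c *R v)) = ?j (hat v)" for v by (simp add: hat_def point_def)
 qed
 hence "has_aff_dim slot_face d" unfolding slot_face_def has_aff_dim_convex_hull .
 hence "has_aff_dim (\<rho> ` (vertices (body C) \<inter> slot_face)) d"
  using vm slot_face(1) unfolding vertex_map_def by blast
 then obtain B' where B': "B' \<subseteq> \<rho> ` (\<lambda>v. point C (m, c *R v)) ` V" "finite B'" "independent (hat ` B')" "int (card B') = d + 1"
  unfolding slot_face(2) by (rule has_aff_dim_subset) blast
 have "hat ` B' \<subseteq> span (insert (q v0) B)" using B'(1) all unfolding q_def by blast
 hence "card (hat ` B') <= card (insert (q v0) B)" using independent_span_bound[OF _ B'(3)] B(1) by blast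
 moreover have "card (insert (q v0) B) <= Suc (card B)" by (rule card_insert_le_m1) simp_all
 moreover have "card (hat ` B') = card B'" by (rule card_image[OF inj_hat])
 ultimately show ?thesis using B'(4) by simp
qed

text \<open>\<open>agree_levels\<close> makes \<open>q v\<close> a multiple \<open>s v\<close> of an
  affine copy \<open>R v\<close>. Factors of both signs are impossible: a segment between two
  realized vertices would meet the span of the hub, which the disjointness of the two faces
  excludes. A common sign is absorbed into the linear map.\<close>

lemma slot_projective:
 fixes \<rho> :: "'a \<times> real \<times> real => 'b::real_vector"
 assumes vm: "vertex_map (body C) S \<rho>"
 defines "q \<equiv> \<lambda>v. hat (\<rho> (point C (m, c *R v)))"
 defines "L \<equiv> span (hat ` \<rho> ` (vertices (body C) \<inter> hub_face))"
 assumes M: "linear M" "inj_on M (span V)" "\<And>v w. v \<in> V ==> w \<in> V ==> M (v - w) \<in> L"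
  and out: "\<And>v. v \<in> V ==> q v \<notin> L" and ind: "\<And>v w. v \<in> V ==> w \<in> V ==> v ~= w ==> q v \<notin> span {q w}"
  and lines: "\<And>J v w. J \<in> insert V (set (levels f (card V - 3) V)) ==> is_edge J v w ==> M (v - w) \<in> span {q v, q w}"
 shows "\<exists>T. linear T & (\<forall>v\<in>V. \<exists>l>0. T (hat v) = l *R q v)"
proof -
 have subL: "subspace L" unfolding L_def by (rule subspace_span)
 interpret agreement L M q V "span V"
  by (rule agreement.intro) (fact subL M out ind subspace_span span_superset)+
 have n3: "card V = (card V - 3) + 3" by (rule n)
 have "agree q M V" by (rule agree_levels[OF V(1) n3 f(2) order_refl lines])
 then obtain R k where R: "k ~= 0" "\<forall>v\<in>V. \<exists>s. s ~= 0 & q v = s *R R v" "\<forall>v\<in>V. \<forall>w\<in>V. R v - R w = k *R M (v - w)"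
  unfolding agree_def by blast
 obtain s where s: "\<forall>v\<in>V. s v ~= 0 & q v = s v *R R v" using bchoice[OF R(2)] by blast
 have Rq: "R v = (1 / s v) *R q v" if "v \<in> V" for v using bspec[OF s that] by simp
 have sign: False if vw: "v \<in> V" "w \<in> V" "s v > 0" "s w < 0" for v w
 proof -
  \<comment> \<open>Opposite signs of \<open>s v\<close> and \<open>s w\<close> make both weights
    positive, and with them \<open>q v\<close> and \<open>q w\<close> combine to
    \<open>R v - R w\<close>, a multiple of \<open>M (v - w)\<close> and so an element of
    \<open>L\<close>.\<close>
  define \<alpha> \<beta> where "\<alpha> = 1 / s v" and "\<beta> = - 1 / s w"
  have ab: "\<alpha> > 0" "\<beta> > 0" using vw by (simp_all add: \<alpha>_def \<beta>_def divide_neg_neg)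
  let ?a = "\<rho> (point C (m, c *R v))" and ?b = "\<rho> (point C (m, c *R w))"
  define z where "z = (\<alpha> / (\<alpha> + \<beta>)) *R ?a + (\<beta> / (\<alpha> + \<beta>)) *R ?b"
  have one: "\<alpha> / (\<alpha> + \<beta>) + \<beta> / (\<alpha> + \<beta>) = 1" using ab by (simp add: add_divide_distrib[symmetric])
  have inV: "?a \<in> \<rho> ` (vertices (body C) \<inter> slot_face)" "?b \<in> \<rho> ` (vertices (body C) \<inter> slot_face)"
   unfolding slot_face(2) using vw by auto
  have zc: "z \<in> convex hull (\<rho> ` (vertices (body C) \<inter> slot_face))"
   unfolding z_def using ab one inV by (intro convexD[OF convex_convex_hull] hull_inc) auto
  have hz: "hat z = (1 / (\<alpha> + \<beta>)) *R (\<alpha> *R q v + \<beta> *R q w)"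
   using one ab by (simp add: hat_def z_def q_def scaleR_add_right)
  have "\<alpha> *R q v + \<beta> *R q w = R v - R w" unfolding Rq[OF vw(1)] Rq[OF vw(2)] by (simp add: \<alpha>_def \<beta>_def)
  also have "... = k *R M (v - w)" using R(3) vw by blast
  also have "... \<in> L" using diffL[OF vw(1,2)] by (rule subspace_scale[OF subL])
  finally have "hat z \<in> L" unfolding hz by (rule subspace_scale[OF subL])
  thus False using vm hub_face(1) slot_face(1) hub_face(2) zc unfolding vertex_map_def L_def by blast
 qed
 have "\<exists>\<sigma>::real. \<sigma> ~= 0 & (\<forall>v\<in>V. \<sigma> / s v > 0)"
 proof (cases "\<exists>v\<in>V. s v > 0")
  case True
  hence "\<forall>v\<in>V. 1 / s v > 0" using sign s by (metis linorder_neqE_linordered_idom zero_less_divide_1_iff)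
  thus ?thesis by (intro exI[of _ 1]) simp
 next
  case False
  hence "\<forall>v\<in>V. s v < 0" using s by (metis linorder_neqE_linordered_idom)
  hence "\<forall>v\<in>V. (-1) / s v > 0" by (simp add: zero_less_divide_iff)
  thus ?thesis by (intro exI[of _ "-1"]) simp
 qed
 then obtain \<sigma> :: real where \<sigma>: "\<forall>v\<in>V. \<sigma> / s v > 0" by blast
 define T where "T y = \<sigma> *R (k *R M (fst y) + snd y *R R 0)" for y :: "'a \<times> real"
 have "linear T"
  unfolding T_def using linear_add[OF M(1)] linear_scale[OF M(1)] by (auto simp: linear_iff algebra_simps)
 moreover have "\<forall>v\<in>V. \<exists>l>0. T (hat v) = l *R q v"
 proof
  fix v assume v: "v \<in> V"
  have "R v - R 0 = k *R M v" using R(3) v V(3) by (metis diff_zero)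
  hence "T (hat v) = \<sigma> *R R v" by (simp add: T_def hat_def algebra_simps)
  also have "... = (\<sigma> / s v) *R q v" unfolding Rq[OF v] by simp
  finally show "\<exists>l>0. T (hat v) = l *R q v" using \<sigma> v by blast
 qed
 ultimately show ?thesis by blast
qed

end

section \<open>Polytopes with a projectively unique face\<close>

text \<open>\<open>g\<close> places a copy of \<open>convex hull V\<close> as a face of \<open>B\<close> whose shape is determined, up to a
 projective transformation, by the face lattice of \<open>B\<close>.\<close>

definition rigid_face :: "rvec set => (rvec \<times> real \<times> real) set => (rvec => rvec \<times> real \<times> real) => bool" where
 "rigid_face V B g \<longleftrightarrow> polytope B & convex hull (g ` V) face_of B & g ` V \<subseteq> vertices B &
   (\<forall>(S :: rvec set) \<rho>. vertex_map B S \<rho> --> (\<exists>T. linear T & (\<forall>v\<in>V. \<exists>l>0. T (hat v) = l *R hat (\<rho> (g v)))))"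

text \<open>The differences of vertices have forced coordinates with respect to a dual basis, so
  \<open>algebra_main\<close> supplies a finite list of parallelograms valid for all realizations;
  the polytope is built from this list. In a realization the resulting linear \<open>M\<close> gives
  all edges of all levels their ideal points.\<close>

lemma rigid_face_gadgets:
 fixes V :: "rvec set"
 assumes V: "convex_position V" "card V >= 3" "0 \<in> V"
  and alg: "\<And>v w k. v \<in> V ==> w \<in> V ==> forced (\<lambda>\<phi>. \<phi> (coord (v - w) k) = coord (v - w) k)"
  and dim: "has_aff_dim V d"
 shows "\<exists>B c s. c > 0 & has_aff_dim B (d + 2) & rigid_face V B (\<lambda>v. (c *R v, s))"
proof -
 have finV: "finite V" using V(1) by (simp add: convex_position_def)
 obtain Bs where Bs: "finite Bs" "Bs \<subseteq> V" "independent Bs" "span Bs = span V" "int (card Bs) = d"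
  by (rule has_aff_dim_span_basis[OF V(3) dim])
 have "\<exists>K b. finite K & card K = card Bs & (\<forall>k\<in>K. \<forall>l\<in>K. coord (b k) l = (if k = l then 1 else 0)) &
  (\<forall>v\<in>span Bs. v = (\<Sum>k\<in>K. coord v k *R b k)) & b ` K \<subseteq> span Bs"
 proof (rule dual_coordinates[OF Bs(1,3)], goal_cases)
  case (1 K b)
  thus ?case by - (rule exI[of _ K], rule exI[of _ b], intro conjI ballI)
 qed
 then obtain K b where KB: "finite K" "card K = card Bs" "\<forall>k\<in>K. \<forall>l\<in>K. coord (b k) l = (if k = l then 1 else 0)"
  "\<forall>v\<in>span Bs. v = (\<Sum>k\<in>K. coord v k *R b k)" "b ` K \<subseteq> span Bs"
  by (elim exE conjE)
 note Kb = KB(1,2) and dual = KB(3)[rule_format] and coord = KB(4)[rule_format] and bK = KB(5)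
 have lsum: "coord (\<Sum>k\<in>K. c k *R b k) l = (\<Sum>k\<in>K. c k * coord (b k) l)" for c l
  using Kb(1) by (induction K rule: finite_induct) (simp_all add: lookup_add lookup_scaleR)
 have indb: "indep_family K b"
  unfolding indep_family_def
 proof (intro conjI allI impI ballI)
  fix c l assume c: "(\<Sum>k\<in>K. c k *R b k) = 0" and l: "l \<in> K"
  have "(\<Sum>k\<in>K. c k * coord (b k) l) = (\<Sum>k\<in>K. if k = l then c k else 0)"
   by (rule sum.cong) (use dual l in auto)
  also have "... = c l" using Kb(1) l by simp
  finally show "c l = 0" using lsum[of c l] c by simp
 qed (rule Kb(1))
 have c2: "card K >= 2"
 proof -
  obtain v w w' where vw: "v \<in> V" "w \<in> V" "w' \<in> V" "v ~= w" "v ~= w'" "v - w' \<notin> span {v - w}"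
   by (rule is_edge_two_directions[OF V(1,2)])
  have "independent {v - w', v - w}" "v - w' ~= v - w"
   using vw(4,6) by (auto simp: independent_insert span_base)
  moreover have "{v - w', v - w} \<subseteq> span Bs" unfolding Bs(4) using vw by (auto intro: span_diff span_base)
  ultimately have "card {v - w', v - w} <= card Bs" using independent_span_bound[OF Bs(1)] by blast
  thus ?thesis using \<open>v - w' ~= v - w\<close> Kb(2) by simp
 qed
 define Cs where "Cs = (\<lambda>(v, w). coord (v - w)) ` {(v, w) \<in> V \<times> V. v ~= w}"
 have dV: "v - w \<in> span Bs" if "v \<in> V" "w \<in> V" for v w unfolding Bs(4) using that by (auto intro: span_diff span_base)
 have finCs: "finite Cs" unfolding Cs_def by (rule finite_imageI, rule finite_subset[of _ "V \<times> V"]) (use finV in auto)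
 have algC: "forced (\<lambda>\<phi>. \<phi> (c k) = c k)" if "c \<in> Cs" "k \<in> K" for c k using that alg by (auto simp: Cs_def)
 have neC: "\<exists>k\<in>K. c k ~= 0" if "c \<in> Cs" for c
 proof (rule ccontr)
  assume z: "\<not> ?thesis"
  obtain v w where vw: "v \<in> V" "w \<in> V" "v ~= w" "c = coord (v - w)" using \<open>c \<in> Cs\<close> by (auto simp: Cs_def)
  have "(\<Sum>k\<in>K. coord (v - w) k *R b k) = 0" using z vw(4) by (intro sum.neutral) auto
  hence "v - w = 0" by (rule trans[OF coord[OF dV[OF vw(1,2)]]])
  thus False using vw(3) by simp
 qed
 show ?thesis
 proof (rule algebra_main[where 'c = "rvec \<times> real" and K = K and b = b and Cs = Cs])
  show "indep_family K b" "2 <= card K" "finite Cs" by (rule indb c2 finCs)+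
  show "forced (\<lambda>\<phi>. \<phi> (c k) = c k)" if "c \<in> Cs" "k \<in> K" for c k by (rule algC[OF that])
  show "\<exists>k\<in>K. c k ~= 0" if "c \<in> Cs" for c by (rule neC[OF that])
  fix PL assume PL: "finite PL" "\<And>p q. (p, q) \<in> PL ==> nondeg p q & p \<in> span (b ` K) & q \<in> span (b ` K)"
   and main: "\<And>X :: rvec => rvec \<times> real. (\<And>c v. c ~= 0 ==> X (c *R v) = X v) ==> (\<And>p q. (p, q) \<in> PL ==> par X p q) ==>
    \<forall>S. finite S --> (\<forall>c\<in>Cs. X (\<Sum>k\<in>K. c k *R b k) \<in> span S) --> card K <= card S ==>
    \<exists>y. indep_family K y & (\<forall>c\<in>Cs. propto (X (\<Sum>k\<in>K. c k *R b k)) (\<Sum>k\<in>K. c k *R y k))"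
  have "span (b ` K) \<subseteq> span V" using bK unfolding Bs(4) by (simp add: span_minimal)
  hence "nondeg p q & p \<in> span V & q \<in> span V" if "(p, q) \<in> PL" for p q using PL(2)[OF that] by blast
  then obtain U D E f C m c where gp: "gadget_polytope V PL U D E f C m c"
   using gadget_polytope_exists[OF V PL(1)] by blast
  interpret gp: gadget_polytope V PL U D E f C m c by (rule gp)
  have "rigid_face V (body C) (\<lambda>v. (c *R v, shadow C m))"
   unfolding rigid_face_def
  proof (intro conjI allI impI)
   show "polytope (body C)"
    unfolding body_def polytope_def using finite_labels[OF gp.C(1)] by blast
   show "convex hull ((\<lambda>v. (c *R v, shadow C m)) ` V) face_of body C"
    using gp.slot_face(1) by (simp add: gp.slot_face_def point_def)
   show "(\<lambda>v. (c *R v, shadow C m)) ` V \<subseteq> vertices (body C)"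
    using gp.slot_face(2) by (auto simp: point_def)
   fix S :: "rvec set" and \<rho> assume vm: "vertex_map (body C) S \<rho>"
   let ?q = "\<lambda>v. hat (\<rho> (point C (m, c *R v)))" and ?L = "span (hat ` \<rho> ` (vertices (body C) \<inter> gp.hub_face))"
   have "\<exists>T. linear T & (\<forall>v\<in>V. \<exists>l>0. T (hat v) = l *R ?q v)"
   proof (rule gp.slot_directions[OF vm])
    fix X assume X: "\<And>k v. k ~= 0 ==> X (k *R v) = X v" "\<And>a b. (a, b) \<in> PL ==> par X a b"
     "\<And>v. v \<in> D ==> X v \<in> ?L" "\<And>v. v \<in> V ==> ?q v \<notin> ?L" "\<And>v w. v \<in> V ==> w \<in> V ==> v ~= w ==> ?q v \<notin> span {?q w}"
     "\<And>J v w. J \<in> insert V (set (levels f (card V - 3) V)) ==> is_edge J v w ==> X (v - w) \<in> span {?q v, ?q w} & X (v - w) ~= 0"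
    have linesV: "X (v - w) \<in> span {?q v, ?q w} & X (v - w) ~= 0" if "is_edge V v w" for v w
     by (rule X(6)[of V]) (use that in auto)
    have rank: "\<forall>S. finite S --> (\<forall>c\<in>Cs. X (\<Sum>k\<in>K. c k *R b k) \<in> span S) --> card K <= card S"
    proof (intro allI impI)
     fix S assume S: "finite S" "\<forall>c\<in>Cs. X (\<Sum>k\<in>K. c k *R b k) \<in> span S"
     have XS: "X (v - w) \<in> span S" if vw: "v \<in> V" "w \<in> V" "v ~= w" for v w
     proof -
      have "coord (v - w) \<in> Cs" using vw by (auto simp: Cs_def)
      from bspec[OF S(2) this] show ?thesis unfolding coord[OF dV[OF vw(1,2)], symmetric] .
     qed
     have "d <= int (card S)"
      by (rule gp.slot_rank[OF vm dim linesV X(3) subspace_span X(4) S(1) XS])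
     thus "card K <= card S" using Bs(5) Kb(2) by simp
    qed
    obtain y where y: "indep_family K y" "\<forall>c\<in>Cs. propto (X (\<Sum>k\<in>K. c k *R b k)) (\<Sum>k\<in>K. c k *R y k)"
     using main[OF X(1,2) rank] by blast
    define M where "M x = (\<Sum>k\<in>K. coord x k *R y k)" for x :: rvec
    have Ml: "linear M"
     by (rule linearI) (simp_all add: M_def lookup_add lookup_scaleR scaleR_add_left sum.distrib scaleR_sum_right)
    have Mi: "inj_on M (span V)"
    proof (rule inj_onI)
     fix x x' assume x: "x \<in> span V" "x' \<in> span V" "M x = M x'"
     have "(\<Sum>k\<in>K. (coord x k - coord x' k) *R y k) = M x - M x'"
      by (simp add: M_def scaleR_diff_left sum_subtractf)
     also have "... = 0" using x(3) by simp
     finally have s: "(\<Sum>k\<in>K. (coord x k - coord x' k) *R y k) = 0" .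
     have "\<forall>c. (\<Sum>k\<in>K. c k *R y k) = 0 --> (\<forall>k\<in>K. c k = 0)" using y(1) by (simp add: indep_family_def)
     from mp[OF spec[OF this, of "\<lambda>k. coord x k - coord x' k"] s]
     have e: "\<forall>k\<in>K. coord x k = coord x' k" by simp
     have "x = (\<Sum>k\<in>K. coord x k *R b k)" using x(1) Bs(4) by (intro coord) simp
     also have "... = (\<Sum>k\<in>K. coord x' k *R b k)" by (rule sum.cong) (use e in auto)
     also have "... = x'" using x(2) Bs(4) by (intro coord[symmetric]) simp
     finally show "x = x'" .
    qed
    have prp: "\<exists>a. a ~= 0 & M (v - w) = a *R X (v - w)" if vw: "v \<in> V" "w \<in> V" "v ~= w" for v w
    proof -
     have "coord (v - w) \<in> Cs" using vw by (auto simp: Cs_def)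
     from bspec[OF y(2) this] have "propto (X (v - w)) (M (v - w))"
      unfolding coord[OF dV[OF vw(1,2)], symmetric] M_def .
     then obtain a where a: "a ~= 0" "X (v - w) = a *R M (v - w)" by (auto simp: propto_def)
     hence "M (v - w) = (1 / a) *R X (v - w)" by simp
     thus ?thesis using a(1) by (intro exI[of _ "1 / a"]) simp
    qed
    have MvwL: "M (v - w) \<in> ?L" if vw: "v \<in> V" "w \<in> V" for v w
    proof (cases "v = w")
     case True
     thus ?thesis using linear_0[OF Ml] by (simp add: span_zero)
    next
     case False
     obtain a where "M (v - w) = a *R X (v - w)" using prp[OF vw False] by blast
     thus ?thesis using X(3)[OF gp.D(1)[OF vw False]] by (simp add: span_scale)
    qed
    have lines: "M (v - w) \<in> span {?q v, ?q w}" if J: "J \<in> insert V (set (levels f (card V - 3) V))" and e: "is_edge J v w" for J v w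
    proof -
     have "J \<subseteq> V" using levels_props[OF V(1) gp.n gp.f(2)] J by blast
     hence vw: "v \<in> V" "w \<in> V" "v ~= w" using e by (auto simp: is_edge_def)
     obtain a where "M (v - w) = a *R X (v - w)" using prp[OF vw] by blast
     thus ?thesis using X(6)[OF J e] by (simp add: span_scale)
    qed
    show ?thesis by (rule gp.slot_projective[OF vm Ml Mi MvwL X(4,5) lines])
   qed
   thus "\<exists>T. linear T & (\<forall>v\<in>V. \<exists>l>0. T (hat v) = l *R hat (\<rho> (c *R v, shadow C m)))"
    by (simp add: point_def)
  qed
  thus ?thesis using gp.slot(3) gp.body_dim[OF dim] by blast
 qed
qed

lemma independent_hat_convex_position:
 assumes "finite A" "independent (hat ` A)"
 shows "convex_position A"
 unfolding convex_position_def
proof (intro conjI ballI notI assms(1))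
 fix v assume v: "v \<in> A" "v \<in> convex hull (A - {v})"
 hence "hat v \<in> span (hat ` (convex hull (A - {v})))" by (intro span_base) auto
 hence "hat v \<in> span (hat ` A - {hat v})"
  unfolding span_hat_convex_hull using span_mono[of "hat ` (A - {v})" "hat ` A - {hat v}"] by (auto simp: hat_def)
 thus False using assms(2) v(1) unfolding dependent_def by blast
qed

text \<open>Affinely independent vertices can be sent anywhere by a linear map on homogeneous
  coordinates, with all factors equal to 1. Two apexes over \<open>V\<close> raise the
  dimension.\<close>

lemma rigid_face_simplex:
 fixes V :: "rvec set"
 assumes V: "finite V" "independent (hat ` V)" and dim: "has_aff_dim V d"
 shows "\<exists>B. has_aff_dim B (d + 2) & rigid_face V B (\<lambda>v. (v, 0, 0))"
proof -
 let ?j = "\<lambda>v :: rvec. (v, 0::real, 0::real)"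
 define A where "A = insert (0, 1, 0) (insert (0, 0, 1) (?j ` V))"
 have finA: "finite A" using V(1) by (simp add: A_def)
 have dimA: "has_aff_dim A (d + 2)" unfolding A_def by (rule has_aff_dim_two_apexes[OF dim])
 have dV: "d = int (card V) - 1"
 proof -
  have "has_aff_dim V (int (card V) - 1)" unfolding has_aff_dim_hat using V by (intro exI[of _ V]) simp
  thus ?thesis using has_aff_dim_unique dim by blast
 qed
 have "card A = card V + 2"
  unfolding A_def using V(1) by (subst card_insert_disjoint, simp, fastforce)+ (simp add: card_image inj_on_def)
 hence cA: "int (card A) = d + 2 + 1" using dV by simp
 obtain B where B: "B \<subseteq> A" "independent (hat ` B)" "int (card B) = d + 2 + 1" by (rule has_aff_dim_subset[OF dimA])
 hence "B = A" using card_subset_eq[OF finA B(1)] cA by simp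
 hence cp: "convex_position A" using independent_hat_convex_position[OF finA] B(2) by simp
 define f :: "rvec \<times> real \<times> real => real" where "f = (\<lambda>x. - fst (snd x) - snd (snd x))"
 have f: "linear f" by (auto simp: f_def linear_iff algebra_simps)
 have "{v \<in> A. f v = 0} = ?j ` V" by (auto simp: A_def f_def)
 moreover have "convex hull {v \<in> A. f v = 0} face_of convex hull A"
  by (rule supporting_face_of[OF finA f]) (auto simp: A_def f_def)
 ultimately have face: "convex hull (?j ` V) face_of convex hull A" by simp
 have vert: "?j ` V \<subseteq> vertices (convex hull A)" unfolding convex_position_vertices[OF cp] by (auto simp: A_def)
 have "\<exists>T. linear T & (\<forall>v\<in>V. \<exists>l>0. T (hat v) = l *R hat (\<rho> (?j v)))" for \<rho> :: "rvec \<times> real \<times> real => rvec"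
 proof -
  obtain T where T: "linear T" "\<forall>x\<in>hat ` V. T x = hat (\<rho> (?j (fst x)))"
   using linear_independent_extend[OF V(2), of "\<lambda>x. hat (\<rho> (?j (fst x)))"] by blast
  have "\<forall>v\<in>V. \<exists>l>0. T (hat v) = l *R hat (\<rho> (?j v))"
   using T(2) by (intro ballI exI[of _ 1]) (simp add: hat_def)
  thus ?thesis using T(1) by blast
 qed
 moreover have "polytope (convex hull A)" unfolding polytope_def using finA by blast
 ultimately have "rigid_face V (convex hull A) ?j" unfolding rigid_face_def using face vert by blast
 moreover have "has_aff_dim (convex hull A) (d + 2)" using dimA by (simp add: has_aff_dim_convex_hull)
 ultimately show ?thesis by blast
qed

section \<open>From linear maps on homogeneous coordinates to projective equivalence\<close>

lemma homogenization_affine_hull: "homogenization (affine hull V) = span (hat ` V)"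
proof -
 have "homogenization (affine hull V) = span (hat ` (affine hull V))"
  unfolding homogenization_def by (simp add: hat_def[abs_def])
 also have "... = span (hat ` V)"
 proof
  have "hat ` (affine hull V) \<subseteq> span (hat ` V)" using hat_in_span_iff by blast
  thus "span (hat ` (affine hull V)) \<subseteq> span (hat ` V)" by (rule span_minimal[OF _ subspace_span])
  show "span (hat ` V) \<subseteq> span (hat ` (affine hull V))" by (intro span_mono image_mono hull_subset)
 qed
 finally show ?thesis .
qed

text \<open>The projective map induced by \<open>T\<close> takes \<open>p\<close> to
  \<open>y\<close>. The factor is required to be positive so that convex combinations go to convex
  combinations.\<close>

definition cone_rel :: "('a::real_vector \<times> real => 'b::real_vector \<times> real) => 'a => 'b => bool" where
 "cone_rel T p y \<longleftrightarrow> (\<exists>l>0. T (hat p) = l *R hat y)"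

lemma hat_combination: "u + v = 1 ==> hat (u *R x + v *R y) = u *R hat x + v *R hat y"
 by (simp add: hat_def)

lemma positive_combination: "0 <= u ==> 0 <= v ==> u + v = 1 ==> 0 < k ==> 0 < l ==> 0 < u * k + v * (l::real)"
 by (cases "u = 0") (auto intro: add_pos_nonneg)

text \<open>The points that are related to something form a convex set: a convex combination is
  mapped to one whose weights are multiplied by the factors and normalised by their positive sum
  \<open>N\<close>.\<close>

lemma cone_rel_forward:
 assumes T: "linear T" and V: "\<And>v. v \<in> V ==> cone_rel T v (\<sigma> v)" and p: "p \<in> convex hull V"
 shows "\<exists>y\<in>convex hull (\<sigma> ` V). cone_rel T p y"
proof -
 let ?Q = "{p. \<exists>y\<in>convex hull (\<sigma> ` V). cone_rel T p y}"
 have "V \<subseteq> ?Q" using V by (auto intro: hull_inc)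
 moreover have "convex ?Q"
 proof (rule convexI)
  fix p1 p2 u v assume p12: "p1 \<in> ?Q" "p2 \<in> ?Q" and uv: "0 <= u" "0 <= v" "u + v = (1::real)"
  obtain y1 l1 where y1: "y1 \<in> convex hull (\<sigma> ` V)" "l1 > 0" "T (hat p1) = l1 *R hat y1" using p12(1) by (auto simp: cone_rel_def)
  obtain y2 l2 where y2: "y2 \<in> convex hull (\<sigma> ` V)" "l2 > 0" "T (hat p2) = l2 *R hat y2" using p12(2) by (auto simp: cone_rel_def)
  define N where "N = u * l1 + v * l2"
  have N: "N > 0" unfolding N_def by (rule positive_combination[OF uv y1(2) y2(2)])
  have one: "u * l1 / N + v * l2 / N = 1" using N by (simp add: N_def add_divide_distrib[symmetric])
  define y where "y = (u * l1 / N) *R y1 + (v * l2 / N) *R y2"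
  have yc: "y \<in> convex hull (\<sigma> ` V)" unfolding y_def
   by (rule convexD[OF convex_convex_hull y1(1) y2(1) _ _ one]) (use uv y1 y2 N in auto)
  have "T (hat (u *R p1 + v *R p2)) = (u * l1) *R hat y1 + (v * l2) *R hat y2"
   unfolding hat_combination[OF uv(3)] linear_add[OF T] linear_scale[OF T] y1(3) y2(3) by simp
  also have "... = N *R hat y" unfolding y_def hat_combination[OF one] using N by (simp add: scaleR_add_right)
  finally have "cone_rel T (u *R p1 + v *R p2) y" unfolding cone_rel_def using N by blast
  thus "u *R p1 + v *R p2 \<in> ?Q" using yc by blast
 qed
 ultimately have "convex hull V \<subseteq> ?Q" by (rule hull_minimal)
 thus ?thesis using p by blast
qed

lemma cone_rel_backward:
 assumes T: "linear T" and V: "\<And>v. v \<in> V ==> cone_rel T v (\<sigma> v)" and y: "y \<in> convex hull (\<sigma> ` V)"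
 shows "\<exists>p\<in>convex hull V. cone_rel T p y"
proof -
 let ?Q = "{y. \<exists>p\<in>convex hull V. cone_rel T p y}"
 have "\<sigma> ` V \<subseteq> ?Q" using V by (auto intro: hull_inc)
 moreover have "convex ?Q"
 proof (rule convexI)
  fix y1 y2 u v assume y12: "y1 \<in> ?Q" "y2 \<in> ?Q" and uv: "0 <= u" "0 <= v" "u + v = (1::real)"
  obtain p1 l1 where p1: "p1 \<in> convex hull V" "l1 > 0" "T (hat p1) = l1 *R hat y1" using y12(1) by (auto simp: cone_rel_def)
  obtain p2 l2 where p2: "p2 \<in> convex hull V" "l2 > 0" "T (hat p2) = l2 *R hat y2" using y12(2) by (auto simp: cone_rel_def)
  define N where "N = u * (1 / l1) + v * (1 / l2)"
  have N: "N > 0" unfolding N_def by (rule positive_combination[OF uv]) (use p1 p2 in auto)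
  have "u * (1 / l1) / N + v * (1 / l2) / N = N / N" unfolding add_divide_distrib[symmetric] N_def[symmetric] ..
  also have "... = 1" using N by simp
  finally have one: "u * (1 / l1) / N + v * (1 / l2) / N = 1" .
  define p where "p = (u * (1 / l1) / N) *R p1 + (v * (1 / l2) / N) *R p2"
  have pc: "p \<in> convex hull V" unfolding p_def
   by (rule convexD[OF convex_convex_hull p1(1) p2(1) _ _ one]) (use uv p1 p2 N in auto)
  have "T (hat p) = (u / N) *R hat y1 + (v / N) *R hat y2"
   unfolding p_def hat_combination[OF one] linear_add[OF T] linear_scale[OF T] p1(3) p2(3) using p1(2) p2(2) by simp
  also have "... = (1 / N) *R hat (u *R y1 + v *R y2)" unfolding hat_combination[OF uv(3)] by (simp add: scaleR_add_right)
  finally have "cone_rel T p (u *R y1 + v *R y2)" unfolding cone_rel_def using N by (intro exI[of _ "1 / N"]) simp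
  thus "u *R y1 + v *R y2 \<in> ?Q" using pc by blast
 qed
 ultimately have "convex hull (\<sigma> ` V) \<subseteq> ?Q" by (rule hull_minimal)
 thus ?thesis using y by blast
qed

text \<open>The finitely supported sequences have room for two more coordinates.\<close>

definition embed :: "rvec \<times> real \<times> real => rvec" where
 "embed y = Abs_poly_mapping (\<lambda>n. if n = 0 then fst (snd y) else if n = 1 then snd (snd y) else coord (fst y) (n - 2))"

lemma lookup_embed: "coord (embed y) n =
  (if n = 0 then fst (snd y) else if n = 1 then snd (snd y) else coord (fst y) (n - 2))"
proof -
 have "{n. (if n = 0 then fst (snd y) else if n = 1 then snd (snd y) else coord (fst y) (n - 2)) ~= 0}
   \<subseteq> {0, 1} \<union> (\<lambda>n. n + 2) ` {n. coord (fst y) n ~= 0}"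
 proof
  fix n assume n: "n \<in> {n. (if n = 0 then fst (snd y) else if n = 1 then snd (snd y) else coord (fst y) (n - 2)) ~= 0}"
  show "n \<in> {0, 1} \<union> (\<lambda>n. n + 2) ` {n. coord (fst y) n ~= 0}"
  proof (cases "n = 0 \<or> n = 1")
   case False
   hence "n = (n - 2) + 2" "coord (fst y) (n - 2) ~= 0" using n by auto
   thus ?thesis by blast
  qed auto
 qed
 moreover have "finite ({0, 1} \<union> (\<lambda>n. n + 2) ` {n. coord (fst y) n ~= 0})" using finite_lookup[of "fst y"] by simp
 ultimately have "finite {n. (if n = 0 then fst (snd y) else if n = 1 then snd (snd y) else coord (fst y) (n - 2)) ~= 0}"
  by (rule finite_subset)
 thus ?thesis unfolding embed_def by (subst Abs_poly_mapping_inverse) auto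
qed

lemma linear_embed: "linear embed"
proof (rule linearI)
 show "embed (x + y) = embed x + embed y" for x y
  by (rule poly_mapping_eqI) (simp add: lookup_embed lookup_add)
 show "embed (t *R x) = t *R embed x" for t x
  by (rule poly_mapping_eqI) (simp add: lookup_embed lookup_scaleR)
qed

lemma inj_embed: "inj embed"
proof (rule injI)
 fix x y assume "embed x = embed y"
 hence l: "coord (embed x) n = coord (embed y) n" for n by simp
 have "fst x = fst y"
 proof (rule poly_mapping_eqI)
  fix n show "coord (fst x) n = coord (fst y) n" using l[of "n + 2"] by (simp add: lookup_embed)
 qed
 moreover have "snd x = snd y" using l[of 0] l[of 1] by (simp add: lookup_embed prod_eq_iff)
 ultimately show "x = y" by (simp add: prod_eq_iff)
qed

lemma realization_lower_interval:
 assumes R: "realization r S F" and f: "f \<in> Field r"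
 shows "Field (lower_interval r f) = {b \<in> Field r. F b \<subseteq> F f}" "realization (lower_interval r f) (F f) F"
proof -
 have S: "polytope S" "bij_betw F (Field r) {G. G face_of S}" "\<And>a b. a \<in> Field r ==> b \<in> Field r ==> (a, b) \<in> r \<longleftrightarrow> F a \<subseteq> F b"
  using R by (auto simp: realization_def)
 have rf: "(b, b) \<in> r" if "b \<in> Field r" for b using S(3)[OF that that] by simp
 have under: "under r f = {b \<in> Field r. F b \<subseteq> F f}"
  unfolding under_def using S(3)[OF _ f] by (blast intro: FieldI1)
 show fld: "Field (lower_interval r f) = {b \<in> Field r. F b \<subseteq> F f}"
 proof
  show "Field (lower_interval r f) \<subseteq> {b \<in> Field r. F b \<subseteq> F f}"
   unfolding lower_interval_def under by (auto simp: Field_def)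
  show "{b \<in> Field r. F b \<subseteq> F f} \<subseteq> Field (lower_interval r f)"
  proof
   fix b assume b: "b \<in> {b \<in> Field r. F b \<subseteq> F f}"
   hence "(b, b) \<in> lower_interval r f" unfolding lower_interval_def under using rf by simp
   thus "b \<in> Field (lower_interval r f)" by (rule FieldI1)
  qed
 qed
 have ff: "F b face_of S" if "b \<in> Field r" for b using bij_betwE[OF S(2)] that by blast
 show "realization (lower_interval r f) (F f) F"
  unfolding realization_def fld
 proof (intro conjI ballI)
  show "polytope (F f)" by (rule polytope_face_polytope[OF S(1) ff[OF f]])
  have "inj_on F {b \<in> Field r. F b \<subseteq> F f}" using bij_betw_imp_inj_on[OF S(2)] by (rule inj_on_subset) blast
  moreover have "F ` {b \<in> Field r. F b \<subseteq> F f} = {G. G face_of F f}"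
  proof -
   have "F ` {b \<in> Field r. F b \<subseteq> F f} = {G \<in> F ` Field r. G \<subseteq> F f}" by auto
   also have "... = {G. G face_of S & G \<subseteq> F f}" unfolding bij_betw_imp_surj_on[OF S(2)] by simp
   also have "... = {G. G face_of F f}" by (rule Collect_cong) (simp add: face_of_face[OF ff[OF f]])
   finally show ?thesis .
  qed
  ultimately show "bij_betw F {b \<in> Field r. F b \<subseteq> F f} {G. G face_of F f}" by (simp add: bij_betw_def)
  fix a b assume "a \<in> {b \<in> Field r. F b \<subseteq> F f}" "b \<in> {b \<in> Field r. F b \<subseteq> F f}"
  thus "((a, b) \<in> lower_interval r f) = (F a \<subseteq> F b)" unfolding lower_interval_def under using S(3) by blast
 qed
qed

lemma realization_pullback:
 assumes R: "realization r (A ` P) F" and A: "inj A" and face: "\<And>G. A ` G face_of A ` P \<longleftrightarrow> G face_of P" and P: "polytope P"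
 shows "realization r P (\<lambda>i. A -` F i)"
proof -
 have S: "bij_betw F (Field r) {G. G face_of A ` P}" "\<And>a b. a \<in> Field r ==> b \<in> Field r ==> (a, b) \<in> r \<longleftrightarrow> F a \<subseteq> F b"
  using R by (auto simp: realization_def)
 have im: "A ` (A -` F a) = F a" if "a \<in> Field r" for a
 proof -
  have "F a face_of A ` P" using bij_betwE[OF S(1)] that by blast
  hence "F a \<subseteq> A ` P" by (rule face_of_imp_subset)
  thus ?thesis by blast
 qed
 have vim: "A -` (A ` G) = G" for G using A by (rule inj_vimage_image_eq)
 show ?thesis
  unfolding realization_def
 proof (intro conjI ballI)
  show "polytope P" by (rule P)
  show "bij_betw (\<lambda>i. A -` F i) (Field r) {G. G face_of P}"
  proof (rule bij_betw_imageI)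
   show "inj_on (\<lambda>i. A -` F i) (Field r)"
   proof (rule inj_onI)
    fix a b assume ab: "a \<in> Field r" "b \<in> Field r" "A -` F a = A -` F b"
    hence "F a = F b" using im by metis
    thus "a = b" using bij_betw_imp_inj_on[OF S(1)] ab unfolding inj_on_def by blast
   qed
   show "(\<lambda>i. A -` F i) ` Field r = {G. G face_of P}"
   proof
    show "(\<lambda>i. A -` F i) ` Field r \<subseteq> {G. G face_of P}"
    proof
     fix G assume "G \<in> (\<lambda>i. A -` F i) ` Field r"
     then obtain i where i: "i \<in> Field r" "G = A -` F i" by auto
     have "A ` G face_of A ` P" unfolding i(2) im[OF i(1)] using bij_betwE[OF S(1)] i(1) by blast
     thus "G \<in> {G. G face_of P}" using face by simp
    qed
    show "{G. G face_of P} \<subseteq> (\<lambda>i. A -` F i) ` Field r"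
    proof
     fix G assume "G \<in> {G. G face_of P}"
     hence "A ` G \<in> F ` Field r" using face bij_betw_imp_surj_on[OF S(1)] by blast
     then obtain a where "a \<in> Field r" "F a = A ` G" by auto
     thus "G \<in> (\<lambda>i. A -` F i) ` Field r" using vim by (metis imageI)
    qed
   qed
  qed
  fix a b assume ab: "a \<in> Field r" "b \<in> Field r"
  show "((a, b) \<in> r) = (A -` F a \<subseteq> A -` F b)"
   unfolding S(2)[OF ab] using im[OF ab(1)] im[OF ab(2)] by (metis image_mono vimage_mono)
 qed
qed

text \<open>A polytope has finitely many faces, so they can be numbered and the poset lives on
  \<open>nat\<close>.\<close>

lemma face_lattice_poset:
 assumes "polytope B"
 obtains r :: "nat rel" and e where "realization r B e" "bounded_poset r"
proof -
 obtain e where e: "bij_betw e {0..<card {G. G face_of B}} {G. G face_of B}"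
  using ex_bij_betw_nat_finite[OF finite_faces_polytope[OF assms]] by blast
 define N where "N = {0..<card {G. G face_of B}}"
 define r where "r = {(i, j). i \<in> N & j \<in> N & e i \<subseteq> e j}"
 have fld: "Field r = N" unfolding r_def Field_def by auto
 have eN: "bij_betw e N {G. G face_of B}" using e by (simp add: N_def)
 have R: "realization r B e"
  unfolding realization_def fld using assms eN by (auto simp: r_def)
 have inj: "i = j" if "i \<in> N" "j \<in> N" "e i = e j" for i j using bij_betw_imp_inj_on[OF eN] that unfolding inj_on_def by blast
 have idx: "\<exists>i\<in>N. e i = G" if "G face_of B" for G
  using bij_betw_imp_surj_on[OF eN] that by (metis (mono_tags, lifting) imageE mem_Collect_eq)
 have "Partial_order r"
  unfolding partial_order_on_def preorder_on_def fld
  using inj by (auto simp: refl_on_def trans_def antisym_def r_def)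
 moreover have "\<exists>b\<in>Field r. \<forall>x\<in>Field r. (b, x) \<in> r"
  using idx[OF empty_face_of] unfolding fld by (auto simp: r_def)
 moreover have "\<exists>t\<in>Field r. \<forall>x\<in>Field r. (x, t) \<in> r"
 proof -
  obtain t where t: "t \<in> N" "e t = B" using idx[OF face_of_refl[OF polytope_imp_convex[OF assms]]] by blast
  have "e x \<subseteq> B" if "x \<in> N" for x using bij_betwE[OF eN] that face_of_imp_subset by blast
  thus ?thesis unfolding fld using t by (intro bexI[of _ t]) (auto simp: r_def)
 qed
 ultimately have "bounded_poset r" by (simp add: bounded_poset_def)
 with R show ?thesis by (rule that)
qed

lemma combinatorial_polytope_embed:
 fixes B :: "(rvec \<times> real \<times> real) set"
 assumes R: "realization r B e" "bounded_poset r" and d: "has_aff_dim B k"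
 shows "combinatorial_polytope k r"
proof -
 have B: "polytope B" "bij_betw e (Field r) {G. G face_of B}" "\<And>a b. a \<in> Field r ==> b \<in> Field r ==> (a, b) \<in> r \<longleftrightarrow> e a \<subseteq> e b"
  using R(1) by (auto simp: realization_def)
 have "has_aff_dim (embed ` B) k"
 proof (rule has_aff_dim_image[OF _ _ _ d])
  let ?T = "\<lambda>y. (embed (fst y), snd y :: real)"
  show "linear ?T" using linear_add[OF linear_embed] linear_scale[OF linear_embed] by (auto simp: linear_iff)
  show "inj ?T" using inj_embed by (auto simp: inj_def prod_eq_iff)
  show "hat (embed x) = ?T (hat x)" for x by (simp add: hat_def)
 qed
 moreover have "realization r (embed ` B) (\<lambda>i. embed ` e i)"
  unfolding realization_def
 proof (intro conjI ballI)
  show "polytope (embed ` B)" by (rule polytope_linear_image[OF linear_embed B(1)])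
  have "bij_betw ((`) embed) {G. G face_of B} ((`) embed ` {G. G face_of B})"
   by (rule bij_betw_imageI) (auto simp: inj_on_def inj_image_eq_iff[OF inj_embed])
  hence "bij_betw ((`) embed) {G. G face_of B} {G. G face_of embed ` B}"
   unfolding faces_of_linear_image[OF linear_embed inj_embed] .
  hence "bij_betw ((`) embed \<circ> e) (Field r) {G. G face_of embed ` B}" by (rule bij_betw_trans[OF B(2)])
  thus "bij_betw (\<lambda>i. embed ` e i) (Field r) {G. G face_of embed ` B}" by (simp add: comp_def)
  show "((a, b) \<in> r) = (embed ` e a \<subseteq> embed ` e b)" if "a \<in> Field r" "b \<in> Field r" for a b
   unfolding B(3)[OF that] inj_image_subset_iff[OF inj_embed] ..
 qed
 ultimately show ?thesis unfolding combinatorial_polytope_def using R(2) by blast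
qed

text \<open>\<open>T\<close> maps the span of \<open>V\<close> onto that of the image. Both have
  dimension \<open>d + 1\<close>, so \<open>T\<close> is injective there. The inverse is needed
  because the equivalence leads from the realized face to \<open>P\<close>.\<close>

lemma cone_rel_left_inverse:
 fixes T :: "'a::real_vector \<times> real => 'b::real_vector \<times> real"
 assumes T: "linear T" and V: "\<And>v. v \<in> V ==> cone_rel T v (\<sigma> v)" and d: "has_aff_dim V d" "has_aff_dim (\<sigma> ` V) d"
 shows "\<exists>T'. linear T' & (\<forall>x\<in>span (hat ` V). T' (T x) = x) & T ` span (hat ` V) = span (hat ` \<sigma> ` V)"
proof -
 obtain A where A: "A \<subseteq> V" "finite A" "independent (hat ` A)" "span (hat ` A) = span (hat ` V)" "int (card A) = d + 1"
  by (rule has_aff_dim_subset[OF d(1)])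
 obtain C where C: "C \<subseteq> \<sigma> ` V" "finite C" "independent (hat ` C)" "span (hat ` C) = span (hat ` \<sigma> ` V)" "int (card C) = d + 1"
  by (rule has_aff_dim_subset[OF d(2)])
 have "T (hat v) \<in> span (hat ` \<sigma> ` V)" if v: "v \<in> V" for v
 proof -
  obtain l where "T (hat v) = l *R hat (\<sigma> v)" using V[OF v] by (auto simp: cone_rel_def)
  thus ?thesis using v by (simp add: span_scale span_base)
 qed
 hence s1: "span (T ` hat ` V) \<subseteq> span (hat ` \<sigma> ` V)" by (intro span_minimal) auto
 have "hat (\<sigma> v) \<in> span (T ` hat ` V)" if v: "v \<in> V" for v
 proof -
  obtain l where "l > 0" "T (hat v) = l *R hat (\<sigma> v)" using V[OF v] by (auto simp: cone_rel_def)
  hence "hat (\<sigma> v) = (1 / l) *R T (hat v)" by simp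
  thus ?thesis using v by (simp add: span_scale span_base)
 qed
 hence "span (hat ` \<sigma> ` V) \<subseteq> span (T ` hat ` V)" by (intro span_minimal) auto
 hence im: "T ` span (hat ` V) = span (hat ` \<sigma> ` V)" using s1 linear_span_image[OF T, of "hat ` V"] by auto
 have TA: "span (T ` hat ` A) = span (hat ` \<sigma> ` V)" using linear_span_image[OF T, of "hat ` A"] A(4) im by simp
 have fam: "indep_family (hat ` A) T"
 proof (rule parallel_family_independent)
  show "finite (hat ` A)" using A(2) by simp
  fix S assume S: "finite S" "T ` hat ` A \<subseteq> span S"
  hence "span (T ` hat ` A) \<subseteq> span S" by (simp add: span_minimal)
  hence "hat ` C \<subseteq> span S" using TA C(4) span_superset[of "hat ` C"] by auto
  hence "card (hat ` C) <= card S" using independent_span_bound[OF S(1) C(3)] by blast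
  moreover have "card (hat ` C) = card C" "card (hat ` A) = card A" by (simp_all add: card_image inj_hat)
  ultimately show "card (hat ` A) <= card S" using A(5) C(5) by simp
 qed
 have inj: "inj_on T (span (hat ` V))"
 proof (rule inj_onI)
  fix x y assume xy: "x \<in> span (hat ` V)" "y \<in> span (hat ` V)" "T x = T y"
  have "x - y \<in> span (hat ` A)" unfolding A(4) using xy(1,2) by (rule span_diff)
  then obtain c where c: "x - y = (\<Sum>a\<in>hat ` A. c a *R a)" using A(2) by (auto simp: span_finite)
  have "(\<Sum>a\<in>hat ` A. c a *R T a) = T (x - y)" unfolding c linear_sum[OF T] linear_scale[OF T] ..
  also have "... = 0" using xy(3) by (simp add: linear_diff[OF T])
  finally have "\<forall>a\<in>hat ` A. c a = 0" using fam unfolding indep_family_def by blast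
  hence "x - y = 0" unfolding c by (intro sum.neutral) auto
  thus "x = y" by simp
 qed
 show ?thesis using linear_exists_left_inverse_on[OF T subspace_span inj] im by blast
qed

lemma projective_face:
 fixes V :: "'a::real_vector set" and \<sigma> :: "'a => 'b::real_vector"
 assumes T: "linear T" and V: "\<And>v. v \<in> V ==> cone_rel T v (\<sigma> v)" and d: "has_aff_dim V d" "has_aff_dim (\<sigma> ` V) d"
  and R: "realization r Q F" "realization r P G"
  and Q: "Q = convex hull (\<sigma> ` V)" and P: "P = convex hull V"
  and faces: "\<And>a. a \<in> Field r ==> \<exists>W\<subseteq>V. G a = convex hull W & F a = convex hull (\<sigma> ` W)"
 shows "projectively_equivalent r Q F P G"
proof -
 obtain T' where T': "linear T'" "\<And>x. x \<in> span (hat ` V) ==> T' (T x) = x" "T ` span (hat ` V) = span (hat ` \<sigma> ` V)"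
  using cone_rel_left_inverse[OF T V d] by blast
 have hQ: "homogenization (affine hull Q) = span (hat ` \<sigma> ` V)" "homogenization (affine hull P) = span (hat ` V)"
  unfolding homogenization_affine_hull Q P span_hat_convex_hull by simp_all
 define \<pi> where "\<pi> l = T' ` l" for l
 have "bij_betw T' (homogenization (affine hull Q)) (homogenization (affine hull P))"
  unfolding hQ T'(3)[symmetric] by (rule bij_betw_byWitness[of _ T]) (auto simp: T'(2))
 hence tr: "projective_transformation (affine hull Q) (affine hull P) \<pi>"
  unfolding projective_transformation_def \<pi>_def using T'(1) by blast
 have pp: "\<pi> (proj_point y) = proj_point p" if py: "cone_rel T p y" "p \<in> convex hull V" for p y
 proof -
  obtain l where l: "l > 0" "T (hat p) = l *R hat y" using py(1) by (auto simp: cone_rel_def)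
  have "hat p \<in> span (hat ` V)" using py(2) span_hat_convex_hull[of V] span_base[of "hat p" "hat ` (convex hull V)"] by auto
  hence "hat p = T' (l *R hat y)" using T'(2) l(2) by metis
  hence "hat p = l *R T' (hat y)" by (simp add: linear_scale[OF T'(1)])
  hence "span {hat p} = span {T' (hat y)}" using span_scale_singleton[of l "T' (hat y)"] l(1) by simp
  moreover have "T' ` span {hat y} = span {T' (hat y)}" using linear_span_image[OF T'(1), of "{hat y}"] by simp
  ultimately show ?thesis by (simp add: \<pi>_def proj_point_def hat_def)
 qed
 have face: "\<pi> ` proj_point ` F a = proj_point ` G a" if a: "a \<in> Field r" for a
 proof -
  obtain W where W: "W \<subseteq> V" "G a = convex hull W" "F a = convex hull (\<sigma> ` W)" using faces[OF a] by blast
  have VW: "\<And>v. v \<in> W ==> cone_rel T v (\<sigma> v)" using V W(1) by blast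
  have sub: "convex hull W \<subseteq> convex hull V" using W(1) by (rule hull_mono)
  show ?thesis
  proof
   show "\<pi> ` proj_point ` F a \<subseteq> proj_point ` G a"
   proof (clarsimp simp: W(2,3))
    fix y assume "y \<in> convex hull (\<sigma> ` W)"
    then obtain p where "p \<in> convex hull W" "cone_rel T p y" using cone_rel_backward[OF T VW] by blast
    thus "\<pi> (proj_point y) \<in> proj_point ` (convex hull W)" using pp[of p y] sub by blast
   qed
   show "proj_point ` G a \<subseteq> \<pi> ` proj_point ` F a"
   proof (clarsimp simp: W(2,3))
    fix p assume p: "p \<in> convex hull W"
    then obtain y where y: "y \<in> convex hull (\<sigma> ` W)" "cone_rel T p y" using cone_rel_forward[OF T VW] by blast
    have "p \<in> convex hull V" using p sub by blast
    hence "proj_point p = \<pi> (proj_point y)" using pp[OF y(2)] by simp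
    thus "proj_point p \<in> \<pi> ` proj_point ` (convex hull (\<sigma> ` W))" using y(1) by blast
   qed
  qed
 qed
 have "\<pi> ` proj_point ` Q \<subseteq> range proj_point"
 proof
  fix x assume "x \<in> \<pi> ` proj_point ` Q"
  then obtain y where y: "y \<in> convex hull (\<sigma> ` V)" "x = \<pi> (proj_point y)" using Q by blast
  then obtain p where "p \<in> convex hull V" "cone_rel T p y" using cone_rel_backward[OF T V] by blast
  thus "x \<in> range proj_point" using pp y(2) by blast
 qed
 thus ?thesis unfolding projectively_equivalent_def
  by (intro conjI R exI[of _ \<pi>] tr ballI face)
qed

text \<open>\<open>A\<close> places \<open>P\<close> itself, undoing the translation by
  \<open>p0\<close>, as a face of \<open>B\<close>. Pulling the faces of \<open>B\<close> back along
  \<open>A\<close> identifies the lower interval with the face lattice of \<open>P\<close>, so both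
  sides carry the same indices.\<close>

lemma rigid_face_conclusion:
 fixes P :: "rvec set"
 assumes P: "polytope P" "has_aff_dim P d" and V: "V = (\<lambda>p. p - p0) ` vertices P" and c: "c > 0"
  and rf: "rigid_face V B (\<lambda>v. (c *R v, s))" and dB: "has_aff_dim B (d + 2)"
 shows "\<exists>(\<S> :: nat rel) f\<^sub>P F\<^sub>P. combinatorial_polytope (d + 2) \<S> & f\<^sub>P \<in> Field \<S> &
  realization (lower_interval \<S> f\<^sub>P) P F\<^sub>P &
  (\<forall>(S :: rvec set) F. realization \<S> S F --> projectively_equivalent (lower_interval \<S> f\<^sub>P) (F f\<^sub>P) F P F\<^sub>P)"
proof -
 have B: "polytope B" using rf by (simp add: rigid_face_def)
 obtain r :: "nat rel" and e where r: "realization r B e" "bounded_poset r" by (rule face_lattice_poset[OF B])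
 have eB: "bij_betw e (Field r) {G. G face_of B}" using r(1) by (simp add: realization_def)
 define j where "j p = (c *R p, 0::real, 0::real)" for p :: rvec
 define a0 where "a0 = (- c *R p0, s)"
 define A where "A p = a0 + j p" for p
 have jl: "linear j" by (simp add: j_def linear_iff algebra_simps)
 have ji: "inj j" using c by (simp add: j_def inj_def)
 have Ai: "inj A" using ji by (simp add: A_def inj_def)
 have Aim: "A ` X = (+) a0 ` (j ` X)" for X by (simp add: A_def image_image)
 have face: "A ` G face_of A ` X \<longleftrightarrow> G face_of X" for G X
  unfolding Aim face_of_translation_eq face_of_linear_image[OF jl ji] ..
 have hull: "convex hull (A ` X) = A ` (convex hull X)" for X
  unfolding Aim convex_hull_translation convex_hull_linear_image[OF jl] ..
 have Ag: "A p = (c *R (p - p0), s)" for p by (cases s) (simp add: A_def a0_def j_def algebra_simps)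
 have gV: "(\<lambda>v. (c *R v, s)) ` V = A ` vertices P" unfolding V by (simp add: image_image Ag)
 have Pv: "convex hull (vertices P) = P" by (rule polytope_vertices(2)[OF P(1)])
 have AP: "A ` P = convex hull (A ` vertices P)" unfolding hull Pv ..
 have fP: "A ` P face_of B" "A ` vertices P \<subseteq> vertices B"
  using rf unfolding rigid_face_def gV AP by blast+
 have vB: "vertices B \<inter> A ` P = A ` vertices P"
 proof
  show "vertices B \<inter> A ` P \<subseteq> A ` vertices P"
  proof
   fix v assume v: "v \<in> vertices B \<inter> A ` P"
   hence "{v} face_of A ` P" using face_of_face[OF fP(1)] by (auto simp: vertices_def)
   hence "v extreme_point_of convex hull (A ` vertices P)" using AP by (simp add: vertices_extreme[symmetric] vertices_def)
   thus "v \<in> A ` vertices P" by (rule extreme_point_of_convex_hull)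
  qed
  show "A ` vertices P \<subseteq> vertices B \<inter> A ` P" using fP(2) unfolding AP by (auto intro: hull_inc)
 qed
 obtain f where f: "f \<in> Field r" "e f = A ` P"
  using bij_betw_imp_surj_on[OF eB] fP(1) by (metis (mono_tags, lifting) imageE mem_Collect_eq)
 define FP where "FP i = A -` e i" for i
 have RP: "realization (lower_interval r f) P FP"
  unfolding FP_def by (rule realization_pullback[OF _ Ai face P(1)]) (use realization_lower_interval(2)[OF r(1) f(1)] f(2) in simp)
 have "projectively_equivalent (lower_interval r f) (F f) F P FP" if R: "realization r S F" for S :: "rvec set" and F
 proof -
  obtain \<rho> where \<rho>: "vertex_map B S \<rho>" "\<forall>a\<in>Field r. F a = convex hull (\<rho> ` (vertices B \<inter> e a))"
   by (rule realization_vertex_map[OF r(1) R])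
  obtain T where T: "linear T" "\<forall>v\<in>V. \<exists>l>0. T (hat v) = l *R hat (\<rho> (c *R v, s))"
   using rf \<rho>(1) unfolding rigid_face_def by blast
  \<comment> \<open>The translation by \<open>- p0\<close> in homogeneous coordinates, followed by
    \<open>T\<close>, since rigidity is known for the translated vertices.\<close>
  define T1 where "T1 y = T (fst y - snd y *R p0, snd y)" for y :: "rvec \<times> real"
  have sl: "linear (\<lambda>y :: rvec \<times> real. (fst y - snd y *R p0, snd y))" by (auto simp: linear_iff algebra_simps)
  have T1: "linear T1" unfolding T1_def[abs_def] using linear_compose[OF sl T(1)] by (simp add: comp_def)
  have cone: "cone_rel T1 p ((\<rho> \<circ> A) p)" if "p \<in> vertices P" for p
   using T(2) that unfolding cone_rel_def V T1_def Ag by (simp add: hat_def)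
  have Ff: "F f = convex hull ((\<rho> \<circ> A) ` vertices P)"
   using \<rho>(2) f vB by (simp add: image_comp)
  have "has_aff_dim (A ` P) d"
  proof (rule has_aff_dim_image[OF _ _ _ P(2)])
   let ?T = "\<lambda>y. ((c *R (fst y - snd y *R p0), snd y *R s), snd y :: real)"
   show "linear ?T" by (auto simp: linear_iff algebra_simps)
   show "inj ?T" using c by (auto simp: inj_def prod_eq_iff)
   show "hat (A x) = ?T (hat x)" for x by (simp add: hat_def Ag)
  qed
  hence "has_aff_dim (\<rho> ` (vertices B \<inter> A ` P)) d" using \<rho>(1) fP(1) unfolding vertex_map_def by blast
  hence d2: "has_aff_dim ((\<rho> \<circ> A) ` vertices P) d" unfolding vB by (simp add: image_comp)
  have d1: "has_aff_dim (vertices P) d" using P(2) Pv has_aff_dim_convex_hull by metis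
  show ?thesis
  proof (rule projective_face[OF T1 cone d1 d2 realization_lower_interval(2)[OF R f(1)] RP Ff Pv[symmetric]])
   fix a assume "a \<in> Field (lower_interval r f)"
   hence a: "a \<in> Field r" "e a \<subseteq> A ` P" unfolding realization_lower_interval(1)[OF r(1) f(1)] using f(2) by auto
   have ea: "e a face_of B" using bij_betwE[OF eB] a(1) by blast
   define W where "W = {p \<in> vertices P. A p \<in> e a}"
   have "vertices B \<inter> e a = (vertices B \<inter> A ` P) \<inter> e a" using a(2) by blast
   also have "... = A ` W" unfolding vB W_def by blast
   finally have vW: "vertices B \<inter> e a = A ` W" .
   have "vertices (e a) \<subseteq> vertices B \<inter> e a"
   proof
    fix v assume "v \<in> vertices (e a)"
    hence v: "{v} face_of e a" by (simp add: vertices_def)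
    show "v \<in> vertices B \<inter> e a"
     using face_of_trans[OF v ea] face_of_imp_subset[OF v] by (simp add: vertices_def)
   qed
   hence "convex hull (vertices (e a)) \<subseteq> convex hull (A ` W)" unfolding vW by (rule hull_mono)
   hence "e a \<subseteq> convex hull (A ` W)" using polytope_vertices(2)[OF polytope_face_polytope[OF B ea]] by simp
   moreover have "convex hull (A ` W) \<subseteq> e a"
    using face_of_imp_convex[OF ea] by (intro hull_minimal) (auto simp: W_def)
   ultimately have "e a = A ` (convex hull W)" unfolding hull by blast
   hence "FP a = convex hull W" unfolding FP_def using inj_vimage_image_eq[OF Ai] by simp
   moreover have "F a = convex hull ((\<rho> \<circ> A) ` W)" using \<rho>(2) a(1) vW by (simp add: image_comp)
   ultimately show "\<exists>W\<subseteq>vertices P. FP a = convex hull W & F a = convex hull ((\<rho> \<circ> A) ` W)"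
    by (intro exI[of _ W]) (simp add: W_def)
  qed
 qed
 thus ?thesis using combinatorial_polytope_embed[OF r dB] f(1) RP by blast
qed

theorem theorem2p1:
  fixes P :: "rvec set" and d :: int
  assumes "algebraic_polytope P" and "has_aff_dim P d"
  shows "\<exists>(\<S> :: nat rel) f\<^sub>P F\<^sub>P.
    combinatorial_polytope (d + 2) \<S> \<and> f\<^sub>P \<in> Field \<S> \<and>
    realization (lower_interval \<S> f\<^sub>P) P F\<^sub>P \<and>
    (\<forall>(S :: rvec set) F. realization \<S> S F \<longrightarrow>
      projectively_equivalent (lower_interval \<S> f\<^sub>P) (F f\<^sub>P) F P F\<^sub>P)"
proof -
 have P: "polytope P" using assms(1) by (simp add: algebraic_polytope_def)
 have cp: "convex_position (vertices P)" and Pv: "convex hull (vertices P) = P"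
  by (rule polytope_vertices[OF P])+
 have fin: "finite (vertices P)" using cp by (simp add: convex_position_def)
 have dV: "has_aff_dim (vertices P) d" using assms(2) Pv has_aff_dim_convex_hull by metis
 have alg: "algebraic (coord p k)" if "p \<in> vertices P" for p k
  using assms(1) that unfolding algebraic_polytope_def vertices_extreme by blast
 show ?thesis
 proof (cases "card (vertices P) >= 3")
  case True
  hence "vertices P ~= {}" by auto
  then obtain p0 where p0: "p0 \<in> vertices P" by blast
  \<comment> \<open>A vertex is moved to the origin, so that the linear span of \<open>V\<close> is
    the direction space of \<open>P\<close>. Differences of vertices, the only vectors whose
    coordinates are used, do not change.\<close>
  define V where "V = (\<lambda>p. p - p0) ` vertices P"
  have V': "V = (+) (- p0) ` vertices P" by (simp add: V_def)
  have "convex_position V"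
   unfolding convex_position_def
  proof (intro conjI ballI notI)
   show "finite V" using fin by (simp add: V_def)
   fix v assume v: "v \<in> V" "v \<in> convex hull (V - {v})"
   obtain p where p: "p \<in> vertices P" "v = - p0 + p" using v(1) unfolding V' by auto
   have "V - {v} = (+) (- p0) ` (vertices P - {p})" unfolding V' p(2) by auto
   hence "v \<in> (+) (- p0) ` (convex hull (vertices P - {p}))" using v(2) convex_hull_translation by metis
   hence "p \<in> convex hull (vertices P - {p})" using p(2) by auto
   thus False using cp p(1) by (simp add: convex_position_def)
  qed
  moreover have "card V >= 3" unfolding V_def using True by (subst card_image) (auto simp: inj_on_def)
  moreover have "0 \<in> V" unfolding V_def using p0 by force
  moreover have "forced (\<lambda>\<phi>. \<phi> (coord (v - w) k) = coord (v - w) k)" if vw: "v \<in> V" "w \<in> V" for v w k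
  proof -
   obtain p q where pq: "p \<in> vertices P" "q \<in> vertices P" "v = p - p0" "w = q - p0" using vw by (auto simp: V_def)
   have "v - w = p - q" using pq by simp
   hence e: "coord (v - w) k = coord p k - coord q k" by (simp add: lookup_minus)
   show ?thesis unfolding e
    by (rule forced_conj_mono[OF forced_conj[OF forced_algebraic[OF alg[OF pq(1), of k]] forced_algebraic[OF alg[OF pq(2), of k]]]
       forced_diff[of "coord p k" "coord q k"]]) simp
  qed
  moreover have "has_aff_dim V d"
   unfolding V_def
  proof (rule has_aff_dim_image[OF _ _ _ dV])
   let ?T = "\<lambda>y :: rvec \<times> real. (fst y - snd y *R p0, snd y)"
   show "linear ?T" by (auto simp: linear_iff algebra_simps)
   show "inj ?T" by (auto simp: inj_def prod_eq_iff)
   show "hat (x - p0) = ?T (hat x)" for x by (simp add: hat_def)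
  qed
  ultimately obtain B c s where "c > 0" "has_aff_dim B (d + 2)" "rigid_face V B (\<lambda>v. (c *R v, s))"
   using rigid_face_gadgets by blast
  thus ?thesis using rigid_face_conclusion[OF P assms(2) V_def] by blast
 next
  case False
  have "independent (hat ` vertices P)"
  proof -
   consider "vertices P = {}" | p where "vertices P = {p}" | p q where "vertices P = {p, q}" "p ~= q"
   proof -
    have "card (vertices P) = 0 \<or> card (vertices P) = 1 \<or> card (vertices P) = 2" using False by linarith
    thus ?thesis using that fin by (auto simp: card_1_singleton_iff card_2_iff)
   qed
   thus ?thesis
   proof cases
    case 1
    thus ?thesis by (simp add: independent_empty)
   next
    case 2
    thus ?thesis by (simp add: hat_def zero_prod_def)
   next
    case 3
    have "hat p \<notin> span {hat q}" using 3(2) by (auto simp: span_singleton hat_def)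
    thus ?thesis using 3 by (simp add: independent_insert hat_def zero_prod_def)
   qed
  qed
  then obtain B where "has_aff_dim B (d + 2)" "rigid_face (vertices P) B (\<lambda>v. (v, 0, 0))"
   using rigid_face_simplex[OF fin _ dV] by blast
  thus ?thesis using rigid_face_conclusion[OF P assms(2), of "vertices P" 0 1 B "(0, 0)"] by simp
 qed
qed

end
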